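(* Let $q\ge 2$, and let $(G_N)$, $G_N=(V_N,E_N)$, $|V_N|=N$, be a sequence of finite connected $(q+1)$-regular graphs satisfying (EXP) and (BST). Let $(\psi_n^{(N)})_{n\in\mathbb{N}}$ be an orthonormal basis of eigenfunctions of $H_{\mathbf{G}_N}$ and let $(\lambda_n^{(N)})_{n\in\mathbb N}$ be the corresponding eigenvalues. Let $I$ be a (nonempty) open interval such that $\overline{I}\subset\sigma_{\mathrm{ac}}(H_{\mathbf{T}_q})$ lies in a fixed band of AC spectrum, and denote by $N(I)$ the number of indices $n$ with $\lambda_n^{(N)}\in I$. For each $N$ let $a=a_N:E_N\to[-1,1]$. Then $$\lim_{N\to\infty}\frac{1}{N(I)}\sum_{\lambda_n^{(N)}\in I}\left|\langle\psi_n^{(N)},a\psi_n^{(N)}\rangle-\langle a\rangle\right|^2=0,$$ where $$\langle\psi_n^{(N)},a\psi_n^{(N)}\rangle=\sum_{e\in E_N}a(e)\int_0^L|\psi_n^{(N)}(x_e)|^2\,dx_e,\qquad \langle a\rangle=\frac{1}{|E_N|}\sum_{e\in E_N}a(e).$$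
   Context: Quantum graphs. Fix $L>0$, $\alpha\in\mathbb{R}$ and a real potential $U\in L^\infty(0,L)$ with $U(L-x)=U(x)$; these do not depend on $N$. For a combinatorial graph $G=(V,E)$, the equilateral metric graph $\mathbf{G}$ is obtained by orienting each edge $e$ (origin $o_e$, terminus $t_e$) and identifying $e$ with $[0,L]$, with $0\leftrightarrow o_e$, $L\leftrightarrow t_e$; $x_e\in[0,L]$ denotes the coordinate on $e$. On $\mathcal{H}=\bigoplus_{e\in E}L^2[0,L]$, the operator $H_{\mathbf{G}}$ acts by $(H_{\mathbf{G}}\psi)_e=-\psi_e''+U\psi_e$ on $\psi=(\psi_e)\in\bigoplus_e W^{2,2}(0,L)$ satisfying the Kirchhoff conditions with parameter $\alpha$: (continuity) at each vertex $v$, the values at $v$ of all $\psi_e$ with $e$ incident to $v$ coincide, the common value being $\psi(v)$; (current conservation) $\sum_{e:o_e=v}\psi_e'(0)-\sum_{e:t_e=v}\psi_e'(L)=\alpha\psi(v)$ for every $v$. For finite $G$ this is self-adjoint with discrete spectrum; for $G=\mathbb{T}_q$, the infinite $(q+1)$-regular tree, with metric tree $\mathbf{T}_q$, $H_{\mathbf{T}_q}$ is the unique self-adjoint extension from compactly supported functions satisfying these conditions. Spectrum of the tree. Let $C_\lambda,S_\lambda$ solve $-\psi''+U\psi=\lambda\psi$ on $[0,L]$ with $C_\lambda(0)=1,\ C_\lambda'(0)=0,\ S_\lambda(0)=0,\ S_\lambda'(0)=1$. Put $c(\lambda)=C_\lambda(L)$, $s(\lambda)=S_\lambda(L)$, $w(\lambda)=(q+1)c(\lambda)+\alpha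 s(\lambda)$. It is known that, for $q\ge2$, $\sigma_{\mathrm{ac}}(H_{\mathbf{T}_q})=\{\lambda\in\mathbb{R}:|w(\lambda)|\le 2\sqrt q\}$. A set $I\subset\sigma_{\mathrm{ac}}(H_{\mathbf{T}_q})$ is in a fixed band if $w$ is injective on $I$. Graph assumptions. $(G_N)$ is a sequence of finite $(q+1)$-regular graphs (every vertex has exactly $q+1$ neighbours), $|V_N|=N$, $N\to\infty$ along the admissible integers. (EXP): there is $\beta>0$ such that for all $N$ the spectrum of $\frac{1}{q+1}\mathcal{A}_{G_N}$ is contained in $[-1+\beta,1-\beta]\cup\{1\}$, where $\mathcal{A}_{G_N}$ is the adjacency matrix. (BST): for all $r>0$, $\lim_{N\to\infty}\frac{1}{N}\#\{x\in V_N:\rho_{G_N}(x)<r\}=0$, where $\rho_{G_N}(x)$ is the largest $\rho$ such that the subgraph contained in the ball of radius $\rho$ centred at $x$ has no closed cycles. Sums over $\lambda_n^{(N)}\in I$ are sums over the indices $n$ (eigenvalues counted with multiplicity). *)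

theory Defs
  imports "HOL-Analysis.Analysis"
begin

section \<open>Combinatorial graphs\<close>

text \<open>A simple graph together with an orientation of its edges. Edges are two-element sets of
  vertices; the origin and terminus maps are only meaningful on edges.\<close>

record 'v ograph =
  verts :: "'v set"
  edges :: "'v set set"
  org :: "'v set \<Rightarrow> 'v"
  trm :: "'v set \<Rightarrow> 'v"

definition simple_ograph :: "'v ograph \<Rightarrow> bool" where
  "simple_ograph G \<longleftrightarrow>
     (\<forall>e\<in>edges G. \<exists>u\<in>verts G. \<exists>v\<in>verts G. u \<noteq> v \<and> e = {u, v}) \<and>
     (\<forall>e\<in>edges G. e = {org G e, trm G e})"

definition adj :: "'v ograph \<Rightarrow> ('v \<times> 'v) set" where
  "adj G = {(u, v). {u, v} \<in> edges G}"

definition regular_graph :: "nat \<Rightarrow> 'v ograph \<Rightarrow> bool" where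
  "regular_graph d G \<longleftrightarrow> (\<forall>v\<in>verts G. finite (adj G `` {v}) \<and> card (adj G `` {v}) = d)"

definition connected_graph :: "'v ograph \<Rightarrow> bool" where
  "connected_graph G \<longleftrightarrow> verts G \<noteq> {} \<and> (\<forall>u\<in>verts G. \<forall>v\<in>verts G. (u, v) \<in> (adj G)\<^sup>*)"

definition has_cycle :: "'v set set \<Rightarrow> bool" where
  "has_cycle E \<longleftrightarrow>
     (\<exists>xs. 3 \<le> length xs \<and> distinct xs \<and>
        (\<forall>i<length xs. {xs ! i, xs ! (Suc i mod length xs)} \<in> E))"

text \<open>The \<open>d\<close>-regular tree is unique up to isomorphism, and infinite when \<open>d \<ge> 2\<close>.\<close>

definition regular_tree :: "nat \<Rightarrow> 'v ograph \<Rightarrow> bool" where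
  "regular_tree d G \<longleftrightarrow>
     simple_ograph G \<and> connected_graph G \<and> \<not> has_cycle (edges G) \<and> regular_graph d G"

definition graph_ball :: "'v ograph \<Rightarrow> 'v \<Rightarrow> nat \<Rightarrow> 'v set" where
  "graph_ball G x r = {y \<in> verts G. \<exists>n\<le>r. (x, y) \<in> adj G ^^ n}"

text \<open>In a finite graph with all degrees at least 2 there is a cycle, so that in the connected case
  the radii below are bounded and the greatest one exists.\<close>

definition inj_radius :: "'v ograph \<Rightarrow> 'v \<Rightarrow> nat" where
  "inj_radius G x = (GREATEST r. \<not> has_cycle {e \<in> edges G. e \<subseteq> graph_ball G x r})"

definition scaled_adj_spectrum :: "real \<Rightarrow> 'v ograph \<Rightarrow> complex set" where
  "scaled_adj_spectrum c G =
     {\<mu>. \<exists>f :: 'v \<Rightarrow> complex. (\<exists>v\<in>verts G. f v \<noteq> 0) \<and>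
          (\<forall>v\<in>verts G. complex_of_real c * (\<Sum>u\<in>adj G `` {v}. f u) = \<mu> * f v)}"

text \<open>The index set \<open>A\<close> consists of the admissible integers.\<close>

definition EXP :: "nat \<Rightarrow> nat set \<Rightarrow> (nat \<Rightarrow> 'v ograph) \<Rightarrow> bool" where
  "EXP q A G \<longleftrightarrow>
     (\<exists>\<beta>>0. \<forall>N\<in>A. scaled_adj_spectrum (1 / (real q + 1)) (G N)
                      \<subseteq> complex_of_real ` ({- 1 + \<beta>..1 - \<beta>} \<union> {1}))"

definition BST :: "nat set \<Rightarrow> (nat \<Rightarrow> 'v ograph) \<Rightarrow> bool" where
  "BST A G \<longleftrightarrow>
     (\<forall>r::real. r > 0 \<longrightarrow>
        ((\<lambda>N. 1 / real N * real (card {x \<in> verts (G N). real (inj_radius (G N) x) < r}))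
          \<longlongrightarrow> 0) (inf sequentially (principal A)))"

section \<open>The space \<open>\<Oplus>\<^sub>e L\<^sup>2[0,L]\<close>\<close>

text \<open>Elements are represented by functions, so equality in the Hilbert space is almost everywhere
  equality on \<open>[0,L]\<close> for every edge in the index set.\<close>

definition qL2 :: "'e set \<Rightarrow> real \<Rightarrow> ('e \<Rightarrow> real \<Rightarrow> complex) set" where
  "qL2 E L = {\<psi>.
     (\<forall>e\<in>E. \<psi> e \<in> borel_measurable (lebesgue_on {0..L}) \<and>
             integrable (lebesgue_on {0..L}) (\<lambda>x. (cmod (\<psi> e x))\<^sup>2)) \<and>
     (\<lambda>e. LINT x|lebesgue_on {0..L}. (cmod (\<psi> e x))\<^sup>2) summable_on E}"

definition qinner ::
    "'e set \<Rightarrow> real \<Rightarrow> ('e \<Rightarrow> real \<Rightarrow> complex) \<Rightarrow> ('e \<Rightarrow> real \<Rightarrow> complex) \<Rightarrow> complex" where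
  "qinner E L \<phi> \<psi> = (\<Sum>\<^sub>\<infinity>e\<in>E. LINT x|lebesgue_on {0..L}. cnj (\<phi> e x) * \<psi> e x)"

definition qnorm :: "'e set \<Rightarrow> real \<Rightarrow> ('e \<Rightarrow> real \<Rightarrow> complex) \<Rightarrow> real" where
  "qnorm E L \<psi> = sqrt (\<Sum>\<^sub>\<infinity>e\<in>E. LINT x|lebesgue_on {0..L}. (cmod (\<psi> e x))\<^sup>2)"

definition orthonormal_basis ::
    "'e set \<Rightarrow> real \<Rightarrow> (nat \<Rightarrow> 'e \<Rightarrow> real \<Rightarrow> complex) \<Rightarrow> bool" where
  "orthonormal_basis E L \<psi> \<longleftrightarrow>
     (\<forall>n. \<psi> n \<in> qL2 E L) \<and>
     (\<forall>m n. qinner E L (\<psi> m) (\<psi> n) = (if m = n then 1 else 0)) \<and>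
     (\<forall>\<phi>\<in>qL2 E L.
        (\<lambda>n. qnorm E L (\<lambda>e x. \<phi> e x - (\<Sum>k<n. qinner E L (\<psi> k) \<phi> * \<psi> k e x)))
          \<longlonglongrightarrow> 0)"

section \<open>Operators on metric graphs\<close>

definition symmetric_Linfty_potential :: "real \<Rightarrow> (real \<Rightarrow> real) \<Rightarrow> bool" where
  "symmetric_Linfty_potential L U \<longleftrightarrow>
     U \<in> borel_measurable (lebesgue_on {0..L}) \<and>
     (\<exists>M. AE x in lebesgue_on {0..L}. \<bar>U x\<bar> \<le> M) \<and>
     (AE x in lebesgue_on {0..L}. U (L - x) = U x)"

text \<open>\<open>f\<close> is the continuously differentiable representative of an element of \<open>W\<^sup>2\<^sup>,\<^sup>2(0,L)\<close>, with first
  derivative \<open>f1\<close> (absolutely continuous) and second weak derivative \<open>f2\<close>.\<close>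

definition W22_derivs ::
    "real \<Rightarrow> (real \<Rightarrow> 'a::{banach, second_countable_topology}) \<Rightarrow> (real \<Rightarrow> 'a) \<Rightarrow> (real \<Rightarrow> 'a) \<Rightarrow> bool"
where
  "W22_derivs L f f1 f2 \<longleftrightarrow>
     f2 \<in> borel_measurable (lebesgue_on {0..L}) \<and>
     integrable (lebesgue_on {0..L}) (\<lambda>x. (norm (f2 x))\<^sup>2) \<and>
     (\<forall>x\<in>{0..L}. f1 x = f1 0 + (LINT t|lebesgue_on {0..x}. f2 t)) \<and>
     (\<forall>x\<in>{0..L}. (f has_vector_derivative f1 x) (at x within {0..L}))"

definition solves_ivp ::
    "real \<Rightarrow> (real \<Rightarrow> real) \<Rightarrow> real \<Rightarrow> real \<Rightarrow> real \<Rightarrow> (real \<Rightarrow> real) \<Rightarrow> bool" where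
  "solves_ivp L U lam y0 y1 f \<longleftrightarrow>
     (\<exists>f1 f2. W22_derivs L f f1 f2 \<and>
        (AE x in lebesgue_on {0..L}. - f2 x + U x * f x = lam * f x) \<and>
        f 0 = y0 \<and> f1 0 = y1)"

definition band_function ::
    "nat \<Rightarrow> real \<Rightarrow> real \<Rightarrow> (real \<Rightarrow> real \<Rightarrow> real) \<Rightarrow> (real \<Rightarrow> real \<Rightarrow> real) \<Rightarrow> real \<Rightarrow> real" where
  "band_function q \<alpha> L C S lam = (real q + 1) * C lam L + \<alpha> * S lam L"

definition kirchhoff ::
    "'v ograph \<Rightarrow> real \<Rightarrow> real \<Rightarrow> ('v set \<Rightarrow> real \<Rightarrow> complex) \<Rightarrow> ('v set \<Rightarrow> real \<Rightarrow> complex) \<Rightarrow> bool" where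
  "kirchhoff G L \<alpha> \<psi> \<psi>1 \<longleftrightarrow>
     (\<exists>val :: 'v \<Rightarrow> complex. \<forall>v\<in>verts G.
        (\<forall>e\<in>edges G. org G e = v \<longrightarrow> \<psi> e 0 = val v) \<and>
        (\<forall>e\<in>edges G. trm G e = v \<longrightarrow> \<psi> e L = val v) \<and>
        (\<Sum>e | e \<in> edges G \<and> org G e = v. \<psi>1 e 0) -
        (\<Sum>e | e \<in> edges G \<and> trm G e = v. \<psi>1 e L) = complex_of_real \<alpha> * val v)"

text \<open>Operators are given by their graphs: \<open>(\<psi>, \<eta>) \<in> T\<close> means that \<open>\<psi>\<close> is in the domain and
  \<open>T \<psi> = \<eta>\<close>. On the domain of the differential operator the continuously differentiable
  representatives are used.\<close>

type_synonym 'e qop = "(('e \<Rightarrow> real \<Rightarrow> complex) \<times> ('e \<Rightarrow> real \<Rightarrow> complex)) set"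

definition quantum_graph_op ::
    "real \<Rightarrow> real \<Rightarrow> (real \<Rightarrow> real) \<Rightarrow> 'v ograph \<Rightarrow> 'v set qop" where
  "quantum_graph_op L \<alpha> U G = {(\<psi>, \<eta>).
     \<psi> \<in> qL2 (edges G) L \<and> \<eta> \<in> qL2 (edges G) L \<and>
     (\<exists>\<psi>1 \<psi>2. (\<forall>e\<in>edges G. W22_derivs L (\<psi> e) (\<psi>1 e) (\<psi>2 e) \<and>
                 (AE x in lebesgue_on {0..L}. \<eta> e x = - \<psi>2 e x + complex_of_real (U x) * \<psi> e x)) \<and>
              kirchhoff G L \<alpha> \<psi> \<psi>1)}"

text \<open>In a locally finite equilateral metric graph, a function has compact support iff it vanishes
  on all but finitely many edges.\<close>

definition compact_quantum_graph_op ::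
    "real \<Rightarrow> real \<Rightarrow> (real \<Rightarrow> real) \<Rightarrow> 'v ograph \<Rightarrow> 'v set qop" where
  "compact_quantum_graph_op L \<alpha> U G =
     {(\<psi>, \<eta>) \<in> quantum_graph_op L \<alpha> U G. finite {e \<in> edges G. \<exists>x\<in>{0..L}. \<psi> e x \<noteq> 0}}"

section \<open>Self-adjointness and absolutely continuous spectrum\<close>

definition qadjoint :: "'e set \<Rightarrow> real \<Rightarrow> 'e qop \<Rightarrow> 'e qop" where
  "qadjoint E L T = {(\<phi>, \<eta>). \<phi> \<in> qL2 E L \<and> \<eta> \<in> qL2 E L \<and>
     (\<forall>(u, g)\<in>T. qinner E L \<phi> g = qinner E L \<eta> u)}"

definition densely_defined :: "'e set \<Rightarrow> real \<Rightarrow> 'e qop \<Rightarrow> bool" where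
  "densely_defined E L T \<longleftrightarrow>
     (\<forall>\<phi>\<in>qL2 E L. \<forall>\<epsilon>>0. \<exists>(u, g)\<in>T. qnorm E L (\<lambda>e x. \<phi> e x - u e x) < \<epsilon>)"

definition self_adjoint :: "'e set \<Rightarrow> real \<Rightarrow> 'e qop \<Rightarrow> bool" where
  "self_adjoint E L T \<longleftrightarrow> densely_defined E L T \<and> T = qadjoint E L T"

text \<open>The spectral measure of \<open>\<psi>\<close> for a self-adjoint \<open>T\<close> is the unique finite Borel measure \<open>\<mu>\<close> with
  \<open>\<langle>\<psi>, (T - z)\<^sup>-\<^sup>1 \<psi>\<rangle> = \<integral> 1 / (t - z) d\<mu>(t)\<close> for all non-real \<open>z\<close>; below, \<open>\<phi> = (T - z)\<^sup>-\<^sup>1 \<psi>\<close>.\<close>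

definition spectral_measure ::
    "'e set \<Rightarrow> real \<Rightarrow> 'e qop \<Rightarrow> ('e \<Rightarrow> real \<Rightarrow> complex) \<Rightarrow> real measure \<Rightarrow> bool" where
  "spectral_measure E L T \<psi> \<mu> \<longleftrightarrow>
     \<psi> \<in> qL2 E L \<and> sets \<mu> = sets borel \<and> finite_measure \<mu> \<and>
     (\<forall>z. Im z \<noteq> 0 \<longrightarrow>
        (\<exists>\<phi>. (\<phi>, \<lambda>e x. z * \<phi> e x + \<psi> e x) \<in> T \<and>
             qinner E L \<psi> \<phi> = (LINT t|\<mu>. 1 / (complex_of_real t - z))))"

text \<open>The closure of the union of the supports of the absolutely continuous spectral measures, that is,
  the spectrum of the part of \<open>T\<close> in its absolutely continuous subspace.\<close>

definition sigma_ac :: "'e set \<Rightarrow> real \<Rightarrow> 'e qop \<Rightarrow> real set" where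
  "sigma_ac E L T = {lam. \<forall>\<epsilon>>0. \<exists>\<psi> \<mu>. spectral_measure E L T \<psi> \<mu> \<and>
     absolutely_continuous lborel \<mu> \<and> emeasure \<mu> {lam - \<epsilon><..<lam + \<epsilon>} \<noteq> 0}"

end

(* On an edge, a solution of the eigenvalue equation with s(lambda) <> 0 is determined by its end
   values, and the Kirchhoff conditions say that the vertex values f form an eigenfunction of the
   adjacency matrix with eigenvalue w(lambda). Since w is injective on I, orthonormal quantum
   eigenfunctions in the window give orthogonal vertex functions, and <psi, a psi> is a combination,
   with bounded coefficients, of Sum kappa(x,y) |f x|^2 and Sum kappa(x,y) Re(cnj (f x) (f y)) over
   directed edges.

   Discrete quantum variance: an eigenfunction lifts to an eigenfunction of the nonbacktracking
   shift on directed edges, so kappa may be replaced by its average along nonbacktracking walks of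
   length n. The averages act, outside the few vertices that see a short cycle, with Hilbert-Schmidt
   norm of order N/n: by the spectral gap kappa is a coboundary up to a martingale difference. The
   argument loses a factor 1/(4q - w^2), so eigenvalues near the ends of the band are estimated
   trivially; by an orthogonal-polynomial kernel they are few, and by the same kernel the window
   contains a positive proportion of N eigenvalues.

   Finally, I in sigma_ac forces |w| <= 2 sqrt q and s <> 0 on I. If |w| > 2 sqrt q and s <> 0, then a
   Schur test for the adjacency operator of the tree, a finite Neumann series and corrections at the
   vertices yield compactly supported approximate solutions of (H - lambda) u = f, hence a bounded
   inverse; this excludes lambda from the spectrum. If s = 0, then |w| = q + 1, which by injectivity
   cannot happen on an interval, so continuity of w settles the remaining points. *)

theory Submission
  imports Defs
begin

section \<open>Nonbacktracking walks\<close>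

text \<open>No pointwise control of eigenfunctions is available; a Hilbert-Schmidt bound replaces
  it. Where a ball is acyclic, a walk is determined by its ends, so the square sum of the averaged
  kernel has no cross terms and is the second moment of a Birkhoff sum. A pairing along walks of
  length n collects n + 1 equal contributions, hence (n + 1)^2 on one side, against a variance of
  order n on the other; this is the whole gain. The pairing is one complex number built from the two
  real sums of the overview, and both can be recovered from it as long as the root
  \<open>eps\<close> is not real; hence the loss at the band ends. All constants are uniform in the
  graph, so bad vertices enter only through their number, for finitely many fixed radii. The lower
  bound for the number of window eigenvalues rests on completeness of the given basis: only then
  does every discrete eigenfunction in the window come from it. On the tree only some self-adjoint
  operator containing the compactly supported one is given, so estimates pass to it through the
  adjoint relation.\<close>

fun nbw :: "'a set set \<Rightarrow> 'a list \<Rightarrow> bool" where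
  "nbw E [] = False"
| "nbw E [x] = True"
| "nbw E [x, y] = ({x, y} \<in> E)"
| "nbw E (x # y # z # r) = ({x, y} \<in> E \<and> x \<noteq> z \<and> nbw E (y # z # r))"

lemma nbw_tl: "nbw E (x # y # r) \<Longrightarrow> nbw E (y # r)"
  by (cases r) auto

lemma nbw_edge: "nbw E (x # y # r) \<Longrightarrow> {x, y} \<in> E"
  by (cases r) auto

lemma nbw_ConsI: "nbw E (y # r) \<Longrightarrow> {x, y} \<in> E \<Longrightarrow> (r \<noteq> [] \<Longrightarrow> x \<noteq> hd r) \<Longrightarrow> nbw E (x # y # r)"
  by (cases r) auto

lemma nbw_join:
  "nbw E (as @ [x]) \<Longrightarrow> nbw E (x # bs) \<Longrightarrow> as \<noteq> [] \<Longrightarrow> bs \<noteq> [] \<Longrightarrow> last as \<noteq> hd bs \<Longrightarrow> nbw E (as @ x # bs)"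
proof (induction as)
  case (Cons a as)
  show ?case
  proof (cases as)
    case Nil
    then show ?thesis using Cons.prems by (auto intro: nbw_ConsI)
  next
    case (Cons a' as')
    have "nbw E (as @ [x])" using Cons.prems(1) Cons nbw_tl by auto
    then have IH: "nbw E (as @ x # bs)" using Cons.IH Cons.prems Cons by auto
    have e: "{a, a'} \<in> E" using Cons.prems(1) Cons nbw_edge by auto
    show ?thesis
    proof (cases as')
      case Nil
      then show ?thesis using Cons.prems(1) Cons IH e by auto
    next
      case (Cons a'' r)
      then show ?thesis using Cons.prems(1) \<open>as = a' # as'\<close> IH e by auto
    qed
  qed
qed simp

lemma nbw_rev: "nbw E xs \<Longrightarrow> nbw E (rev xs)"
proof (induction E xs rule: nbw.induct)
  case (3 E x y)
  then show ?case by (simp add: insert_commute)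
next
  case (4 E x y z r)
  then have *: "nbw E (rev (z # r) @ [y])" by simp
  have "nbw E [y, x]" using 4 by (simp add: insert_commute)
  from nbw_join[OF * this] 4 show ?case by auto
qed auto

lemma nbw_nth_edge: "nbw E xs \<Longrightarrow> Suc i < length xs \<Longrightarrow> {xs ! i, xs ! Suc i} \<in> E"
proof (induction xs arbitrary: i rule: nbw.induct[of _ E])
  case (4 E x y z r)
  then show ?case by (cases i) auto
qed auto

lemma nbw_nth_nb: "nbw E xs \<Longrightarrow> Suc (Suc i) < length xs \<Longrightarrow> xs ! i \<noteq> xs ! Suc (Suc i)"
proof (induction xs arbitrary: i rule: nbw.induct[of _ E])
  case (4 E x y z r)
  then show ?case by (cases i) auto
qed auto

text \<open>Take two equal entries at the least possible distance d. Distance 1 would be a loop and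
  distance 2 a backtracking step, so d \<ge> 3, and minimality makes the segment between them a
  simple cycle.\<close>

lemma nbw_distinct:
  assumes ac: "\<not> has_cycle E" and sl: "\<And>x. {x} \<notin> E" and w: "nbw E xs"
  shows "distinct xs"
proof (rule ccontr)
  assume nd: "\<not> distinct xs"
  define P where "P d \<longleftrightarrow> d > 0 \<and> (\<exists>i. i + d < length xs \<and> xs ! i = xs ! (i + d))" for d
  from nd obtain i0 j0 where "i0 < length xs" "j0 < length xs" "i0 \<noteq> j0" "xs ! i0 = xs ! j0"
    by (auto simp: distinct_conv_nth)
  then have "\<exists>i j. i < j \<and> j < length xs \<and> xs ! i = xs ! j" by (metis linorder_neqE_nat)
  then obtain i j where "i < j" "j < length xs" "xs ! i = xs ! j" by blast
  then have "P (j - i)" unfolding P_def by (intro conjI exI[of _ i]) auto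
  then have "P (LEAST d. P d)" by (rule LeastI)
  define d where "d = (LEAST d. P d)"
  have Pd: "P d" using \<open>P (LEAST d. P d)\<close> d_def by simp
  have mn: "\<not> P d'" if "d' < d" for d' using not_less_Least that d_def by blast
  obtain i where i: "i + d < length xs" "xs ! i = xs ! (i + d)" and d0: "d > 0" using Pd P_def by auto
  have d1: "d \<noteq> 1" using nbw_nth_edge[OF w, of i] i sl by auto
  have d2: "d \<noteq> 2" using nbw_nth_nb[OF w, of i] i by auto
  define zs where "zs = take d (drop i xs)"
  have len: "length zs = d" using i zs_def by simp
  have nth: "zs ! k = xs ! (i + k)" if "k < d" for k using that i by (simp add: zs_def)
  have dis: "distinct zs"
  proof (rule ccontr)
    assume "\<not> distinct zs"
    then obtain a b where "a < d" "b < d" "a \<noteq> b" "zs ! a = zs ! b"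
      by (auto simp: distinct_conv_nth len)
    then have "\<exists>a b. a < b \<and> b < d \<and> zs ! a = zs ! b" by (metis linorder_neqE_nat)
    then obtain a b where ab: "a < b" "b < d" "zs ! a = zs ! b" by blast
    then have "P (b - a)" unfolding P_def using nth[of a] nth[of b] i by (intro conjI exI[of _ "i + a"]) auto
    then show False using mn[of "b - a"] ab by auto
  qed
  have "{zs ! k, zs ! (Suc k mod length zs)} \<in> E" if "k < length zs" for k
  proof (cases "Suc k < d")
    case True
    then show ?thesis using nbw_nth_edge[OF w, of "i + k"] nth[of k] nth[of "Suc k"] len i by auto
  next
    case False
    then have "Suc k = d" using that len by auto
    then show ?thesis using nbw_nth_edge[OF w, of "i + k"] nth[of k] nth[of 0] len i d0 by auto
  qed
  then have "has_cycle E" unfolding has_cycle_def using dis len d0 d1 d2 by (intro exI[of _ zs]) auto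
  then show False using ac by simp
qed

text \<open>Where the two walks part, one of them read backwards and continued by the other is again
  nonbacktracking, hence has distinct vertices; but it contains the common end point twice.\<close>

lemma nbw_unique:
  assumes ac: "\<not> has_cycle E" and sl: "\<And>x. {x} \<notin> E"
  shows "nbw E xs \<Longrightarrow> nbw E ys \<Longrightarrow> hd xs = hd ys \<Longrightarrow> last xs = last ys \<Longrightarrow> xs = ys"
proof (induction xs arbitrary: ys)
  case (Cons x r)
  obtain ys' where ys: "ys = x # ys'" using Cons.prems by (cases ys) auto
  have dx: "distinct (x # r)" "distinct ys" using nbw_distinct[OF ac sl] Cons.prems by blast+
  show ?case
  proof (cases "r = [] \<or> ys' = []")
    case True
    then show ?thesis using dx Cons.prems ys by (metis distinct.simps(2) last_ConsL last_ConsR last_in_set)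
  next
    case False
    then obtain y r' y' s' where r: "r = y # r'" "ys' = y' # s'" by (meson neq_Nil_conv)
    show ?thesis
    proof (cases "y = y'")
      case True
      then have "r = ys'" using Cons.IH[of ys'] Cons.prems ys r nbw_tl[of E x y r'] nbw_tl[of E x y s'] by auto
      then show ?thesis using ys by simp
    next
      case False
      have "nbw E (rev r @ [x])" using nbw_rev[OF Cons.prems(1)] by simp
      then have "nbw E (rev r @ x # ys')"
        by (rule nbw_join) (use Cons.prems False r ys in auto)
      then have "distinct (rev r @ x # ys')" by (rule nbw_distinct[OF ac sl])
      have "last r = last ys'" using Cons.prems(4) ys r by simp
      moreover have "last r \<in> set r" "last ys' \<in> set ys'" using r by (simp_all only: last_in_set list.distinct not_False_eq_True)
      moreover have "set r \<inter> set ys' = {}" using \<open>distinct (rev r @ x # ys')\<close> by auto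
      ultimately show ?thesis by (metis disjoint_iff)
    qed
  qed
qed simp

lemma nbw_restrict: "nbw E xs \<Longrightarrow> set xs \<subseteq> B \<Longrightarrow> nbw {e \<in> E. e \<subseteq> B} xs"
  by (induction E xs rule: nbw.induct) auto

section \<open>Simple graphs\<close>

lemma adj_iff: "(x, y) \<in> adj G \<longleftrightarrow> {x, y} \<in> edges G"
  by (simp add: adj_def)

lemma adj_sym: "(x, y) \<in> adj G \<Longrightarrow> (y, x) \<in> adj G"
  by (simp add: adj_def insert_commute)

lemma simple_adjD:
  assumes "simple_ograph G" "(x, y) \<in> adj G"
  shows "x \<in> verts G" "y \<in> verts G" "x \<noteq> y"
proof -
  have "{x, y} \<in> edges G" using assms by (simp add: adj_def)
  then obtain u v where "u \<in> verts G" "v \<in> verts G" "u \<noteq> v" "{x, y} = {u, v}"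
    using assms(1) unfolding simple_ograph_def by blast
  then show "x \<in> verts G" "y \<in> verts G" "x \<noteq> y" by (auto simp: doubleton_eq_iff)
qed

lemma simple_no_loop: "simple_ograph G \<Longrightarrow> {x} \<notin> edges G"
  using simple_adjD(3)[of G x x] by (auto simp: adj_def)

text \<open>The property whose greatest radius is \<open>inj_radius\<close>; at a fixed radius it
  can be counted directly.\<close>

definition acyclic_ball :: "'v ograph \<Rightarrow> nat \<Rightarrow> 'v \<Rightarrow> bool" where
  "acyclic_ball G r x \<longleftrightarrow> \<not> has_cycle {e \<in> edges G. e \<subseteq> graph_ball G x r}"

lemma nbw_in_ball:
  assumes "simple_ograph G" "nbw (edges G) xs" "hd xs \<in> verts G" "length xs \<le> Suc r"
  shows "set xs \<subseteq> graph_ball G (hd xs) r"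
proof -
  have *: "(hd xs, xs ! i) \<in> adj G ^^ i" if "i < length xs" for i
    using that
  proof (induction i)
    case 0
    then show ?case by (cases xs) auto
  next
    case (Suc i)
    then show ?case using nbw_nth_edge[OF assms(2), of i] by (auto simp: adj_iff intro: relpow_Suc_I)
  qed
  have v: "xs ! i \<in> verts G" if "i < length xs" for i
  proof (cases i)
    case 0
    then show ?thesis using assms(2,3) by (cases xs) auto
  next
    case (Suc k)
    then show ?thesis using nbw_nth_edge[OF assms(2), of k] that simple_adjD(2)[OF assms(1)] adj_iff by metis
  qed
  show ?thesis
  proof
    fix y assume "y \<in> set xs"
    then obtain i where i: "i < length xs" "y = xs ! i" by (metis in_set_conv_nth)
    then have "i \<le> r" using assms(4) by simp
    then show "y \<in> graph_ball G (hd xs) r" using * v i by (auto simp: graph_ball_def)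
  qed
qed

text \<open>A walk of at most r steps, that is, a list of length at most \<open>Suc r\<close>, stays
  in the ball, so it is a walk in the subgraph induced there and only cycles of that subgraph
  matter.\<close>

lemma acyclic_ball_nbw_unique:
  assumes "simple_ograph G" "acyclic_ball G r x" "x \<in> verts G"
    and "nbw (edges G) xs" "nbw (edges G) ys" "hd xs = x" "hd ys = x"
    and "length xs \<le> Suc r" "length ys \<le> Suc r" "last xs = last ys"
  shows "xs = ys"
proof (rule nbw_unique)
  show "\<not> has_cycle {e \<in> edges G. e \<subseteq> graph_ball G x r}"
    using assms by (simp add: acyclic_ball_def)
  show "nbw {e \<in> edges G. e \<subseteq> graph_ball G x r} xs" "nbw {e \<in> edges G. e \<subseteq> graph_ball G x r} ys"
    using assms nbw_in_ball by (metis nbw_restrict)+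
qed (use assms simple_no_loop[OF assms(1)] in auto)

lemma has_cycle_mono: "E \<subseteq> F \<Longrightarrow> has_cycle E \<Longrightarrow> has_cycle F"
  unfolding has_cycle_def by blast

lemma graph_ball_mono: "r \<le> s \<Longrightarrow> graph_ball G x r \<subseteq> graph_ball G x s"
  unfolding graph_ball_def using le_trans by blast

section \<open>Finite connected regular graphs and their injectivity radius\<close>

locale fgraph =
  fixes G :: "'a ograph" and q :: nat
  assumes simple: "simple_ograph G" and finV: "finite (verts G)"
    and conn: "connected_graph G" and reg: "regular_graph (q + 1) G" and q2: "q \<ge> 2"
begin

abbreviation "V \<equiv> verts G"
abbreviation "nb x \<equiv> adj G `` {x}"

lemma nb_iff: "y \<in> nb x \<longleftrightarrow> (x, y) \<in> adj G" by simp

lemma nb_sym: "y \<in> nb x \<longleftrightarrow> x \<in> nb y"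
  using adj_sym by fastforce

lemma nb_V: "y \<in> nb x \<Longrightarrow> y \<in> V" "y \<in> nb x \<Longrightarrow> x \<in> V" "x \<notin> nb x"
  using simple_adjD[OF simple] by blast+

lemma nb_fin [simp]: "finite (nb x)"
  by (rule finite_subset[OF _ finV]) (use nb_V in auto)

lemma nb_card: "x \<in> V \<Longrightarrow> card (nb x) = q + 1"
  using reg by (auto simp: regular_graph_def)

lemma V_ne: "V \<noteq> {}"
  using conn by (auto simp: connected_graph_def)

lemma nb_minus_card: "y \<in> V \<Longrightarrow> x \<in> nb y \<Longrightarrow> card (nb y - {x}) = q"
  using nb_card by simp

lemma long_nbw: "\<exists>xs. nbw (edges G) xs \<and> length xs = Suc n \<and> set xs \<subseteq> V"
proof (induction n)
  case 0
  obtain v where "v \<in> V" using V_ne by auto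
  then show ?case by (intro exI[of _ "[v]"]) auto
next
  case (Suc n)
  then obtain xs where xs: "nbw (edges G) xs" "length xs = Suc n" "set xs \<subseteq> V" by blast
  then obtain y r where yr: "xs = y # r" by (cases xs) auto
  then have "y \<in> V" using xs by auto
  \<comment> \<open>For a one-vertex walk \<open>hd r\<close> is an unspecified vertex; removing any
    single vertex still leaves at least q neighbours.\<close>
  have "card (nb y - {hd r}) \<ge> q" using nb_card[OF \<open>y \<in> V\<close>] by (simp add: card_Diff_singleton_if)
  then have "nb y - {hd r} \<noteq> {}" using q2 by fastforce
  then obtain z where z: "z \<in> nb y" "z \<noteq> hd r" by blast
  then have "nbw (edges G) (z # xs)" using xs yr by (auto intro!: nbw_ConsI simp: adj_def insert_commute)
  then show ?case using xs z nb_V by (intro exI[of _ "z # xs"]) auto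
qed

text \<open>A nonbacktracking walk with more entries than there are vertices must repeat one, which
  is impossible in a forest.\<close>

lemma has_cycle_G: "has_cycle (edges G)"
proof (rule ccontr)
  assume nc: "\<not> has_cycle (edges G)"
  obtain xs where xs: "nbw (edges G) xs" "length xs = Suc (card V)" "set xs \<subseteq> V" using long_nbw by blast
  have "distinct xs" using nbw_distinct[OF nc _ xs(1)] simple_no_loop[OF simple] by blast
  then have "card (set xs) = Suc (card V)" using xs by (simp add: distinct_card)
  then show False using card_mono[OF finV xs(3)] by simp
qed

lemma ball_all:
  assumes "x \<in> V" shows "\<exists>R. graph_ball G x R = V"
proof -
  have "\<forall>y\<in>V. \<exists>n. (x, y) \<in> adj G ^^ n"
    using conn assms unfolding connected_graph_def by (meson rtrancl_imp_relpow)
  then obtain f where f: "\<And>y. y \<in> V \<Longrightarrow> (x, y) \<in> adj G ^^ f y" by metis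
  have "graph_ball G x (Max (f ` V)) = V"
  proof -
    have "\<exists>n\<le>Max (f ` V). (x, y) \<in> adj G ^^ n" if "y \<in> V" for y
      using f[OF that] finV that by (intro exI[of _ "f y"]) auto
    then show ?thesis unfolding graph_ball_def by blast
  qed
  then show ?thesis by blast
qed

text \<open>\<open>GREATEST\<close> yields a radius with the property only because the admissible
  radii are nonempty and bounded: a ball of radius 0 spans no edge, and a large ball is the whole
  graph, which has a cycle.\<close>

lemma acyclic_ball_inj_radius:
  assumes "x \<in> V" "real r \<le> real (inj_radius G x)" shows "acyclic_ball G r x"
proof -
  obtain R where R: "graph_ball G x R = V" using ball_all[OF assms(1)] by blast
  have sub: "{e \<in> edges G. e \<subseteq> V} = edges G"
    using simple unfolding simple_ograph_def by auto
  have cyc: "\<not> acyclic_ball G R x"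
    using R has_cycle_G sub by (simp add: acyclic_ball_def)
  have mono: "acyclic_ball G s x" if "acyclic_ball G t x" "s \<le> t" for s t
    using that has_cycle_mono[of "{e \<in> edges G. e \<subseteq> graph_ball G x s}" "{e \<in> edges G. e \<subseteq> graph_ball G x t}"]
      graph_ball_mono[OF that(2), of G x] unfolding acyclic_ball_def by blast
  have "{e \<in> edges G. e \<subseteq> graph_ball G x 0} = {}"
  proof -
    have "graph_ball G x 0 \<subseteq> {x}" by (auto simp: graph_ball_def)
    moreover have "\<not> e \<subseteq> {x}" if "e \<in> edges G" for e
      using that simple unfolding simple_ograph_def by fastforce
    ultimately show ?thesis by blast
  qed
  then have "acyclic_ball G 0 x"
    unfolding acyclic_ball_def has_cycle_def
    by (metis empty_iff gr_zeroI not_numeral_le_zero)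
  moreover have "t \<le> R" if "acyclic_ball G t x" for t using mono[OF that] cyc by (meson nat_le_linear)
  ultimately have "acyclic_ball G (GREATEST r. acyclic_ball G r x) x"
    by (intro GreatestI_nat[of "\<lambda>r. acyclic_ball G r x" 0 R]) auto
  then have "acyclic_ball G (inj_radius G x) x"
    by (simp add: inj_radius_def acyclic_ball_def)
  then show ?thesis using mono assms(2) by auto
qed

end

section \<open>Finite-dimensional linear algebra\<close>

text \<open>Functions live on the whole vertex type; only their values on V count, here and in
  \<open>ns\<close>.\<close>

definition ip :: "'a set \<Rightarrow> ('a \<Rightarrow> complex) \<Rightarrow> ('a \<Rightarrow> complex) \<Rightarrow> complex" where
  "ip V f g = (\<Sum>x\<in>V. cnj (f x) * g x)"

definition ns :: "'a set \<Rightarrow> ('a \<Rightarrow> complex) \<Rightarrow> real" where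
  "ns V f = (\<Sum>x\<in>V. (cmod (f x))^2)"

lemma ip_self: "ip V f f = of_real (ns V f)"
  by (simp add: ip_def ns_def complex_norm_square mult.commute del: of_real_power)

lemma ns_nonneg: "ns V f \<ge> 0"
  by (simp add: ns_def sum_nonneg)

lemma ns_eq_0_iff: "finite V \<Longrightarrow> ns V f = 0 \<longleftrightarrow> (\<forall>x\<in>V. f x = 0)"
  by (simp add: ns_def sum_nonneg_eq_0_iff)

lemma cnj_ip: "cnj (ip V f g) = ip V g f"
  by (simp add: ip_def mult.commute)

lemma ip_add_right: "ip V f (\<lambda>x. g x + h x) = ip V f g + ip V f h"
  by (simp add: ip_def ring_distribs sum.distrib)

lemma ip_diff_right: "ip V f (\<lambda>x. g x - h x) = ip V f g - ip V f h"
  by (simp add: ip_def ring_distribs sum_subtractf)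

lemma ip_scale_right: "ip V f (\<lambda>x. c * g x) = c * ip V f g"
  by (simp add: ip_def sum_distrib_left mult.left_commute)

lemma ip_sum_right: "ip V f (\<lambda>x. \<Sum>j\<in>J. g j x) = (\<Sum>j\<in>J. ip V f (g j))"
  unfolding ip_def sum_distrib_left by (rule sum.swap)

lemma ns_add: "ns V (\<lambda>x. f x + g x) = ns V f + ns V g + 2 * Re (ip V f g)"
proof -
  have "complex_of_real (ns V (\<lambda>x. f x + g x)) = ip V (\<lambda>x. f x + g x) (\<lambda>x. f x + g x)" by (simp add: ip_self)
  also have "... = ip V f f + ip V g g + (ip V f g + cnj (ip V f g))"
    by (simp add: cnj_ip) (simp add: ip_def ring_distribs sum.distrib)
  also have "... = complex_of_real (ns V f + ns V g + 2 * Re (ip V f g))"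
    by (simp add: ip_self complex_add_cnj)
  finally show ?thesis using of_real_eq_iff by blast
qed

lemma ns_scale: "ns V (\<lambda>x. c * f x) = (cmod c)^2 * ns V f"
  by (simp add: ns_def sum_distrib_left norm_mult power_mult_distrib)

lemma cauchy_ip: "(cmod (ip V f g))^2 \<le> ns V f * ns V g"
proof -
  have "cmod (ip V f g) \<le> (\<Sum>x\<in>V. cmod (f x) * cmod (g x))"
    unfolding ip_def by (rule order_trans[OF norm_sum]) (simp add: norm_mult)
  then have "(cmod (ip V f g))^2 \<le> (\<Sum>x\<in>V. cmod (f x) * cmod (g x))^2"
    by (rule power_mono) simp
  also have "... \<le> ns V f * ns V g" unfolding ns_def by (rule Cauchy_Schwarz_ineq_sum)
  finally show ?thesis .
qed

definition orthonormal_on :: "'a set \<Rightarrow> 'i set \<Rightarrow> ('i \<Rightarrow> 'a \<Rightarrow> complex) \<Rightarrow> bool" where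
  "orthonormal_on V J \<phi> \<longleftrightarrow> (\<forall>i\<in>J. \<forall>j\<in>J. ip V (\<phi> i) (\<phi> j) = (if i = j then 1 else 0))"

text \<open>Bessel's inequality for an orthogonal family with squared norms at most C. Let s be the
  left side and g the sum of \<open>ip V (\<phi> i) f * \<phi> i\<close>; then
  \<open>ip V f g\<close> is s and \<open>ns V g\<close> is at most C s, and Cauchy-Schwarz
  finishes. The lifts of eigenfunctions to directed edges form such a family.\<close>

lemma orthogonal_residual:
  assumes "finite J" "\<And>i j. i \<in> J \<Longrightarrow> j \<in> J \<Longrightarrow> ip V (\<phi> i) (\<phi> j) = (if i = j then of_real (c i) else 0)"
    "\<And>i. i \<in> J \<Longrightarrow> c i \<le> C" "C \<ge> 0"
  shows "(\<Sum>i\<in>J. (cmod (ip V (\<phi> i) f))^2) \<le> C * ns V f"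
proof (cases "ns V f = 0 \<or> J = {}")
  case True
  have "(cmod (ip V (\<phi> i) f))^2 = 0" if "J \<noteq> {}" for i
    using cauchy_ip[of V "\<phi> i" f] True that by simp
  then have "(\<Sum>i\<in>J. (cmod (ip V (\<phi> i) f))^2) = 0" by (cases "J = {}") auto
  then show ?thesis using assms(4) ns_nonneg[of V f] by simp
next
  case False
  then have nf: "ns V f > 0" using ns_nonneg[of V f] by linarith
  define s where "s = (\<Sum>i\<in>J. (cmod (ip V (\<phi> i) f))^2)"
  define g where "g = (\<lambda>x. \<Sum>i\<in>J. ip V (\<phi> i) f * \<phi> i x)"
  have ig: "ip V f g = of_real s"
    unfolding g_def ip_sum_right ip_scale_right s_def
    by (simp add: cnj_ip[symmetric, of V f] complex_norm_square del: of_real_power)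
  have ig2: "ip V (\<phi> i) g = of_real (c i) * ip V (\<phi> i) f" if "i \<in> J" for i
  proof -
    have "ip V (\<phi> i) g = (\<Sum>j\<in>J. if i = j then ip V (\<phi> j) f * of_real (c i) else 0)"
      unfolding g_def ip_sum_right ip_scale_right using assms(2)[OF that] by (intro sum.cong) auto
    then show ?thesis using assms(1) that by simp
  qed
  have "complex_of_real (ns V g) = ip V g g" by (simp add: ip_self)
  also have "... = (\<Sum>i\<in>J. ip V (\<phi> i) f * ip V g (\<phi> i))"
    by (subst (2) g_def) (simp only: ip_sum_right ip_scale_right)
  also have "... = (\<Sum>i\<in>J. ip V (\<phi> i) f * cnj (ip V (\<phi> i) g))"
    by (simp only: cnj_ip)
  also have "... = of_real (\<Sum>i\<in>J. c i * (cmod (ip V (\<phi> i) f))^2)"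
    by (simp add: ig2 complex_norm_square mult_ac del: of_real_power)
  finally have "ns V g = (\<Sum>i\<in>J. c i * (cmod (ip V (\<phi> i) f))^2)" using of_real_eq_iff by blast
  also have "... \<le> C * s" unfolding s_def sum_distrib_left by (intro sum_mono mult_right_mono assms) auto
  finally have ng: "ns V g \<le> C * s" .
  have "s^2 \<le> ns V f * ns V g" using cauchy_ip[of V f g] ig by simp
  also have "... \<le> ns V f * (C * s)" using ng nf by (intro mult_left_mono) auto
  finally have "s * s \<le> (C * ns V f) * s" by (simp add: power2_eq_square mult_ac)
  moreover have "s \<ge> 0" by (simp add: s_def sum_nonneg)
  moreover have "C * ns V f \<ge> 0" using assms(4) nf by simp
  ultimately show ?thesis unfolding s_def[symmetric] by (metis dual_order.order_iff_strict mult_le_cancel_right not_le)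
qed

lemma bessel:
  assumes "finite J" "orthonormal_on V J \<phi>"
  shows "(\<Sum>i\<in>J. (cmod (ip V (\<phi> i) f))^2) \<le> ns V f"
  using orthogonal_residual[of J V \<phi> "\<lambda>_. 1" 1 f] assms by (auto simp: orthonormal_on_def)

definition delta :: "'a \<Rightarrow> 'a \<Rightarrow> complex" where
  "delta x y = (if y = x then 1 else 0)"

lemma ip_delta: "finite V \<Longrightarrow> x \<in> V \<Longrightarrow> ip V f (delta x) = cnj (f x)"
  by (simp add: ip_def delta_def if_distrib cong: if_cong)

lemma ns_delta: "finite V \<Longrightarrow> x \<in> V \<Longrightarrow> ns V (delta x) = 1"
  by (simp add: ns_def delta_def if_distrib[of cmod] if_distrib[of "\<lambda>z. z^2"] cong: if_cong)

lemma orthonormal_residual_eq: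
  assumes "finite J" "orthonormal_on V J \<phi>"
  shows "ns V (\<lambda>x. f x - (\<Sum>i\<in>J. ip V (\<phi> i) f * \<phi> i x)) = ns V f - (\<Sum>i\<in>J. (cmod (ip V (\<phi> i) f))^2)"
    and "j \<in> J \<Longrightarrow> ip V (\<phi> j) (\<lambda>x. f x - (\<Sum>i\<in>J. ip V (\<phi> i) f * \<phi> i x)) = 0"
proof -
  define h where "h = (\<lambda>x. f x - (\<Sum>i\<in>J. ip V (\<phi> i) f * \<phi> i x))"
  have j: "ip V (\<phi> j) h = 0" if "j \<in> J" for j
  proof -
    have o: "ip V (\<phi> j) (\<phi> i) = (if j = i then 1 else 0)" if "i \<in> J" for i
      using assms(2) that \<open>j \<in> J\<close> unfolding orthonormal_on_def by blast
    show ?thesis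
      unfolding h_def ip_diff_right ip_sum_right ip_scale_right using assms(1) that
      by (simp add: o if_distrib cong: if_cong)
  qed
  then show "j \<in> J \<Longrightarrow> ip V (\<phi> j) (\<lambda>x. f x - (\<Sum>i\<in>J. ip V (\<phi> i) f * \<phi> i x)) = 0"
    by (simp add: h_def)
  have j': "ip V h (\<phi> j) = 0" if "j \<in> J" for j using j[OF that] cnj_ip[of V "\<phi> j" h] by simp
  have "ip V h h = ip V h f - ip V h (\<lambda>x. \<Sum>i\<in>J. ip V (\<phi> i) f * \<phi> i x)"
    by (subst (2) h_def) (simp add: ip_diff_right)
  also have "... = cnj (ip V f h)" by (simp add: ip_sum_right ip_scale_right j' cnj_ip)
  also have "ip V f h = of_real (ns V f - (\<Sum>i\<in>J. (cmod (ip V (\<phi> i) f))^2))"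
    unfolding h_def ip_diff_right ip_sum_right ip_scale_right ip_self
    by (simp add: cnj_ip[symmetric, of V f] complex_norm_square del: of_real_power)
  finally have "complex_of_real (ns V h) = of_real (ns V f - (\<Sum>i\<in>J. (cmod (ip V (\<phi> i) f))^2))"
    by (simp only: ip_self complex_cnj_complex_of_real)
  then show "ns V (\<lambda>x. f x - (\<Sum>i\<in>J. ip V (\<phi> i) f * \<phi> i x)) = ns V f - (\<Sum>i\<in>J. (cmod (ip V (\<phi> i) f))^2)"
    unfolding h_def of_real_eq_iff .
qed

text \<open>The trace of the projection onto the span, evaluated in the basis of point
  masses.\<close>

lemma orthonormal_on_sum_delta:
  assumes "finite V" "finite J" "orthonormal_on V J \<phi>"
  shows "(\<Sum>x\<in>V. \<Sum>i\<in>J. (cmod (ip V (\<phi> i) (delta x)))^2) = real (card J)"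
proof -
  have "(\<Sum>x\<in>V. \<Sum>i\<in>J. (cmod (ip V (\<phi> i) (delta x)))^2) = (\<Sum>i\<in>J. \<Sum>x\<in>V. (cmod (\<phi> i x))^2)"
    by (subst sum.swap) (simp add: ip_delta assms)
  also have "... = (\<Sum>i\<in>J. 1)"
  proof (rule sum.cong)
    fix i assume "i \<in> J"
    then have "ns V (\<phi> i) = 1" using assms(3) ip_self[of V "\<phi> i"] by (simp add: orthonormal_on_def)
    then show "(\<Sum>x\<in>V. (cmod (\<phi> i x))^2) = 1" by (simp add: ns_def)
  qed simp
  finally show ?thesis by simp
qed

lemma orthonormal_on_card_le:
  assumes "finite V" "finite J" "orthonormal_on V J \<phi>"
  shows "card J \<le> card V"
proof -
  have "real (card J) \<le> (\<Sum>x\<in>V. ns V (delta x))"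
    unfolding orthonormal_on_sum_delta[OF assms, symmetric] by (intro sum_mono bessel assms)
  also have "... = real (card V)" using assms by (simp add: ns_delta)
  finally show ?thesis by simp
qed

text \<open>By the trace identity the point masses cannot all lie in a span of dimension less than
  card V, and the residual of one that does not is the new vector. It is cut off outside V so that,
  after normalisation, it lies in a compact set of functions.\<close>

lemma orthonormal_extend:
  assumes "finite V" "finite J" "orthonormal_on V J \<phi>" "card J < card V"
  shows "\<exists>f. ns V f > 0 \<and> (\<forall>j\<in>J. ip V (\<phi> j) f = 0) \<and> (\<forall>x. x \<notin> V \<longrightarrow> f x = 0)"
proof -
  have "\<exists>x\<in>V. (\<Sum>i\<in>J. (cmod (ip V (\<phi> i) (delta x)))^2) < ns V (delta x)"
  proof (rule ccontr)
    assume "\<not> ?thesis"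
    then have "(\<Sum>x\<in>V. ns V (delta x)) \<le> real (card J)"
      unfolding orthonormal_on_sum_delta[OF assms(1-3), symmetric] by (intro sum_mono) auto
    then show False using assms by (simp add: ns_delta)
  qed
  then obtain x where x: "x \<in> V" "(\<Sum>i\<in>J. (cmod (ip V (\<phi> i) (delta x)))^2) < ns V (delta x)" by blast
  define f where "f = (\<lambda>y. delta x y - (\<Sum>i\<in>J. ip V (\<phi> i) (delta x) * \<phi> i y))"
  have 1: "ns V f > 0" "\<forall>j\<in>J. ip V (\<phi> j) f = 0"
    unfolding f_def using orthonormal_residual_eq[OF assms(2,3)] x by auto
  define f' where "f' = (\<lambda>y. if y \<in> V then f y else 0)"
  have "ns V f' = ns V f" "ip V g f' = ip V g f" for g
    by (simp_all add: ns_def ip_def f'_def)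
  then show ?thesis using 1 by (intro exI[of _ f']) (auto simp: f'_def)
qed

text \<open>The Bessel defects of the point masses are nonnegative and sum to zero by the trace
  identity, so every point mass lies in the span.\<close>

lemma orthonormal_complete:
  assumes "finite V" "finite J" "orthonormal_on V J \<phi>" "card J = card V"
  shows "(\<Sum>i\<in>J. (cmod (ip V (\<phi> i) f))^2) = ns V f"
    and "x \<in> V \<Longrightarrow> f x = (\<Sum>i\<in>J. ip V (\<phi> i) f * \<phi> i x)"
proof -
  have eq: "ns V (delta x) - (\<Sum>i\<in>J. (cmod (ip V (\<phi> i) (delta x)))^2) = 0" if "x \<in> V" for x
  proof -
    have "(\<Sum>x\<in>V. ns V (delta x) - (\<Sum>i\<in>J. (cmod (ip V (\<phi> i) (delta x)))^2)) = 0"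
      unfolding sum_subtractf orthonormal_on_sum_delta[OF assms(1-3)] using assms by (simp add: ns_delta)
    moreover have "ns V (delta x) - (\<Sum>i\<in>J. (cmod (ip V (\<phi> i) (delta x)))^2) \<ge> 0" for x
      using bessel[OF assms(2,3), of "delta x"] by simp
    ultimately show ?thesis using that assms(1) by (simp add: sum_nonneg_eq_0_iff)
  qed
  have d: "delta x y = (\<Sum>i\<in>J. cnj (\<phi> i x) * \<phi> i y)" if "x \<in> V" "y \<in> V" for x y
  proof -
    have "ns V (\<lambda>y. delta x y - (\<Sum>i\<in>J. ip V (\<phi> i) (delta x) * \<phi> i y)) = 0"
      using orthonormal_residual_eq(1)[OF assms(2,3)] eq[OF that(1)] by simp
    then show ?thesis using that assms(1) by (simp add: ns_eq_0_iff ip_delta)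
  qed
  show rep: "f x = (\<Sum>i\<in>J. ip V (\<phi> i) f * \<phi> i x)" if "x \<in> V" for x f
  proof -
    have "f x = (\<Sum>y\<in>V. f y * delta y x)" using that assms(1) by (simp add: delta_def if_distrib cong: if_cong)
    also have "... = (\<Sum>y\<in>V. \<Sum>i\<in>J. f y * (cnj (\<phi> i y) * \<phi> i x))"
      using that by (simp add: d sum_distrib_left)
    also have "... = (\<Sum>i\<in>J. ip V (\<phi> i) f * \<phi> i x)"
      by (subst sum.swap) (simp add: ip_def sum_distrib_left mult_ac)
    finally show ?thesis .
  qed
  have "ns V (\<lambda>x. f x - (\<Sum>i\<in>J. ip V (\<phi> i) f * \<phi> i x)) = 0"
    using rep[of _ f] by (simp add: ns_def)
  then show "(\<Sum>i\<in>J. (cmod (ip V (\<phi> i) f))^2) = ns V f"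
    using orthonormal_residual_eq(1)[OF assms(2,3), of f] by simp
qed

definition kap :: "'a set \<Rightarrow> ('a \<Rightarrow> 'a \<Rightarrow> complex) \<Rightarrow> ('a \<Rightarrow> complex) \<Rightarrow> 'a \<Rightarrow> complex" where
  "kap V K f x = (\<Sum>y\<in>V. K x y * f y)"

lemma kap_hermitian:
  assumes "\<And>x y. x \<in> V \<Longrightarrow> y \<in> V \<Longrightarrow> K y x = cnj (K x y)"
  shows "ip V f (kap V K g) = ip V (kap V K f) g"
proof -
  have "ip V f (kap V K g) = (\<Sum>x\<in>V. \<Sum>y\<in>V. cnj (f x) * (K x y * g y))"
    by (simp add: ip_def kap_def sum_distrib_left)
  also have "... = (\<Sum>y\<in>V. \<Sum>x\<in>V. cnj (f x) * (K x y * g y))" by (rule sum.swap)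
  also have "... = ip V (kap V K f) g"
    unfolding ip_def
  proof (rule sum.cong[OF refl])
    fix y assume y: "y \<in> V"
    have "cnj (kap V K f y) = (\<Sum>x\<in>V. cnj (f x) * K x y)"
      unfolding kap_def cnj_sum
    proof (rule sum.cong[OF refl])
      fix x assume "x \<in> V"
      then show "cnj (K y x * f x) = cnj (f x) * K x y" using assms[OF \<open>x \<in> V\<close> y] by simp
    qed
    then show "(\<Sum>x\<in>V. cnj (f x) * (K x y * g y)) = cnj (kap V K f y) * g y"
      by (simp add: sum_distrib_right mult.assoc)
  qed
  finally show ?thesis .
qed

text \<open>With the coordinates outside V pinned to zero the set is a product of compact sets, so
  Tychonoff's theorem applies in the product topology of the function type.\<close>

lemma compact_supported_unit_ball:
  fixes V :: "'a set"
  shows "compact {f :: 'a \<Rightarrow> complex. (\<forall>x\<in>V. cmod (f x) \<le> 1) \<and> (\<forall>x. x \<notin> V \<longrightarrow> f x = 0)}"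
proof -
  have "compactin (product_topology (\<lambda>_. euclidean) UNIV) (PiE UNIV (\<lambda>x. if x \<in> V then cball 0 1 else {0 :: complex}))"
    unfolding compactin_PiE by (auto simp: compactin_euclidean_iff)
  moreover have "PiE UNIV (\<lambda>x. if x \<in> V then cball 0 1 else {0 :: complex}) =
     {f :: 'a \<Rightarrow> complex. (\<forall>x\<in>V. cmod (f x) \<le> 1) \<and> (\<forall>x. x \<notin> V \<longrightarrow> f x = 0)}"
    by (auto simp: PiE_iff split: if_splits)
  ultimately show ?thesis by (simp add: euclidean_product_topology compactin_euclidean_iff)
qed

text \<open>Let f maximise the quadratic form on unit vectors orthogonal to the eigenvectors already
  found, with maximum m. The residual g = K f - m f is orthogonal to them as well, so f + t g is an
  admissible competitor, and for small t > 0 it would beat f unless g = 0.\<close>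

lemma rayleigh_eigenvector:
  assumes fin: "finite V" and J: "finite J" "orthonormal_on V J \<phi>" "card J < card V"
    and herm: "\<And>x y. x \<in> V \<Longrightarrow> y \<in> V \<Longrightarrow> K y x = cnj (K x y)"
    and eig: "\<And>j x. j \<in> J \<Longrightarrow> x \<in> V \<Longrightarrow> kap V K (\<phi> j) x = complex_of_real (\<mu> j) * \<phi> j x"
  shows "\<exists>f m. ns V f = 1 \<and> (\<forall>j\<in>J. ip V (\<phi> j) f = 0) \<and> (\<forall>x\<in>V. kap V K f x = complex_of_real m * f x)"
proof -
  define B where "B = {f :: 'a \<Rightarrow> complex. (\<forall>x\<in>V. cmod (f x) \<le> 1) \<and> (\<forall>x. x \<notin> V \<longrightarrow> f x = 0)}"
  define S where "S = B \<inter> {f. ns V f = 1} \<inter> (\<Inter>j\<in>J. {f. ip V (\<phi> j) f = 0})"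
  define R where "R f = Re (ip V f (kap V K f))" for f
  have c0: "continuous_on UNIV (\<lambda>f. f x)" for x :: 'a
    using continuous_on_product_coordinates .
  have "closed {f. ns V f = 1}" unfolding ns_def
    by (intro closed_Collect_eq continuous_intros c0)
  moreover have "closed {f. ip V g f = 0}" for g unfolding ip_def
    by (intro closed_Collect_eq continuous_intros c0)
  ultimately have cS: "compact S" unfolding S_def
    by (intro compact_Int_closed closed_INT ballI) (auto simp: B_def compact_supported_unit_ball)
  have cR: "continuous_on S R"
    unfolding R_def ip_def kap_def by (intro continuous_intros continuous_on_subset[OF c0]) auto
  have scaled: "(\<lambda>x. complex_of_real (1 / sqrt (ns V g)) * g x) \<in> S"
    if "ns V g > 0" "\<forall>j\<in>J. ip V (\<phi> j) g = 0" "\<forall>x. x \<notin> V \<longrightarrow> g x = 0" for g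
  proof -
    let ?h = "\<lambda>x. complex_of_real (1 / sqrt (ns V g)) * g x"
    have n1: "ns V ?h = 1" using that by (simp add: ns_scale norm_divide power_divide del: of_real_divide)
    have "cmod (?h x) \<le> 1" if "x \<in> V" for x
    proof -
      have "(cmod (?h x))^2 \<le> ns V ?h" unfolding ns_def using fin that by (intro member_le_sum) auto
      then have le: "(cmod (?h x))^2 \<le> 1^2" unfolding n1 by simp
      show ?thesis by (rule power2_le_imp_le[OF le]) simp
    qed
    moreover have "\<forall>j\<in>J. ip V (\<phi> j) ?h = 0" using that(2) by (simp add: ip_scale_right del: of_real_divide)
    ultimately show ?thesis unfolding S_def B_def using n1 that(3) by auto
  qed
  obtain g where "ns V g > 0" "\<forall>j\<in>J. ip V (\<phi> j) g = 0" "\<forall>x. x \<notin> V \<longrightarrow> g x = 0"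
    using orthonormal_extend[OF fin J] by blast
  then have "S \<noteq> {}" using scaled by blast
  then obtain f where fS: "f \<in> S" and mx: "\<And>h. h \<in> S \<Longrightarrow> R h \<le> R f"
    using continuous_attains_sup[OF cS _ cR] by blast
  define m where "m = R f"
  have nf: "ns V f = 1" and pf: "\<forall>j\<in>J. ip V (\<phi> j) f = 0" and zf: "\<forall>x. x \<notin> V \<longrightarrow> f x = 0"
    using fS by (auto simp: S_def B_def)
  have ray: "R h \<le> m * ns V h" if "\<forall>j\<in>J. ip V (\<phi> j) h = 0" "\<forall>x. x \<notin> V \<longrightarrow> h x = 0" for h
  proof (cases "ns V h = 0")
    case True
    then have "h x = 0" if "x \<in> V" for x using ns_eq_0_iff[OF fin] that by blast
    then have "R h = 0" by (simp add: R_def ip_def)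
    then show ?thesis using True by simp
  next
    case False
    then have pos: "ns V h > 0" using ns_nonneg[of V h] by linarith
    define c where "c = 1 / sqrt (ns V h)"
    have "R (\<lambda>x. complex_of_real c * h x) = c^2 * R h"
    proof -
      have k: "kap V K (\<lambda>x. complex_of_real c * h x) = (\<lambda>x. complex_of_real c * kap V K h x)"
        by (rule ext) (simp add: kap_def sum_distrib_left mult_ac)
      have "ip V (\<lambda>x. complex_of_real c * h x) (\<lambda>x. complex_of_real c * kap V K h x)
         = complex_of_real (c * c) * ip V h (kap V K h)"
        by (simp add: ip_def sum_distrib_left mult_ac)
      then have "R (\<lambda>x. complex_of_real c * h x) = Re (complex_of_real (c * c) * ip V h (kap V K h))"
        by (simp only: R_def k)
      also have "... = c * c * R h" unfolding R_def by simp
      finally show ?thesis by (simp only: power2_eq_square)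
    qed
    also have "c^2 = 1 / ns V h" using pos by (simp add: c_def power_divide)
    finally have "R h / ns V h \<le> m" using mx[OF scaled[OF pos that], folded c_def] by (simp add: m_def)
    then show ?thesis using pos by (simp add: field_simps)
  qed
  define g where "g = (\<lambda>x. if x \<in> V then kap V K f x - complex_of_real m * f x else 0)"
  have ipg: "ip V h g = ip V h (kap V K f) - complex_of_real m * ip V h f" for h
  proof -
    have "ip V h g = ip V h (\<lambda>x. kap V K f x - complex_of_real m * f x)" by (simp add: g_def ip_def)
    then show ?thesis by (simp add: ip_diff_right ip_scale_right)
  qed
  have pg: "\<forall>j\<in>J. ip V (\<phi> j) g = 0"
  proof
    fix j assume j: "j \<in> J"
    have "ip V (\<phi> j) (kap V K f) = ip V (kap V K (\<phi> j)) f" by (rule kap_hermitian[OF herm])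
    also have "... = complex_of_real (\<mu> j) * ip V (\<phi> j) f"
      unfolding ip_def sum_distrib_left using eig[OF j] by (intro sum.cong) auto
    finally show "ip V (\<phi> j) g = 0" using pf j by (simp add: ipg)
  qed
  have key: "0 \<le> - 2 * t * ns V g + t^2 * (m * ns V g - R g)" for t :: real
  proof -
    let ?h = "\<lambda>x. f x + complex_of_real t * g x"
    have k: "kap V K ?h = (\<lambda>x. kap V K f x + complex_of_real t * kap V K g x)"
      by (rule ext) (simp add: kap_def sum_distrib_left sum.distrib ring_distribs mult_ac)
    have ipl: "ip V ?h u = ip V f u + complex_of_real t * ip V g u" for u
      by (simp add: ip_def ring_distribs sum.distrib sum_distrib_left mult_ac)
    have fg: "ip V f (kap V K g) = cnj (ip V g (kap V K f))"
    proof -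
      have "ip V f (kap V K g) = ip V (kap V K f) g" by (rule kap_hermitian[OF herm])
      then show ?thesis by (simp add: cnj_ip)
    qed
    have gf: "Re (ip V g (kap V K f)) = ns V g + m * Re (ip V g f)"
    proof -
      have "Re (ip V g g) = Re (ip V g (kap V K f)) - m * Re (ip V g f)" unfolding ipg[of g] by simp
      then show ?thesis by (simp add: ip_self)
    qed
    have "R ?h = R f + 2 * t * Re (ip V g (kap V K f)) + t^2 * R g"
      unfolding R_def k ipl ip_add_right ip_scale_right fg
      by (simp add: power2_eq_square algebra_simps)
    moreover have "ns V ?h = 1 + t^2 * ns V g + 2 * t * Re (ip V g f)"
    proof -
      have "Re (ip V f g) = Re (ip V g f)" using arg_cong[OF cnj_ip[of V f g], of Re] by simp
      then show ?thesis by (simp add: ns_add ns_scale ip_scale_right nf)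
    qed
    moreover have "R ?h \<le> m * ns V ?h"
      using pf pg zf by (intro ray) (auto simp: ip_add_right ip_scale_right g_def)
    ultimately show ?thesis unfolding gf m_def[symmetric] by (simp add: algebra_simps)
  qed
  have "ns V g = 0"
  proof (rule ccontr)
    assume "ns V g \<noteq> 0"
    then have p: "ns V g > 0" using ns_nonneg[of V g] by linarith
    \<comment> \<open>Q is a positive upper bound for the quadratic coefficient, so at t =
      \<open>ns V g / Q\<close> the linear term of \<open>key\<close> prevails.\<close>
    define Q where "Q = \<bar>m * ns V g - R g\<bar> + 1"
    define t where "t = ns V g / Q"
    have Q: "Q > 0" "m * ns V g - R g \<le> Q" by (auto simp: Q_def)
    have "t > 0" using p Q by (simp add: t_def)
    have "t^2 * (m * ns V g - R g) \<le> t^2 * Q" using Q by (intro mult_left_mono) auto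
    also have "... = t * ns V g" using Q by (simp add: t_def power2_eq_square)
    finally have "0 \<le> - (t * ns V g)" using key[of t] by linarith
    then show False using mult_pos_pos[OF \<open>t > 0\<close> p] by linarith
  qed
  then have "\<forall>x\<in>V. kap V K f x = complex_of_real m * f x"
    using ns_eq_0_iff[OF fin, of g] by (auto simp: g_def)
  then show ?thesis using nf pf by blast
qed

theorem hermitian_spectral:
  assumes fin: "finite V"
    and herm: "\<And>x y. x \<in> V \<Longrightarrow> y \<in> V \<Longrightarrow> K y x = cnj (K x y)"
  shows "\<exists>\<phi> \<mu>. orthonormal_on V {..<card V} \<phi> \<and>
     (\<forall>j<card V. \<forall>x\<in>V. kap V K (\<phi> j) x = complex_of_real (\<mu> j) * \<phi> j x)"
proof -
  have "\<exists>\<phi> \<mu>. orthonormal_on V {..<n} \<phi> \<and>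
     (\<forall>j<n. \<forall>x\<in>V. kap V K (\<phi> j) x = complex_of_real (\<mu> j) * \<phi> j x)" if "n \<le> card V" for n
    using that
  proof (induction n)
    case 0
    then show ?case by (simp add: orthonormal_on_def)
  next
    case (Suc n)
    then obtain \<phi> \<mu> where o: "orthonormal_on V {..<n} \<phi>"
      and e: "\<And>j x. j < n \<Longrightarrow> x \<in> V \<Longrightarrow> kap V K (\<phi> j) x = complex_of_real (\<mu> j) * \<phi> j x" by auto
    have "\<exists>f m. ns V f = 1 \<and> (\<forall>j\<in>{..<n}. ip V (\<phi> j) f = 0) \<and> (\<forall>x\<in>V. kap V K f x = complex_of_real m * f x)"
      using Suc.prems by (intro rayleigh_eigenvector[OF fin _ o _ herm e]) auto
    then obtain f m where f: "ns V f = 1" "\<forall>j<n. ip V (\<phi> j) f = 0" "\<forall>x\<in>V. kap V K f x = complex_of_real m * f x"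
      by auto
    have f2: "ip V f (\<phi> j) = 0" if "j < n" for j
      using f(2) that cnj_ip[of V "\<phi> j" f] by simp
    have "orthonormal_on V {..<Suc n} (\<phi>(n := f))"
    proof -
      have "ip V f f = 1" using f(1) by (simp add: ip_self)
      then show ?thesis using o f(2) f2 by (auto simp: orthonormal_on_def less_Suc_eq)
    qed
    moreover have "\<forall>j<Suc n. \<forall>x\<in>V. kap V K ((\<phi>(n := f)) j) x = complex_of_real ((\<mu>(n := m)) j) * (\<phi>(n := f)) j x"
    proof (intro allI impI ballI)
      fix j x assume "j < Suc n" "x \<in> V"
      then show "kap V K ((\<phi>(n := f)) j) x = complex_of_real ((\<mu>(n := m)) j) * (\<phi>(n := f)) j x"
        using e[of j x] f(3) by (cases "j = n") (simp_all only: fun_upd_same fun_upd_other less_Suc_eq, simp_all)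
    qed
    ultimately show ?case by blast
  qed
  then show ?thesis by blast
qed

section \<open>Square sums of weights pushed forward to end points\<close>

text \<open>A fibre has at most one element, so there are no cross terms. Applied to walks and their
  ends, this is how acyclic balls enter the estimates.\<close>

lemma sum_fiber_square_inj:
  fixes d :: "'g \<Rightarrow> real"
  assumes "finite T" "finite B" "l ` T \<subseteq> B" "inj_on l T"
  shows "(\<Sum>y\<in>B. (\<Sum>ws | ws \<in> T \<and> l ws = y. d ws)^2) = (\<Sum>ws\<in>T. (d ws)^2)"
proof -
  have f: "{ws'. ws' \<in> T \<and> l ws' = l ws} = {ws}" if "ws \<in> T" for ws
    using assms(4) that by (auto simp: inj_on_def)
  have "(\<Sum>y\<in>B. (\<Sum>ws | ws \<in> T \<and> l ws = y. d ws)^2) = (\<Sum>y\<in>l ` T. (\<Sum>ws | ws \<in> T \<and> l ws = y. d ws)^2)"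
  proof (rule sum.mono_neutral_right[OF assms(2,3)])
    show "\<forall>y\<in>B - l ` T. (\<Sum>ws | ws \<in> T \<and> l ws = y. d ws)^2 = 0"
    proof
      fix y assume "y \<in> B - l ` T"
      then have "{ws. ws \<in> T \<and> l ws = y} = {}" by auto
      then show "(\<Sum>ws | ws \<in> T \<and> l ws = y. d ws)^2 = 0" by (simp only: sum.empty) simp
    qed
  qed
  also have "... = (\<Sum>ws\<in>T. (d ws)^2)"
    unfolding sum.reindex[OF assms(4)] using f by (intro sum.cong) auto
  finally show ?thesis .
qed

lemma sum_square_le_square_sum:
  fixes w :: "'b \<Rightarrow> real"
  assumes "finite B" shows "(\<Sum>y\<in>B. (w y)^2) \<le> (\<Sum>y\<in>B. \<bar>w y\<bar>)^2"
  using assms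
proof (induction B)
  case (insert b B)
  have "0 \<le> 2 * \<bar>w b\<bar> * (\<Sum>y\<in>B. \<bar>w y\<bar>)" by (intro mult_nonneg_nonneg sum_nonneg) auto
  then show ?case using insert.IH by (simp only: sum.insert[OF insert.hyps(1,2)] power2_sum power2_abs)
qed simp

text \<open>The substitute at vertices whose balls contain cycles: crude, but it depends on the
  number and weights of the walks only.\<close>

lemma sum_fiber_square_le:
  fixes d :: "'g \<Rightarrow> real"
  assumes "finite T" "finite B" "l ` T \<subseteq> B"
  shows "(\<Sum>y\<in>B. (\<Sum>ws | ws \<in> T \<and> l ws = y. d ws)^2) \<le> (\<Sum>ws\<in>T. \<bar>d ws\<bar>)^2"
proof -
  have "(\<Sum>y\<in>B. (\<Sum>ws | ws \<in> T \<and> l ws = y. d ws)^2) \<le> (\<Sum>y\<in>B. \<bar>\<Sum>ws | ws \<in> T \<and> l ws = y. d ws\<bar>)^2"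
    by (rule sum_square_le_square_sum[OF assms(2)])
  also have "... \<le> (\<Sum>y\<in>B. \<Sum>ws | ws \<in> T \<and> l ws = y. \<bar>d ws\<bar>)^2"
    by (intro power_mono sum_mono sum_abs sum_nonneg) auto
  also have "(\<Sum>y\<in>B. \<Sum>ws | ws \<in> T \<and> l ws = y. \<bar>d ws\<bar>) = (\<Sum>ws\<in>T. \<bar>d ws\<bar>)"
    by (rule sum.group[OF assms])
  finally show ?thesis .
qed

section \<open>Walks issuing from a directed edge\<close>

context fgraph begin

text \<open>Paths of n steps in the graph of directed edges starting at (x, y): a list in
  \<open>W n x y\<close> has n + 2 vertices and n + 1 edges.\<close>

primrec W :: "nat \<Rightarrow> 'a \<Rightarrow> 'a \<Rightarrow> 'a list set" where
  "W 0 x y = {[x, y]}"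
| "W (Suc n) x y = (\<Union>z\<in>nb y - {x}. Cons x ` W n y z)"

lemma W_shape: "ws \<in> W n x y \<Longrightarrow> (\<exists>r. ws = x # y # r) \<and> length ws = n + 2"
proof (induction n arbitrary: x y ws)
  case (Suc n)
  then obtain z ws' where z: "ws' \<in> W n y z" "ws = x # ws'" by auto
  from Suc.IH[OF z(1)] z(2) show ?case by auto
qed simp

lemma W_nth1: "ws \<in> W n x y \<Longrightarrow> ws ! Suc 0 = y"
  using W_shape[of ws n x y] by auto

lemma W_finite [simp]: "finite (W n x y)"
  by (induction n arbitrary: x y) auto

lemma W_sum: "(\<Sum>ws\<in>W (Suc n) x y. f ws) = (\<Sum>z\<in>nb y - {x}. \<Sum>ws\<in>W n y z. f (x # ws))"
proof -
  have "(\<Sum>ws\<in>W (Suc n) x y. f ws) = (\<Sum>z\<in>nb y - {x}. \<Sum>ws\<in>Cons x ` W n y z. f ws)"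
    unfolding W.simps
  proof (rule sum.UNION_disjoint)
    show "\<forall>i\<in>nb y - {x}. \<forall>j\<in>nb y - {x}. i \<noteq> j \<longrightarrow> Cons x ` W n y i \<inter> Cons x ` W n y j = {}"
      by (auto dest!: W_nth1)
  qed auto
  also have "... = (\<Sum>z\<in>nb y - {x}. \<Sum>ws\<in>W n y z. f (x # ws))"
    by (simp add: sum.reindex)
  finally show ?thesis .
qed

lemma W_nbw: "y \<in> nb x \<Longrightarrow> ws \<in> W n x y \<Longrightarrow> nbw (edges G) ws"
proof (induction n arbitrary: x y ws)
  case 0
  then show ?case by (simp add: adj_def)
next
  case (Suc n)
  then obtain z ws' where z: "z \<in> nb y" "z \<noteq> x" "ws' \<in> W n y z" "ws = x # ws'" by auto
  obtain r where r: "ws' = y # z # r" using W_shape[OF z(3)] by blast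
  have "nbw (edges G) (y # z # r)" using Suc.IH[OF z(1,3)] r by simp
  then show ?case using z r Suc.prems by (simp add: adj_def)
qed

lemma W_card: "y \<in> nb x \<Longrightarrow> card (W n x y) = q ^ n"
proof (induction n arbitrary: x y)
  case (Suc n)
  have "card (W (Suc n) x y) = (\<Sum>z\<in>nb y - {x}. card (W n y z))"
    unfolding card_eq_sum W_sum by simp
  also have "... = (\<Sum>z\<in>nb y - {x}. q ^ n)" by (intro sum.cong Suc.IH) auto
  also have "... = q ^ Suc n"
    using nb_minus_card[of y x] Suc.prems nb_V nb_sym[of x y] by simp
  finally show ?case .
qed simp

text \<open>Together with \<open>last\<close> it gives the final directed edge of a walk.\<close>

definition pen :: "'a list \<Rightarrow> 'a" where "pen ws = last (butlast ws)"

lemma W_ends: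
  assumes "ws \<in> W n x y" shows "pen (z # ws) = pen ws" "last (z # ws) = last ws"
  using W_shape[OF assms] by (auto simp: pen_def)

lemma W_last_adj: "y \<in> nb x \<Longrightarrow> ws \<in> W n x y \<Longrightarrow> last ws \<in> nb (pen ws)"
proof (induction n arbitrary: x y ws)
  case 0
  then show ?case by (simp add: pen_def)
next
  case (Suc n)
  then obtain z ws' where z: "z \<in> nb y" "ws' \<in> W n y z" "ws = x # ws'" by auto
  then show ?case using Suc.IH[OF z(1,2)] W_ends[OF z(2)] by simp
qed

lemma W_unique:
  assumes "acyclic_ball G r x" "y \<in> nb x" "y' \<in> nb x" "ws \<in> W n x y" "ws' \<in> W m x y'"
    "Suc n \<le> r" "Suc m \<le> r" "last ws = last ws'"
  shows "ws = ws'"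
proof (rule acyclic_ball_nbw_unique[OF simple assms(1)])
  show "x \<in> V" using nb_V(2)[OF assms(2)] .
  show "nbw (edges G) ws" by (rule W_nbw[OF assms(2,4)])
  show "nbw (edges G) ws'" by (rule W_nbw[OF assms(3,5)])
  show "hd ws = x" "length ws \<le> Suc r" using W_shape[OF assms(4)] assms(6) by auto
  show "hd ws' = x" "length ws' \<le> Suc r" using W_shape[OF assms(5)] assms(7) by auto
qed (rule assms(8))

text \<open>The hypothesis makes g an eigenfunction of the nonbacktracking shift on directed edges;
  summing over walks applies the n-th power of the shift.\<close>

lemma sum_walk_eigen:
  fixes g :: "'a \<Rightarrow> 'a \<Rightarrow> complex"
  assumes "\<And>x y. y \<in> nb x \<Longrightarrow> (\<Sum>z\<in>nb y - {x}. g y z) = c * g x y"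
  shows "y \<in> nb x \<Longrightarrow> (\<Sum>ws\<in>W n x y. g (pen ws) (last ws)) = c ^ n * g x y"
proof (induction n arbitrary: x y)
  case 0
  then show ?case by (simp add: pen_def)
next
  case (Suc n)
  have "(\<Sum>ws\<in>W (Suc n) x y. g (pen ws) (last ws)) = (\<Sum>z\<in>nb y - {x}. \<Sum>ws\<in>W n y z. g (pen ws) (last ws))"
    unfolding W_sum using W_ends by (intro sum.cong refl) simp
  also have "... = (\<Sum>z\<in>nb y - {x}. c ^ n * g y z)"
    by (intro sum.cong refl Suc.IH) auto
  finally show ?case using assms[OF Suc.prems] by (simp add: sum_distrib_left[symmetric])
qed

section \<open>Spectral counting\<close>

definition eigenfn :: "complex \<Rightarrow> ('a \<Rightarrow> complex) \<Rightarrow> bool" where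
  "eigenfn \<mu> f \<longleftrightarrow> (\<forall>x\<in>V. (\<Sum>y\<in>nb x. f y) = \<mu> * f x)"

text \<open>Walks of exactly k steps from x; in a tree their ends run once through the sphere of
  radius k.\<close>

primrec sph :: "nat \<Rightarrow> 'a \<Rightarrow> 'a list set" where
  "sph 0 x = {[x]}"
| "sph (Suc k) x = (\<Union>y\<in>nb x. W k x y)"

lemma sph_finite [simp]: "finite (sph k x)" by (cases k) auto

lemma sph_sum_Suc: "(\<Sum>ws\<in>sph (Suc k) x. f ws) = (\<Sum>y\<in>nb x. \<Sum>ws\<in>W k x y. f ws)"
  unfolding sph.simps
proof (rule sum.UNION_disjoint)
  show "\<forall>i\<in>nb x. \<forall>j\<in>nb x. i \<noteq> j \<longrightarrow> W k x i \<inter> W k x j = {}"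
    by (auto dest!: W_nth1)
qed auto

lemma sph_shape: "ws \<in> sph k x \<Longrightarrow> hd ws = x \<and> length ws = Suc k"
proof (cases k)
  case (Suc m)
  assume "ws \<in> sph k x"
  then obtain y where "ws \<in> W m x y" using Suc by auto
  from W_shape[OF this] show ?thesis using Suc by auto
qed simp

lemma sph_nbw: "ws \<in> sph k x \<Longrightarrow> nbw (edges G) ws"
proof (cases k)
  case (Suc m)
  assume "ws \<in> sph k x"
  then obtain y where "y \<in> nb x" "ws \<in> W m x y" using Suc by auto
  then show ?thesis by (rule W_nbw)
qed simp

lemma sph_last: "x \<in> V \<Longrightarrow> ws \<in> sph k x \<Longrightarrow> last ws \<in> V"
proof (cases k)
  case (Suc m)
  assume "ws \<in> sph k x"
  then obtain y where "y \<in> nb x" "ws \<in> W m x y" using Suc by auto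
  then show ?thesis by (rule nb_V(1)[OF W_last_adj])
qed simp

end

section \<open>Sphere polynomials of the regular tree\<close>

definition sphere_size :: "nat \<Rightarrow> nat \<Rightarrow> real" where
  "sphere_size q k = (if k = 0 then 1 else (real q + 1) * real q ^ (k - 1))"

text \<open>Summation over nonbacktracking walks of k steps is this polynomial in the adjacency
  operator. The degree 2 case breaks the pattern because the first step has q + 1 choices and every
  later one only q.\<close>

fun apoly :: "nat \<Rightarrow> nat \<Rightarrow> real \<Rightarrow> real" where
  "apoly q 0 t = 1"
| "apoly q (Suc 0) t = t"
| "apoly q (Suc (Suc 0)) t = t^2 - (real q + 1)"
| "apoly q (Suc (Suc (Suc k))) t = t * apoly q (Suc (Suc k)) t - real q * apoly q (Suc k) t"

context fgraph begin

lemma sph_card: "x \<in> V \<Longrightarrow> real (card (sph k x)) = sphere_size q k"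
proof (cases k)
  case (Suc m)
  assume x: "x \<in> V"
  have "real (card (sph k x)) = (\<Sum>y\<in>nb x. real (card (W m x y)))"
    unfolding Suc card_eq_sum sph_sum_Suc by simp
  also have "... = (\<Sum>y\<in>nb x. real q ^ m)" by (intro sum.cong) (auto simp: W_card)
  finally show ?thesis using nb_card[OF x] Suc by (simp add: sphere_size_def)
qed (simp add: sphere_size_def)

text \<open>Let F k x sum f over the ends of k-step walks from x, and H k x y over those in
  \<open>W k x y\<close>. After the edge (x, y) a walk may continue from y in any way that does not
  start back to x, so H (k + 1) x y = F (k + 1) y - H k y x; summing over y gives the recurrence of
  \<open>apoly\<close>.\<close>

lemma sum_sph_eigen:
  assumes e: "eigenfn (of_real \<mu>) f" and x: "x \<in> V"
  shows "(\<Sum>ws\<in>sph k x. f (last ws)) = of_real (apoly q k \<mu>) * f x"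
proof -
  define H where "H k x y = (\<Sum>ws\<in>W k x y. f (last ws))" for k x y
  define F where "F k x = (\<Sum>ws\<in>sph k x. f (last ws))" for k x
  have F_Suc: "F (Suc k) x = (\<Sum>y\<in>nb x. H k x y)" for k x
    unfolding F_def H_def sph_sum_Suc ..
  have H0: "H 0 x y = f y" for x y by (simp add: H_def)
  have H_Suc: "H (Suc k) x y = F (Suc k) y - H k y x" if "y \<in> nb x" for k x y
  proof -
    have "H (Suc k) x y = (\<Sum>z\<in>nb y - {x}. H k y z)"
      unfolding H_def W_sum using W_ends(2) by (intro sum.cong refl) simp
    also have "... = F (Suc k) y - H k y x"
      unfolding F_Suc using that nb_sym[of x y] by (subst sum_diff1) auto
    finally show ?thesis .
  qed
  have A: "(\<Sum>y\<in>nb x. c * f y) = of_real \<mu> * (c * f x)" if "x \<in> V" for x c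
    using e that by (simp add: eigenfn_def sum_distrib_left[symmetric] del: of_real_power)
  have main: "\<forall>x\<in>V. F k x = of_real (apoly q k \<mu>) * f x" for k
  proof (rule apoly.induct[of "\<lambda>_ k _. \<forall>x\<in>V. F k x = of_real (apoly q k \<mu>) * f x" q k \<mu>])
    show "\<forall>x\<in>V. F 0 x = of_real (apoly q 0 \<mu>) * f x" by (simp add: F_def)
    show "\<forall>x\<in>V. F (Suc 0) x = of_real (apoly q (Suc 0) \<mu>) * f x"
      using A[of _ 1] by (auto simp: F_Suc H0)
    show "\<forall>x\<in>V. F (Suc (Suc 0)) x = of_real (apoly q (Suc (Suc 0)) \<mu>) * f x"
    proof
      fix x assume x: "x \<in> V"
      have F1: "F (Suc 0) y = of_real \<mu> * f y" if "y \<in> V" for y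
        using A[OF that, of 1] by (simp add: F_Suc H0)
      have "F (Suc (Suc 0)) x = (\<Sum>y\<in>nb x. of_real \<mu> * f y - f x)"
        unfolding F_Suc[of "Suc 0"] using nb_V(1)[of _ x] by (intro sum.cong refl) (simp add: H_Suc H0 F1 del: Image_singleton_iff)
      also have "... = of_real \<mu> * (of_real \<mu> * f x) - (of_nat q + 1) * f x"
        using A[OF x, of "of_real \<mu>"] nb_card[OF x] by (simp add: sum_subtractf)
      finally show "F (Suc (Suc 0)) x = of_real (apoly q (Suc (Suc 0)) \<mu>) * f x"
        by (simp add: power2_eq_square algebra_simps)
    qed
  next
    fix k
    assume IH: "\<forall>x\<in>V. F (Suc (Suc k)) x = of_real (apoly q (Suc (Suc k)) \<mu>) * f x"
      "\<forall>x\<in>V. F (Suc k) x = of_real (apoly q (Suc k) \<mu>) * f x"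
    show "\<forall>x\<in>V. F (Suc (Suc (Suc k))) x = of_real (apoly q (Suc (Suc (Suc k))) \<mu>) * f x"
    proof
      fix x assume x: "x \<in> V"
      have "F (Suc (Suc (Suc k))) x = (\<Sum>y\<in>nb x. F (Suc (Suc k)) y - (F (Suc k) x - H k x y))"
        unfolding F_Suc[of "Suc (Suc k)"] using nb_sym[of _ x] by (intro sum.cong refl) (simp add: H_Suc del: Image_singleton_iff)
      also have "... = (\<Sum>y\<in>nb x. of_real (apoly q (Suc (Suc k)) \<mu>) * f y) - (of_nat (card (nb x)) * F (Suc k) x - F (Suc k) x)"
      proof -
        have "(\<Sum>y\<in>nb x. F (Suc (Suc k)) y) = (\<Sum>y\<in>nb x. of_real (apoly q (Suc (Suc k)) \<mu>) * f y)"
          using IH(1) nb_V(1)[of _ x] by (intro sum.cong refl) blast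
        then show ?thesis by (simp add: sum_subtractf F_Suc[of k])
      qed
      also have "... = of_real \<mu> * (of_real (apoly q (Suc (Suc k)) \<mu>) * f x) - of_nat q * (of_real (apoly q (Suc k) \<mu>) * f x)"
        unfolding A[OF x] using IH(2) x nb_card[OF x] by (simp add: algebra_simps del: apoly.simps)
      finally show "F (Suc (Suc (Suc k))) x = of_real (apoly q (Suc (Suc (Suc k))) \<mu>) * f x"
        by (simp add: algebra_simps)
    qed
  qed
  show ?thesis using main x by (simp add: F_def)
qed

text \<open>Row x of the polynomial with coefficients c in the basis \<open>apoly\<close>, taken at
  the adjacency matrix and computed through walks. A walk of k steps is a list of length k +
  1.\<close>

definition wcol :: "(nat \<Rightarrow> real) \<Rightarrow> nat \<Rightarrow> 'a \<Rightarrow> 'a \<Rightarrow> real" where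
  "wcol c n x y = (\<Sum>ws | ws \<in> (\<Union>k\<le>n. sph k x) \<and> last ws = y. c (length ws - 1))"

lemma sum_union_sph: "(\<Sum>ws\<in>(\<Union>k\<le>n. sph k x). f ws) = (\<Sum>k\<le>n. \<Sum>ws\<in>sph k x. f ws)"
proof (rule sum.UNION_disjoint)
  show "\<forall>i\<in>{..n}. \<forall>j\<in>{..n}. i \<noteq> j \<longrightarrow> sph i x \<inter> sph j x = {}"
  proof (intro ballI impI)
    fix i j :: nat assume "i \<noteq> j"
    then show "sph i x \<inter> sph j x = {}" by (auto dest!: sph_shape)
  qed
qed auto

lemma sum_sph_const: "x \<in> V \<Longrightarrow> (\<Sum>k\<le>n. \<Sum>ws\<in>sph k x. (d (length ws - 1) :: real)) = (\<Sum>k\<le>n. d k * sphere_size q k)"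
proof (intro sum.cong refl)
  fix k assume x: "x \<in> V"
  have "(\<Sum>ws\<in>sph k x. d (length ws - 1)) = (\<Sum>ws\<in>sph k x. d k)"
    by (intro sum.cong refl) (simp add: sph_shape)
  then show "(\<Sum>ws\<in>sph k x. d (length ws - 1)) = d k * sphere_size q k"
    using sph_card[OF x] by (simp add: mult.commute)
qed

lemma wcol_last: "x \<in> V \<Longrightarrow> last ` (\<Union>k\<le>n. sph k x) \<subseteq> V"
  using sph_last by auto

lemma wcol_ip:
  assumes e: "eigenfn (of_real \<mu>) f" and x: "x \<in> V"
  shows "ip V f (\<lambda>y. of_real (wcol c n x y)) = cnj (of_real (\<Sum>k\<le>n. c k * apoly q k \<mu>) * f x)"
proof -
  let ?T = "\<Union>k\<le>n. sph k x"
  have "cnj (ip V f (\<lambda>y. of_real (wcol c n x y))) = (\<Sum>y\<in>V. \<Sum>ws | ws \<in> ?T \<and> last ws = y. of_real (c (length ws - 1)) * f (last ws))"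
    unfolding ip_def wcol_def by (simp add: sum_distrib_left mult.commute)
  also have "... = (\<Sum>ws\<in>?T. of_real (c (length ws - 1)) * f (last ws))"
    by (rule sum.group[OF _ finV wcol_last[OF x]]) simp
  also have "... = (\<Sum>k\<le>n. \<Sum>ws\<in>sph k x. of_real (c k) * f (last ws))"
    unfolding sum_union_sph by (intro sum.cong refl) (simp add: sph_shape)
  also have "... = (\<Sum>k\<le>n. of_real (c k) * (of_real (apoly q k \<mu>) * f x))"
    by (simp add: sum_distrib_left[symmetric] sum_sph_eigen[OF e x])
  also have "... = of_real (\<Sum>k\<le>n. c k * apoly q k \<mu>) * f x"
    by (simp add: sum_distrib_right mult.assoc)
  finally show ?thesis by (metis complex_cnj_cnj)
qed

lemma wcol_norm_good:
  assumes x: "x \<in> V" and g: "acyclic_ball G n x"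
  shows "(\<Sum>y\<in>V. (wcol c n x y)^2) = (\<Sum>k\<le>n. (c k)^2 * sphere_size q k)"
proof -
  let ?T = "\<Union>k\<le>n. sph k x"
  have inj: "inj_on last ?T"
  proof (rule inj_onI)
    fix ws ws' assume h: "ws \<in> ?T" "ws' \<in> ?T" "last ws = last ws'"
    show "ws = ws'"
      by (rule acyclic_ball_nbw_unique[OF simple g x]) (use h sph_shape sph_nbw in auto)
  qed
  have "(\<Sum>y\<in>V. (wcol c n x y)^2) = (\<Sum>ws\<in>?T. (c (length ws - 1))^2)"
    unfolding wcol_def by (rule sum_fiber_square_inj[OF _ finV wcol_last[OF x] inj]) simp
  also have "... = (\<Sum>k\<le>n. (c k)^2 * sphere_size q k)"
    unfolding sum_union_sph by (rule sum_sph_const[OF x])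
  finally show ?thesis .
qed

lemma wcol_norm_le:
  assumes x: "x \<in> V"
  shows "(\<Sum>y\<in>V. (wcol c n x y)^2) \<le> (\<Sum>k\<le>n. \<bar>c k\<bar> * sphere_size q k)^2"
proof -
  let ?T = "\<Union>k\<le>n. sph k x"
  have "(\<Sum>y\<in>V. (wcol c n x y)^2) \<le> (\<Sum>ws\<in>?T. \<bar>c (length ws - 1)\<bar>)^2"
    unfolding wcol_def by (rule sum_fiber_square_le[OF _ finV wcol_last[OF x]]) simp
  also have "(\<Sum>ws\<in>?T. \<bar>c (length ws - 1)\<bar>) = (\<Sum>k\<le>n. \<bar>c k\<bar> * sphere_size q k)"
    unfolding sum_union_sph by (rule sum_sph_const[OF x])
  finally show ?thesis .
qed

definition bad :: "nat \<Rightarrow> nat" where "bad n = card {x \<in> V. \<not> acyclic_ball G n x}"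

text \<open>The squared Hilbert-Schmidt norm of a polynomial in the adjacency matrix. A vertex with
  acyclic ball contributes exactly the value of the tree, a bad vertex something between zero and
  the crude bound.\<close>

lemma sum_wcol_norm:
  shows "(\<Sum>x\<in>V. \<Sum>y\<in>V. (wcol c n x y)^2)
       \<le> real (card V) * (\<Sum>k\<le>n. (c k)^2 * sphere_size q k) + real (bad n) * (\<Sum>k\<le>n. \<bar>c k\<bar> * sphere_size q k)^2" (is "?L \<le> _ * ?S + _ * ?K")
    and "real (card V) * (\<Sum>k\<le>n. (c k)^2 * sphere_size q k) - real (bad n) * (\<Sum>k\<le>n. (c k)^2 * sphere_size q k)
       \<le> (\<Sum>x\<in>V. \<Sum>y\<in>V. (wcol c n x y)^2)"
proof -
  let ?B = "{x \<in> V. \<not> acyclic_ball G n x}"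
  have S0: "?S \<ge> 0" by (intro sum_nonneg) (auto simp: sphere_size_def)
  have sub: "?B \<subseteq> V" by auto
  have "?L \<le> (\<Sum>x\<in>V. ?S + (if x \<in> ?B then ?K else 0))"
    using S0 by (intro sum_mono) (auto simp: wcol_norm_good intro: add_increasing wcol_norm_le)
  also have "... = real (card V) * ?S + (\<Sum>x\<in>?B. ?K)"
    using finV by (simp add: sum.distrib sum.If_cases Int_absorb1[OF sub] del: sum_constant)
       (simp add: Collect_conj_eq Int_assoc[symmetric])
  finally show "?L \<le> real (card V) * ?S + real (bad n) * ?K" by (simp add: bad_def)
  have "(\<Sum>x\<in>V. ?S) - (\<Sum>x\<in>?B. ?S) = (\<Sum>x\<in>V - ?B. ?S)" using finV sub by (simp only: sum_diff)
  also have "... = (\<Sum>x\<in>V - ?B. \<Sum>y\<in>V. (wcol c n x y)^2)"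
    by (intro sum.cong) (auto simp: wcol_norm_good)
  also have "... \<le> ?L" using finV by (intro sum_mono2) (auto intro: sum_nonneg)
  finally show "real (card V) * ?S - real (bad n) * ?S \<le> ?L" by (simp add: bad_def)
qed

text \<open>Both sides are the squared Hilbert-Schmidt norm of the polynomial in the adjacency
  matrix restricted to the span of the family, on the right row by row.\<close>

lemma orthonormal_sum_poly:
  assumes J: "finite J" and o: "orthonormal_on V J \<phi>" and e: "\<And>i. i \<in> J \<Longrightarrow> eigenfn (of_real (\<mu> i)) (\<phi> i)"
  shows "(\<Sum>i\<in>J. (\<Sum>k\<le>n. c k * apoly q k (\<mu> i))^2) = (\<Sum>x\<in>V. \<Sum>i\<in>J. (cmod (ip V (\<phi> i) (\<lambda>y. of_real (wcol c n x y))))^2)"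
proof -
  have "(\<Sum>x\<in>V. \<Sum>i\<in>J. (cmod (ip V (\<phi> i) (\<lambda>y. of_real (wcol c n x y))))^2)
     = (\<Sum>x\<in>V. \<Sum>i\<in>J. (\<Sum>k\<le>n. c k * apoly q k (\<mu> i))^2 * (cmod (\<phi> i x))^2)"
    using wcol_ip[OF e] by (intro sum.cong refl) (simp add: norm_mult power_mult_distrib del: of_real_sum of_real_mult)
  also have "... = (\<Sum>i\<in>J. (\<Sum>k\<le>n. c k * apoly q k (\<mu> i))^2 * ns V (\<phi> i))"
    by (subst sum.swap) (simp add: ns_def sum_distrib_left)
  also have "... = (\<Sum>i\<in>J. (\<Sum>k\<le>n. c k * apoly q k (\<mu> i))^2)"
  proof (intro sum.cong refl)
    fix i assume "i \<in> J"
    then have "of_real (ns V (\<phi> i)) = (1 :: complex)" using o by (simp add: orthonormal_on_def flip: ip_self)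
    then show "(\<Sum>k\<le>n. c k * apoly q k (\<mu> i))^2 * ns V (\<phi> i) = (\<Sum>k\<le>n. c k * apoly q k (\<mu> i))^2"
      by simp
  qed
  finally show ?thesis by simp
qed

lemma orthonormal_sum_poly_le:
  assumes J: "finite J" and o: "orthonormal_on V J \<phi>" and e: "\<And>i. i \<in> J \<Longrightarrow> eigenfn (of_real (\<mu> i)) (\<phi> i)"
  shows "(\<Sum>i\<in>J. (\<Sum>k\<le>n. c k * apoly q k (\<mu> i))^2)
     \<le> real (card V) * (\<Sum>k\<le>n. (c k)^2 * sphere_size q k) + real (bad n) * (\<Sum>k\<le>n. \<bar>c k\<bar> * sphere_size q k)^2"
proof -
  have "(\<Sum>x\<in>V. \<Sum>i\<in>J. (cmod (ip V (\<phi> i) (\<lambda>y. of_real (wcol c n x y))))^2)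
      \<le> (\<Sum>x\<in>V. ns V (\<lambda>y. of_real (wcol c n x y)))"
    by (intro sum_mono bessel J o)
  also have "... = (\<Sum>x\<in>V. \<Sum>y\<in>V. (wcol c n x y)^2)" by (simp add: ns_def)
  finally show ?thesis using sum_wcol_norm(1)[where c = c and n = n] orthonormal_sum_poly[OF J o e, where c = c and n = n] by linarith
qed

text \<open>For a complete family the inequality of Bessel behind the upper bound becomes Parseval's
  identity; hence the condition on card J.\<close>

lemma orthonormal_sum_poly_ge:
  assumes J: "finite J" and o: "orthonormal_on V J \<phi>" and e: "\<And>i. i \<in> J \<Longrightarrow> eigenfn (of_real (\<mu> i)) (\<phi> i)"
    and "card J = card V"
  shows "(\<Sum>i\<in>J. (\<Sum>k\<le>n. c k * apoly q k (\<mu> i))^2)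
     \<ge> real (card V) * (\<Sum>k\<le>n. (c k)^2 * sphere_size q k) - real (bad n) * (\<Sum>k\<le>n. (c k)^2 * sphere_size q k)"
proof -
  have "(\<Sum>x\<in>V. \<Sum>i\<in>J. (cmod (ip V (\<phi> i) (\<lambda>y. of_real (wcol c n x y))))^2)
      = (\<Sum>x\<in>V. ns V (\<lambda>y. of_real (wcol c n x y)))"
    by (intro sum.cong refl orthonormal_complete(1) J o finV assms)
  also have "... = (\<Sum>x\<in>V. \<Sum>y\<in>V. (wcol c n x y)^2)" by (simp add: ns_def)
  finally show ?thesis using sum_wcol_norm(2)[where c = c and n = n] orthonormal_sum_poly[OF J o e, where c = c and n = n] by linarith
qed

end

text \<open>The quadratic form q a^2 + b^2 - t a b in two consecutive values is multiplied by q, the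
  determinant of the recurrence, at every step. It is positive definite exactly for |t| < 2 sqrt q,
  which singles out the band.\<close>

lemma apoly_energy:
  "real q * (apoly q (Suc k) t)^2 + (apoly q (Suc (Suc k)) t)^2 - t * apoly q (Suc k) t * apoly q (Suc (Suc k)) t
     = real q ^ k * ((real q + 1)^2 - t^2)"
proof (induction k)
  case 0
  show ?case by (simp add: power2_eq_square algebra_simps)
next
  case (Suc k)
  define a b where "a = apoly q (Suc k) t" and "b = apoly q (Suc (Suc k)) t"
  have "apoly q (Suc (Suc (Suc k))) t = t * b - real q * a" by (simp add: a_def b_def)
  moreover have "real q * b^2 + (t * b - real q * a)^2 - t * b * (t * b - real q * a)
      = real q * (real q * a^2 + b^2 - t * a * b)"
    by (simp add: power2_eq_square algebra_simps)
  ultimately show ?case using Suc unfolding a_def[symmetric] b_def[symmetric] by simp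
qed

lemma sphere_size_pos: "q \<ge> 1 \<Longrightarrow> sphere_size q k > 0"
  by (simp add: sphere_size_def)

text \<open>The square of the k-th orthonormal polynomial at t.\<close>

definition level :: "nat \<Rightarrow> real \<Rightarrow> nat \<Rightarrow> real" where
  "level q t k = (apoly q k t)^2 / sphere_size q k"

lemma level_nonneg: "q \<ge> 1 \<Longrightarrow> level q t k \<ge> 0"
  using sphere_size_pos[of q k] by (simp add: level_def)

lemma level_pair:
  assumes "q \<ge> 1"
  shows "level q t (Suc k) + level q t (Suc (Suc k)) =
    (real q * (apoly q (Suc k) t)^2 + (apoly q (Suc (Suc k)) t)^2) / ((real q + 1) * (real q * real q ^ k))"
  using assms unfolding level_def sphere_size_def by (simp add: add_divide_distrib del: apoly.simps)

lemma mixed_le: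
  fixes t a b s :: real
  assumes "\<bar>t\<bar> \<le> 2 * s" "s \<ge> 0"
  shows "\<bar>t * a * b\<bar> \<le> \<bar>t\<bar> / (2 * s) * (s^2 * a^2 + b^2)"
proof (cases "s = 0")
  case False
  then have s: "s > 0" using assms by simp
  have "0 \<le> (s * \<bar>a\<bar> - \<bar>b\<bar>)^2" by simp
  then have "2 * s * \<bar>a\<bar> * \<bar>b\<bar> \<le> s^2 * a^2 + b^2" by (simp add: power2_diff power_mult_distrib)
  then have "\<bar>t\<bar> / (2 * s) * (2 * s * \<bar>a\<bar> * \<bar>b\<bar>) \<le> \<bar>t\<bar> / (2 * s) * (s^2 * a^2 + b^2)"
    using s by (intro mult_left_mono) auto
  then show ?thesis using s by (simp add: abs_mult)
qed (use assms in auto)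

text \<open>At the ends of the band the energy form is only semidefinite, but it is still at most 2
  (q a^2 + b^2), and the energy stays positive because (q + 1)^2 - 4 q = (q - 1)^2 \<ge> 1. Two
  consecutive levels are taken together since a single one may vanish.\<close>

lemma level_lower:
  assumes q: "q \<ge> 2" and t: "\<bar>t\<bar> \<le> 2 * sqrt (real q)"
  shows "level q t (Suc k) + level q t (Suc (Suc k)) \<ge> 1 / (2 * real q * (real q + 1))"
proof -
  define a b where "a = apoly q (Suc k) t" and "b = apoly q (Suc (Suc k)) t"
  have sq: "sqrt (real q) > 0" using q by simp
  have "\<bar>t * a * b\<bar> \<le> \<bar>t\<bar> / (2 * sqrt q) * (real q * a^2 + b^2)" using mixed_le[OF t, of a b] by simp
  also have "... \<le> 1 * (real q * a^2 + b^2)" using t sq by (intro mult_right_mono) auto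
  finally have m: "- (t * a * b) \<le> real q * a^2 + b^2" by (simp add: abs_le_iff)
  have "t^2 \<le> (2 * sqrt q)^2" using t by (metis abs_ge_zero power2_abs power_mono)
  then have "t^2 \<le> 4 * real q" by (simp add: power_mult_distrib)
  moreover have "(real q - 1)^2 \<ge> 1" using q by (intro one_le_power) simp
  ultimately have "(real q + 1)^2 - t^2 \<ge> 1" by (simp add: power2_eq_square algebra_simps)
  then have "real q ^ k * ((real q + 1)^2 - t^2) \<ge> real q ^ k * 1" by (intro mult_left_mono) auto
  then have "real q ^ k \<le> real q * a^2 + b^2 - t * a * b"
    using apoly_energy[of q k t, folded a_def b_def] by simp
  then have "real q ^ k \<le> 2 * (real q * a^2 + b^2)" using m by argo
  then have "real q ^ k / 2 / ((real q + 1) * (real q * real q ^ k)) \<le> (real q * a^2 + b^2) / ((real q + 1) * (real q * real q ^ k))"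
    by (intro divide_right_mono) auto
  moreover have "P / 2 / ((Q + 1) * (Q * P)) = 1 / (2 * Q * (Q + 1))" if "P > 0" "Q > 0" for P Q :: real
    using that by (simp add: divide_simps)
  from this[of "real q ^ k" "real q"]
  have "real q ^ k / 2 / ((real q + 1) * (real q * real q ^ k)) = 1 / (2 * real q * (real q + 1))"
    using q by simp
  ultimately show ?thesis using level_pair[of q t k] q unfolding a_def b_def by (simp add: mult_ac)
qed

text \<open>Strictly inside the band the energy form is at least 1 - \<rho> times q a^2 + b^2 with
  \<rho> = |t| / (2 sqrt q); the bound degenerates at the ends.\<close>

lemma level_upper:
  assumes q: "q \<ge> 2" and t: "\<bar>t\<bar> < 2 * sqrt (real q)"
  shows "\<exists>B. \<forall>k. level q t (Suc k) + level q t (Suc (Suc k)) \<le> B"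
proof -
  define \<rho> where "\<rho> = \<bar>t\<bar> / (2 * sqrt q)"
  have sq: "sqrt (real q) > 0" using q by simp
  have r: "0 \<le> \<rho>" "\<rho> < 1" using t sq by (auto simp: \<rho>_def)
  have "level q t (Suc k) + level q t (Suc (Suc k)) \<le> (real q + 1)^2 / (1 - \<rho>)" for k
  proof -
    define a b where "a = apoly q (Suc k) t" and "b = apoly q (Suc (Suc k)) t"
    have "\<bar>t * a * b\<bar> \<le> \<rho> * (real q * a^2 + b^2)" using mixed_le[of t "sqrt q" a b] t unfolding \<rho>_def by simp
    then have "(1 - \<rho>) * (real q * a^2 + b^2) \<le> real q * a^2 + b^2 - t * a * b" by (simp add: algebra_simps)
    also have "... = real q ^ k * ((real q + 1)^2 - t^2)" using apoly_energy[of q k t, folded a_def b_def] by simp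
    also have "... \<le> real q ^ k * (real q + 1)^2" by (intro mult_left_mono) auto
    finally have "real q * a^2 + b^2 \<le> real q ^ k * ((real q + 1)^2 / (1 - \<rho>))" using r by (simp add: field_simps)
    then have "(real q * a^2 + b^2) / ((real q + 1) * (real q * real q ^ k))
        \<le> real q ^ k * ((real q + 1)^2 / (1 - \<rho>)) / ((real q + 1) * (real q * real q ^ k))"
      by (intro divide_right_mono) auto
    also have "... = ((real q + 1)^2 / (1 - \<rho>)) / ((real q + 1) * real q)" using q by simp
    also have "... \<le> ((real q + 1)^2 / (1 - \<rho>)) / 1"
    proof (rule divide_left_mono)
      have "1 * 1 \<le> (real q + 1) * real q" using q by (intro mult_mono) auto
      then show "1 \<le> (real q + 1) * real q" by simp
    qed (use r q in auto)
    finally show ?thesis using level_pair[of q t k] q unfolding a_def b_def by simp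
  qed
  then show ?thesis by blast
qed

lemma level_sum_unbounded:
  assumes q: "q \<ge> 2" and t: "\<bar>t\<bar> \<le> 2 * sqrt (real q)"
  shows "\<exists>n\<ge>1. (\<Sum>k\<le>n. level q t k) \<ge> B"
proof -
  define c where "c = 1 / (2 * real q * (real q + 1))"
  have c: "c > 0" using q by (simp add: c_def)
  have l0: "level q t k \<ge> 0" for k using level_nonneg q by simp
  have *: "(\<Sum>k\<le>2 * m. level q t k) \<ge> real m * c" for m
  proof (induction m)
    case 0
    then show ?case using l0 by simp
  next
    case (Suc m)
    have "(\<Sum>k\<le>2 * Suc m. level q t k) = (\<Sum>k\<le>2 * m. level q t k) + (level q t (Suc (2 * m)) + level q t (Suc (Suc (2 * m))))"
      by simp
    then show ?case using Suc level_lower[OF q t, of "2 * m"] unfolding c_def[symmetric] by (simp add: algebra_simps)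
  qed
  obtain m :: nat where "B / c \<le> real m" using real_arch_simple by blast
  then have "B \<le> real m * c" using c by (simp add: field_simps)
  also have "... \<le> real (Suc m) * c" using c by simp
  also have "... \<le> (\<Sum>k\<le>2 * Suc m. level q t k)" by (rule *)
  finally show ?thesis by (intro exI[of _ "2 * Suc m"]) simp
qed

text \<open>Bounded last levels against a divergent sum. The last levels measure what multiplication
  by t - s leaves of the kernel, the sum measures the kernel itself.\<close>

lemma level_ratio_small:
  assumes q: "q \<ge> 2" and t: "\<bar>t\<bar> < 2 * sqrt (real q)" and e: "\<epsilon> > 0"
  shows "\<exists>n\<ge>1. (level q t n + level q t (Suc n)) \<le> \<epsilon> * (\<Sum>k\<le>n. level q t k) \<and> (\<Sum>k\<le>n. level q t k) > 0"
proof -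
  obtain B where B: "\<And>k. level q t (Suc k) + level q t (Suc (Suc k)) \<le> B" using level_upper[OF q t] by blast
  obtain n where n: "n \<ge> 1" "(\<Sum>k\<le>n. level q t k) \<ge> \<bar>B\<bar> / \<epsilon> + 1"
    using level_sum_unbounded[OF q, of t "\<bar>B\<bar> / \<epsilon> + 1"] t by auto
  have "\<epsilon> * (\<bar>B\<bar> / \<epsilon> + 1) = \<bar>B\<bar> + \<epsilon>" using e by (simp add: field_simps)
  then have "B \<le> \<epsilon> * (\<bar>B\<bar> / \<epsilon> + 1)" using e by linarith
  also have "... \<le> \<epsilon> * (\<Sum>k\<le>n. level q t k)" using n e by (intro mult_left_mono) auto
  finally have "level q t n + level q t (Suc n) \<le> \<epsilon> * (\<Sum>k\<le>n. level q t k)"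
    using B[of "n - 1"] n by simp
  moreover have "(\<Sum>k\<le>n. level q t k) > 0" using n e by (smt (verit) divide_nonneg_pos abs_ge_zero)
  ultimately show ?thesis using n by blast
qed

text \<open>The \<open>apoly q k\<close> are orthogonal for the spectral measure of the \<open>(q+1)\<close>-regular tree, with squared norms
  \<open>sphere_size q k\<close>. Their reproducing kernel concentrates at \<open>s\<close>, and the trace of a polynomial in the
  adjacency matrix sees the graph only through balls, so it counts the eigenvalues near \<open>s\<close>.\<close>

definition kern_poly :: "nat \<Rightarrow> real \<Rightarrow> nat \<Rightarrow> real \<Rightarrow> real" where
  "kern_poly q s n t = (\<Sum>k\<le>n. apoly q k s / sphere_size q k * apoly q k t)"

lemma kern_poly_diag: "kern_poly q s n s = (\<Sum>k\<le>n. level q s k)"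
  by (simp add: kern_poly_def level_def power2_eq_square)

text \<open>The Christoffel-Darboux formula: the three-term recurrence makes everything telescope
  except the two top polynomials.\<close>

lemma christoffel_darboux:
  assumes "q \<ge> 1"
  shows "(t - s) * kern_poly q s (Suc n) t * sphere_size q (Suc n)
     = apoly q (Suc (Suc n)) t * apoly q (Suc n) s - apoly q (Suc n) t * apoly q (Suc (Suc n)) s"
proof (induction n)
  case 0
  have "real q + 1 > 0" by simp
  then have "kern_poly q s (Suc 0) t * sphere_size q (Suc 0) = (real q + 1) + t * s"
    by (simp add: kern_poly_def sphere_size_def field_simps)
  then show ?case by (simp add: mult.assoc) (simp add: power2_eq_square algebra_simps)
next
  case (Suc n)
  have pos: "sphere_size q (Suc (Suc n)) > 0" using sphere_size_pos[OF assms] .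
  have ss: "sphere_size q (Suc (Suc n)) = real q * sphere_size q (Suc n)" by (simp add: sphere_size_def)
  define Y where "Y = apoly q (Suc (Suc n)) s / sphere_size q (Suc (Suc n)) * apoly q (Suc (Suc n)) t"
  have Y: "Y * sphere_size q (Suc (Suc n)) = apoly q (Suc (Suc n)) s * apoly q (Suc (Suc n)) t"
    using pos by (simp add: Y_def del: apoly.simps)
  have K: "kern_poly q s (Suc (Suc n)) t = kern_poly q s (Suc n) t + Y"
    by (simp add: kern_poly_def Y_def del: apoly.simps)
  have "(t - s) * kern_poly q s (Suc (Suc n)) t * sphere_size q (Suc (Suc n))
     = (t - s) * kern_poly q s (Suc n) t * sphere_size q (Suc (Suc n)) + (t - s) * (Y * sphere_size q (Suc (Suc n)))"
    unfolding K by (simp add: algebra_simps)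
  also have "... = real q * ((t - s) * kern_poly q s (Suc n) t * sphere_size q (Suc n))
       + (t - s) * (apoly q (Suc (Suc n)) s * apoly q (Suc (Suc n)) t)"
    unfolding Y by (simp add: ss algebra_simps del: apoly.simps)
  also have "... = apoly q (Suc (Suc (Suc n))) t * apoly q (Suc (Suc n)) s - apoly q (Suc (Suc n)) t * apoly q (Suc (Suc (Suc n))) s"
    unfolding Suc apoly.simps(4) by (simp add: algebra_simps del: apoly.simps)
  finally show ?case .
qed

lemma continuous_apoly: "isCont (apoly q k) t"
proof -
  have "\<forall>t. isCont (apoly q k) t"
  proof (rule apoly.induct[of "\<lambda>_ k _. \<forall>t. isCont (apoly q k) t" q k t])
    have "apoly q 0 = (\<lambda>t. 1)" by (rule ext) simp
    then show "\<forall>t. isCont (apoly q 0) t" by simp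
    have "apoly q (Suc 0) = (\<lambda>t. t)" by (rule ext) simp
    then show "\<forall>t. isCont (apoly q (Suc 0)) t" by simp
    have "apoly q (Suc (Suc 0)) = (\<lambda>t. t^2 - (real q + 1))" by (rule ext) simp
    then show "\<forall>t. isCont (apoly q (Suc (Suc 0))) t" by (simp add: continuous_intros)
    fix k assume "\<forall>t. isCont (apoly q (Suc (Suc k))) t" "\<forall>t. isCont (apoly q (Suc k)) t"
    then have "isCont (\<lambda>t. t * apoly q (Suc (Suc k)) t - real q * apoly q (Suc k) t) t" for t
      by (intro continuous_intros) auto
    moreover have "apoly q (Suc (Suc (Suc k))) = (\<lambda>t. t * apoly q (Suc (Suc k)) t - real q * apoly q (Suc k) t)"
      by (rule ext) simp
    ultimately show "\<forall>t. isCont (apoly q (Suc (Suc (Suc k)))) t" by simp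
  qed
  then show ?thesis by blast
qed

lemma continuous_kern_poly: "isCont (kern_poly q s n) t"
  unfolding kern_poly_def by (intro continuous_intros continuous_apoly)

text \<open>The kernel at s has diagonal value S, and its squared norm is also S. An eigenvalue near
  s therefore uses up (S / 2)^2 of a total of about S |V|, so there are at most 4 |V| / S of them,
  and S is unbounded. This includes the ends of the band, where it will be applied.\<close>

theorem eigenvalue_count_upper:
  assumes q: "q \<ge> 2" and s: "\<bar>s\<bar> \<le> 2 * sqrt (real q)" and e: "\<eta> > 0"
  shows "\<exists>\<delta>>0. \<exists>n K. \<forall>(G :: 'a ograph) (J :: 'i set) \<phi> \<mu>. fgraph G q \<longrightarrow> finite J \<longrightarrow> orthonormal_on (verts G) J \<phi> \<longrightarrow>
     (\<forall>i\<in>J. fgraph.eigenfn G (of_real (\<mu> i)) (\<phi> i)) \<longrightarrow> (\<forall>i\<in>J. \<bar>\<mu> i - s\<bar> < \<delta>) \<longrightarrow>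
     real (card J) \<le> \<eta> * real (card (verts G)) + K * real (fgraph.bad G n)"
proof -
  obtain n where n: "(\<Sum>k\<le>n. level q s k) \<ge> 4 / \<eta>" using level_sum_unbounded[OF q s] by blast
  define S where "S = (\<Sum>k\<le>n. level q s k)"
  have S: "S \<ge> 4 / \<eta>" "S > 0" using n e unfolding S_def by (auto intro: less_le_trans[rotated])
  have "(kern_poly q s n \<longlongrightarrow> S) (at s)"
    using continuous_kern_poly[where q = q and s = s and n = n and t = s] by (simp add: isCont_def kern_poly_diag S_def)
  then have "\<forall>\<^sub>F t in at s. dist (kern_poly q s n t) S < S / 2" using S(2) by (intro tendstoD) auto
  then obtain \<delta> where d: "\<delta> > 0" "\<And>t. t \<noteq> s \<Longrightarrow> dist t s < \<delta> \<Longrightarrow> dist (kern_poly q s n t) S < S / 2"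
    unfolding eventually_at by auto
  have low: "(kern_poly q s n t)^2 \<ge> (S / 2)^2" if "\<bar>t - s\<bar> < \<delta>" for t
  proof (rule power_mono)
    show "S / 2 \<le> kern_poly q s n t"
    proof (cases "t = s")
      case True
      then show ?thesis using S by (simp add: kern_poly_diag S_def)
    next
      case False
      then have "\<bar>kern_poly q s n t - S\<bar> < S / 2" using d(2)[of t] that by (simp add: dist_real_def)
      then show ?thesis unfolding abs_less_iff by linarith
    qed
  qed (use S in simp)
  define c where "c k = apoly q k s / sphere_size q k" for k
  have kc: "(\<Sum>k\<le>n. c k * apoly q k t) = kern_poly q s n t" for t by (simp add: kern_poly_def c_def)
  have cS: "(\<Sum>k\<le>n. (c k)^2 * sphere_size q k) = S"
    unfolding S_def
  proof (intro sum.cong refl)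
    fix k show "(c k)^2 * sphere_size q k = level q s k"
      using sphere_size_pos[of q k] q by (simp add: c_def level_def power2_eq_square)
  qed
  define K where "K = (\<Sum>k\<le>n. \<bar>c k\<bar> * sphere_size q k)^2 / (S / 2)^2"
  show ?thesis
  proof (rule exI[of _ \<delta>], intro conjI exI[of _ n] exI[of _ K] allI impI)
    fix G :: "'a ograph" and J :: "'i set" and \<phi> \<mu>
    assume G: "fgraph G q" and J: "finite J" and o: "orthonormal_on (verts G) J \<phi>"
      and ei: "\<forall>i\<in>J. fgraph.eigenfn G (of_real (\<mu> i)) (\<phi> i)" and near: "\<forall>i\<in>J. \<bar>\<mu> i - s\<bar> < \<delta>"
    interpret fgraph G q by (rule G)
    have "real (card J) * (S / 2)^2 \<le> (\<Sum>i\<in>J. (kern_poly q s n (\<mu> i))^2)"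
      using sum_mono[of J "\<lambda>_. (S / 2)^2" "\<lambda>i. (kern_poly q s n (\<mu> i))^2"] low near by simp
    also have "... \<le> real (card V) * S + real (bad n) * (\<Sum>k\<le>n. \<bar>c k\<bar> * sphere_size q k)^2"
      using orthonormal_sum_poly_le[OF J o, where \<mu> = \<mu> and c = c and n = n] ei unfolding kc cS by blast
    finally have "real (card J) \<le> (real (card V) * S + real (bad n) * (\<Sum>k\<le>n. \<bar>c k\<bar> * sphere_size q k)^2) / (S / 2)^2"
      using S by (simp add: pos_le_divide_eq)
    also have "... = real (card V) * (4 / S) + K * real (bad n)"
      using S unfolding K_def by (simp add: add_divide_distrib power2_eq_square)
    also have "... \<le> real (card V) * \<eta> + K * real (bad n)"
      using S e by (intro add_right_mono mult_left_mono) (auto simp: field_simps)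
    finally show "real (card J) \<le> \<eta> * real (card V) + K * real (bad n)" by (simp add: mult.commute)
  qed (rule d)
qed

text \<open>Let p be the kernel at s. For a complete family the values p^2 sum to about S |V|, while
  those of ((t - s) p)^2 sum to at most about half of \<delta>^2 S |V|. So eigenvalues at distance
  at least \<delta> carry at most half of the mass of p^2, and each near one carries at most
  M.\<close>

theorem eigenvalue_count_lower:
  assumes q: "q \<ge> 2" and s: "\<bar>s\<bar> < 2 * sqrt (real q)" and d: "\<delta> > 0"
  shows "\<exists>c0>0. \<exists>n K. \<forall>(G :: 'a ograph) \<phi> \<mu>. fgraph G q \<longrightarrow> orthonormal_on (verts G) {..<card (verts G)} \<phi> \<longrightarrow>
     (\<forall>i<card (verts G). fgraph.eigenfn G (of_real (\<mu> i)) (\<phi> i)) \<longrightarrow>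
     real (card {i. i < card (verts G) \<and> \<bar>\<mu> i - s\<bar> < \<delta>}) \<ge> c0 * real (card (verts G)) - K * real (fgraph.bad G n)"
proof -
  \<comment> \<open>Chosen so that q times the last two levels, which is the squared norm of (t - s)
    p, is at most \<delta>^2 / 2 times S.\<close>
  define \<epsilon> where "\<epsilon> = \<delta>^2 / (2 * real q)"
  have "\<epsilon> > 0" using d q by (simp add: \<epsilon>_def)
  then obtain n where n: "n \<ge> 1" "level q s n + level q s (Suc n) \<le> \<epsilon> * (\<Sum>k\<le>n. level q s k)" "(\<Sum>k\<le>n. level q s k) > 0"
    using level_ratio_small[OF q s] by blast
  define S where "S = (\<Sum>k\<le>n. level q s k)"
  have S: "S > 0" using n by (simp add: S_def)
  have "\<exists>M>0. \<forall>t\<in>{s - \<delta>..s + \<delta>}. (kern_poly q s n t)^2 \<le> M"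
  proof -
    have "continuous_on {s - \<delta>..s + \<delta>} (\<lambda>t. (kern_poly q s n t)^2)"
      using continuous_kern_poly by (intro continuous_intros continuous_at_imp_continuous_on) auto
    then have "compact ((\<lambda>t. (kern_poly q s n t)^2) ` {s - \<delta>..s + \<delta>})" by (rule compact_continuous_image) auto
    then have "bounded ((\<lambda>t. (kern_poly q s n t)^2) ` {s - \<delta>..s + \<delta>})" by (rule compact_imp_bounded)
    then obtain M where "M > 0" "\<And>y. y \<in> (\<lambda>t. (kern_poly q s n t)^2) ` {s - \<delta>..s + \<delta>} \<Longrightarrow> norm y \<le> M"
      by (meson bounded_pos)
    then have "\<forall>t\<in>{s - \<delta>..s + \<delta>}. (kern_poly q s n t)^2 \<le> M" by fastforce
    with \<open>M > 0\<close> show ?thesis by blast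
  qed
  then obtain M where M: "M > 0" "\<And>t. \<bar>t - s\<bar> < \<delta> \<Longrightarrow> (kern_poly q s n t)^2 \<le> M" by force
  \<comment> \<open>Padded by zero to degree \<open>Suc n\<close>, so that p and (t - s) p refer to
    the same radius and the same bad vertices.\<close>
  define c where "c k = (if k \<le> n then apoly q k s / sphere_size q k else 0)" for k
  have kc: "(\<Sum>k\<le>Suc n. c k * apoly q k t) = kern_poly q s n t" for t
    by (simp add: kern_poly_def c_def del: apoly.simps)
  have cS: "(\<Sum>k\<le>Suc n. (c k)^2 * sphere_size q k) = S"
    unfolding S_def sum.atMost_Suc
  proof -
    have "(\<Sum>k\<le>n. (c k)^2 * sphere_size q k) = (\<Sum>k\<le>n. level q s k)"
    proof (intro sum.cong refl)
      fix k assume "k \<in> {..n}" then show "(c k)^2 * sphere_size q k = level q s k"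
        using sphere_size_pos[of q k] q by (simp add: c_def level_def power2_eq_square)
    qed
    then show "(\<Sum>k\<le>n. (c k)^2 * sphere_size q k) + (c (Suc n))^2 * sphere_size q (Suc n) = (\<Sum>k\<le>n. level q s k)"
      by (simp add: c_def)
  qed
  \<comment> \<open>The coefficients of (t - s) p according to the Christoffel-Darboux
    formula.\<close>
  define d' where "d' k = (if k = Suc n then apoly q n s / sphere_size q n
     else if k = n then - apoly q (Suc n) s / sphere_size q n else 0)" for k
  have dsum: "(\<Sum>k\<le>Suc n. F (d' k) k) = F (- apoly q (Suc n) s / sphere_size q n) n + F (apoly q n s / sphere_size q n) (Suc n)"
    if "\<And>k. F 0 k = 0" for F :: "real \<Rightarrow> nat \<Rightarrow> real"
  proof -
    have "(\<Sum>k\<le>n. F (d' k) k) = (\<Sum>k\<in>{n}. F (d' k) k)"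
      by (rule sum.mono_neutral_right) (auto simp: d'_def that)
    then show ?thesis by (simp add: d'_def)
  qed
  have rn: "sphere_size q n > 0" using sphere_size_pos q by simp
  have rS: "sphere_size q (Suc n) = real q * sphere_size q n"
  proof -
    obtain m where "n = Suc m" using n(1) by (cases n) auto
    then show ?thesis by (simp add: sphere_size_def)
  qed
  have kd: "(\<Sum>k\<le>Suc n. d' k * apoly q k t) = (t - s) * kern_poly q s n t" for t
  proof -
    obtain m where m: "n = Suc m" using n(1) by (cases n) auto
    have "(t - s) * kern_poly q s n t * sphere_size q n = apoly q (Suc n) t * apoly q n s - apoly q n t * apoly q (Suc n) s"
      using christoffel_darboux[of q t s m] q m by simp
    then have "(t - s) * kern_poly q s n t = (apoly q (Suc n) t * apoly q n s - apoly q n t * apoly q (Suc n) s) / sphere_size q n"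
      using rn by (metis nonzero_mult_div_cancel_right less_irrefl)
    moreover have "(\<Sum>k\<le>Suc n. d' k * apoly q k t) = - apoly q (Suc n) s / sphere_size q n * apoly q n t + apoly q n s / sphere_size q n * apoly q (Suc n) t"
      by (rule dsum) simp
    ultimately show ?thesis by (simp only: diff_divide_distrib) (simp add: mult.commute del: apoly.simps sum.atMost_Suc)
  qed
  have dS: "(\<Sum>k\<le>Suc n. (d' k)^2 * sphere_size q k) \<le> \<delta>^2 / 2 * S"
  proof -
    have "(\<Sum>k\<le>Suc n. (d' k)^2 * sphere_size q k)
        = (- apoly q (Suc n) s / sphere_size q n)^2 * sphere_size q n + (apoly q n s / sphere_size q n)^2 * sphere_size q (Suc n)"
      by (rule dsum) simp
    also have "... = real q * (level q s n + level q s (Suc n))"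
      using rn q unfolding level_def rS by (simp add: power2_eq_square field_simps del: apoly.simps)
    also have "... \<le> real q * (\<epsilon> * S)" using n(2) unfolding S_def by (intro mult_left_mono) auto
    also have "... = \<delta>^2 / 2 * S" using q by (simp add: \<epsilon>_def)
    finally show ?thesis .
  qed
  define K1 where "K1 = (\<Sum>k\<le>Suc n. \<bar>d' k\<bar> * sphere_size q k)^2"
  show ?thesis
  proof (rule exI[of _ "S / (2 * M)"], intro conjI exI[of _ "Suc n"] exI[of _ "(S + K1 / \<delta>^2) / M"] allI impI)
    fix G :: "'a ograph" and \<phi> \<mu>
    assume G: "fgraph G q" and o: "orthonormal_on (verts G) {..<card (verts G)} \<phi>"
      and ei: "\<forall>i<card (verts G). fgraph.eigenfn G (of_real (\<mu> i)) (\<phi> i)"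
    interpret fgraph G q by (rule G)
    let ?J = "{..<card V}"
    define A where "A = {i. i < card V \<and> \<bar>\<mu> i - s\<bar> < \<delta>}"
    have AJ: "A \<subseteq> ?J" and fA: "finite A" by (auto simp: A_def)
    have e': "\<And>i. i \<in> ?J \<Longrightarrow> eigenfn (of_real (\<mu> i)) (\<phi> i)" using ei by auto
    have 1: "real (card V) * S - real (bad (Suc n)) * S \<le> (\<Sum>i\<in>?J. (kern_poly q s n (\<mu> i))^2)"
      using orthonormal_sum_poly_ge[OF _ o e', where c = c and n = "Suc n"] unfolding kc cS by simp
    have 2: "(\<Sum>i\<in>?J. ((\<mu> i - s) * kern_poly q s n (\<mu> i))^2) \<le> real (card V) * (\<delta>^2 / 2 * S) + real (bad (Suc n)) * K1"
    proof -
      have "(\<Sum>i\<in>?J. ((\<mu> i - s) * kern_poly q s n (\<mu> i))^2)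
        \<le> real (card V) * (\<Sum>k\<le>Suc n. (d' k)^2 * sphere_size q k) + real (bad (Suc n)) * K1"
        using orthonormal_sum_poly_le[OF _ o e', where c = d' and n = "Suc n"] unfolding kd K1_def by simp
      also have "... \<le> real (card V) * (\<delta>^2 / 2 * S) + real (bad (Suc n)) * K1"
        using dS by (intro add_right_mono mult_left_mono) auto
      finally show ?thesis .
    qed
    have far: "(\<Sum>i\<in>?J - A. (kern_poly q s n (\<mu> i))^2) \<le> (\<Sum>i\<in>?J. ((\<mu> i - s) * kern_poly q s n (\<mu> i))^2) / \<delta>^2"
    proof -
      have "(\<Sum>i\<in>?J - A. (kern_poly q s n (\<mu> i))^2) \<le> (\<Sum>i\<in>?J - A. ((\<mu> i - s) * kern_poly q s n (\<mu> i))^2 / \<delta>^2)"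
      proof (rule sum_mono)
        fix i assume "i \<in> ?J - A"
        then have "\<delta> \<le> \<bar>\<mu> i - s\<bar>" by (auto simp: A_def)
        then have "\<delta>^2 \<le> (\<mu> i - s)^2" using d by (metis less_eq_real_def power2_abs power_mono)
        then have "\<delta>^2 * (kern_poly q s n (\<mu> i))^2 \<le> (\<mu> i - s)^2 * (kern_poly q s n (\<mu> i))^2" by (rule mult_right_mono) simp
        then show "(kern_poly q s n (\<mu> i))^2 \<le> ((\<mu> i - s) * kern_poly q s n (\<mu> i))^2 / \<delta>^2"
          using d by (simp add: pos_le_divide_eq power_mult_distrib mult.commute)
      qed
      also have "... \<le> (\<Sum>i\<in>?J. ((\<mu> i - s) * kern_poly q s n (\<mu> i))^2 / \<delta>^2)"
        by (intro sum_mono2) auto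
      finally show ?thesis by (simp add: sum_divide_distrib)
    qed
    have near: "(\<Sum>i\<in>A. (kern_poly q s n (\<mu> i))^2) \<le> real (card A) * M"
      using sum_mono[of A "\<lambda>i. (kern_poly q s n (\<mu> i))^2" "\<lambda>_. M"] M(2) by (simp add: A_def)
    have split: "(\<Sum>i\<in>?J. (kern_poly q s n (\<mu> i))^2) = (\<Sum>i\<in>?J - A. (kern_poly q s n (\<mu> i))^2) + (\<Sum>i\<in>A. (kern_poly q s n (\<mu> i))^2)"
      by (rule sum.subset_diff[OF AJ]) simp
    have "(\<Sum>i\<in>?J. ((\<mu> i - s) * kern_poly q s n (\<mu> i))^2) / \<delta>^2 \<le> (real (card V) * (\<delta>^2 / 2 * S) + real (bad (Suc n)) * K1) / \<delta>^2"
      using 2 by (rule divide_right_mono) simp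
    also have "... = real (card V) * S / 2 + real (bad (Suc n)) * (K1 / \<delta>^2)"
      using d by (simp add: add_divide_distrib)
    finally have "real (card V) * S / 2 - real (bad (Suc n)) * (S + K1 / \<delta>^2) \<le> real (card A) * M"
      using 1 far near split unfolding distrib_left by linarith
    then have "(real (card V) * S / 2 - real (bad (Suc n)) * (S + K1 / \<delta>^2)) / M \<le> real (card A)"
      using M(1) by (simp add: pos_divide_le_eq)
    moreover have "(real (card V) * S / 2 - real (bad (Suc n)) * (S + K1 / \<delta>^2)) / M
       = S / (2 * M) * real (card V) - (S + K1 / \<delta>^2) / M * real (bad (Suc n))"
      using M(1) by (simp add: diff_divide_distrib mult.commute)
    ultimately show "S / (2 * M) * real (card V) - (S + K1 / \<delta>^2) / M * real (bad (Suc n))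
      \<le> real (card {i. i < card V \<and> \<bar>\<mu> i - s\<bar> < \<delta>})" unfolding A_def by simp
  qed (use S M in simp)
qed

section \<open>Quantum variance on a regular graph\<close>

context fgraph begin

lemma sum_bond_swap:
  fixes h :: "'a \<Rightarrow> 'a \<Rightarrow> 'b::comm_monoid_add"
  shows "(\<Sum>x\<in>V. \<Sum>y\<in>nb x. h x y) = (\<Sum>x\<in>V. \<Sum>y\<in>nb x. h y x)"
proof -
  have e: "(\<Sum>y\<in>nb x. g y) = (\<Sum>y\<in>V. if (x, y) \<in> adj G then g y else 0)" for x and g :: "'a \<Rightarrow> 'b"
  proof -
    have "nb x = {y \<in> V. (x, y) \<in> adj G}" using nb_V(1)[of _ x] by auto
    then show ?thesis using finV by (simp add: sum.inter_filter)
  qed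
  have "(\<Sum>x\<in>V. \<Sum>y\<in>nb x. h x y) = (\<Sum>y\<in>V. \<Sum>x\<in>V. if (x, y) \<in> adj G then h x y else 0)"
    unfolding e by (rule sum.swap)
  also have "... = (\<Sum>y\<in>V. \<Sum>x\<in>V. if (y, x) \<in> adj G then h x y else 0)"
    using adj_sym[of _ _ G] by (intro sum.cong refl if_cong) blast
  finally show ?thesis unfolding e .
qed

lemma sum_bond_transfer:
  fixes h :: "'a \<Rightarrow> 'a \<Rightarrow> 'a \<Rightarrow> 'b::comm_monoid_add"
  shows "(\<Sum>x\<in>V. \<Sum>y\<in>nb x. \<Sum>z\<in>nb y - {x}. h x y z) = (\<Sum>y\<in>V. \<Sum>z\<in>nb y. \<Sum>x\<in>nb y - {z}. h x y z)"
proof -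
  have r: "(\<Sum>z\<in>nb y - {x}. g z) = (\<Sum>z\<in>nb y. if z \<noteq> x then g z else 0)" for x y and g :: "'a \<Rightarrow> 'b"
  proof -
    have "nb y - {x} = {z \<in> nb y. z \<noteq> x}" by auto
    show ?thesis unfolding \<open>nb y - {x} = _\<close> by (rule sum.inter_filter) simp
  qed
  have "(\<Sum>x\<in>V. \<Sum>y\<in>nb x. \<Sum>z\<in>nb y - {x}. h x y z) = (\<Sum>y\<in>V. \<Sum>x\<in>nb y. \<Sum>z\<in>nb y - {x}. h x y z)"
    by (rule sum_bond_swap)
  also have "... = (\<Sum>y\<in>V. \<Sum>z\<in>nb y. \<Sum>x\<in>nb y - {z}. h x y z)"
  proof (rule sum.cong[OF refl])
    fix y
    have "(\<Sum>x\<in>nb y. \<Sum>z\<in>nb y - {x}. h x y z) = (\<Sum>z\<in>nb y. \<Sum>x\<in>nb y. if z \<noteq> x then h x y z else 0)"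
      unfolding r by (rule sum.swap)
    also have "... = (\<Sum>z\<in>nb y. \<Sum>x\<in>nb y. if x \<noteq> z then h x y z else 0)"
      by (intro sum.cong refl if_cong) auto
    finally show "(\<Sum>x\<in>nb y. \<Sum>z\<in>nb y - {x}. h x y z) = (\<Sum>z\<in>nb y. \<Sum>x\<in>nb y - {z}. h x y z)"
      unfolding r .
  qed
  finally show ?thesis .
qed

text \<open>Every directed edge has exactly q predecessors, so counting measure on directed edges is
  invariant under the shift up to the factor q.\<close>

lemma sum_bond_step:
  fixes h :: "'a \<Rightarrow> 'a \<Rightarrow> real"
  shows "(\<Sum>x\<in>V. \<Sum>y\<in>nb x. \<Sum>z\<in>nb y - {x}. h y z) = real q * (\<Sum>x\<in>V. \<Sum>y\<in>nb x. h x y)"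
proof -
  have "(\<Sum>x\<in>nb y - {z}. h y z) = real q * h y z" if "y \<in> V" "z \<in> nb y" for y z
    using nb_minus_card[OF that] by simp
  then show ?thesis unfolding sum_bond_transfer[of "\<lambda>x y z. h y z"]
    by (simp add: sum_distrib_left del: sum_constant Image_singleton_iff cong: sum.cong)
qed

lemma sum_bond_origin:
  fixes h :: "'a \<Rightarrow> 'b::comm_semiring_1"
  shows "(\<Sum>x\<in>V. \<Sum>y\<in>nb x. h x) = of_nat (q + 1) * (\<Sum>x\<in>V. h x)"
  and "(\<Sum>x\<in>V. \<Sum>y\<in>nb x. h y) = of_nat (q + 1) * (\<Sum>x\<in>V. h x)"
proof -
  show 1: "(\<Sum>x\<in>V. \<Sum>y\<in>nb x. h x) = of_nat (q + 1) * (\<Sum>x\<in>V. h x)"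
    unfolding sum_distrib_left by (intro sum.cong refl) (simp add: nb_card del: of_nat_add of_nat_Suc)
  show "(\<Sum>x\<in>V. \<Sum>y\<in>nb x. h y) = of_nat (q + 1) * (\<Sum>x\<in>V. h x)"
    using sum_bond_swap[of "\<lambda>x y. h y"] 1 by simp
qed

text \<open>The Birkhoff sum over the edges of a walk, the first and the last included; for
  \<open>W n x y\<close> these are n + 1 terms.\<close>

fun bsum :: "('a \<Rightarrow> 'a \<Rightarrow> real) \<Rightarrow> 'a list \<Rightarrow> real" where
  "bsum \<kappa> (x # y # r) = \<kappa> x y + bsum \<kappa> (y # r)"
| "bsum \<kappa> _ = 0"

lemma bsum_W: "ws \<in> W n y z \<Longrightarrow> bsum \<kappa> (x # ws) = \<kappa> x y + bsum \<kappa> ws"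
  using W_shape[of ws n y z] by auto

lemma bsum_abs_le:
  assumes "\<And>x y. \<bar>\<kappa> x y\<bar> \<le> M"
  shows "ws \<in> W n x y \<Longrightarrow> \<bar>bsum \<kappa> ws\<bar> \<le> (real n + 1) * M"
proof (induction n arbitrary: x y ws)
  case 0
  then show ?case using assms by simp
next
  case (Suc n)
  then obtain z ws' where z: "ws' \<in> W n y z" "ws = x # ws'" by auto
  have "\<bar>bsum \<kappa> ws\<bar> \<le> \<bar>\<kappa> x y\<bar> + \<bar>bsum \<kappa> ws'\<bar>" using bsum_W[OF z(1)] z(2) by simp
  then show ?case using assms[of x y] Suc.IH[OF z(1)] by (simp add: algebra_simps)
qed

text \<open>Here g is a right and k a left eigenfunction of the shift for the same eigenvalue c.
  Whichever of the n + 1 edges of the walk carries the factor \<kappa>, the steps before it act on k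
  and those after it on g, so each position contributes the same amount c^n times the single-edge
  pairing.\<close>

lemma sum_walk_bsum:
  fixes g k :: "'a \<Rightarrow> 'a \<Rightarrow> complex"
  assumes g: "\<And>x y. y \<in> nb x \<Longrightarrow> (\<Sum>z\<in>nb y - {x}. g y z) = c * g x y"
    and k: "\<And>y z. z \<in> nb y \<Longrightarrow> (\<Sum>x\<in>nb y - {z}. k x y) = c * k y z"
  shows "(\<Sum>x\<in>V. \<Sum>y\<in>nb x. k x y * (\<Sum>ws\<in>W n x y. of_real (bsum \<kappa> ws) * g (pen ws) (last ws)))
     = of_nat (n + 1) * c ^ n * (\<Sum>x\<in>V. \<Sum>y\<in>nb x. k x y * of_real (\<kappa> x y) * g x y)"
proof (induction n)
  case 0
  show ?case by (simp add: pen_def mult.assoc del: Image_singleton_iff)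
next
  case (Suc n)
  define T where "T n x y = (\<Sum>ws\<in>W n x y. of_real (bsum \<kappa> ws) * g (pen ws) (last ws))" for n x y
  let ?Y = "\<Sum>x\<in>V. \<Sum>y\<in>nb x. k x y * of_real (\<kappa> x y) * g x y"
  have T_Suc: "T (Suc n) x y = of_real (\<kappa> x y) * (c ^ Suc n * g x y) + (\<Sum>z\<in>nb y - {x}. T n y z)" if "y \<in> nb x" for x y
  proof -
    have "T (Suc n) x y = (\<Sum>z\<in>nb y - {x}. \<Sum>ws\<in>W n y z. of_real (\<kappa> x y) * g (pen ws) (last ws)
         + of_real (bsum \<kappa> ws) * g (pen ws) (last ws))"
      unfolding T_def W_sum
      by (intro sum.cong refl) (simp add: bsum_W W_ends ring_distribs del: last.simps)
    also have "... = of_real (\<kappa> x y) * (\<Sum>z\<in>nb y - {x}. \<Sum>ws\<in>W n y z. g (pen ws) (last ws)) + (\<Sum>z\<in>nb y - {x}. T n y z)"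
      by (simp add: sum.distrib T_def sum_distrib_left)
    also have "(\<Sum>z\<in>nb y - {x}. \<Sum>ws\<in>W n y z. g (pen ws) (last ws)) = (\<Sum>z\<in>nb y - {x}. c ^ n * g y z)"
      using sum_walk_eigen[OF g] by (intro sum.cong refl) blast
    also have "... = c ^ Suc n * g x y" using g[OF that] by (simp add: sum_distrib_left[symmetric])
    finally show ?thesis .
  qed
  have "(\<Sum>x\<in>V. \<Sum>y\<in>nb x. k x y * T (Suc n) x y)
     = (\<Sum>x\<in>V. \<Sum>y\<in>nb x. c ^ Suc n * (k x y * of_real (\<kappa> x y) * g x y) + (\<Sum>z\<in>nb y - {x}. k x y * T n y z))"
    using T_Suc by (intro sum.cong refl) (simp add: ring_distribs sum_distrib_left mult_ac del: Image_singleton_iff)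
  also have "... = c ^ Suc n * ?Y + (\<Sum>x\<in>V. \<Sum>y\<in>nb x. \<Sum>z\<in>nb y - {x}. k x y * T n y z)"
    by (simp only: sum.distrib sum_distrib_left)
  also have "(\<Sum>x\<in>V. \<Sum>y\<in>nb x. \<Sum>z\<in>nb y - {x}. k x y * T n y z) = (\<Sum>y\<in>V. \<Sum>z\<in>nb y. c * (k y z * T n y z))"
    unfolding sum_bond_transfer using k
    by (intro sum.cong refl) (simp add: sum_distrib_right[symmetric] mult.assoc del: Image_singleton_iff)
  also have "... = c * (of_nat (n + 1) * c ^ n * ?Y)"
    using Suc.IH by (simp only: T_def sum_distrib_left[symmetric])
  also have "c ^ Suc n * ?Y + c * (of_nat (n + 1) * c ^ n * ?Y) = of_nat (Suc n + 1) * c ^ Suc n * ?Y"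
    by (simp add: algebra_simps)
  finally show ?case by (simp only: T_def)
qed

subsection \<open>Variance of Birkhoff sums along nonbacktracking walks\<close>

lemma sum_walk_last:
  fixes h :: "'a \<Rightarrow> 'a \<Rightarrow> real"
  shows "(\<Sum>x\<in>V. \<Sum>y\<in>nb x. \<Sum>ws\<in>W n x y. h (pen ws) (last ws)) = real q ^ n * (\<Sum>x\<in>V. \<Sum>y\<in>nb x. h x y)"
proof (induction n)
  case 0
  show ?case by (simp add: pen_def)
next
  case (Suc n)
  have "(\<Sum>x\<in>V. \<Sum>y\<in>nb x. \<Sum>ws\<in>W (Suc n) x y. h (pen ws) (last ws))
      = (\<Sum>x\<in>V. \<Sum>y\<in>nb x. \<Sum>z\<in>nb y - {x}. \<Sum>ws\<in>W n y z. h (pen ws) (last ws))"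
    unfolding W_sum by (intro sum.cong refl) (simp add: W_ends del: last.simps)
  then show ?case using Suc by (simp add: sum_bond_step)
qed

text \<open>If \<open>\<kappa>\<close> is \<open>u\<close> minus its average over the continuations of a walk, then, up to the last term, the sum of
  \<open>\<kappa>\<close> along a random nonbacktracking walk is a martingale, and its variance grows only linearly.\<close>

lemma birkhoff_variance:
  fixes u \<kappa> :: "'a \<Rightarrow> 'a \<Rightarrow> real"
  assumes \<kappa>: "\<And>x y. y \<in> nb x \<Longrightarrow> real q * u x y - (\<Sum>z\<in>nb y - {x}. u y z) = real q * \<kappa> x y"
  shows "(\<Sum>x\<in>V. \<Sum>y\<in>nb x. \<Sum>ws\<in>W n x y. (bsum \<kappa> ws)^2) \<le> 3 * real (n + 2) * real q ^ n * (\<Sum>x\<in>V. \<Sum>y\<in>nb x. (u x y)^2)"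
proof -
  have q0: "real q > 0" using q2 by simp
  \<comment> \<open>The conditional expectation of u on the next edge of a random nonbacktracking
    walk.\<close>
  define p where "p x y = (\<Sum>z\<in>nb y - {x}. u y z) / real q" for x y
  have ku: "\<kappa> x y = u x y - p x y" if "y \<in> nb x" for x y
    using \<kappa>[OF that] q0 by (simp add: p_def field_simps del: Image_singleton_iff)
  have psum: "(\<Sum>z\<in>nb y - {x}. u y z - p x y) = 0" if "y \<in> nb x" for x y
    using nb_minus_card[of y x] nb_V(1)[OF that] that nb_sym[of x y] q0
    by (simp add: sum_subtractf p_def)
  \<comment> \<open>After telescoping, m is the sum over the later edges of u minus its conditional
    expectation given the preceding edge: a martingale started at zero.\<close>
  define m where "m x y ws = bsum \<kappa> ws - u x y + p (pen ws) (last ws)" for x y ws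
  have m_step: "m x y (x # ws) = m y z ws + (u y z - p x y)" if "y \<in> nb x" "ws \<in> W n y z" for x y z ws n
    using ku[OF that(1)] that(2) by (simp add: m_def bsum_W W_ends del: last.simps)
  have mean: "y \<in> nb x \<Longrightarrow> (\<Sum>ws\<in>W n x y. m x y ws) = 0" for n x y
  proof (induction n arbitrary: x y)
    case 0
    then show ?case using ku[of y x] by (simp add: m_def pen_def)
  next
    case (Suc n)
    have "(\<Sum>ws\<in>W (Suc n) x y. m x y ws) = (\<Sum>z\<in>nb y - {x}. \<Sum>ws\<in>W n y z. m y z ws + (u y z - p x y))"
      unfolding W_sum using m_step[OF Suc.prems] by (intro sum.cong refl) blast
    also have "... = (\<Sum>z\<in>nb y - {x}. real q ^ n * (u y z - p x y))"
    proof (rule sum.cong[OF refl])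
      fix z assume "z \<in> nb y - {x}"
      then have z: "z \<in> nb y" by blast
      show "(\<Sum>ws\<in>W n y z. m y z ws + (u y z - p x y)) = real q ^ n * (u y z - p x y)"
        unfolding sum.distrib Suc.IH[OF z] by (simp add: W_card[OF z])
    qed
    also have "... = 0" using psum[OF Suc.prems] by (simp only: sum_distrib_left[symmetric] mult_zero_right)
    finally show ?case .
  qed
  let ?U = "\<Sum>x\<in>V. \<Sum>y\<in>nb x. (u x y)^2"
  have var: "(\<Sum>z\<in>nb y - {x}. (u y z - p x y)^2) \<le> (\<Sum>z\<in>nb y - {x}. (u y z)^2)" if "y \<in> nb x" for x y
  proof -
    have "(\<Sum>z\<in>nb y - {x}. (u y z)^2) = (\<Sum>z\<in>nb y - {x}. (u y z - p x y)^2 + (2 * p x y * (u y z - p x y) + (p x y)^2))"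
      by (intro sum.cong refl) (simp add: power2_eq_square algebra_simps)
    also have "... = (\<Sum>z\<in>nb y - {x}. (u y z - p x y)^2) + (2 * p x y * (\<Sum>z\<in>nb y - {x}. u y z - p x y) + (\<Sum>z\<in>nb y - {x}. (p x y)^2))"
      by (simp only: sum.distrib sum_distrib_left)
    also have "... = (\<Sum>z\<in>nb y - {x}. (u y z - p x y)^2) + (\<Sum>z\<in>nb y - {x}. (p x y)^2)"
      unfolding psum[OF that] by simp
    finally show ?thesis by (simp add: sum_nonneg)
  qed
  have p2: "(p x y)^2 \<le> (\<Sum>z\<in>nb y - {x}. (u y z)^2) / real q" if "y \<in> nb x" for x y
  proof -
    have c: "card (nb y - {x}) = q" using nb_minus_card[of y x] nb_V(1)[OF that] that nb_sym[of x y] by simp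
    have "(\<Sum>z\<in>nb y - {x}. 1 * u y z)^2 \<le> (\<Sum>z\<in>nb y - {x}. 1^2) * (\<Sum>z\<in>nb y - {x}. (u y z)^2)"
      by (rule Cauchy_Schwarz_ineq_sum)
    then have "(\<Sum>z\<in>nb y - {x}. u y z)^2 \<le> real q * (\<Sum>z\<in>nb y - {x}. (u y z)^2)" using c by simp
    then have "(\<Sum>z\<in>nb y - {x}. u y z)^2 / (real q)^2 \<le> real q * (\<Sum>z\<in>nb y - {x}. (u y z)^2) / (real q)^2"
      by (rule divide_right_mono) simp
    then show ?thesis using q0 by (simp add: p_def power_divide power2_eq_square)
  qed
  have second: "(\<Sum>x\<in>V. \<Sum>y\<in>nb x. \<Sum>ws\<in>W n x y. (m x y ws)^2) \<le> real n * real q ^ n * ?U" for n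
  proof (induction n)
    case 0
    have "(\<Sum>ws\<in>W 0 x y. (m x y ws)^2) = 0" if "y \<in> nb x" for x y
      using ku[OF that] by (simp add: m_def pen_def)
    then show ?case by (simp del: Image_singleton_iff W.simps)
  next
    case (Suc n)
    have "(\<Sum>x\<in>V. \<Sum>y\<in>nb x. \<Sum>ws\<in>W (Suc n) x y. (m x y ws)^2)
        \<le> (\<Sum>x\<in>V. \<Sum>y\<in>nb x. \<Sum>z\<in>nb y - {x}. (\<Sum>ws\<in>W n y z. (m y z ws)^2) + real q ^ n * (u y z)^2)"
    proof (intro sum_mono)
      fix x y assume y: "y \<in> nb x"
      have "(\<Sum>ws\<in>W (Suc n) x y. (m x y ws)^2) = (\<Sum>z\<in>nb y - {x}. \<Sum>ws\<in>W n y z. (m y z ws + (u y z - p x y))^2)"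
        unfolding W_sum using m_step[OF y] by (intro sum.cong refl) (metis (no_types))
      also have "... = (\<Sum>z\<in>nb y - {x}. (\<Sum>ws\<in>W n y z. (m y z ws)^2) + real q ^ n * (u y z - p x y)^2)"
      proof (rule sum.cong[OF refl])
        fix z assume "z \<in> nb y - {x}"
        then have z: "z \<in> nb y" by blast
        have "(\<Sum>ws\<in>W n y z. (m y z ws + (u y z - p x y))^2)
           = (\<Sum>ws\<in>W n y z. (m y z ws)^2 + (2 * (u y z - p x y) * m y z ws + (u y z - p x y)^2))"
          by (intro sum.cong refl) (simp add: power2_eq_square algebra_simps)
        also have "... = (\<Sum>ws\<in>W n y z. (m y z ws)^2) + (2 * (u y z - p x y) * (\<Sum>ws\<in>W n y z. m y z ws) + (\<Sum>ws\<in>W n y z. (u y z - p x y)^2))"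
          by (simp only: sum.distrib sum_distrib_left)
        also have "... = (\<Sum>ws\<in>W n y z. (m y z ws)^2) + real q ^ n * (u y z - p x y)^2"
          unfolding mean[OF z] by (simp add: W_card[OF z])
        finally show "(\<Sum>ws\<in>W n y z. (m y z ws + (u y z - p x y))^2)
           = (\<Sum>ws\<in>W n y z. (m y z ws)^2) + real q ^ n * (u y z - p x y)^2" .
      qed
      also have "... \<le> (\<Sum>z\<in>nb y - {x}. (\<Sum>ws\<in>W n y z. (m y z ws)^2) + real q ^ n * (u y z)^2)"
        unfolding sum.distrib sum_distrib_left[symmetric] using var[OF y] by (intro add_left_mono mult_left_mono) auto
      finally show "(\<Sum>ws\<in>W (Suc n) x y. (m x y ws)^2)
        \<le> (\<Sum>z\<in>nb y - {x}. (\<Sum>ws\<in>W n y z. (m y z ws)^2) + real q ^ n * (u y z)^2)" .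
    qed
    also have "... = real q * (\<Sum>x\<in>V. \<Sum>y\<in>nb x. (\<Sum>ws\<in>W n x y. (m x y ws)^2) + real q ^ n * (u x y)^2)"
      by (rule sum_bond_step)
    also have "... = real q * ((\<Sum>x\<in>V. \<Sum>y\<in>nb x. \<Sum>ws\<in>W n x y. (m x y ws)^2) + real q ^ n * ?U)"
      by (simp only: sum.distrib sum_distrib_left)
    also have "... \<le> real q * (real n * real q ^ n * ?U + real q ^ n * ?U)"
      using Suc by (intro mult_left_mono add_right_mono) auto
    also have "... = real (Suc n) * real q ^ Suc n * ?U" by (simp add: algebra_simps)
    finally show ?case .
  qed
  \<comment> \<open>The Birkhoff sum is m + u - p. Up to the common factor q^n times the norm of u,
    the three squares cost n, 1 and 1, which is the origin of 3 (n + 2).\<close>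
  have "(\<Sum>x\<in>V. \<Sum>y\<in>nb x. \<Sum>ws\<in>W n x y. (bsum \<kappa> ws)^2)
      \<le> (\<Sum>x\<in>V. \<Sum>y\<in>nb x. \<Sum>ws\<in>W n x y. 3 * (m x y ws)^2 + 3 * (u x y)^2 + 3 * (p (pen ws) (last ws))^2)"
  proof (intro sum_mono)
    fix x y ws
    have "(a + b - c)^2 \<le> 3 * a^2 + 3 * b^2 + 3 * c^2" for a b c :: real
      using zero_le_power2[of "a - b"] zero_le_power2[of "a + c"] zero_le_power2[of "b + c"]
      by (simp add: power2_eq_square algebra_simps)
    from this[of "m x y ws" "u x y" "p (pen ws) (last ws)"]
    show "(bsum \<kappa> ws)^2 \<le> 3 * (m x y ws)^2 + 3 * (u x y)^2 + 3 * (p (pen ws) (last ws))^2"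
      by (simp add: m_def)
  qed
  also have "... = 3 * (\<Sum>x\<in>V. \<Sum>y\<in>nb x. \<Sum>ws\<in>W n x y. (m x y ws)^2) + 3 * (\<Sum>x\<in>V. \<Sum>y\<in>nb x. \<Sum>ws\<in>W n x y. (u x y)^2)
      + 3 * (\<Sum>x\<in>V. \<Sum>y\<in>nb x. \<Sum>ws\<in>W n x y. (p (pen ws) (last ws))^2)"
    by (simp only: sum.distrib sum_distrib_left)
  also have "(\<Sum>x\<in>V. \<Sum>y\<in>nb x. \<Sum>ws\<in>W n x y. (u x y)^2) = real q ^ n * ?U"
    unfolding sum_distrib_left by (intro sum.cong refl) (simp add: W_card)
  also have "(\<Sum>x\<in>V. \<Sum>y\<in>nb x. \<Sum>ws\<in>W n x y. (p (pen ws) (last ws))^2) = real q ^ n * (\<Sum>x\<in>V. \<Sum>y\<in>nb x. (p x y)^2)"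
    by (rule sum_walk_last)
  also have "3 * (\<Sum>x\<in>V. \<Sum>y\<in>nb x. \<Sum>ws\<in>W n x y. (m x y ws)^2) + 3 * (real q ^ n * ?U) + 3 * (real q ^ n * (\<Sum>x\<in>V. \<Sum>y\<in>nb x. (p x y)^2))
     \<le> 3 * (real n * real q ^ n * ?U) + 3 * (real q ^ n * ?U) + 3 * (real q ^ n * ?U)"
  proof -
    have "(\<Sum>x\<in>V. \<Sum>y\<in>nb x. (p x y)^2) \<le> (\<Sum>x\<in>V. \<Sum>y\<in>nb x. \<Sum>z\<in>nb y - {x}. (u y z)^2 / real q)"
    proof -
      have "(\<Sum>x\<in>V. \<Sum>y\<in>nb x. (p x y)^2) \<le> (\<Sum>x\<in>V. \<Sum>y\<in>nb x. (\<Sum>z\<in>nb y - {x}. (u y z)^2) / real q)"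
        by (intro sum_mono p2)
      then show ?thesis by (simp only: sum_divide_distrib)
    qed
    also have "... = ?U" unfolding sum_bond_step[of "\<lambda>y z. (u y z)^2 / real q"] using q0
      by (simp add: sum_divide_distrib[symmetric])
    finally show ?thesis using second[of n] by (intro add_mono mult_left_mono) auto
  qed
  also have "... = 3 * real (n + 2) * real q ^ n * ?U" by (simp add: algebra_simps)
  finally show ?thesis .
qed

end

context fgraph begin

subsection \<open>The Poisson equation\<close>

definition gap :: "real \<Rightarrow> bool" where
  "gap \<beta> \<longleftrightarrow> (\<forall>(\<mu>::real) f. eigenfn (of_real \<mu>) f \<longrightarrow> (\<exists>x\<in>V. f x \<noteq> 0) \<longrightarrow> \<mu> \<le> (1 - \<beta>) * (real q + 1) \<or> \<mu> = real q + 1)"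

lemma adjacency_spectral:
  obtains \<phi> \<mu> where "orthonormal_on V {..<card V} \<phi>" "\<And>j. j < card V \<Longrightarrow> eigenfn (of_real (\<mu> j)) (\<phi> j)"
proof -
  define K where "K x y = (if (x, y) \<in> adj G then 1 else 0 :: complex)" for x y
  have k: "kap V K f x = (\<Sum>y\<in>nb x. f y)" for f x
  proof -
    have "nb x = {y \<in> V. (x, y) \<in> adj G}" using nb_V(1)[of _ x] by auto
    moreover have "kap V K f x = (\<Sum>y\<in>V. if (x, y) \<in> adj G then f y else 0)"
      unfolding kap_def K_def by (intro sum.cong) auto
    ultimately show ?thesis using finV by (simp add: sum.inter_filter)
  qed
  have "K y x = cnj (K x y)" for x y using adj_sym[of _ _ G] by (auto simp: K_def)
  from hermitian_spectral[of V K, OF finV this] show ?thesis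
    unfolding k using that by (auto simp: eigenfn_def simp del: Image_singleton_iff)
qed

text \<open>At the eigenvalue q + 1 the Dirichlet sum of |f x - f y|^2 over directed edges vanishes,
  so f is constant along edges, and the graph is connected.\<close>

lemma eigen_top_const:
  assumes e: "eigenfn (of_real (real q + 1)) f" and "x \<in> V" "y \<in> V"
  shows "f x = f y"
proof -
  have sq: "(cmod (a - b))^2 = (cmod a)^2 + (cmod b)^2 - 2 * Re (cnj a * b)" for a b
    unfolding cmod_power2 by (simp add: power2_eq_square algebra_simps)
  have cross: "(\<Sum>x\<in>V. \<Sum>y\<in>nb x. Re (cnj (f x) * f y)) = (real q + 1) * ns V f"
  proof -
    have "(\<Sum>y\<in>nb x. Re (cnj (f x) * f y)) = (real q + 1) * (cmod (f x))^2" if "x \<in> V" for x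
    proof -
      have "(\<Sum>y\<in>nb x. Re (cnj (f x) * f y)) = Re (cnj (f x) * (\<Sum>y\<in>nb x. f y))"
        by (simp only: Re_sum sum_distrib_left)
      also have "... = Re (cnj (f x) * (of_real (real q + 1) * f x))"
        using e that by (simp only: eigenfn_def)
      also have "... = (real q + 1) * (cmod (f x))^2"
        unfolding cmod_power2 by (simp add: power2_eq_square algebra_simps)
      finally show ?thesis .
    qed
    then show ?thesis by (simp add: ns_def sum_distrib_left del: Image_singleton_iff cong: sum.cong)
  qed
  have "(\<Sum>x\<in>V. \<Sum>y\<in>nb x. (cmod (f x - f y))^2) = 0"
    unfolding sq sum_subtractf sum.distrib sum_distrib_left[symmetric] cross
    using sum_bond_origin[of "\<lambda>x. (cmod (f x))^2"] by (simp add: ns_def algebra_simps)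
  then have adj_eq: "f x = f y" if "y \<in> nb x" for x y
    using that nb_V(2)[OF that] finV
    by (subst (asm) sum_nonneg_eq_0_iff) (auto simp: sum_nonneg sum_nonneg_eq_0_iff)
  have "(x, y) \<in> (adj G)\<^sup>*" using conn assms by (simp add: connected_graph_def)
  then show ?thesis
    by (induction rule: rtrancl_induct) (use adj_eq in auto)
qed

text \<open>Expand D in eigenfunctions and divide by q + 1 - \<mu>. The top eigenspace consists of
  constants, to which D is orthogonal; elsewhere the gap bounds the divisor from below by \<beta> (q
  + 1).\<close>

lemma poisson:
  assumes g: "gap \<beta>" and b: "\<beta> > 0" and D0: "(\<Sum>x\<in>V. D x) = (0 :: real)"
  shows "\<exists>F. (\<forall>x\<in>V. (real q + 1) * F x - (\<Sum>y\<in>nb x. F y) = D x) \<and>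
     (\<Sum>x\<in>V. (F x)^2) \<le> (\<Sum>x\<in>V. (D x)^2) / (\<beta> * (real q + 1))^2"
proof -
  obtain \<phi> \<mu> where o: "orthonormal_on V {..<card V} \<phi>" and e: "\<And>j. j < card V \<Longrightarrow> eigenfn (of_real (\<mu> j)) (\<phi> j)"
    using adjacency_spectral by blast
  let ?J = "{..<card V}"
  let ?D = "\<lambda>x. complex_of_real (D x)"
  define d where "d = real q + 1"
  have d: "d > 0" by (simp add: d_def)
  \<comment> \<open>At the top eigenvalue the coefficient is free, as D has no component there; zero
    keeps the norm of F smallest.\<close>
  define c where "c j = (if \<mu> j = d then 0 else ip V (\<phi> j) ?D / of_real (d - \<mu> j))" for j
  define F where "F x = (\<Sum>j\<in>?J. c j * \<phi> j x)" for x
  have nz: "\<exists>x\<in>V. \<phi> j x \<noteq> 0" if "j \<in> ?J" for j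
  proof (rule ccontr)
    assume "\<not> ?thesis"
    then have "ip V (\<phi> j) (\<phi> j) = 0" by (simp add: ip_def)
    then show False using o that by (auto simp: orthonormal_on_def)
  qed
  have top: "ip V (\<phi> j) ?D = 0" if "j \<in> ?J" "\<mu> j = d" for j
  proof -
    obtain x0 where x0: "x0 \<in> V" using V_ne by blast
    have "eigenfn (of_real (real q + 1)) (\<phi> j)" using e[of j] that by (simp add: d_def)
    then have "\<phi> j x = \<phi> j x0" if "x \<in> V" for x by (rule eigen_top_const[OF _ that x0])
    then have "ip V (\<phi> j) ?D = cnj (\<phi> j x0) * of_real (\<Sum>x\<in>V. D x)"
      unfolding ip_def of_real_sum sum_distrib_left by (intro sum.cong refl) simp
    then show ?thesis using D0 by simp
  qed
  have cd: "c j * of_real (d - \<mu> j) = ip V (\<phi> j) ?D" if "j \<in> ?J" for j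
  proof (cases "\<mu> j = d")
    case False
    then have "complex_of_real (d - \<mu> j) \<noteq> 0" by simp
    then show ?thesis using False by (simp add: c_def del: of_real_diff)
  qed (use top that in \<open>simp add: c_def\<close>)
  have eq: "of_real d * F x - (\<Sum>y\<in>nb x. F y) = ?D x" if x: "x \<in> V" for x
  proof -
    have "(\<Sum>y\<in>nb x. F y) = (\<Sum>j\<in>?J. c j * (\<Sum>y\<in>nb x. \<phi> j y))"
      unfolding F_def sum_distrib_left by (rule sum.swap)
    also have "... = (\<Sum>j\<in>?J. c j * (of_real (\<mu> j) * \<phi> j x))"
      using e x by (intro sum.cong refl) (simp add: eigenfn_def del: Image_singleton_iff)
    finally have "of_real d * F x - (\<Sum>y\<in>nb x. F y) = (\<Sum>j\<in>?J. c j * of_real (d - \<mu> j) * \<phi> j x)"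
      by (simp add: F_def sum_distrib_left sum_subtractf[symmetric] algebra_simps)
    also have "... = (\<Sum>j\<in>?J. ip V (\<phi> j) ?D * \<phi> j x)" by (intro sum.cong refl) (simp only: cd)
    also have "... = ?D x" using orthonormal_complete(2)[OF finV _ o _ x, of ?D] by simp
    finally show ?thesis .
  qed
  have cF: "ip V (\<phi> i) F = c i" if "i \<in> ?J" for i
  proof -
    have "ip V (\<phi> i) F = (\<Sum>j\<in>?J. if i = j then c j else 0)"
      unfolding F_def ip_sum_right ip_scale_right using o that by (intro sum.cong refl) (auto simp: orthonormal_on_def)
    then show ?thesis using that by simp
  qed
  have "ns V F = (\<Sum>i\<in>?J. (cmod (c i))^2)"
    using orthonormal_complete(1)[OF finV _ o, of F] cF by simp
  also have "... \<le> (\<Sum>i\<in>?J. (cmod (ip V (\<phi> i) ?D))^2 / (\<beta> * d)^2)"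
  proof (rule sum_mono)
    fix j assume j: "j \<in> ?J"
    show "(cmod (c j))^2 \<le> (cmod (ip V (\<phi> j) ?D))^2 / (\<beta> * d)^2"
    proof (cases "\<mu> j = d")
      case False
      then have "\<mu> j \<le> (1 - \<beta>) * d" using g nz[OF j] e[of j] j unfolding gap_def d_def by auto
      then have ge: "\<beta> * d \<le> d - \<mu> j" by (simp add: algebra_simps)
      have p: "\<beta> * d > 0" using b d by simp
      have "(cmod (c j))^2 = (cmod (ip V (\<phi> j) ?D))^2 / (d - \<mu> j)^2"
        using False by (simp add: c_def norm_divide power_divide del: of_real_diff)
      also have "... \<le> (cmod (ip V (\<phi> j) ?D))^2 / (\<beta> * d)^2"
        using ge p by (intro divide_left_mono power_mono mult_pos_pos) auto
      finally show ?thesis .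
    qed (simp add: c_def)
  qed
  also have "... = ns V ?D / (\<beta> * d)^2"
    using orthonormal_complete(1)[OF finV _ o, of ?D] by (simp add: sum_divide_distrib[symmetric])
  finally have nF: "ns V F \<le> (\<Sum>x\<in>V. (D x)^2) / (\<beta> * (real q + 1))^2" by (simp add: ns_def d_def)
  have "(\<Sum>x\<in>V. (Re (F x))^2) \<le> ns V F"
    unfolding ns_def by (intro sum_mono) (simp add: cmod_power2)
  moreover have "\<forall>x\<in>V. (real q + 1) * Re (F x) - (\<Sum>y\<in>nb x. Re (F y)) = D x"
  proof
    fix x assume "x \<in> V"
    from arg_cong[OF eq[OF this], of Re] show "(real q + 1) * Re (F x) - (\<Sum>y\<in>nb x. Re (F y)) = D x"
      by (simp add: d_def)
  qed
  ultimately show ?thesis using nF by (intro exI[of _ "\<lambda>x. Re (F x)"]) auto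
qed

text \<open>Write F y for the sum of u y z over all neighbours z. The equation becomes q u x y + u y
  x = q \<kappa> x y + F y; together with its mirror image this is a linear system of determinant
  q^2 - 1, solved by the formula for u below. Consistency with the meaning of F is the Poisson
  equation with right-hand side (q - 1) times the sum of \<kappa> x y over y, of mean zero by
  assumption.\<close>

lemma cohomological:
  fixes \<kappa> :: "'a \<Rightarrow> 'a \<Rightarrow> real"
  assumes g: "gap \<beta>" and b: "\<beta> > 0" and sym: "\<And>x y. \<kappa> x y = \<kappa> y x" and zero: "(\<Sum>x\<in>V. \<Sum>y\<in>nb x. \<kappa> x y) = 0"
  shows "\<exists>u. (\<forall>x y. y \<in> nb x \<longrightarrow> real q * u x y - (\<Sum>z\<in>nb y - {x}. u y z) = real q * \<kappa> x y) \<and>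
     (\<Sum>x\<in>V. \<Sum>y\<in>nb x. (u x y)^2) \<le> (3 + 6 * (real q - 1)^2 / \<beta>^2) * (\<Sum>x\<in>V. \<Sum>y\<in>nb x. (\<kappa> x y)^2)"
proof -
  define Q where "Q = real q"
  have Q: "Q \<ge> 2" using q2 by (simp add: Q_def)
  define D where "D x = (Q - 1) * (\<Sum>y\<in>nb x. \<kappa> x y)" for x
  have "(\<Sum>x\<in>V. D x) = 0" using zero by (simp add: D_def sum_distrib_left[symmetric])
  then obtain F where F: "\<And>x. x \<in> V \<Longrightarrow> (Q + 1) * F x - (\<Sum>y\<in>nb x. F y) = D x"
    and Fn: "(\<Sum>x\<in>V. (F x)^2) \<le> (\<Sum>x\<in>V. (D x)^2) / (\<beta> * (Q + 1))^2"
    using poisson[OF g b, of D] unfolding Q_def by blast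
  define E where "E = Q^2 - 1"
  have "2 * Q \<le> Q^2" using Q by (simp add: power2_eq_square)
  moreover have "Q * (Q - 1) = Q^2 - Q" by (simp add: power2_eq_square algebra_simps)
  ultimately have E: "E \<ge> 1" "E \<ge> Q" "E \<ge> Q * (Q - 1)" using Q unfolding E_def by linarith+
  define u where "u x y = (Q * (Q - 1) * \<kappa> x y + Q * F y - F x) / E" for x y
  let ?K = "\<Sum>x\<in>V. \<Sum>y\<in>nb x. (\<kappa> x y)^2"
  have 1: "Q * u x y - (\<Sum>z\<in>nb y - {x}. u y z) = Q * \<kappa> x y" if y: "y \<in> nb x" for x y
  proof -
    have xy: "x \<in> nb y" "y \<in> V" using y nb_sym nb_V(1) by blast+
    have "E * (\<Sum>z\<in>nb y. u y z) = (\<Sum>z\<in>nb y. Q * ((Q - 1) * \<kappa> y z) + Q * F z - F y)"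
      unfolding sum_distrib_left using E by (intro sum.cong refl) (simp add: u_def)
    also have "... = Q * ((Q - 1) * (\<Sum>z\<in>nb y. \<kappa> y z)) + Q * (\<Sum>z\<in>nb y. F z) - (\<Sum>z\<in>nb y. F y)"
      by (simp only: sum.distrib sum_subtractf sum_distrib_left)
    also have "(\<Sum>z\<in>nb y. F y) = (Q + 1) * F y" using nb_card[OF xy(2)] by (simp add: Q_def)
    also have "(\<Sum>z\<in>nb y. F z) = (Q + 1) * F y - D y" using F[OF xy(2)] by simp
    also have "(Q - 1) * (\<Sum>z\<in>nb y. \<kappa> y z) = D y" by (simp add: D_def)
    also have "Q * D y + Q * ((Q + 1) * F y - D y) - (Q + 1) * F y = E * F y" by (simp add: E_def power2_eq_square algebra_simps)
    finally have "(\<Sum>z\<in>nb y. u y z) = F y" using E by simp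
    then have "(\<Sum>z\<in>nb y - {x}. u y z) = F y - u y x" using xy by (simp add: sum_diff1)
    moreover have "E * (Q * u x y + u y x) = E * (Q * \<kappa> x y + F y)"
    proof -
      have "E * u x y = Q * (Q - 1) * \<kappa> x y + Q * F y - F x" "E * u y x = Q * (Q - 1) * \<kappa> x y + Q * F x - F y"
        using E sym[of y x] by (auto simp: u_def)
      then have "E * (Q * u x y + u y x) = Q * (Q * (Q - 1) * \<kappa> x y + Q * F y - F x) + (Q * (Q - 1) * \<kappa> x y + Q * F x - F y)"
        by (simp add: distrib_left mult.left_commute)
      then show ?thesis by (simp add: E_def power2_eq_square algebra_simps)
    qed
    ultimately show ?thesis using E by simp
  qed
  \<comment> \<open>The three coefficients of u have absolute value at most 1 because E dominates Q
    (Q - 1), Q and 1.\<close>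
  have u2: "(u x y)^2 \<le> 3 * (\<kappa> x y)^2 + 3 * (F y)^2 + 3 * (F x)^2" for x y
  proof -
    define a b c where "a = Q * (Q - 1) / E" and "b = Q / E" and "c = 1 / E"
    have l: "0 \<le> a" "a \<le> 1" "0 \<le> b" "b \<le> 1" "0 \<le> c" "c \<le> 1" using E Q by (auto simp: a_def b_def c_def)
    have u: "u x y = a * \<kappa> x y + b * F y - c * F x" by (simp add: u_def a_def b_def c_def add_divide_distrib diff_divide_distrib)
    have t: "(p + r - s)^2 \<le> 3 * p^2 + 3 * r^2 + 3 * s^2" for p r s :: real
      using zero_le_power2[of "p - r"] zero_le_power2[of "p + s"] zero_le_power2[of "r + s"]
      by (simp add: power2_eq_square algebra_simps)
    have m: "(p * r)^2 \<le> r^2" if "0 \<le> p" "p \<le> 1" for p r :: real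
    proof -
      have "p^2 * r^2 \<le> 1 * r^2" using that by (intro mult_right_mono power_le_one) auto
      then show ?thesis by (simp add: power_mult_distrib)
    qed
    show ?thesis using t[of "a * \<kappa> x y" "b * F y" "c * F x"] m[OF l(1,2), of "\<kappa> x y"] m[OF l(3,4), of "F y"] m[OF l(5,6), of "F x"]
      unfolding u by linarith
  qed
  have D2: "(\<Sum>x\<in>V. (D x)^2) \<le> (Q - 1)^2 * (Q + 1) * ?K"
  proof -
    have "(D x)^2 \<le> (Q - 1)^2 * ((Q + 1) * (\<Sum>y\<in>nb x. (\<kappa> x y)^2))" if "x \<in> V" for x
    proof -
      have "(\<Sum>y\<in>nb x. 1 * \<kappa> x y)^2 \<le> (\<Sum>y\<in>nb x. 1^2) * (\<Sum>y\<in>nb x. (\<kappa> x y)^2)" by (rule Cauchy_Schwarz_ineq_sum)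
      then have "(\<Sum>y\<in>nb x. \<kappa> x y)^2 \<le> (Q + 1) * (\<Sum>y\<in>nb x. (\<kappa> x y)^2)"
        using nb_card[OF that] by (simp add: Q_def add.commute)
      then show ?thesis unfolding D_def power_mult_distrib by (intro mult_left_mono) auto
    qed
    then have "(\<Sum>x\<in>V. (D x)^2) \<le> (\<Sum>x\<in>V. (Q - 1)^2 * ((Q + 1) * (\<Sum>y\<in>nb x. (\<kappa> x y)^2)))" by (rule sum_mono)
    then show ?thesis by (simp add: sum_distrib_left mult.assoc)
  qed
  have "(\<Sum>x\<in>V. \<Sum>y\<in>nb x. (u x y)^2) \<le> (\<Sum>x\<in>V. \<Sum>y\<in>nb x. 3 * (\<kappa> x y)^2 + 3 * (F y)^2 + 3 * (F x)^2)"
    by (intro sum_mono u2)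
  also have "... = 3 * ?K + 3 * (\<Sum>x\<in>V. \<Sum>y\<in>nb x. (F y)^2) + 3 * (\<Sum>x\<in>V. \<Sum>y\<in>nb x. (F x)^2)"
    by (simp only: sum.distrib sum_distrib_left)
  also have "... = 3 * ?K + 6 * (Q + 1) * (\<Sum>x\<in>V. (F x)^2)"
    unfolding sum_bond_origin by (simp add: Q_def algebra_simps)
  also have "... \<le> 3 * ?K + 6 * (Q + 1) * ((Q - 1)^2 * (Q + 1) * ?K / (\<beta> * (Q + 1))^2)"
  proof -
    have "(\<Sum>x\<in>V. (F x)^2) \<le> (Q - 1)^2 * (Q + 1) * ?K / (\<beta> * (Q + 1))^2"
      using Fn D2 by (meson divide_right_mono order_trans zero_le_power2)
    then show ?thesis using Q by (intro add_left_mono mult_left_mono) auto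
  qed
  also have "6 * (Q + 1) * ((Q - 1)^2 * (Q + 1) * ?K / (\<beta> * (Q + 1))^2) = 6 * (Q - 1)^2 / \<beta>^2 * ?K"
  proof -
    have gen: "6 * P * (A * P * K / (B * P)^2) = 6 * A / B^2 * K" if "P \<noteq> 0" "B \<noteq> 0" for P A K B :: real
      using that by (simp add: power2_eq_square divide_simps)
    show ?thesis by (rule gen) (use Q b in auto)
  qed
  finally have "(\<Sum>x\<in>V. \<Sum>y\<in>nb x. (u x y)^2) \<le> (3 + 6 * (Q - 1)^2 / \<beta>^2) * ?K"
    by (simp only: distrib_right)
  then show ?thesis using 1 unfolding Q_def by blast
qed

subsection \<open>Hilbert--Schmidt bound\<close>

definition bonds :: "('a \<times> 'a) set" where "bonds = Sigma V (\<lambda>x. nb x)"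

lemma bonds_finite [simp]: "finite bonds"
  unfolding bonds_def by (intro finite_SigmaI finV nb_fin)

lemma sum_bonds: "(\<Sum>b\<in>bonds. h b) = (\<Sum>x\<in>V. \<Sum>y\<in>nb x. h (x, y))"
  unfolding bonds_def using sum.Sigma[OF finV, of "\<lambda>x. nb x" "\<lambda>x y. h (x, y)"]
  by (simp add: split_def del: Image_singleton_iff)

text \<open>The roots of \<open>q x\<^sup>2 - \<mu> x + 1\<close> are \<open>eps \<mu>\<close> and its conjugate. Therefore \<open>gfun\<close> and \<open>kfun\<close> turn an eigenfunction
  of the graph into eigenfunctions of the nonbacktracking shift on directed edges and of its transpose.\<close>

definition eps :: "real \<Rightarrow> complex" where
  "eps \<mu> = Complex (\<mu> / (2 * real q)) (sqrt (4 * real q - \<mu>^2) / (2 * real q))"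

lemma eps_facts:
  assumes "\<mu>^2 \<le> 4 * real q"
  shows "(cmod (eps \<mu>))^2 = 1 / real q" and "of_real \<mu> - of_nat q * eps \<mu> = of_nat q * cnj (eps \<mu>)"
    and "of_nat q * cnj (eps \<mu>) * eps \<mu> = 1"
proof -
  have q0: "real q > 0" using q2 by simp
  show c: "(cmod (eps \<mu>))^2 = 1 / real q"
    using assms q0 unfolding cmod_power2 by (simp add: eps_def power_divide power_mult_distrib) (simp add: field_simps power2_eq_square)
  show "of_real \<mu> - of_nat q * eps \<mu> = of_nat q * cnj (eps \<mu>)"
    using q0 by (simp add: complex_eq_iff eps_def field_simps)
  have "of_nat q * cnj (eps \<mu>) * eps \<mu> = of_nat q * complex_of_real ((cmod (eps \<mu>))^2)"
    by (simp only: complex_norm_square mult_ac)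
  also have "... = 1" unfolding c using q0 by simp
  finally show "of_nat q * cnj (eps \<mu>) * eps \<mu> = 1" .
qed

definition gfun :: "real \<Rightarrow> ('a \<Rightarrow> complex) \<Rightarrow> 'a \<Rightarrow> 'a \<Rightarrow> complex" where
  "gfun \<mu> f x y = f y - eps \<mu> * f x"

definition kfun :: "real \<Rightarrow> ('a \<Rightarrow> complex) \<Rightarrow> 'a \<Rightarrow> 'a \<Rightarrow> complex" where
  "kfun \<mu> f x y = cnj (f x) - eps \<mu> * cnj (f y)"

lemma gfun_eigen:
  assumes e: "eigenfn (of_real \<mu>) f" and m: "\<mu>^2 \<le> 4 * real q" and y: "y \<in> nb x"
  shows "(\<Sum>z\<in>nb y - {x}. gfun \<mu> f y z) = of_nat q * cnj (eps \<mu>) * gfun \<mu> f x y"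
proof -
  have xy: "x \<in> nb y" "y \<in> V" using y nb_sym nb_V(1) by blast+
  have "(\<Sum>z\<in>nb y - {x}. gfun \<mu> f y z) = (\<Sum>z\<in>nb y. gfun \<mu> f y z) - gfun \<mu> f y x"
    using xy by (simp add: sum_diff1)
  also have "... = (of_real \<mu> - of_nat q * eps \<mu>) * f y - f x"
    using e xy(2) nb_card[OF xy(2)] unfolding gfun_def sum_subtractf
    by (simp add: eigenfn_def algebra_simps del: Image_singleton_iff)
  also have "... = of_nat q * cnj (eps \<mu>) * f y - (of_nat q * cnj (eps \<mu>) * eps \<mu>) * f x"
    unfolding eps_facts(2,3)[OF m] by simp
  finally show ?thesis by (simp add: gfun_def algebra_simps)
qed

lemma kfun_eigen:
  assumes e: "eigenfn (of_real \<mu>) f" and m: "\<mu>^2 \<le> 4 * real q" and z: "z \<in> nb y"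
  shows "(\<Sum>x\<in>nb y - {z}. kfun \<mu> f x y) = of_nat q * cnj (eps \<mu>) * kfun \<mu> f y z"
proof -
  have y: "y \<in> V" using z nb_V(2) by blast
  have s: "(\<Sum>x\<in>nb y. cnj (f x)) = of_real \<mu> * cnj (f y)"
  proof -
    have "cnj (\<Sum>x\<in>nb y. f x) = cnj (of_real \<mu> * f y)" using e y by (simp only: eigenfn_def)
    then show ?thesis by (simp only: cnj_sum complex_cnj_mult complex_cnj_complex_of_real)
  qed
  have "(\<Sum>x\<in>nb y - {z}. kfun \<mu> f x y) = (\<Sum>x\<in>nb y. kfun \<mu> f x y) - kfun \<mu> f z y"
    using z by (simp add: sum_diff1)
  also have "... = (of_real \<mu> - of_nat q * eps \<mu>) * cnj (f y) - cnj (f z)"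
    using nb_card[OF y] unfolding kfun_def sum_subtractf s
    by (simp add: algebra_simps)
  also have "... = of_nat q * cnj (eps \<mu>) * cnj (f y) - (of_nat q * cnj (eps \<mu>) * eps \<mu>) * cnj (f z)"
    unfolding eps_facts(2,3)[OF m] by simp
  finally show ?thesis by (simp add: kfun_def algebra_simps)
qed

end

section \<open>Lifted eigenfunctions and the kernel of the walk average\<close>

context fgraph begin

lemma sum_cross_eigen:
  assumes "eigenfn (of_real \<mu>) f"
  shows "(\<Sum>x\<in>V. \<Sum>y\<in>nb x. cnj (h x) * f y) = of_real \<mu> * ip V h f"
proof -
  have "(\<Sum>x\<in>V. \<Sum>y\<in>nb x. cnj (h x) * f y) = (\<Sum>x\<in>V. cnj (h x) * (of_real \<mu> * f x))"
    using assms by (intro sum.cong refl) (simp add: eigenfn_def sum_distrib_left[symmetric] del: Image_singleton_iff)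
  then show ?thesis by (simp add: ip_def sum_distrib_left mult.left_commute)
qed

text \<open>By regularity and the eigenvalue equation every term of the pairing is a multiple of
  \<open>ip V (f i) (f j)\<close>, so orthogonality survives the lift even though the lift depends
  on the eigenvalue. This makes a Bessel inequality on directed edges possible.\<close>

lemma gfun_gram:
  assumes o: "orthonormal_on V J f" and e: "\<And>i. i \<in> J \<Longrightarrow> eigenfn (of_real (\<mu> i)) (f i)"
    and m: "\<And>i. i \<in> J \<Longrightarrow> (\<mu> i)^2 \<le> 4 * real q" and i: "i \<in> J" and j: "j \<in> J"
  shows "ip bonds (\<lambda>b. gfun (\<mu> i) (f i) (fst b) (snd b)) (\<lambda>b. gfun (\<mu> j) (f j) (fst b) (snd b)) =
     (if i = j then of_real ((real q + 1) * (1 + 1 / real q) - (\<mu> i)^2 / real q) else 0)"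
proof -
  have q0: "real q > 0" using q2 by simp
  let ?p = "ip V (f i) (f j)"
  have "ip bonds (\<lambda>b. gfun (\<mu> i) (f i) (fst b) (snd b)) (\<lambda>b. gfun (\<mu> j) (f j) (fst b) (snd b))
     = (\<Sum>x\<in>V. \<Sum>y\<in>nb x. cnj (f i y) * f j y - eps (\<mu> j) * (cnj (f i y) * f j x) - cnj (eps (\<mu> i)) * (cnj (f i x) * f j y)
        + cnj (eps (\<mu> i)) * eps (\<mu> j) * (cnj (f i x) * f j x))"
    unfolding ip_def sum_bonds gfun_def by (intro sum.cong refl) (simp add: algebra_simps)
  also have "... = (\<Sum>x\<in>V. \<Sum>y\<in>nb x. cnj (f i y) * f j y) - eps (\<mu> j) * (\<Sum>x\<in>V. \<Sum>y\<in>nb x. cnj (f i y) * f j x)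
     - cnj (eps (\<mu> i)) * (\<Sum>x\<in>V. \<Sum>y\<in>nb x. cnj (f i x) * f j y)
     + cnj (eps (\<mu> i)) * eps (\<mu> j) * (\<Sum>x\<in>V. \<Sum>y\<in>nb x. cnj (f i x) * f j x)"
    by (simp only: sum.distrib sum_subtractf sum_distrib_left)
  also have "(\<Sum>x\<in>V. \<Sum>y\<in>nb x. cnj (f i y) * f j x) = (\<Sum>x\<in>V. \<Sum>y\<in>nb x. cnj (f i x) * f j y)"
    by (rule sum_bond_swap)
  also have "(\<Sum>x\<in>V. \<Sum>y\<in>nb x. cnj (f i x) * f j y) = of_real (\<mu> j) * ?p"
    by (rule sum_cross_eigen[OF e[OF j]])
  also have "(\<Sum>x\<in>V. \<Sum>y\<in>nb x. cnj (f i y) * f j y) = of_nat (q + 1) * ?p"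
    using sum_bond_origin(2)[of "\<lambda>x. cnj (f i x) * f j x"] by (simp only: ip_def)
  also have "(\<Sum>x\<in>V. \<Sum>y\<in>nb x. cnj (f i x) * f j x) = of_nat (q + 1) * ?p"
    using sum_bond_origin(1)[of "\<lambda>x. cnj (f i x) * f j x"] by (simp only: ip_def)
  finally have eq: "ip bonds (\<lambda>b. gfun (\<mu> i) (f i) (fst b) (snd b)) (\<lambda>b. gfun (\<mu> j) (f j) (fst b) (snd b))
     = of_nat (q + 1) * ?p - eps (\<mu> j) * (of_real (\<mu> j) * ?p) - cnj (eps (\<mu> i)) * (of_real (\<mu> j) * ?p)
       + cnj (eps (\<mu> i)) * eps (\<mu> j) * (of_nat (q + 1) * ?p)" .
  show ?thesis
  proof (cases "i = j")
    case True
    have p: "?p = 1" using o i j True by (auto simp: orthonormal_on_def)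
    have ee: "cnj (eps (\<mu> i)) * eps (\<mu> i) = of_real (1 / real q)"
      using eps_facts(1)[OF m[OF i]] by (metis complex_norm_square mult.commute)
    have "eps (\<mu> i) + cnj (eps (\<mu> i)) = of_real (\<mu> i / real q)"
      using q0 by (simp add: complex_eq_iff eps_def)
    then have "eps (\<mu> i) * of_real (\<mu> i) + cnj (eps (\<mu> i)) * of_real (\<mu> i) = of_real ((\<mu> i)^2 / real q)"
      unfolding distrib_right[symmetric] by (simp add: power2_eq_square)
    moreover have "ip bonds (\<lambda>b. gfun (\<mu> i) (f i) (fst b) (snd b)) (\<lambda>b. gfun (\<mu> i) (f i) (fst b) (snd b))
      = of_nat (q + 1) - (eps (\<mu> i) * of_real (\<mu> i) + cnj (eps (\<mu> i)) * of_real (\<mu> i)) + of_real (1 / real q) * of_nat (q + 1)"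
    proof -
      have p': "ip V (f i) (f i) = 1" using p True by simp
      have "ip bonds (\<lambda>b. gfun (\<mu> i) (f i) (fst b) (snd b)) (\<lambda>b. gfun (\<mu> i) (f i) (fst b) (snd b))
        = of_nat (q + 1) * 1 - eps (\<mu> i) * (of_real (\<mu> i) * 1) - cnj (eps (\<mu> i)) * (of_real (\<mu> i) * 1)
          + of_real (1 / real q) * (of_nat (q + 1) * 1)"
        using eq unfolding True[symmetric] p' ee .
      then show ?thesis by (simp only: mult_1_right diff_diff_eq)
    qed
    ultimately show ?thesis using True by (simp add: algebra_simps)
  next
    case False
    then have "?p = 0" using o i j by (auto simp: orthonormal_on_def)
    then show ?thesis using eq False by simp
  qed
qed

lemma kfun_norm:
  assumes m: "\<mu>^2 \<le> 4 * real q"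
  shows "(\<Sum>b\<in>bonds. (cmod (kfun \<mu> f (fst b) (snd b)))^2) \<le> 4 * (real q + 1) * ns V f"
proof -
  have "(cmod (kfun \<mu> f x y))^2 \<le> 2 * (cmod (f x))^2 + 2 * (cmod (f y))^2" for x y
  proof -
    have "(cmod (eps \<mu>))^2 \<le> 1" using eps_facts(1)[OF m] q2 by simp
    then have "(cmod (eps \<mu>))^2 * (cmod (f y))^2 \<le> 1 * (cmod (f y))^2" by (intro mult_right_mono) auto
    moreover have "(cmod (kfun \<mu> f x y))^2 \<le> (cmod (f x) + cmod (eps \<mu>) * cmod (f y))^2"
      unfolding kfun_def using norm_triangle_ineq4[of "cnj (f x)" "eps \<mu> * cnj (f y)"]
      by (intro power_mono) (auto simp: norm_mult)
    moreover have "(a + b)^2 \<le> 2 * a^2 + 2 * b^2" for a b :: real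
      using zero_le_power2[of "a - b"] by (simp add: power2_eq_square algebra_simps)
    ultimately show ?thesis by (smt (verit) power_mult_distrib)
  qed
  then have "(\<Sum>b\<in>bonds. (cmod (kfun \<mu> f (fst b) (snd b)))^2) \<le> (\<Sum>x\<in>V. \<Sum>y\<in>nb x. 2 * (cmod (f x))^2 + 2 * (cmod (f y))^2)"
    unfolding sum_bonds by (intro sum_mono) simp
  also have "... = 2 * (\<Sum>x\<in>V. \<Sum>y\<in>nb x. (cmod (f x))^2) + 2 * (\<Sum>x\<in>V. \<Sum>y\<in>nb x. (cmod (f y))^2)"
    by (simp only: sum.distrib sum_distrib_left)
  also have "... = 4 * (real q + 1) * ns V f"
    unfolding sum_bond_origin by (simp add: ns_def algebra_simps)
  finally show ?thesis .
qed

text \<open>Birkhoff sums collected according to the final directed edge b: row (x, y) of the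
  operator that sums over walks.\<close>

definition wker :: "('a \<Rightarrow> 'a \<Rightarrow> real) \<Rightarrow> nat \<Rightarrow> 'a \<Rightarrow> 'a \<Rightarrow> 'a \<times> 'a \<Rightarrow> real" where
  "wker \<kappa> n x y b = (\<Sum>ws | ws \<in> W n x y \<and> (pen ws, last ws) = b. bsum \<kappa> ws)"

lemma W_bonds: "y \<in> nb x \<Longrightarrow> (\<lambda>ws. (pen ws, last ws)) ` W n x y \<subseteq> bonds"
  using W_last_adj[of y x] nb_V(2) unfolding bonds_def by blast

lemma wker_norm:
  assumes y: "y \<in> nb x"
  shows "acyclic_ball G (Suc n) x \<Longrightarrow> (\<Sum>b\<in>bonds. (wker \<kappa> n x y b)^2) = (\<Sum>ws\<in>W n x y. (bsum \<kappa> ws)^2)"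
    and "(\<Sum>b\<in>bonds. (wker \<kappa> n x y b)^2) \<le> (\<Sum>ws\<in>W n x y. \<bar>bsum \<kappa> ws\<bar>)^2"
proof -
  show "(\<Sum>b\<in>bonds. (wker \<kappa> n x y b)^2) \<le> (\<Sum>ws\<in>W n x y. \<bar>bsum \<kappa> ws\<bar>)^2"
    unfolding wker_def by (rule sum_fiber_square_le[OF W_finite bonds_finite W_bonds[OF y]])
  assume a: "acyclic_ball G (Suc n) x"
  have "inj_on (\<lambda>ws. (pen ws, last ws)) (W n x y)"
    by (rule inj_onI) (use W_unique[OF a y y] in blast)
  then show "(\<Sum>b\<in>bonds. (wker \<kappa> n x y b)^2) = (\<Sum>ws\<in>W n x y. (bsum \<kappa> ws)^2)"
    unfolding wker_def by (rule sum_fiber_square_inj[OF W_finite bonds_finite W_bonds[OF y]])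
qed

lemma walk_sum_ip:
  assumes "y \<in> nb x"
  shows "cmod (\<Sum>ws\<in>W n x y. of_real (bsum \<kappa> ws) * g (pen ws) (last ws))
     = cmod (ip bonds (\<lambda>b. g (fst b) (snd b)) (\<lambda>b. of_real (wker \<kappa> n x y b)))"
proof -
  have "cnj (ip bonds (\<lambda>b. g (fst b) (snd b)) (\<lambda>b. of_real (wker \<kappa> n x y b)))
     = (\<Sum>b\<in>bonds. \<Sum>ws | ws \<in> W n x y \<and> (pen ws, last ws) = b. of_real (bsum \<kappa> ws) * g (pen ws) (last ws))"
    unfolding ip_def cnj_sum wker_def by (intro sum.cong refl) (auto simp: sum_distrib_left mult.commute intro!: sum.cong)
  also have "... = (\<Sum>ws\<in>W n x y. of_real (bsum \<kappa> ws) * g (pen ws) (last ws))"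
    by (rule sum.group[OF W_finite bonds_finite W_bonds[OF assms]])
  finally show ?thesis by (metis complex_mod_cnj)
qed

text \<open>Cauchy-Schwarz over directed edges takes out \<open>kfun\<close>, whose norm is bounded;
  Bessel for the \<open>gfun\<close> lifts bounds the sum over i of the squared walk sums by the
  square sum of \<open>wker\<close>; at good vertices the latter is the second moment of the
  Birkhoff sum. The left side carries (n + 1)^2 q^n, the right side order n q^n.\<close>

lemma walk_variance_bound:
  assumes J: "finite J" and o: "orthonormal_on V J f" and e: "\<And>i. i \<in> J \<Longrightarrow> eigenfn (of_real (\<mu> i)) (f i)"
    and m: "\<And>i. i \<in> J \<Longrightarrow> (\<mu> i)^2 \<le> 4 * real q" and M: "\<And>x y. \<bar>\<kappa> x y\<bar> \<le> M"
    and u: "\<And>x y. y \<in> nb x \<Longrightarrow> real q * u x y - (\<Sum>z\<in>nb y - {x}. u y z) = real q * \<kappa> x y"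
  shows "(\<Sum>i\<in>J. (cmod (\<Sum>x\<in>V. \<Sum>y\<in>nb x. kfun (\<mu> i) (f i) x y * of_real (\<kappa> x y) * gfun (\<mu> i) (f i) x y))^2)
     \<le> 8 * (real q + 1)^2 * (6 / real (n + 1) * (\<Sum>x\<in>V. \<Sum>y\<in>nb x. (u x y)^2) + real (bad (n + 1)) * ((real q + 1) * real q ^ n * M^2))"
proof -
  have q0: "real q > 0" using q2 by simp
  define Y where "Y i = (\<Sum>x\<in>V. \<Sum>y\<in>nb x. kfun (\<mu> i) (f i) x y * of_real (\<kappa> x y) * gfun (\<mu> i) (f i) x y)" for i
  define T where "T i x y = (\<Sum>ws\<in>W n x y. of_real (bsum \<kappa> ws) * gfun (\<mu> i) (f i) (pen ws) (last ws))" for i x y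
  let ?U = "\<Sum>x\<in>V. \<Sum>y\<in>nb x. (u x y)^2"
  \<comment> \<open>There are q^n walks with n + 1 edges each, so N M bounds the absolute sum over
    walks at a bad vertex.\<close>
  define N where "N = real q ^ n * real (n + 1)"
  have N0: "N > 0" using q0 by (simp add: N_def)
  have M0: "M \<ge> 0" using M[of undefined undefined] by linarith
  have ns1: "ns V (f i) = 1" if "i \<in> J" for i
    using o that ip_self[of V "f i"] by (simp add: orthonormal_on_def)
  \<comment> \<open>The shift eigenvalue has modulus sqrt q, so its n-th power contributes q^n after
    squaring.\<close>
  have step1: "(real (n + 1))^2 * real q ^ n * (cmod (Y i))^2 \<le> 4 * (real q + 1) * (\<Sum>x\<in>V. \<Sum>y\<in>nb x. (cmod (T i x y))^2)"
    if i: "i \<in> J" for i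
  proof -
    let ?c = "of_nat q * cnj (eps (\<mu> i))"
    have "(\<Sum>x\<in>V. \<Sum>y\<in>nb x. kfun (\<mu> i) (f i) x y * T i x y) = of_nat (n + 1) * ?c ^ n * Y i"
      unfolding T_def Y_def by (rule sum_walk_bsum[OF gfun_eigen[OF e[OF i] m[OF i]] kfun_eigen[OF e[OF i] m[OF i]]])
    then have "(cmod (of_nat (n + 1) * ?c ^ n * Y i))^2 = (cmod (\<Sum>b\<in>bonds. kfun (\<mu> i) (f i) (fst b) (snd b) * T i (fst b) (snd b)))^2"
      unfolding sum_bonds by simp
    also have "... = (cmod (ip bonds (\<lambda>b. cnj (kfun (\<mu> i) (f i) (fst b) (snd b))) (\<lambda>b. T i (fst b) (snd b))))^2"
      by (simp add: ip_def)
    also have "... \<le> ns bonds (\<lambda>b. cnj (kfun (\<mu> i) (f i) (fst b) (snd b))) * ns bonds (\<lambda>b. T i (fst b) (snd b))"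
      by (rule cauchy_ip)
    also have "... \<le> 4 * (real q + 1) * ns bonds (\<lambda>b. T i (fst b) (snd b))"
      using kfun_norm[OF m[OF i], of "f i"] ns1[OF i] by (intro mult_right_mono ns_nonneg) (simp add: ns_def)
    also have "ns bonds (\<lambda>b. T i (fst b) (snd b)) = (\<Sum>x\<in>V. \<Sum>y\<in>nb x. (cmod (T i x y))^2)"
      by (simp add: ns_def sum_bonds del: Image_singleton_iff)
    also have "(cmod (of_nat (n + 1) * ?c ^ n * Y i))^2 = (real (n + 1))^2 * ((cmod ?c)^2) ^ n * (cmod (Y i))^2"
      by (simp only: norm_mult norm_power norm_of_nat power_mult_distrib power_mult[symmetric] mult.commute[of n 2])
    also have "(cmod ?c)^2 = real q"
      using eps_facts(1)[OF m[OF i]] q0 by (simp add: norm_mult power_mult_distrib power2_eq_square[of "real q"])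
    finally show ?thesis .
  qed
  have step2: "(\<Sum>i\<in>J. (cmod (T i x y))^2) \<le> 2 * (real q + 1) * (\<Sum>b\<in>bonds. (wker \<kappa> n x y b)^2)" if y: "y \<in> nb x" for x y
  proof -
    have "(\<Sum>i\<in>J. (cmod (T i x y))^2)
      = (\<Sum>i\<in>J. (cmod (ip bonds (\<lambda>b. gfun (\<mu> i) (f i) (fst b) (snd b)) (\<lambda>b. of_real (wker \<kappa> n x y b))))^2)"
      unfolding T_def walk_sum_ip[OF y] ..
    also have "... \<le> 2 * (real q + 1) * ns bonds (\<lambda>b. of_real (wker \<kappa> n x y b))"
    proof (rule orthogonal_residual[OF J gfun_gram[OF o e m]])
      show "(real q + 1) * (1 + 1 / real q) - (\<mu> i)^2 / real q \<le> 2 * (real q + 1)" if "i \<in> J" for i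
      proof -
        have "(real q + 1) * (1 + 1 / real q) \<le> (real q + 1) * 2" using q2 by (intro mult_left_mono) auto
        moreover have "(\<mu> i)^2 / real q \<ge> 0" by simp
        ultimately show ?thesis by linarith
      qed
    qed auto
    finally show ?thesis by (simp add: ns_def)
  qed
  have step3: "(\<Sum>x\<in>V. \<Sum>y\<in>nb x. \<Sum>b\<in>bonds. (wker \<kappa> n x y b)^2)
     \<le> (\<Sum>x\<in>V. \<Sum>y\<in>nb x. \<Sum>ws\<in>W n x y. (bsum \<kappa> ws)^2) + real (bad (n + 1)) * ((real q + 1) * (N * M)^2)"
  proof -
    let ?B = "{x \<in> V. \<not> acyclic_ball G (n + 1) x}"
    have "(\<Sum>x\<in>V. \<Sum>y\<in>nb x. \<Sum>b\<in>bonds. (wker \<kappa> n x y b)^2)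
       \<le> (\<Sum>x\<in>V. (\<Sum>y\<in>nb x. \<Sum>ws\<in>W n x y. (bsum \<kappa> ws)^2) + (if x \<in> ?B then (real q + 1) * (N * M)^2 else 0))"
    proof (rule sum_mono)
      fix x assume x: "x \<in> V"
      show "(\<Sum>y\<in>nb x. \<Sum>b\<in>bonds. (wker \<kappa> n x y b)^2)
        \<le> (\<Sum>y\<in>nb x. \<Sum>ws\<in>W n x y. (bsum \<kappa> ws)^2) + (if x \<in> ?B then (real q + 1) * (N * M)^2 else 0)"
      proof (cases "x \<in> ?B")
        case True
        have "(\<Sum>y\<in>nb x. \<Sum>b\<in>bonds. (wker \<kappa> n x y b)^2) \<le> (\<Sum>y\<in>nb x. (N * M)^2)"
        proof (rule sum_mono)
          fix y assume y: "y \<in> nb x"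
          have "(\<Sum>ws\<in>W n x y. \<bar>bsum \<kappa> ws\<bar>) \<le> (\<Sum>ws\<in>W n x y. (real n + 1) * M)"
            by (intro sum_mono bsum_abs_le[OF M])
          also have "... = N * M" using W_card[OF y] by (simp add: N_def algebra_simps)
          finally have "(\<Sum>ws\<in>W n x y. \<bar>bsum \<kappa> ws\<bar>)^2 \<le> (N * M)^2" by (intro power_mono sum_nonneg) auto
          then show "(\<Sum>b\<in>bonds. (wker \<kappa> n x y b)^2) \<le> (N * M)^2"
            using wker_norm(2)[OF y, of \<kappa> n] by linarith
        qed
        also have "... = (real q + 1) * (N * M)^2" using nb_card[OF x] by (simp add: algebra_simps)
        finally show ?thesis using True by (simp add: add_increasing sum_nonneg)
      next
        case False
        then have "acyclic_ball G (Suc n) x" using x by simp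
        then show ?thesis using False wker_norm(1) by (simp del: Image_singleton_iff cong: sum.cong)
      qed
    qed
    also have "... = (\<Sum>x\<in>V. \<Sum>y\<in>nb x. \<Sum>ws\<in>W n x y. (bsum \<kappa> ws)^2) + (\<Sum>x\<in>V. if x \<in> ?B then (real q + 1) * (N * M)^2 else 0)"
      by (rule sum.distrib)
    also have "(\<Sum>x\<in>V. if x \<in> ?B then (real q + 1) * (N * M)^2 else 0) = (\<Sum>x\<in>?B. (real q + 1) * (N * M)^2)"
    proof -
      have "V \<inter> ?B = ?B" by blast
      then show ?thesis using sum.inter_restrict[OF finV, of "\<lambda>x. (real q + 1) * (N * M)^2" ?B] by simp
    qed
    finally show ?thesis by (simp add: bad_def)
  qed
  have "(real (n + 1))^2 * real q ^ n * (\<Sum>i\<in>J. (cmod (Y i))^2) \<le> (\<Sum>i\<in>J. 4 * (real q + 1) * (\<Sum>x\<in>V. \<Sum>y\<in>nb x. (cmod (T i x y))^2))"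
    unfolding sum_distrib_left by (rule sum_mono) (use step1 in \<open>simp add: sum_distrib_left\<close>)
  also have "... = 4 * (real q + 1) * (\<Sum>x\<in>V. \<Sum>y\<in>nb x. \<Sum>i\<in>J. (cmod (T i x y))^2)"
  proof -
    have "(\<Sum>i\<in>J. \<Sum>x\<in>V. \<Sum>y\<in>nb x. (cmod (T i x y))^2) = (\<Sum>x\<in>V. \<Sum>i\<in>J. \<Sum>y\<in>nb x. (cmod (T i x y))^2)"
      by (rule sum.swap)
    also have "... = (\<Sum>x\<in>V. \<Sum>y\<in>nb x. \<Sum>i\<in>J. (cmod (T i x y))^2)"
      by (intro sum.cong refl sum.swap)
    finally show ?thesis by (simp only: sum_distrib_left[symmetric])
  qed
  also have "... \<le> 4 * (real q + 1) * (\<Sum>x\<in>V. \<Sum>y\<in>nb x. 2 * (real q + 1) * (\<Sum>b\<in>bonds. (wker \<kappa> n x y b)^2))"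
    by (intro mult_left_mono sum_mono step2) auto
  also have "... = 8 * (real q + 1)^2 * (\<Sum>x\<in>V. \<Sum>y\<in>nb x. \<Sum>b\<in>bonds. (wker \<kappa> n x y b)^2)"
  proof -
    have c: "4 * (real q + 1) * (2 * (real q + 1) * s) = 8 * (real q + 1)^2 * s" for s
      by (simp add: power2_eq_square algebra_simps)
    show ?thesis by (simp only: sum_distrib_left[symmetric] c)
  qed
  also have "... \<le> 8 * (real q + 1)^2 * (3 * real (n + 2) * real q ^ n * ?U + real (bad (n + 1)) * ((real q + 1) * (N * M)^2))"
    using step3 birkhoff_variance[OF u, of n] by (intro mult_left_mono) auto
  finally have main: "(real (n + 1))^2 * real q ^ n * (\<Sum>i\<in>J. (cmod (Y i))^2)
    \<le> 8 * (real q + 1)^2 * (3 * real (n + 2) * real q ^ n * ?U + real (bad (n + 1)) * ((real q + 1) * (N * M)^2))" .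
  define P where "P = (real (n + 1))^2 * real q ^ n"
  have P: "P > 0" using q0 by (simp add: P_def)
  have U0: "?U \<ge> 0" by (intro sum_nonneg) auto
  have "3 * real (n + 2) * real q ^ n * ?U + real (bad (n + 1)) * ((real q + 1) * (N * M)^2)
     \<le> P * (6 / real (n + 1) * ?U + real (bad (n + 1)) * ((real q + 1) * real q ^ n * M^2))"
  proof -
    have "P * (6 / real (n + 1) * ?U) = 6 * real (n + 1) * real q ^ n * ?U" by (simp add: P_def power2_eq_square)
    moreover have "3 * real (n + 2) * real q ^ n * ?U \<le> 6 * real (n + 1) * real q ^ n * ?U"
      using U0 q0 by (intro mult_right_mono) auto
    moreover have "P * (real (bad (n + 1)) * ((real q + 1) * real q ^ n * M^2)) = real (bad (n + 1)) * ((real q + 1) * (N * M)^2)"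
      by (simp add: P_def N_def power_mult_distrib power2_eq_square[of "real q ^ n"])
    ultimately show ?thesis unfolding distrib_left by linarith
  qed
  then have "8 * (real q + 1)^2 * (3 * real (n + 2) * real q ^ n * ?U + real (bad (n + 1)) * ((real q + 1) * (N * M)^2))
     \<le> 8 * (real q + 1)^2 * (P * (6 / real (n + 1) * ?U + real (bad (n + 1)) * ((real q + 1) * real q ^ n * M^2)))"
    by (intro mult_left_mono) auto
  with main have "P * (\<Sum>i\<in>J. (cmod (Y i))^2)
     \<le> P * (8 * (real q + 1)^2 * (6 / real (n + 1) * ?U + real (bad (n + 1)) * ((real q + 1) * real q ^ n * M^2)))"
    unfolding P_def[symmetric] by (simp only: mult.left_commute[of P])
  then show ?thesis using P unfolding Y_def by (simp only: mult_le_cancel_left_pos)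
qed

section \<open>From the edge pairing back to the two vertex forms\<close>

definition diagX :: "('a \<Rightarrow> 'a \<Rightarrow> real) \<Rightarrow> ('a \<Rightarrow> complex) \<Rightarrow> real" where
  "diagX \<kappa> f = (\<Sum>x\<in>V. \<Sum>y\<in>nb x. \<kappa> x y * (cmod (f x))^2)"

definition offZ :: "('a \<Rightarrow> 'a \<Rightarrow> real) \<Rightarrow> ('a \<Rightarrow> complex) \<Rightarrow> real" where
  "offZ \<kappa> f = (\<Sum>x\<in>V. \<Sum>y\<in>nb x. \<kappa> x y * Re (cnj (f x) * f y))"

text \<open>Symmetry of \<kappa> makes the off-diagonal sum real and identifies the reversed sums
  with the original ones, so only two real numbers remain.\<close>

lemma bond_form_split:
  assumes sym: "\<And>x y. \<kappa> x y = \<kappa> y x" and m: "\<mu>^2 \<le> 4 * real q"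
  shows "(\<Sum>x\<in>V. \<Sum>y\<in>nb x. kfun \<mu> f x y * of_real (\<kappa> x y) * gfun \<mu> f x y)
     = (1 + (eps \<mu>)^2) * of_real (offZ \<kappa> f) - 2 * eps \<mu> * of_real (diagX \<kappa> f)"
proof -
  let ?Z = "\<Sum>x\<in>V. \<Sum>y\<in>nb x. of_real (\<kappa> x y) * (cnj (f x) * f y)"
  have Zs: "(\<Sum>x\<in>V. \<Sum>y\<in>nb x. of_real (\<kappa> x y) * (cnj (f y) * f x)) = ?Z"
    using sum_bond_swap[of "\<lambda>x y. of_real (\<kappa> x y) * (cnj (f y) * f x)"] sym by simp
  have "cnj ?Z = ?Z" using Zs by (simp add: mult.commute)
  moreover have "z = of_real (Re z)" if "cnj z = z" for z using that by (simp add: complex_eq_iff)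
  ultimately have "?Z = of_real (Re ?Z)" by blast
  also have "Re ?Z = offZ \<kappa> f" by (simp add: offZ_def)
  finally have Z: "?Z = of_real (offZ \<kappa> f)" .
  have X: "(\<Sum>x\<in>V. \<Sum>y\<in>nb x. of_real (\<kappa> x y) * (cnj (f x) * f x)) = of_real (diagX \<kappa> f)"
    unfolding diagX_def of_real_sum by (intro sum.cong refl) (simp add: complex_norm_square mult.commute del: of_real_power)
  have X': "(\<Sum>x\<in>V. \<Sum>y\<in>nb x. of_real (\<kappa> x y) * (cnj (f y) * f y)) = of_real (diagX \<kappa> f)"
    using sum_bond_swap[of "\<lambda>x y. of_real (\<kappa> x y) * (cnj (f y) * f y)"] sym X by simp
  have "(\<Sum>x\<in>V. \<Sum>y\<in>nb x. kfun \<mu> f x y * of_real (\<kappa> x y) * gfun \<mu> f x y)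
     = (\<Sum>x\<in>V. \<Sum>y\<in>nb x. of_real (\<kappa> x y) * (cnj (f x) * f y) + (eps \<mu>)^2 * (of_real (\<kappa> x y) * (cnj (f y) * f x))
         - eps \<mu> * (of_real (\<kappa> x y) * (cnj (f x) * f x)) - eps \<mu> * (of_real (\<kappa> x y) * (cnj (f y) * f y)))"
    unfolding kfun_def gfun_def by (intro sum.cong refl) (simp add: power2_eq_square algebra_simps)
  also have "... = ?Z + (eps \<mu>)^2 * (\<Sum>x\<in>V. \<Sum>y\<in>nb x. of_real (\<kappa> x y) * (cnj (f y) * f x))
       - eps \<mu> * (\<Sum>x\<in>V. \<Sum>y\<in>nb x. of_real (\<kappa> x y) * (cnj (f x) * f x))
       - eps \<mu> * (\<Sum>x\<in>V. \<Sum>y\<in>nb x. of_real (\<kappa> x y) * (cnj (f y) * f y))"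
    by (simp only: sum.distrib sum_subtractf sum_distrib_left)
  also have "... = (1 + (eps \<mu>)^2) * of_real (offZ \<kappa> f) - 2 * eps \<mu> * of_real (diagX \<kappa> f)"
    unfolding Zs X X' Z by (simp add: algebra_simps)
  finally show ?thesis .
qed

text \<open>Multiply the complex number Y by c = q times the conjugate of \<open>eps \<mu>\<close>.
  Since c times \<open>eps \<mu>\<close> is 1, this gives (c + eps) Z - 2 X. Its imaginary part is
  -(q - 1) Im eps times Z, so Z is recovered at the cost of a factor 1 / \<sigma>, and then X by the
  triangle inequality.\<close>

lemma bond_form_controls:
  fixes X Z :: real
  assumes m: "\<mu>^2 + \<sigma>^2 \<le> 4 * real q" and s: "\<sigma> > 0" "\<sigma> \<le> 1"
  shows "\<bar>X\<bar> + \<bar>Z\<bar> \<le> 8 * real q ^ 3 / \<sigma> * cmod ((1 + (eps \<mu>)^2) * of_real Z - 2 * eps \<mu> * of_real X)"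
proof -
  define Q where "Q = real q"
  have Q: "Q \<ge> 2" using q2 by (simp add: Q_def)
  have m': "\<mu>^2 \<le> 4 * real q" using m by (smt (verit) zero_le_power2)
  define c where "c = of_nat q * cnj (eps \<mu>)"
  define Y where "Y = (1 + (eps \<mu>)^2) * of_real Z - 2 * eps \<mu> * of_real X"
  have ce: "c * eps \<mu> = 1" using eps_facts(3)[OF m'] by (simp add: c_def)
  have cY: "c * Y = (c + eps \<mu>) * of_real Z - 2 * of_real X"
  proof -
    have "c * Y = (c + (c * eps \<mu>) * eps \<mu>) * of_real Z - 2 * (c * eps \<mu>) * of_real X"
      by (simp add: Y_def power2_eq_square algebra_simps)
    then show ?thesis by (simp add: ce)
  qed
  have normc: "cmod c \<le> Q"
  proof -
    have "(cmod c)^2 = Q" using eps_facts(1)[OF m'] Q by (simp add: c_def Q_def norm_mult power_mult_distrib power2_eq_square[of "real q"])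
    also have "Q \<le> Q^2" using Q by (simp add: power2_eq_square)
    finally show ?thesis by (rule power2_le_imp_le) (use Q in simp)
  qed
  have se: "sqrt (4 * Q - \<mu>^2) \<ge> \<sigma>" using m s by (intro real_le_rsqrt) (simp add: Q_def)
  have "Im (c * Y) = - ((Q - 1) * Im (eps \<mu>) * Z)"
    unfolding cY by (simp add: c_def Q_def algebra_simps)
  then have "(Q - 1) * Im (eps \<mu>) * \<bar>Z\<bar> = \<bar>Im (c * Y)\<bar>"
    using Q m' by (simp add: abs_mult eps_def Q_def)
  also have "... \<le> cmod (c * Y)" by (rule abs_Im_le_cmod)
  also have "... \<le> Q * cmod Y" using normc by (simp add: norm_mult mult_right_mono)
  finally have 1: "(Q - 1) * Im (eps \<mu>) * \<bar>Z\<bar> \<le> Q * cmod Y" .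
  have "1 * (\<sigma> / (2 * Q)) * \<bar>Z\<bar> \<le> (Q - 1) * Im (eps \<mu>) * \<bar>Z\<bar>"
    using Q s se by (intro mult_right_mono mult_mono) (auto simp: eps_def Q_def divide_right_mono)
  then have "\<sigma> / (2 * Q) * \<bar>Z\<bar> \<le> Q * cmod Y" using 1 by simp
  then have Z: "\<bar>Z\<bar> \<le> 2 * Q^2 / \<sigma> * cmod Y" using Q s by (simp add: field_simps power2_eq_square)
  have "cmod (eps \<mu>) \<le> 1"
  proof -
    have "(cmod (eps \<mu>))^2 \<le> 1^2" using eps_facts(1)[OF m'] q2 by simp
    then show ?thesis by (rule power2_le_imp_le) simp
  qed
  then have "cmod (c + eps \<mu>) \<le> Q + 1" using normc norm_triangle_ineq[of c "eps \<mu>"] by linarith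
  have "2 * of_real X = (c + eps \<mu>) * of_real Z - c * Y" using cY by simp
  then have "cmod (2 * of_real X) \<le> cmod ((c + eps \<mu>) * of_real Z) + cmod (c * Y)"
    by (simp only: norm_triangle_ineq4)
  also have "... \<le> (Q + 1) * \<bar>Z\<bar> + Q * cmod Y"
    using \<open>cmod (c + eps \<mu>) \<le> Q + 1\<close> normc by (intro add_mono) (auto simp: norm_mult intro!: mult_right_mono)
  finally have X: "2 * \<bar>X\<bar> \<le> (Q + 1) * \<bar>Z\<bar> + Q * cmod Y" by (simp add: norm_mult)
  have "\<bar>X\<bar> + \<bar>Z\<bar> \<le> (Q + 3) / 2 * \<bar>Z\<bar> + Q / 2 * cmod Y"
  proof -
    have "(Q + 3) / 2 * \<bar>Z\<bar> = (Q + 1) * \<bar>Z\<bar> / 2 + \<bar>Z\<bar>" by (simp add: field_simps)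
    then show ?thesis using X by linarith
  qed
  also have "... \<le> 2 * Q * \<bar>Z\<bar> + Q / 2 * cmod Y" using Q by (intro add_mono mult_right_mono) auto
  also have "... \<le> 2 * Q * (2 * Q^2 / \<sigma> * cmod Y) + Q / 2 * cmod Y" using Z Q by (intro add_mono mult_left_mono) auto
  finally have fin: "\<bar>X\<bar> + \<bar>Z\<bar> \<le> (4 * Q ^ 3 / \<sigma> + Q / 2) * cmod Y"
    by (simp add: algebra_simps power2_eq_square power3_eq_cube)
  have "Q / 2 * \<sigma> \<le> Q / 2 * 1" using Q s by (intro mult_left_mono) auto
  also have "... \<le> 4 * (Q * (1 * 1))" using Q by simp
  also have "... \<le> 4 * (Q * (Q * Q))" using Q by (intro mult_left_mono mult_mono) auto
  finally have "Q / 2 \<le> 4 * Q ^ 3 / \<sigma>" using s by (simp add: pos_le_divide_eq power3_eq_cube)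
  then have "(4 * Q ^ 3 / \<sigma> + Q / 2) * cmod Y \<le> (8 * Q ^ 3 / \<sigma>) * cmod Y"
    by (intro mult_right_mono) auto
  with fin show ?thesis unfolding Y_def Q_def by linarith
qed

text \<open>The first term decays like 1 / n uniformly in the graph; the second grows like q^n but
  carries the number of bad vertices. So n is to be fixed before the graphs grow.\<close>

theorem discrete_quantum_variance:
  assumes J: "finite J" and o: "orthonormal_on V J f" and e: "\<And>i. i \<in> J \<Longrightarrow> eigenfn (of_real (\<mu> i)) (f i)"
    and m: "\<And>i. i \<in> J \<Longrightarrow> (\<mu> i)^2 + \<sigma>^2 \<le> 4 * real q" and s: "\<sigma> > 0" "\<sigma> \<le> 1"
    and M: "\<And>x y. \<bar>\<kappa> x y\<bar> \<le> M" and sym: "\<And>x y. \<kappa> x y = \<kappa> y x" and zero: "(\<Sum>x\<in>V. \<Sum>y\<in>nb x. \<kappa> x y) = 0"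
    and g: "gap \<beta>" and b: "\<beta> > 0"
  shows "(\<Sum>i\<in>J. (\<bar>diagX \<kappa> (f i)\<bar> + \<bar>offZ \<kappa> (f i)\<bar>)^2)
     \<le> (8 * real q ^ 3 / \<sigma>)^2 * (8 * (real q + 1)^2 * (6 / real (n + 1) * ((3 + 6 * (real q - 1)^2 / \<beta>^2) * ((real q + 1) * real (card V) * M^2))
         + real (bad (n + 1)) * ((real q + 1) * real q ^ n * M^2)))"
proof -
  have m': "(\<mu> i)^2 \<le> 4 * real q" if "i \<in> J" for i using m[OF that] by (smt (verit) zero_le_power2)
  obtain u where u: "\<And>x y. y \<in> nb x \<Longrightarrow> real q * u x y - (\<Sum>z\<in>nb y - {x}. u y z) = real q * \<kappa> x y"
    and un: "(\<Sum>x\<in>V. \<Sum>y\<in>nb x. (u x y)^2) \<le> (3 + 6 * (real q - 1)^2 / \<beta>^2) * (\<Sum>x\<in>V. \<Sum>y\<in>nb x. (\<kappa> x y)^2)"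
    using cohomological[OF g b sym zero] by blast
  define Y where "Y i = (\<Sum>x\<in>V. \<Sum>y\<in>nb x. kfun (\<mu> i) (f i) x y * of_real (\<kappa> x y) * gfun (\<mu> i) (f i) x y)" for i
  have "(\<Sum>x\<in>V. \<Sum>y\<in>nb x. (\<kappa> x y)^2) \<le> (\<Sum>x\<in>V. \<Sum>y\<in>nb x. M^2)"
  proof (intro sum_mono)
    fix x y show "(\<kappa> x y)^2 \<le> M^2" using M[of x y] by (metis abs_ge_zero power2_abs power_mono)
  qed
  also have "... = (real q + 1) * real (card V) * M^2"
    using sum_bond_origin(1)[of "\<lambda>_. M^2"] by simp
  finally have "(3 + 6 * (real q - 1)^2 / \<beta>^2) * (\<Sum>x\<in>V. \<Sum>y\<in>nb x. (\<kappa> x y)^2)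
     \<le> (3 + 6 * (real q - 1)^2 / \<beta>^2) * ((real q + 1) * real (card V) * M^2)"
    by (rule mult_left_mono) simp
  with un have U: "(\<Sum>x\<in>V. \<Sum>y\<in>nb x. (u x y)^2) \<le> (3 + 6 * (real q - 1)^2 / \<beta>^2) * ((real q + 1) * real (card V) * M^2)"
    by (rule order_trans)
  have "(\<Sum>i\<in>J. (\<bar>diagX \<kappa> (f i)\<bar> + \<bar>offZ \<kappa> (f i)\<bar>)^2) \<le> (\<Sum>i\<in>J. (8 * real q ^ 3 / \<sigma>)^2 * (cmod (Y i))^2)"
  proof (rule sum_mono)
    fix i assume i: "i \<in> J"
    have "\<bar>diagX \<kappa> (f i)\<bar> + \<bar>offZ \<kappa> (f i)\<bar> \<le> 8 * real q ^ 3 / \<sigma> * cmod (Y i)"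
      unfolding Y_def bond_form_split[OF sym m'[OF i]] by (rule bond_form_controls[OF m[OF i] s])
    then have "(\<bar>diagX \<kappa> (f i)\<bar> + \<bar>offZ \<kappa> (f i)\<bar>)^2 \<le> (8 * real q ^ 3 / \<sigma> * cmod (Y i))^2"
      by (rule power_mono) simp
    then show "(\<bar>diagX \<kappa> (f i)\<bar> + \<bar>offZ \<kappa> (f i)\<bar>)^2 \<le> (8 * real q ^ 3 / \<sigma>)^2 * (cmod (Y i))^2"
      by (simp only: power_mult_distrib)
  qed
  also have "... = (8 * real q ^ 3 / \<sigma>)^2 * (\<Sum>i\<in>J. (cmod (Y i))^2)" by (simp only: sum_distrib_left)
  also have "... \<le> (8 * real q ^ 3 / \<sigma>)^2 * (8 * (real q + 1)^2 * (6 / real (n + 1) * (\<Sum>x\<in>V. \<Sum>y\<in>nb x. (u x y)^2) + real (bad (n + 1)) * ((real q + 1) * real q ^ n * M^2)))"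
    unfolding Y_def by (intro mult_left_mono walk_variance_bound[OF J o e m' M u]) auto
  also have "... \<le> (8 * real q ^ 3 / \<sigma>)^2 * (8 * (real q + 1)^2 * (6 / real (n + 1) * ((3 + 6 * (real q - 1)^2 / \<beta>^2) * ((real q + 1) * real (card V) * M^2))
         + real (bad (n + 1)) * ((real q + 1) * real q ^ n * M^2)))"
    by (intro mult_left_mono add_right_mono U) auto
  finally show ?thesis .
qed

end

section \<open>Sturm--Liouville equations on an interval\<close>

abbreviation (input) leb :: "real \<Rightarrow> real measure" where
  "leb L \<equiv> lebesgue_on {0..L}"

lemma finite_measure_interval: "finite_measure (leb X)"
  by (rule finite_measure_lebesgue_on) simp

lemma integral_interval_if:
  fixes f :: "real \<Rightarrow> complex"
  assumes "0 \<le> t" "t \<le> X"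
  shows "(LINT s|leb X. (if s \<le> t then f s else 0)) = (LINT s|leb t. f s)"
proof -
  have "(LINT s|leb X. (if s \<le> t then f s else 0)) = (LINT s|lebesgue. (if s \<in> {0..X} then (if s \<le> t then f s else 0) else (0::complex)))"
    by (rule Lebesgue_Measure.integral_restrict_UNIV[symmetric]) simp
  also have "... = (LINT s|lebesgue. (if s \<in> {0..t} then f s else 0))"
    using assms by (intro Bochner_Integration.integral_cong refl) auto
  also have "... = (LINT s|leb t. f s)"
    by (rule Lebesgue_Measure.integral_restrict_UNIV) simp
  finally show ?thesis .
qed

lemma AE_interval_neq: "AE t in leb X. t \<noteq> s"
proof -
  have "AE t in lebesgue. t \<notin> {s}" by (rule AE_not_in) simp
  then show ?thesis by (auto simp: AE_restrict_space_iff elim!: eventually_mono)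
qed

text \<open>Both sides compute the integral of \<open>f(s) g(t)\<close> over the square by Fubini, split along the diagonal.\<close>

lemma integral_product_by_parts:
  fixes f g :: "real \<Rightarrow> complex"
  assumes X: "0 \<le> X" and f: "integrable (leb X) f" and g: "integrable (leb X) g"
  defines "F \<equiv> \<lambda>x. LINT t|leb x. f t" and "G \<equiv> \<lambda>x. LINT t|leb x. g t"
  shows "(LINT t|leb X. f t * G t + F t * g t) = F X * G X"
    and "integrable (leb X) (\<lambda>t. f t * G t)" and "integrable (leb X) (\<lambda>t. F t * g t)"
proof -
  define M where "M = leb X"
  interpret M: finite_measure M unfolding M_def by (rule finite_measure_interval)
  interpret MM: pair_sigma_finite M M ..
  have f: "integrable M f" and g: "integrable M g" using f g by (auto simp: M_def)
  have fm[measurable]: "f \<in> borel_measurable M" "g \<in> borel_measurable M" using f g by auto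
  have id[measurable]: "(\<lambda>x. x) \<in> borel_measurable M"
    unfolding M_def using id_borel_measurable_lebesgue_on[of "{0..X}"] by (simp add: id_def)
  have int: "integrable (M \<Otimes>\<^sub>M M) (\<lambda>(s, t). f s * g t)"
  proof (rule MM.Fubini_integrable)
    show "(\<lambda>(s, t). f s * g t) \<in> borel_measurable (M \<Otimes>\<^sub>M M)" by measurable
    have "integrable M (\<lambda>x. cmod (f x) * (LINT y|M. cmod (g y)))" using f by (intro integrable_mult_left) auto
    then show "integrable M (\<lambda>x. LINT y|M. norm (case (x, y) of (s, t) \<Rightarrow> f s * g t))" by (simp add: norm_mult)
    show "AE x in M. integrable M (\<lambda>y. case (x, y) of (s, t) \<Rightarrow> f s * g t)" using g by simp
  qed
  have int1: "integrable (M \<Otimes>\<^sub>M M) (\<lambda>(s, t). (if s \<le> t then f s * g t else 0))"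
    by (rule Bochner_Integration.integrable_bound[OF int]) (auto simp: case_prod_beta)
  have int2: "integrable (M \<Otimes>\<^sub>M M) (\<lambda>(s, t). (if t < s then f s * g t else 0))"
    by (rule Bochner_Integration.integrable_bound[OF int]) (auto simp: case_prod_beta)
  have sp: "space M = {0..X}" by (simp add: M_def)
  have in1: "(LINT s|M. (if s \<le> t then f s * g t else 0)) = F t * g t" if "t \<in> {0..X}" for t
  proof -
    have "(LINT s|M. (if s \<le> t then f s * g t else 0)) = (LINT s|M. (if s \<le> t then f s else 0) * g t)"
      by (intro Bochner_Integration.integral_cong refl) auto
    also have "... = (LINT s|M. (if s \<le> t then f s else 0)) * g t" by simp
    finally show ?thesis using that by (simp add: F_def M_def integral_interval_if)
  qed
  have in2: "(LINT t|M. (if t < s then f s * g t else 0)) = f s * G s" if "s \<in> {0..X}" for s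
  proof -
    have "(LINT t|M. (if t < s then f s * g t else 0)) = (LINT t|M. f s * (if t \<le> s then g t else 0))"
    proof (rule integral_cong_AE)
      show "AE t in M. (if t < s then f s * g t else 0) = f s * (if t \<le> s then g t else 0)"
        using AE_interval_neq[where X = X and s = s] unfolding M_def[symmetric] by eventually_elim auto
    qed measurable
    also have "... = f s * (LINT t|M. (if t \<le> s then g t else 0))" by simp
    finally show ?thesis using that by (simp add: G_def M_def integral_interval_if)
  qed
  have i1: "integrable M (\<lambda>t. F t * g t)"
    using MM.integrable_snd[OF int1] Bochner_Integration.integrable_cong[of M M "\<lambda>t. LINT s|M. (if s \<le> t then f s * g t else 0)" "\<lambda>t. F t * g t"] in1 sp by simp
  have i2: "integrable M (\<lambda>t. f t * G t)"
    using MM.integrable_fst[OF int2] Bochner_Integration.integrable_cong[of M M "\<lambda>s. LINT t|M. (if t < s then f s * g t else 0)" "\<lambda>t. f t * G t"] in2 sp by simp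
  show "integrable (leb X) (\<lambda>t. f t * G t)" "integrable (leb X) (\<lambda>t. F t * g t)"
    using i1 i2 by (simp_all add: M_def)
  have "F X * G X = (LINT s|M. LINT t|M. f s * g t)"
    by (simp add: F_def G_def M_def[symmetric])
  also have "... = integral\<^sup>L (M \<Otimes>\<^sub>M M) (\<lambda>(s, t). f s * g t)" by (rule MM.integral_fst[OF int])
  also have "... = integral\<^sup>L (M \<Otimes>\<^sub>M M) (\<lambda>p. (case p of (s, t) \<Rightarrow> if t < s then f s * g t else 0) + (case p of (s, t) \<Rightarrow> if s \<le> t then f s * g t else 0))"
    by (intro Bochner_Integration.integral_cong refl) auto
  also have "... = integral\<^sup>L (M \<Otimes>\<^sub>M M) (\<lambda>(s, t). (if t < s then f s * g t else 0)) + integral\<^sup>L (M \<Otimes>\<^sub>M M) (\<lambda>(s, t). (if s \<le> t then f s * g t else 0))"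
    by (rule Bochner_Integration.integral_add[OF int2 int1])
  also have "integral\<^sup>L (M \<Otimes>\<^sub>M M) (\<lambda>(s, t). (if t < s then f s * g t else 0)) = (LINT s|M. LINT t|M. (if t < s then f s * g t else 0))"
    by (rule MM.integral_fst[OF int2, symmetric])
  also have "... = (LINT s|M. f s * G s)" by (intro Bochner_Integration.integral_cong refl in2) (simp add: sp)
  also have "integral\<^sup>L (M \<Otimes>\<^sub>M M) (\<lambda>(s, t). (if s \<le> t then f s * g t else 0)) = (LINT t|M. LINT s|M. (if s \<le> t then f s * g t else 0))"
    by (rule MM.integral_snd[OF int1, symmetric])
  also have "... = (LINT t|M. F t * g t)" by (intro Bochner_Integration.integral_cong refl in1) (simp add: sp)
  also have "(LINT s|M. f s * G s) + (LINT t|M. F t * g t) = (LINT t|M. f t * G t + F t * g t)"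
    by (rule Bochner_Integration.integral_add[OF i2 i1, symmetric])
  finally show "(LINT t|leb X. f t * G t + F t * g t) = F X * G X" by (simp add: M_def)
qed

text \<open>Absolutely continuous functions with an integrable derivative f, in the form in which
  \<open>W22_derivs\<close> states it; the preceding identity makes them closed under
  products.\<close>

definition prim :: "real \<Rightarrow> (real \<Rightarrow> complex) \<Rightarrow> (real \<Rightarrow> complex) \<Rightarrow> bool" where
  "prim L F f \<longleftrightarrow> integrable (leb L) f \<and> (\<forall>x\<in>{0..L}. F x = F 0 + (LINT t|leb x. f t))"

lemma integrable_initial:
  fixes f :: "real \<Rightarrow> complex"
  shows "integrable (leb L) f \<Longrightarrow> x \<le> L \<Longrightarrow> integrable (leb x) f"
  by (rule integrable_subinterval[of 0 L]) auto

lemma prim_continuous: "prim L F f \<Longrightarrow> continuous_on {0..L} F"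
proof -
  assume p: "prim L F f"
  then have "continuous_on {0..L} (\<lambda>x. F 0 + (LINT t|leb x. f t))"
    unfolding prim_def by (intro continuous_intros indefinite_integral_continuous_real) auto
  then show ?thesis by (rule continuous_on_eq) (use p in \<open>auto simp only: prim_def\<close>)
qed

lemma prim_lincomb:
  assumes "prim L F f" "prim L G g" shows "prim L (\<lambda>x. a * F x + b * G x) (\<lambda>x. a * f x + b * g x)"
  unfolding prim_def
proof (intro conjI ballI)
  show "integrable (leb L) (\<lambda>x. a * f x + b * g x)" using assms by (simp add: prim_def)
  fix x assume x: "x \<in> {0..L}"
  have "integrable (leb x) f" "integrable (leb x) g"
    using assms x integrable_initial by (auto simp: prim_def)
  then have "(LINT t|leb x. a * f t + b * g t) = a * (LINT t|leb x. f t) + b * (LINT t|leb x. g t)"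
    by simp
  moreover have "F x = F 0 + (LINT t|leb x. f t)" "G x = G 0 + (LINT t|leb x. g t)"
    using assms x unfolding prim_def by blast+
  ultimately show "a * F x + b * G x = a * F 0 + b * G 0 + (LINT t|leb x. a * f t + b * g t)"
    by (simp add: algebra_simps)
qed

lemma integrable_times_continuous:
  fixes f G :: "real \<Rightarrow> complex"
  assumes f: "integrable (leb L) f" and G: "continuous_on {0..L} G"
  shows "integrable (leb L) (\<lambda>x. f x * G x)"
proof -
  have "compact (G ` {0..L})" using G by (intro compact_continuous_image) auto
  then obtain B where B: "\<And>x. x \<in> {0..L} \<Longrightarrow> cmod (G x) \<le> B"
    by (metis bounded_iff compact_imp_bounded imageI)
  have Gm: "G \<in> borel_measurable (leb L)"
    using continuous_imp_integrable_real[OF G] by auto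
  show ?thesis
  proof (rule Bochner_Integration.integrable_bound)
    show "integrable (leb L) (\<lambda>x. B * cmod (f x))" using f by auto
    show "(\<lambda>x. f x * G x) \<in> borel_measurable (leb L)" using f Gm by auto
    show "AE x in leb L. norm (f x * G x) \<le> norm (B * cmod (f x))"
    proof (rule AE_I2)
      fix x assume "x \<in> space (leb L)"
      then have "cmod (G x) \<le> B" using B by simp
      then have "cmod (f x) * cmod (G x) \<le> cmod (f x) * \<bar>B\<bar>" by (intro mult_left_mono) auto
      then show "norm (f x * G x) \<le> norm (B * cmod (f x))" by (simp add: norm_mult abs_mult mult.commute)
    qed
  qed
qed

lemma prim_mult:
  assumes "prim L F f" "prim L G g" shows "prim L (\<lambda>x. F x * G x) (\<lambda>x. f x * G x + F x * g x)"
  unfolding prim_def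
proof (intro conjI ballI)
  have fi: "integrable (leb L) f" and gi: "integrable (leb L) g" using assms by (auto simp: prim_def)
  have c: "continuous_on {0..L} F" "continuous_on {0..L} G" using assms prim_continuous by auto
  show "integrable (leb L) (\<lambda>x. f x * G x + F x * g x)"
    using integrable_times_continuous[OF fi c(2)] integrable_times_continuous[OF gi c(1)] by (simp add: mult.commute)
  fix x assume x: "x \<in> {0..L}"
  let ?F = "\<lambda>x. LINT t|leb x. f t" and ?G = "\<lambda>x. LINT t|leb x. g t"
  have f: "integrable (leb x) f" and g: "integrable (leb x) g"
    using fi gi x integrable_initial by auto
  note ibp = integral_product_by_parts[OF _ f g]
  have F: "F t = F 0 + ?F t" and G: "G t = G 0 + ?G t" if "t \<in> {0..x}" for t
  proof -
    have "t \<in> {0..L}" using that x by auto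
    then show "F t = F 0 + ?F t" "G t = G 0 + ?G t" using assms unfolding prim_def by blast+
  qed
  have "(LINT t|leb x. f t * G t + F t * g t)
     = (LINT t|leb x. (f t * ?G t + ?F t * g t) + (G 0 * f t + F 0 * g t))"
  proof (rule Bochner_Integration.integral_cong[OF refl])
    fix t assume "t \<in> space (leb x)"
    then have t: "t \<in> {0..x}" by simp
    show "f t * G t + F t * g t = (f t * ?G t + ?F t * g t) + (G 0 * f t + F 0 * g t)"
      by (subst F[OF t], subst G[OF t]) (simp only: algebra_simps)
  qed
  also have "... = (LINT t|leb x. f t * ?G t + ?F t * g t) + (LINT t|leb x. G 0 * f t + F 0 * g t)"
    using x ibp(2,3) f g by (intro Bochner_Integration.integral_add Bochner_Integration.integrable_add) auto
  also have "... = ?F x * ?G x + (G 0 * ?F x + F 0 * ?G x)"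
    using x f g by (subst ibp(1)) auto
  finally show "F x * G x = F 0 * G 0 + (LINT t|leb x. f t * G t + F t * g t)"
    using F[of x] G[of x] x by (simp add: algebra_simps)
qed

lemma prim_C1:
  assumes d: "\<And>x. x \<in> {0..L} \<Longrightarrow> (F has_vector_derivative f x) (at x within {0..L})" and c: "continuous_on {0..L} f"
  shows "prim L F f"
  unfolding prim_def
proof (intro conjI ballI)
  show "integrable (leb L) f" by (rule continuous_imp_integrable_real[OF c])
  fix x assume x: "x \<in> {0..L}"
  have "(f has_integral (F x - F 0)) {0..x}"
    using x by (intro fundamental_theorem_of_calculus) (auto intro!: has_vector_derivative_within_subset[OF d])
  moreover have "integrable (leb x) f"
    using x by (intro continuous_imp_integrable_real continuous_on_subset[OF c]) auto
  ultimately show "F x = F 0 + (LINT t|leb x. f t)"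
    using lebesgue_integral_eq_integral[of "{0..x}" f] by (simp add: integral_unique)
qed

lemma prim_deriv:
  assumes p: "prim L F f" and c: "continuous_on {0..L} f" and x: "x \<in> {0..L}"
  shows "(F has_vector_derivative f x) (at x within {0..L})"
proof -
  have "((\<lambda>u. integral {0..u} f) has_vector_derivative f x) (at x within {0..L})"
    by (rule integral_has_vector_derivative[OF c x])
  then have "((\<lambda>u. F 0 + integral {0..u} f) has_vector_derivative f x) (at x within {0..L})"
    by (auto intro!: derivative_eq_intros)
  then show ?thesis
  proof (rule has_vector_derivative_transform[rotated 2])
    show "x \<in> {0..L}" by (rule x)
    fix u assume u: "u \<in> {0..L}"
    have "integrable (lebesgue_on {0..u}) f" using p u integrable_initial by (auto simp: prim_def)
    then have "(LINT t|lebesgue_on {0..u}. f t) = integral {0..u} f"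
      by (rule lebesgue_integral_eq_integral) simp
    moreover have "F u = F 0 + (LINT t|lebesgue_on {0..u}. f t)" using p u unfolding prim_def by blast
    ultimately show "F u = F 0 + integral {0..u} f" by simp
  qed
qed

text \<open>Compare with the maximum m of exp (-2 K x) y x. With the rate 2 K instead of K the
  integral contributes at most m / 2, which gives m \<le> 2 A without iteration.\<close>

lemma gronwall:
  fixes y :: "real \<Rightarrow> real"
  assumes c: "continuous_on {0..L} y" and y0: "\<And>x. x \<in> {0..L} \<Longrightarrow> y x \<ge> 0" and K: "K > 0"
    and le: "\<And>x. x \<in> {0..L} \<Longrightarrow> y x \<le> A + K * integral {0..x} y" and x: "x \<in> {0..L}"
  shows "y x \<le> 2 * A * exp (2 * K * x)"
proof -
  have "continuous_on {0..L} (\<lambda>x. exp (- (2 * K * x)) * y x)" by (intro continuous_intros c)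
  then obtain z where z: "z \<in> {0..L}" and mx: "\<And>x. x \<in> {0..L} \<Longrightarrow> exp (- (2 * K * x)) * y x \<le> exp (- (2 * K * z)) * y z"
    using continuous_attains_sup[of "{0..L}" "\<lambda>x. exp (- (2 * K * x)) * y x"] x by auto
  define m where "m = exp (- (2 * K * z)) * y z"
  have m: "y t \<le> m * exp (2 * K * t)" if "t \<in> {0..L}" for t
    using mx[OF that] by (simp add: m_def exp_minus field_simps)
  have m0: "m \<ge> 0" using y0[OF z] by (simp add: m_def)
  have A0: "A \<ge> 0" using le[of 0] y0[of 0] x by (auto intro: order_trans)
  have hi: "((\<lambda>t. m * exp (2 * K * t)) has_integral (m * exp (2 * K * z) / (2 * K) - m * exp (2 * K * 0) / (2 * K))) {0..z}"
    using z K by (intro fundamental_theorem_of_calculus) (auto intro!: derivative_eq_intros simp: has_real_derivative_iff_has_vector_derivative[symmetric])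
  have "y integrable_on {0..z}" using z by (intro integrable_continuous_real continuous_on_subset[OF c]) auto
  then have "integral {0..z} y \<le> integral {0..z} (\<lambda>t. m * exp (2 * K * t))"
    by (rule integral_le[OF _ has_integral_integrable[OF hi]]) (use m z in auto)
  also have "... = m * exp (2 * K * z) / (2 * K) - m * exp (2 * K * 0) / (2 * K)"
    by (rule integral_unique[OF hi])
  also have "... \<le> m * exp (2 * K * z) / (2 * K)" using m0 K by simp
  finally have "K * integral {0..z} y \<le> K * (m * exp (2 * K * z) / (2 * K))" using K by (intro mult_left_mono) auto
  then have "y z \<le> A + m * exp (2 * K * z) / 2" using le[OF z] K by simp
  then have "exp (- (2 * K * z)) * y z \<le> exp (- (2 * K * z)) * (A + m * exp (2 * K * z) / 2)" by (intro mult_left_mono) auto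
  also have "... = exp (- (2 * K * z)) * A + m / 2" by (simp add: distrib_left exp_minus)
  also have "exp (- (2 * K * z)) * A \<le> 1 * A" using z K A0 by (intro mult_right_mono) auto
  finally have "m \<le> 2 * A" by (simp add: m_def)
  then have "m * exp (2 * K * x) \<le> 2 * A * exp (2 * K * x)" by (intro mult_right_mono) auto
  then show ?thesis using m[OF x] by linarith
qed

section \<open>Square-integrable and twice weakly differentiable functions on an edge\<close>

definition L2 :: "real \<Rightarrow> (real \<Rightarrow> complex) \<Rightarrow> bool" where
  "L2 L f \<longleftrightarrow> f \<in> borel_measurable (leb L) \<and> integrable (leb L) (\<lambda>x. (cmod (f x))^2)"

definition N2 :: "real \<Rightarrow> (real \<Rightarrow> complex) \<Rightarrow> real" where
  "N2 L f = (LINT x|leb L. (cmod (f x))^2)"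

lemma N2_nonneg [simp]: "N2 L f \<ge> 0"
  by (simp add: N2_def)

lemma sq_sum_le: "(cmod (a + b))^2 \<le> 2 * (cmod a)^2 + 2 * (cmod b)^2"
proof -
  have "(cmod (a + b))^2 \<le> (cmod a + cmod b)^2" by (intro power_mono norm_triangle_ineq) auto
  also have "... \<le> 2 * (cmod a)^2 + 2 * (cmod b)^2"
    using zero_le_power2[of "cmod a - cmod b"] by (simp add: power2_eq_square algebra_simps)
  finally show ?thesis .
qed

lemma L2_dominated:
  assumes "f \<in> borel_measurable (leb L)" "integrable (leb L) g"
    and "AE x in leb L. (cmod (f x))^2 \<le> g x"
  shows "L2 L f"
  unfolding L2_def
proof (intro conjI assms(1) Bochner_Integration.integrable_bound[OF assms(2)])
  show "(\<lambda>x. (cmod (f x))^2) \<in> borel_measurable (leb L)" using assms(1) by measurable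
  show "AE x in leb L. norm ((cmod (f x))^2) \<le> norm (g x)"
    using assms(3) by eventually_elim auto
qed

lemma L2_add: "L2 L f \<Longrightarrow> L2 L g \<Longrightarrow> L2 L (\<lambda>x. f x + g x)"
  by (rule L2_dominated[where g = "\<lambda>x. 2 * (cmod (f x))^2 + 2 * (cmod (g x))^2"])
    (auto simp: L2_def sq_sum_le)

lemma L2_scale: "L2 L f \<Longrightarrow> L2 L (\<lambda>x. c * f x)"
  by (auto simp: L2_def norm_mult power_mult_distrib)

lemma L2_diff: "L2 L f \<Longrightarrow> L2 L g \<Longrightarrow> L2 L (\<lambda>x. f x - g x)"
  using L2_add[of L f "\<lambda>x. (-1) * g x"] L2_scale[of L g "-1"] by simp

lemma L2_continuous: "continuous_on {0..L} f \<Longrightarrow> L2 L f"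
proof -
  assume c: "continuous_on {0..L} f"
  have "integrable (leb L) f" by (rule continuous_imp_integrable_real[OF c])
  moreover have "integrable (leb L) (\<lambda>x. (cmod (f x))^2)"
    by (intro continuous_imp_integrable_real continuous_intros c)
  ultimately show ?thesis by (auto simp: L2_def)
qed

lemma L2_times_bounded:
  assumes f: "L2 L f" and h: "h \<in> borel_measurable (leb L)" and b: "AE x in leb L. cmod (h x) \<le> B"
  shows "L2 L (\<lambda>x. h x * f x)"
proof (rule L2_dominated[where g = "\<lambda>x. B^2 * (cmod (f x))^2"])
  show "(\<lambda>x. h x * f x) \<in> borel_measurable (leb L)" using f h by (auto simp: L2_def)
  show "integrable (leb L) (\<lambda>x. B^2 * (cmod (f x))^2)" using f by (auto simp: L2_def)
  show "AE x in leb L. (cmod (h x * f x))^2 \<le> B^2 * (cmod (f x))^2"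
    using b by eventually_elim (auto simp: norm_mult power_mult_distrib intro!: mult_right_mono power_mono)
qed

lemma L2_times_continuous:
  assumes f: "L2 L f" and h: "continuous_on {0..L} h" shows "L2 L (\<lambda>x. h x * f x)"
proof -
  have "compact (h ` {0..L})" using h by (intro compact_continuous_image) auto
  then obtain B where B: "\<And>x. x \<in> {0..L} \<Longrightarrow> cmod (h x) \<le> B"
    by (metis bounded_iff compact_imp_bounded imageI)
  show ?thesis
    by (rule L2_times_bounded[OF f, where B = B]) (use B L2_continuous[OF h] in \<open>auto simp: L2_def intro!: AE_I2\<close>)
qed

lemma L2_integrable: "L2 L f \<Longrightarrow> integrable (leb L) f"
proof -
  assume f: "L2 L f"
  interpret finite_measure "leb L" by (rule finite_measure_interval)
  show ?thesis
  proof (rule Bochner_Integration.integrable_bound)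
    show "integrable (leb L) (\<lambda>x. 1 + (cmod (f x))^2)" using f by (auto simp: L2_def)
    show "f \<in> borel_measurable (leb L)" using f by (simp add: L2_def)
    have "t \<le> 1 + t^2" for t :: real using zero_le_power2[of "t - 1"] by (simp add: power2_eq_square algebra_simps) (smt (verit) zero_le_square)
    then show "AE x in leb L. norm (f x) \<le> norm (1 + (cmod (f x))^2)" by (intro AE_I2) (auto intro: order_trans)
  qed
qed

lemma L2_product_integrable: "L2 L f \<Longrightarrow> L2 L g \<Longrightarrow> integrable (leb L) (\<lambda>x. cnj (f x) * g x)"
proof -
  assume f: "L2 L f" and g: "L2 L g"
  show ?thesis
  proof (rule Bochner_Integration.integrable_bound)
    show "integrable (leb L) (\<lambda>x. (cmod (f x))^2 + (cmod (g x))^2)" using f g by (auto simp: L2_def)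
    have "(\<lambda>x. cnj (f x)) \<in> borel_measurable (leb L)"
      using f unfolding L2_def by (auto intro!: borel_measurable_continuous_on[of cnj] continuous_intros)
    then show "(\<lambda>x. cnj (f x) * g x) \<in> borel_measurable (leb L)" using g by (auto simp: L2_def)
    show "AE x in leb L. norm (cnj (f x) * g x) \<le> norm ((cmod (f x))^2 + (cmod (g x))^2)"
    proof (rule AE_I2)
      fix x
      have "cmod (f x) * cmod (g x) \<le> (cmod (f x))^2 + (cmod (g x))^2"
        using zero_le_power2[of "cmod (f x) - cmod (g x)"] by (simp add: power2_eq_square algebra_simps) (smt (verit) mult_nonneg_nonneg norm_ge_zero)
      then show "norm (cnj (f x) * g x) \<le> norm ((cmod (f x))^2 + (cmod (g x))^2)" by (simp add: norm_mult)
    qed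
  qed
qed

text \<open>With m the mean of |f|, this is the nonnegativity of the variance of |f|.\<close>

lemma integral_norm_sq_le:
  assumes L: "L > 0" and f: "L2 L f"
  shows "(LINT x|leb L. cmod (f x))^2 \<le> L * N2 L f"
proof -
  interpret finite_measure "leb L" by (rule finite_measure_interval)
  define I where "I = (LINT x|leb L. cmod (f x))"
  define m where "m = I / L"
  have i1: "integrable (leb L) (\<lambda>x. cmod (f x))" using L2_integrable[OF f] by simp
  have i2: "integrable (leb L) (\<lambda>x. (cmod (f x))^2)" using f by (simp add: L2_def)
  have "0 \<le> (LINT x|leb L. (cmod (f x) - m)^2)" by simp
  also have "... = (LINT x|leb L. (cmod (f x))^2 - 2 * m * cmod (f x) + m^2)"
    by (intro Bochner_Integration.integral_cong refl) (simp add: power2_diff)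
  also have "... = N2 L f - 2 * m * I + m^2 * L"
    using i1 i2 L by (simp add: N2_def I_def measure_restrict_space)
  also have "... = N2 L f - I^2 / L" using L by (simp add: m_def power2_eq_square field_simps)
  finally show ?thesis using L by (simp add: I_def field_simps)
qed

lemma W22_L2: "W22_derivs L f f1 (f2 :: real \<Rightarrow> complex) \<Longrightarrow> L2 L f2"
  by (simp add: W22_derivs_def L2_def)

lemma W22_prim1: "W22_derivs L f f1 (f2 :: real \<Rightarrow> complex) \<Longrightarrow> prim L f1 f2"
  using L2_integrable[OF W22_L2[of L f f1 f2]] unfolding W22_derivs_def prim_def by blast

lemma W22_prim0: "W22_derivs L f f1 (f2 :: real \<Rightarrow> complex) \<Longrightarrow> prim L f f1"
proof -
  assume w: "W22_derivs L f f1 f2"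
  show "prim L f f1"
  proof (rule prim_C1)
    show "continuous_on {0..L} f1" by (rule prim_continuous[OF W22_prim1[OF w]])
    fix x assume "x \<in> {0..L}"
    then show "(f has_vector_derivative f1 x) (at x within {0..L})" using w unfolding W22_derivs_def by blast
  qed
qed

lemma W22_continuous:
  assumes "W22_derivs L f f1 (f2 :: real \<Rightarrow> complex)"
  shows "continuous_on {0..L} f" "continuous_on {0..L} f1"
  using prim_continuous[OF W22_prim0[OF assms]] prim_continuous[OF W22_prim1[OF assms]] by auto

lemma W22_intro:
  assumes "L2 L f2" "prim L f1 f2" "\<And>x. x \<in> {0..L} \<Longrightarrow> (f has_vector_derivative f1 x) (at x within {0..L})"
  shows "W22_derivs L f f1 (f2 :: real \<Rightarrow> complex)"
  using assms unfolding W22_derivs_def L2_def prim_def by blast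

lemma W22_lincomb:
  assumes "W22_derivs L f f1 f2" "W22_derivs L h h1 h2"
  shows "W22_derivs L (\<lambda>x. a * f x + b * h x) (\<lambda>x. a * f1 x + b * h1 x) (\<lambda>x. a * f2 x + b * h2 x :: complex)"
proof (rule W22_intro)
  show "L2 L (\<lambda>x. a * f2 x + b * h2 x)" using assms by (intro L2_add L2_scale W22_L2)
  show "prim L (\<lambda>x. a * f1 x + b * h1 x) (\<lambda>x. a * f2 x + b * h2 x)" using assms by (intro prim_lincomb W22_prim1)
  fix x assume x: "x \<in> {0..L}"
  then have "(f has_vector_derivative f1 x) (at x within {0..L})" "(h has_vector_derivative h1 x) (at x within {0..L})"
    using assms unfolding W22_derivs_def by blast+
  then show "((\<lambda>x. a * f x + b * h x) has_vector_derivative a * f1 x + b * h1 x) (at x within {0..L})"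
    by (intro has_vector_derivative_add has_vector_derivative_mult_right)
qed

lemma W22_cnj:
  assumes "W22_derivs L f f1 f2" shows "W22_derivs L (\<lambda>x. cnj (f x)) (\<lambda>x. cnj (f1 x)) (\<lambda>x. cnj (f2 x))"
proof (rule W22_intro)
  have m: "(\<lambda>x. cnj (f2 x)) \<in> borel_measurable (leb L)"
    using W22_L2[OF assms] unfolding L2_def by (auto intro!: borel_measurable_continuous_on[of cnj] continuous_intros)
  then show "L2 L (\<lambda>x. cnj (f2 x))" using W22_L2[OF assms] by (simp add: L2_def)
  then show "prim L (\<lambda>x. cnj (f1 x)) (\<lambda>x. cnj (f2 x))"
    unfolding prim_def
  proof (intro conjI ballI)
    assume "L2 L (\<lambda>x. cnj (f2 x))"
    then show "integrable (leb L) (\<lambda>x. cnj (f2 x))" by (rule L2_integrable)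
    fix x assume "x \<in> {0..L}"
    then have "f1 x = f1 0 + (LINT t|leb x. f2 t)" using assms unfolding W22_derivs_def by blast
    from arg_cong[OF this, of cnj] show "cnj (f1 x) = cnj (f1 0) + (LINT t|leb x. cnj (f2 t))"
      by (simp add: integral_cnj)
  qed
  fix x assume "x \<in> {0..L}"
  then have "(f has_vector_derivative f1 x) (at x within {0..L})" using assms unfolding W22_derivs_def by blast
  then show "((\<lambda>x. cnj (f x)) has_vector_derivative cnj (f1 x)) (at x within {0..L})"
    by (rule has_vector_derivative_cnj)
qed

lemma W22_of_real:
  assumes "W22_derivs L f f1 (f2 :: real \<Rightarrow> real)"
  shows "W22_derivs L (\<lambda>x. complex_of_real (f x)) (\<lambda>x. complex_of_real (f1 x)) (\<lambda>x. complex_of_real (f2 x))"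
  unfolding W22_derivs_def
proof (intro conjI ballI)
  have "f2 \<in> borel_measurable (leb L)" "integrable (leb L) (\<lambda>x. (norm (f2 x))^2)"
    using assms unfolding W22_derivs_def by blast+
  then show "(\<lambda>x. complex_of_real (f2 x)) \<in> borel_measurable (leb L)"
    "integrable (leb L) (\<lambda>x. (norm (complex_of_real (f2 x)))^2)" by auto
  fix x assume x: "x \<in> {0..L}"
  then have "f1 x = f1 0 + (LINT t|leb x. f2 t)" using assms unfolding W22_derivs_def by blast
  from arg_cong[OF this, of complex_of_real]
  show "complex_of_real (f1 x) = complex_of_real (f1 0) + (LINT t|leb x. complex_of_real (f2 t))" by simp
  have "(f has_vector_derivative f1 x) (at x within {0..L})" using x assms unfolding W22_derivs_def by blast
  then show "((\<lambda>x. complex_of_real (f x)) has_vector_derivative complex_of_real (f1 x)) (at x within {0..L})"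
    by (rule bounded_linear.has_vector_derivative[OF bounded_linear_of_real])
qed

lemma W22_green:
  fixes f h :: "real \<Rightarrow> complex"
  assumes L: "L > 0" and f: "W22_derivs L f f1 f2" and h: "W22_derivs L h h1 h2"
  shows "(LINT x|leb L. f2 x * h x) - (LINT x|leb L. f x * h2 x)
     = (f1 L * h L - f L * h1 L) - (f1 0 * h 0 - f 0 * h1 0)"
proof -
  note pf = W22_prim1[OF f] and ph = W22_prim1[OF h]
  note qf = W22_prim0[OF f] and qh = W22_prim0[OF h]
  have p: "prim L (\<lambda>x. 1 * (f1 x * h x) + (- 1) * (f x * h1 x)) (\<lambda>x. 1 * (f2 x * h x + f1 x * h1 x) + (- 1) * (f1 x * h1 x + f x * h2 x))"
    by (intro prim_lincomb prim_mult pf ph qf qh)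
  then have "1 * (f1 L * h L) + (- 1) * (f L * h1 L) = 1 * (f1 0 * h 0) + (- 1) * (f 0 * h1 0)
     + (LINT x|leb L. 1 * (f2 x * h x + f1 x * h1 x) + (- 1) * (f1 x * h1 x + f x * h2 x))"
    using L unfolding prim_def by (meson atLeastAtMost_iff less_eq_real_def)
  moreover have "(LINT x|leb L. 1 * (f2 x * h x + f1 x * h1 x) + (- 1) * (f1 x * h1 x + f x * h2 x))
     = (LINT x|leb L. f2 x * h x - h2 x * f x)"
    by (intro Bochner_Integration.integral_cong refl) (simp add: algebra_simps)
  moreover have "... = (LINT x|leb L. f2 x * h x) - (LINT x|leb L. h2 x * f x)"
    using L2_integrable[OF W22_L2[OF f]] L2_integrable[OF W22_L2[OF h]] W22_continuous[OF f] W22_continuous[OF h]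
    by (intro Bochner_Integration.integral_diff integrable_times_continuous)
  ultimately show ?thesis by (simp add: mult.commute[of "h2 _"])
qed

text \<open>The first derivative is exposed because vertex conditions read it at the ends; the
  second one matters only through the equation and stays existential.\<close>

definition csol :: "(real \<Rightarrow> real) \<Rightarrow> real \<Rightarrow> real \<Rightarrow> (real \<Rightarrow> complex) \<Rightarrow> (real \<Rightarrow> complex) \<Rightarrow> (real \<Rightarrow> complex) \<Rightarrow> bool" where
  "csol U L lam f f1 g \<longleftrightarrow> (\<exists>f2. W22_derivs L f f1 f2 \<and>
     (AE x in leb L. - f2 x + of_real (U x) * f x = of_real lam * f x + g x))"

lemma csol_of_real:
  assumes "solves_ivp L U lam y0 y1 f"
  shows "\<exists>f1. csol U L lam (\<lambda>x. of_real (f x)) f1 (\<lambda>_. 0) \<and> f 0 = y0 \<and> f1 0 = of_real y1"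
proof -
  obtain f1 f2 where w: "W22_derivs L f f1 f2" and ae: "AE x in leb L. - f2 x + U x * f x = lam * f x"
    and i: "f 0 = y0" "f1 0 = y1" using assms unfolding solves_ivp_def by blast
  have "AE x in leb L. - complex_of_real (f2 x) + of_real (U x) * of_real (f x) = of_real lam * of_real (f x) + 0"
    using ae by eventually_elim (metis add.right_neutral of_real_add of_real_minus of_real_mult)
  then have "csol U L lam (\<lambda>x. of_real (f x)) (\<lambda>x. of_real (f1 x)) (\<lambda>_. 0)"
    using W22_of_real[OF w] unfolding csol_def by blast
  then show ?thesis using i by blast
qed

lemma csol_lincomb:
  assumes "csol U L lam f f1 g" "csol U L lam h h1 k"
  shows "csol U L lam (\<lambda>x. a * f x + b * h x) (\<lambda>x. a * f1 x + b * h1 x) (\<lambda>x. a * g x + b * k x)"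
proof -
  obtain f2 h2 where w: "W22_derivs L f f1 f2" "W22_derivs L h h1 h2"
    and ae: "AE x in leb L. - f2 x + of_real (U x) * f x = of_real lam * f x + g x"
      "AE x in leb L. - h2 x + of_real (U x) * h x = of_real lam * h x + k x"
    using assms unfolding csol_def by blast
  have "AE x in leb L. - (a * f2 x + b * h2 x) + of_real (U x) * (a * f x + b * h x) = of_real lam * (a * f x + b * h x) + (a * g x + b * k x)"
    using ae
  proof eventually_elim
    case (elim x)
    have "- (a * f2 x + b * h2 x) + of_real (U x) * (a * f x + b * h x)
      = a * (- f2 x + of_real (U x) * f x) + b * (- h2 x + of_real (U x) * h x)" by (simp add: algebra_simps)
    then show ?case unfolding elim by (simp add: algebra_simps)
  qed
  then show ?thesis using W22_lincomb[OF w] unfolding csol_def by blast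
qed

lemma csol_continuous:
  assumes "csol U L lam f f1 g"
  shows "continuous_on {0..L} f" "continuous_on {0..L} f1"
  using assms W22_continuous unfolding csol_def by blast+

text \<open>Gronwall for |f| + |f1|: the summand 1 of the rate accounts for f1, the others for the
  factor |U - lam| in f2. K may be any larger number, so that one rate can serve a bounded set of
  lam.\<close>

lemma csol_bound:
  assumes L: "L > 0" and f: "csol U L lam f f1 g" and g: "integrable (leb L) g"
    and M: "AE x in leb L. \<bar>U x\<bar> \<le> M" and x: "x \<in> {0..L}" and K: "K \<ge> 1 + \<bar>M\<bar> + \<bar>lam\<bar>"
  shows "cmod (f x) + cmod (f1 x) \<le> 2 * (cmod (f 0) + cmod (f1 0) + (LINT t|leb L. cmod (g t))) * exp (2 * K * L)"
proof -
  obtain f2 where w: "W22_derivs L f f1 f2"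
    and ae: "AE x in leb L. - f2 x + of_real (U x) * f x = of_real lam * f x + g x"
    using f unfolding csol_def by blast
  note p1 = W22_prim1[OF w] and p0 = W22_prim0[OF w]
  note c = W22_continuous[OF w]
  define y where "y t = cmod (f t) + cmod (f1 t)" for t
  define A where "A = cmod (f 0) + cmod (f1 0) + (LINT t|leb L. cmod (g t))"
  have cy: "continuous_on {0..L} y" unfolding y_def by (intro continuous_intros c)
  have K0: "K > 0" using K by linarith
  have A0: "A \<ge> 0" by (simp add: A_def)
  have "y x \<le> 2 * A * exp (2 * K * x)"
  proof (rule gronwall[OF cy _ K0 _ x])
    show "y t \<ge> 0" for t by (simp add: y_def)
    fix t assume t: "t \<in> {0..L}"
    have i1: "integrable (leb t) f1" "integrable (leb t) f2" "integrable (leb t) g"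
      using p0 p1 g t integrable_initial by (auto simp: prim_def)
    have iy: "integrable (leb t) y"
      using t by (intro continuous_imp_integrable_real continuous_on_subset[OF cy]) auto
    have "f t = f 0 + (LINT s|leb t. f1 s)" using p0 t unfolding prim_def by blast
    then have "cmod (f t) \<le> cmod (f 0) + cmod (LINT s|leb t. f1 s)" by (metis norm_triangle_ineq)
    also have "cmod (LINT s|leb t. f1 s) \<le> (LINT s|leb t. cmod (f1 s))" by (rule integral_norm_bound)
    finally have b0: "cmod (f t) \<le> cmod (f 0) + (LINT s|leb t. cmod (f1 s))" by simp
    have "f1 t = f1 0 + (LINT s|leb t. f2 s)" using p1 t unfolding prim_def by blast
    then have "cmod (f1 t) \<le> cmod (f1 0) + cmod (LINT s|leb t. f2 s)" by (metis norm_triangle_ineq)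
    also have "cmod (LINT s|leb t. f2 s) \<le> (LINT s|leb t. cmod (f2 s))" by (rule integral_norm_bound)
    finally have b1: "cmod (f1 t) \<le> cmod (f1 0) + (LINT s|leb t. cmod (f2 s))" by simp
    have "(LINT s|leb t. cmod (f1 s)) + (LINT s|leb t. cmod (f2 s)) = (LINT s|leb t. cmod (f1 s) + cmod (f2 s))"
      using i1 by simp
    also have "... \<le> (LINT s|leb t. K * y s + cmod (g s))"
    proof (rule integral_mono_AE)
      show "integrable (leb t) (\<lambda>s. cmod (f1 s) + cmod (f2 s))" using i1 by auto
      show "integrable (leb t) (\<lambda>s. K * y s + cmod (g s))" using i1 iy by auto
      have "AE s in leb L. cmod (f1 s) + cmod (f2 s) \<le> K * y s + cmod (g s)"
        using ae M
      proof eventually_elim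
        case (elim s)
        have "f2 s = of_real (U s - lam) * f s - g s" using elim(1) by (simp add: algebra_simps)
        then have "cmod (f2 s) \<le> \<bar>U s - lam\<bar> * cmod (f s) + cmod (g s)"
          using norm_triangle_ineq4[of "of_real (U s - lam) * f s" "g s"] by (simp only: norm_mult norm_of_real)
        also have "\<bar>U s - lam\<bar> * cmod (f s) \<le> K * cmod (f s)" using elim(2) K by (intro mult_right_mono) auto
        finally have "cmod (f2 s) \<le> K * cmod (f s) + cmod (g s)" by simp
        moreover have "cmod (f1 s) \<le> K * cmod (f1 s)" using K mult_right_mono[of 1 K "cmod (f1 s)"] by simp
        ultimately show ?case by (simp add: y_def distrib_left)
      qed
      then show "AE s in leb t. cmod (f1 s) + cmod (f2 s) \<le> K * y s + cmod (g s)"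
        using t by (auto simp: AE_restrict_space_iff elim!: eventually_mono)
    qed
    also have "... = K * (LINT s|leb t. y s) + (LINT s|leb t. cmod (g s))"
      using i1 iy by simp
    also have "(LINT s|leb t. cmod (g s)) \<le> (LINT s|leb L. cmod (g s))"
      by (rule integral_mono_lebesgue_on_AE) (use g t in auto)
    also have "(LINT s|leb t. y s) = integral {0..t} y"
      by (rule lebesgue_integral_eq_integral[OF iy]) simp
    finally show "y t \<le> A + K * integral {0..t} y" using b0 b1 by (simp add: y_def A_def)
  qed
  also have "... \<le> 2 * A * exp (2 * K * L)" using A0 K0 x by (intro mult_left_mono) auto
  finally show ?thesis by (simp add: y_def A_def)
qed

lemma AE_reflect:
  assumes "AE x in lebesgue_on {0..L::real}. P x"
  shows "AE x in leb L. P (L - x)"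
proof -
  define T where "T = (\<lambda>x::real. L + (- 1) * x)"
  have Tm: "T \<in> measurable lebesgue lebesgue"
    using lebesgue_affine_measurable[where c = "\<lambda>x::real. - 1" and t = L] by (simp add: T_def)
  have "lebesgue = density (distr lebesgue lebesgue T) (\<lambda>_. ennreal \<bar>- 1\<bar>)"
    unfolding T_def by (rule lebesgue_real_affine) simp
  then have D: "distr lebesgue lebesgue T = lebesgue" by (simp add: density_1)
  have "AE x in lebesgue. x \<in> {0..L} \<longrightarrow> P x" using assms by (simp add: AE_restrict_space_iff)
  then have "AE x in distr lebesgue lebesgue T. x \<in> {0..L} \<longrightarrow> P x" by (simp only: D)
  then have "AE x in lebesgue. T x \<in> {0..L} \<longrightarrow> P (T x)" by (rule AE_distrD[OF Tm])
  then show ?thesis by (auto simp: AE_restrict_space_iff T_def elim!: eventually_mono)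
qed

lemma has_bochner_integral_reflect_interval:
  fixes f :: "real \<Rightarrow> 'b::euclidean_space"
  shows "has_bochner_integral (lebesgue_on {a..b}) f i \<longleftrightarrow> has_bochner_integral (lebesgue_on {L - b..L - a}) (\<lambda>x. f (L - x)) i"
proof -
  have ind: "indicator {a..b} (L - x) = (indicator {L - b..L - a} x :: real)" for x
    by (auto simp: indicator_def)
  have "has_bochner_integral (lebesgue_on {a..b}) f i \<longleftrightarrow> has_bochner_integral lebesgue (\<lambda>x. indicator {a..b} x *\<^sub>R f x) i"
    by (rule has_bochner_integral_restrict_space) simp
  also have "... \<longleftrightarrow> has_bochner_integral lebesgue (\<lambda>x. indicator {a..b} (L + (- 1) * x) *\<^sub>R f (L + (- 1) * x)) (i /\<^sub>R \<bar>- 1\<bar>)"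
    by (rule has_bochner_integral_lebesgue_real_affine_iff) simp
  also have "... \<longleftrightarrow> has_bochner_integral lebesgue (\<lambda>x. indicator {L - b..L - a} x *\<^sub>R f (L - x)) i"
    by (simp add: ind)
  also have "... \<longleftrightarrow> has_bochner_integral (lebesgue_on {L - b..L - a}) (\<lambda>x. f (L - x)) i"
    by (rule has_bochner_integral_restrict_space[symmetric]) simp
  finally show ?thesis .
qed

lemma integrable_reflect_interval:
  fixes f :: "real \<Rightarrow> 'b::euclidean_space"
  assumes "integrable (leb L) f"
  shows "integrable (leb L) (\<lambda>x. f (L - x))"
    and "(LINT x|leb L. f (L - x)) = (LINT x|leb L. f x)"
  using has_bochner_integral_reflect_interval[of 0 L f "LINT x|leb L. f x" L] assms
  by (auto simp: has_bochner_integral_iff)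

lemma L2_reflect: "L2 L f \<Longrightarrow> L2 L (\<lambda>x. f (L - x))"
  using integrable_reflect_interval(1)[OF L2_integrable[of L f]] integrable_reflect_interval(1)[of L "\<lambda>x. (cmod (f x))^2"]
  unfolding L2_def by auto

lemma W22_reflect:
  assumes w: "W22_derivs L f f1 (f2 :: real \<Rightarrow> complex)"
  shows "W22_derivs L (\<lambda>x. f (L - x)) (\<lambda>x. - f1 (L - x)) (\<lambda>x. f2 (L - x))"
proof (rule W22_intro)
  show l2: "L2 L (\<lambda>x. f2 (L - x))" by (rule L2_reflect[OF W22_L2[OF w]])
  show "prim L (\<lambda>x. - f1 (L - x)) (\<lambda>x. f2 (L - x))"
    unfolding prim_def
  proof (intro conjI ballI)
    show "integrable (leb L) (\<lambda>x. f2 (L - x))" by (rule L2_integrable[OF l2])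
    fix x assume x: "x \<in> {0..L}"
    have i2: "integrable (leb L) f2" by (rule L2_integrable[OF W22_L2[OF w]])
    have i3: "integrable (lebesgue_on {L - x..L}) f2" by (rule integrable_subinterval[OF i2]) (use x in auto)
    have r: "(LINT t|leb x. f2 (L - t)) = (LINT t|lebesgue_on {L - x..L}. f2 t)"
      using has_bochner_integral_reflect_interval[of "L - x" L f2 "LINT t|lebesgue_on {L - x..L}. f2 t" L] i3
      by (auto simp: has_bochner_integral_iff)
    have s: "(LINT t|leb L. f2 t) = (LINT t|lebesgue_on {0..L - x}. f2 t) + (LINT t|lebesgue_on {L - x..L}. f2 t)"
      by (rule Equivalence_Measurable_On_Borel.integral_combine[OF i2]) (use x in auto)
    have e: "f1 y = f1 0 + (LINT t|lebesgue_on {0..y}. f2 t)" if "y \<in> {0..L}" for y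
      using w that unfolding W22_derivs_def by blast
    have "f1 L = f1 0 + (LINT t|leb L. f2 t)" "f1 (L - x) = f1 0 + (LINT t|lebesgue_on {0..L - x}. f2 t)"
      by (rule e, use x in auto)+
    then show "- f1 (L - x) = - f1 (L - 0) + (LINT t|leb x. f2 (L - t))"
      unfolding r using s by simp
  qed
  fix x assume x: "x \<in> {0..L}"
  have "(f has_vector_derivative f1 (L - x)) (at (L - x) within {0..L})"
    using w x unfolding W22_derivs_def by (metis atLeastAtMost_iff diff_ge_0_iff_ge diff_le_eq le_add_same_cancel1)
  moreover have "(\<lambda>x. L - x) ` {0..L} = {0..L}" by (auto simp: image_iff intro!: bexI[of _ "L - _"])
  moreover have "((\<lambda>x. L - x) has_vector_derivative - 1) (at x within {0..L})" by (auto intro!: derivative_eq_intros)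
  ultimately show "((\<lambda>x. f (L - x)) has_vector_derivative - f1 (L - x)) (at x within {0..L})"
    using vector_diff_chain_within[of "\<lambda>x. L - x" "- 1" x "{0..L}" f "f1 (L - x)"] by (simp add: o_def)
qed

lemma isCont_from_lipschitz:
  fixes f :: "real \<Rightarrow> 'b::real_normed_vector"
  assumes "\<And>z. \<bar>z - z0\<bar> \<le> 1 \<Longrightarrow> norm (f z - f z0) \<le> B * \<bar>z - z0\<bar>"
  shows "isCont f z0"
proof -
  have "((\<lambda>z. f z - f z0) \<longlongrightarrow> 0) (at z0)"
  proof (rule Lim_null_comparison)
    show "\<forall>\<^sub>F z in at z0. norm (f z - f z0) \<le> B * \<bar>z - z0\<bar>"
      unfolding eventually_at by (rule exI[of _ 1]) (auto simp: dist_real_def intro!: assms)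
    have "((\<lambda>z. B * \<bar>z - z0\<bar>) \<longlongrightarrow> B * \<bar>z0 - z0\<bar>) (at z0)" by (intro tendsto_intros)
    then show "((\<lambda>z. B * \<bar>z - z0\<bar>) \<longlongrightarrow> 0) (at z0)" by simp
  qed
  then show ?thesis unfolding isCont_def by (rule Lim_null[THEN iffD2])
qed

section \<open>Solutions for a symmetric potential\<close>

locale sturm =
  fixes L :: real and U :: "real \<Rightarrow> real"
  assumes Lpos: "L > 0" and pot: "symmetric_Linfty_potential L U"
begin

definition Ub :: real where
  "Ub = (SOME M. AE x in leb L. \<bar>U x\<bar> \<le> M)"

lemma Ub: "AE x in leb L. \<bar>U x\<bar> \<le> Ub"
proof -
  have "\<exists>M. AE x in leb L. \<bar>U x\<bar> \<le> M"
    using pot unfolding symmetric_Linfty_potential_def by blast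
  then show ?thesis unfolding Ub_def by (rule someI_ex)
qed

lemma zero_L: "0 \<in> {0..L}" "L \<in> {0..L}" using Lpos by auto

lemma csol_zero:
  assumes f: "csol U L lam f f1 (\<lambda>_. 0)" "f 0 = 0" "f1 0 = 0" and x: "x \<in> {0..L}"
  shows "f x = 0" "f1 x = 0"
proof -
  have "cmod (f x) + cmod (f1 x) \<le> 0"
    using csol_bound[OF Lpos f(1) _ Ub x order_refl] f(2,3) by simp
  then have "cmod (f x) \<le> 0" "cmod (f1 x) \<le> 0" using norm_ge_zero[of "f x"] norm_ge_zero[of "f1 x"] by linarith+
  then show "f x = 0" "f1 x = 0" by simp_all
qed

lemma csol_unique:
  assumes f: "csol U L lam f f1 g" and h: "csol U L lam h h1 g" and i: "f 0 = h 0" "f1 0 = h1 0" and x: "x \<in> {0..L}"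
  shows "f x = h x" "f1 x = h1 x"
proof -
  have "csol U L lam (\<lambda>x. 1 * f x + (- 1) * h x) (\<lambda>x. 1 * f1 x + (- 1) * h1 x) (\<lambda>x. 1 * g x + (- 1) * g x)"
    by (rule csol_lincomb[OF f h])
  then have "csol U L lam (\<lambda>x. 1 * f x + (- 1) * h x) (\<lambda>x. 1 * f1 x + (- 1) * h1 x) (\<lambda>x. 0)" by simp
  from csol_zero[OF this _ _ x] i show "f x = h x" "f1 x = h1 x" by simp_all
qed

lemma csol_reflect:
  assumes f: "csol U L lam f f1 (\<lambda>_. 0)"
  shows "csol U L lam (\<lambda>x. f (L - x)) (\<lambda>x. - f1 (L - x)) (\<lambda>_. 0)"
proof -
  obtain f2 where w: "W22_derivs L f f1 f2"
    and ae: "AE x in leb L. - f2 x + of_real (U x) * f x = of_real lam * f x + 0"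
    using f unfolding csol_def by blast
  have "AE x in leb L. U (L - x) = U x"
    using pot unfolding symmetric_Linfty_potential_def by blast
  with AE_reflect[OF ae]
  have "AE x in leb L. - f2 (L - x) + of_real (U x) * f (L - x) = of_real lam * f (L - x) + 0"
    by eventually_elim simp
  then show ?thesis using W22_reflect[OF w] unfolding csol_def by blast
qed

text \<open>The difference of the solutions for z and z0 has zero initial data and source (z0 - z) F
  z0, so the a priori bound is a Lipschitz estimate. The rate 2 + |Ub| + |z0| serves all z at
  distance at most 1.\<close>

lemma solution_continuous_in_parameter:
  fixes F :: "real \<Rightarrow> real \<Rightarrow> real"
  assumes F: "\<And>z. solves_ivp L U z y0 y1 (F z)"
  shows "isCont (\<lambda>z. F z L) z0"
proof (rule isCont_from_lipschitz)
  obtain h1 where h: "csol U L z0 (\<lambda>x. of_real (F z0 x)) h1 (\<lambda>_. 0)" "F z0 0 = y0" "h1 0 = of_real y1"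
    using csol_of_real[OF F[of z0]] by blast
  let ?I = "LINT t|leb L. cmod (of_real (F z0 t))"
  let ?B = "2 * ?I * exp (2 * (2 + \<bar>Ub\<bar> + \<bar>z0\<bar>) * L)"
  fix z :: real assume z: "\<bar>z - z0\<bar> \<le> 1"
  obtain f1 where f: "csol U L z (\<lambda>x. of_real (F z x)) f1 (\<lambda>_. 0)" "F z 0 = y0" "f1 0 = of_real y1"
    using csol_of_real[OF F[of z]] by blast
  define g where "g x = complex_of_real (z0 - z) * of_real (F z0 x)" for x
  have "csol U L z (\<lambda>x. of_real (F z0 x)) h1 g"
  proof -
    obtain h2 where "W22_derivs L (\<lambda>x. of_real (F z0 x)) h1 h2"
      "AE x in leb L. - h2 x + of_real (U x) * of_real (F z0 x) = of_real z0 * of_real (F z0 x) + 0"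
      using h(1) unfolding csol_def by blast
    moreover from this(2) have "AE x in leb L. - h2 x + of_real (U x) * of_real (F z0 x) = of_real z * of_real (F z0 x) + g x"
      by eventually_elim (simp add: g_def algebra_simps)
    ultimately show ?thesis unfolding csol_def by blast
  qed
  from csol_lincomb[OF f(1) this, of 1 "- 1"]
  have d: "csol U L z (\<lambda>x. 1 * of_real (F z x) + - 1 * of_real (F z0 x)) (\<lambda>x. 1 * f1 x + - 1 * h1 x) (\<lambda>x. 1 * 0 + - 1 * g x)" .
  have gi: "integrable (leb L) (\<lambda>x. 1 * 0 + - 1 * g x)"
  proof -
    have "continuous_on {0..L} (\<lambda>x. (- complex_of_real (z0 - z)) * of_real (F z0 x))"
      by (rule continuous_on_mult_left[OF csol_continuous(1)[OF h(1)]])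
    moreover have "(\<lambda>x. 1 * 0 + - 1 * g x) = (\<lambda>x. (- complex_of_real (z0 - z)) * of_real (F z0 x))"
      by (rule ext) (simp add: g_def left_diff_distrib)
    ultimately show ?thesis by (simp only: continuous_imp_integrable_real)
  qed
  have "cmod (1 * of_real (F z L) + - 1 * of_real (F z0 L)) + cmod (1 * f1 L + - 1 * h1 L)
     \<le> 2 * (cmod (1 * of_real (F z 0) + - 1 * of_real (F z0 0)) + cmod (1 * f1 0 + - 1 * h1 0) + (LINT t|leb L. cmod (1 * 0 + - 1 * g t)))
       * exp (2 * (2 + \<bar>Ub\<bar> + \<bar>z0\<bar>) * L)"
    by (rule csol_bound[OF Lpos d gi Ub zero_L(2)]) (use z in auto)
  also have "... = ?B * \<bar>z - z0\<bar>"
    using f(2,3) h(2,3) by (simp add: g_def norm_mult abs_minus_commute mult_ac flip: of_real_diff)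
  finally have "cmod (1 * of_real (F z L) + - 1 * of_real (F z0 L)) \<le> ?B * \<bar>z - z0\<bar>"
    by (smt (verit) norm_ge_zero)
  moreover have "cmod (1 * of_real (F z L) + - 1 * of_real (F z0 L)) = norm (F z L - F z0 L)"
    by (simp flip: of_real_diff)
  ultimately show "norm (F z L - F z0 L) \<le> ?B * \<bar>z - z0\<bar>" by simp
qed

end

locale fundamental = sturm +
  fixes lam :: real and C C1 S S1 :: "real \<Rightarrow> complex"
  assumes C: "csol U L lam C C1 (\<lambda>_. 0)" "C 0 = 1" "C1 0 = 0"
    and S: "csol U L lam S S1 (\<lambda>_. 0)" "S 0 = 0" "S1 0 = 1"
begin

lemma solution_rep:
  assumes f: "csol U L lam f f1 (\<lambda>_. 0)" and x: "x \<in> {0..L}"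
  shows "f x = f 0 * C x + f1 0 * S x" "f1 x = f 0 * C1 x + f1 0 * S1 x"
proof -
  have "csol U L lam (\<lambda>x. f 0 * C x + f1 0 * S x) (\<lambda>x. f 0 * C1 x + f1 0 * S1 x) (\<lambda>x. 0)"
    using csol_lincomb[OF C(1) S(1), of "f 0" "f1 0"] by simp
  from csol_unique[OF f this _ _ x] C S show "f x = f 0 * C x + f1 0 * S x" "f1 x = f 0 * C1 x + f1 0 * S1 x" by simp_all
qed

text \<open>Reflected at the midpoint, the fundamental solutions are solutions again, by symmetry of
  the potential; expand them in C and S and evaluate at L.\<close>

lemma symmetric_data:
  shows "C L * C L - C1 L * S L = 1" and "S L \<noteq> 0 \<Longrightarrow> S1 L = C L"
proof -
  have "C (L - L) = C (L - 0) * C L + - C1 (L - 0) * S L"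
    by (rule solution_rep(1)[OF csol_reflect[OF C(1)] zero_L(2)])
  then show "C L * C L - C1 L * S L = 1" using C by simp
  have "S (L - L) = S (L - 0) * C L + - S1 (L - 0) * S L"
    by (rule solution_rep(1)[OF csol_reflect[OF S(1)] zero_L(2)])
  then show "S L \<noteq> 0 \<Longrightarrow> S1 L = C L" using S by simp
qed

lemma reflected_S:
  assumes x: "x \<in> {0..L}" and nz: "S L \<noteq> 0"
  shows "S (L - x) = S L * C x - C L * S x"
  using solution_rep(1)[OF csol_reflect[OF S(1)] x] symmetric_data(2)[OF nz] by simp

lemma wronskian:
  assumes x: "x \<in> {0..L}" shows "C x * S1 x - C1 x * S x = 1"
proof -
  obtain C2 where wC: "W22_derivs L C C1 C2" and aC: "AE x in leb L. - C2 x + of_real (U x) * C x = of_real lam * C x + 0"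
    using C(1) unfolding csol_def by blast
  obtain S2 where wS: "W22_derivs L S S1 S2" and aS: "AE x in leb L. - S2 x + of_real (U x) * S x = of_real lam * S x + 0"
    using S(1) unfolding csol_def by blast
  have p: "prim L (\<lambda>x. 1 * (C x * S1 x) + (- 1) * (C1 x * S x)) (\<lambda>x. 1 * (C1 x * S1 x + C x * S2 x) + (- 1) * (C2 x * S x + C1 x * S1 x))"
    by (intro prim_lincomb prim_mult W22_prim0[OF wC] W22_prim1[OF wC] W22_prim0[OF wS] W22_prim1[OF wS])
  have "AE t in leb L. 1 * (C1 t * S1 t + C t * S2 t) + (- 1) * (C2 t * S t + C1 t * S1 t) = 0"
    using aC aS
  proof eventually_elim
    case (elim t)
    then have "C2 t = of_real (U t - lam) * C t" "S2 t = of_real (U t - lam) * S t" by (simp_all add: algebra_simps)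
    then show ?case by simp
  qed
  then have "AE t in leb x. 1 * (C1 t * S1 t + C t * S2 t) + (- 1) * (C2 t * S t + C1 t * S1 t) = 0"
    using x by (auto simp: AE_restrict_space_iff elim!: eventually_mono)
  then have "(LINT t|leb x. 1 * (C1 t * S1 t + C t * S2 t) + (- 1) * (C2 t * S t + C1 t * S1 t)) = 0"
    by (rule integral_eq_zero_AE)
  moreover have "1 * (C x * S1 x) + (- 1) * (C1 x * S x) = 1 * (C 0 * S1 0) + (- 1) * (C1 0 * S 0)
    + (LINT t|leb x. 1 * (C1 t * S1 t + C t * S2 t) + (- 1) * (C2 t * S t + C1 t * S1 t))"
    using p x unfolding prim_def by blast
  ultimately show ?thesis using C S by simp
qed

text \<open>Variation of constants: v = C b - S a, where a and b are the primitives of f C and f S,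
  and the Wronskian is 1.\<close>

lemma inhomogeneous_solution:
  assumes f: "L2 L f"
  shows "\<exists>v v1. csol U L lam v v1 f \<and> v 0 = 0 \<and> v1 0 = 0"
proof -
  obtain C2 where wC: "W22_derivs L C C1 C2" and aC: "AE x in leb L. - C2 x + of_real (U x) * C x = of_real lam * C x + 0"
    using C(1) unfolding csol_def by blast
  obtain S2 where wS: "W22_derivs L S S1 S2" and aS: "AE x in leb L. - S2 x + of_real (U x) * S x = of_real lam * S x + 0"
    using S(1) unfolding csol_def by blast
  note cC = W22_continuous[OF wC] and cS = W22_continuous[OF wS]
  note fi = L2_integrable[OF f]
  define a where "a x = (LINT t|leb x. f t * C t)" for x
  define b where "b x = (LINT t|leb x. f t * S t)" for x
  have a0: "a 0 = 0" "b 0 = 0" by (auto simp: a_def b_def intro!: integral_eq_zero_null_sets)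
  have pa: "prim L a (\<lambda>x. f x * C x)" using integrable_times_continuous[OF fi cC(1)] a0 unfolding prim_def a_def by simp
  have pb: "prim L b (\<lambda>x. f x * S x)" using integrable_times_continuous[OF fi cS(1)] a0 unfolding prim_def b_def by simp
  note ca = prim_continuous[OF pa] and cb = prim_continuous[OF pb]
  define v where "v x = (- 1) * (S x * a x) + 1 * (C x * b x)" for x
  define v1 where "v1 x = (- 1) * (S1 x * a x) + 1 * (C1 x * b x)" for x
  define v2 where "v2 x = (- 1) * (S2 x * a x + S1 x * (f x * C x)) + 1 * (C2 x * b x + C1 x * (f x * S x))" for x
  have "prim L v (\<lambda>x. (- 1) * (S1 x * a x + S x * (f x * C x)) + 1 * (C1 x * b x + C x * (f x * S x)))"
    unfolding v_def by (intro prim_lincomb prim_mult W22_prim0[OF wC] W22_prim0[OF wS] pa pb)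
  moreover have "(\<lambda>x. (- 1) * (S1 x * a x + S x * (f x * C x)) + 1 * (C1 x * b x + C x * (f x * S x))) = v1"
    by (rule ext) (simp add: v1_def algebra_simps)
  ultimately have pv: "prim L v v1" by simp
  have cv1: "continuous_on {0..L} v1" unfolding v1_def by (intro continuous_intros cC cS ca cb)
  have pv1: "prim L v1 v2"
    unfolding v1_def v2_def by (intro prim_lincomb prim_mult W22_prim1[OF wC] W22_prim1[OF wS] pa pb)
  have l2: "L2 L v2"
  proof -
    have "L2 L (\<lambda>x. (- 1) * (a x * S2 x + S1 x * (C x * f x)) + 1 * (b x * C2 x + C1 x * (S x * f x)))"
      by (intro L2_add L2_scale L2_times_continuous cC cS ca cb W22_L2[OF wC] W22_L2[OF wS] f)
    moreover have "(\<lambda>x. (- 1) * (a x * S2 x + S1 x * (C x * f x)) + 1 * (b x * C2 x + C1 x * (S x * f x))) = v2"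
      by (rule ext) (simp add: v2_def mult_ac)
    ultimately show ?thesis by simp
  qed
  have w: "W22_derivs L v v1 v2" by (rule W22_intro[OF l2 pv1 prim_deriv[OF pv cv1]])
  have "AE x in leb L. x \<in> {0..L}" using AE_space[of "leb L"] by simp
  then have "AE x in leb L. - v2 x + of_real (U x) * v x = of_real lam * v x + f x"
    using aC aS
  proof eventually_elim
    case (elim x)
    then have e: "C2 x = of_real (U x - lam) * C x" "S2 x = of_real (U x - lam) * S x" by (simp_all add: algebra_simps)
    have "- v2 x + of_real (U x) * v x - of_real lam * v x = f x * (C x * S1 x - C1 x * S x)"
      unfolding v2_def v_def e by (simp add: algebra_simps)
    then show ?case using wronskian[OF elim(1)] by (simp add: algebra_simps)
  qed
  then have "csol U L lam v v1 f" using w unfolding csol_def by blast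
  moreover have "v 0 = 0" "v1 0 = 0" by (simp_all add: v_def v1_def a0)
  ultimately show ?thesis by blast
qed

text \<open>The solution with zero initial data is corrected by the multiple of S that makes it
  vanish at L, which is where \<open>S L\<close> must not vanish. One constant K serves all three
  bounds.\<close>

lemma dirichlet_solution:
  assumes nz: "S L \<noteq> 0"
  shows "\<exists>K\<ge>0. \<forall>f. L2 L f \<longrightarrow> (\<exists>v v1. csol U L lam v v1 f \<and> v 0 = 0 \<and> v L = 0 \<and>
     (cmod (v1 0))^2 \<le> K * N2 L f \<and> (cmod (v1 L))^2 \<le> K * N2 L f \<and> N2 L v \<le> K * N2 L f)"
proof -
  define E where "E = 2 * exp (2 * (1 + \<bar>Ub\<bar> + \<bar>lam\<bar>) * L)"
  have E: "E > 0" by (simp add: E_def)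
  define D where "D = E * (1 + E / cmod (S L))"
  have D: "D \<ge> 0" using E by (simp add: D_def)
  have main: "\<exists>v v1. csol U L lam v v1 f \<and> v 0 = 0 \<and> v L = 0 \<and>
     (\<forall>x\<in>{0..L}. (cmod (v x))^2 \<le> D^2 * L * N2 L f \<and> (cmod (v1 x))^2 \<le> D^2 * L * N2 L f)" if f: "L2 L f" for f
  proof -
    obtain w w1 where w: "csol U L lam w w1 f" "w 0 = 0" "w1 0 = 0" using inhomogeneous_solution[OF f] by blast
    define I where "I = (LINT t|leb L. cmod (f t))"
    have I0: "I \<ge> 0" by (simp add: I_def)
    have bw: "cmod (w x) + cmod (w1 x) \<le> E * I" if "x \<in> {0..L}" for x
      using csol_bound[OF Lpos w(1) L2_integrable[OF f] Ub that order_refl] w(2,3) by (simp add: E_def I_def mult_ac)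
    have bS: "cmod (S x) + cmod (S1 x) \<le> E" if "x \<in> {0..L}" for x
      using csol_bound[OF Lpos S(1) _ Ub that order_refl] S(2,3) by (simp add: E_def)
    define k where "k = - w L / S L"
    have k: "cmod k \<le> E * I / cmod (S L)"
      using bw[OF zero_L(2)] norm_ge_zero[of "w1 L"] unfolding k_def norm_divide norm_minus_cancel
      by (intro divide_right_mono) (linarith, simp)
    define v where "v x = 1 * w x + k * S x" for x
    define v1 where "v1 x = 1 * w1 x + k * S1 x" for x
    have "csol U L lam v v1 (\<lambda>x. 1 * f x + k * 0)" unfolding v_def v1_def by (rule csol_lincomb[OF w(1) S(1)])
    then have 1: "csol U L lam v v1 f" by simp
    have 2: "v 0 = 0" "v L = 0" using w S nz by (simp_all add: v_def k_def)
    have 3: "(cmod (v x))^2 \<le> D^2 * L * N2 L f \<and> (cmod (v1 x))^2 \<le> D^2 * L * N2 L f" if x: "x \<in> {0..L}" for x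
    proof -
      have "cmod (S x) \<le> E" "cmod (S1 x) \<le> E"
        using bS[OF x] norm_ge_zero[of "S x"] norm_ge_zero[of "S1 x"] by linarith+
      then have kS: "cmod k * cmod (S x) \<le> E * I / cmod (S L) * E" "cmod k * cmod (S1 x) \<le> E * I / cmod (S L) * E"
        using k I0 E by (intro mult_mono; simp)+
      have DI: "D * I = E * I + E * I / cmod (S L) * E" by (simp add: D_def algebra_simps)
      have "cmod (v x) \<le> cmod (w x) + cmod k * cmod (S x)" "cmod (v1 x) \<le> cmod (w1 x) + cmod k * cmod (S1 x)"
        unfolding v_def v1_def using norm_triangle_ineq[of "w x" "k * S x"] norm_triangle_ineq[of "w1 x" "k * S1 x"] by (simp_all add: norm_mult)
      then have "cmod (v x) \<le> D * I" "cmod (v1 x) \<le> D * I"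
        using bw[OF x] kS norm_ge_zero[of "w x"] norm_ge_zero[of "w1 x"] unfolding DI by linarith+
      then have "(cmod (v x))^2 \<le> (D * I)^2" "(cmod (v1 x))^2 \<le> (D * I)^2" by (auto intro: power_mono)
      moreover have "(D * I)^2 \<le> D^2 * (L * N2 L f)"
        using integral_norm_sq_le[OF Lpos f] by (simp add: power_mult_distrib I_def mult_left_mono)
      ultimately show ?thesis by (simp add: mult.assoc)
    qed
    show ?thesis using 1 2 3 by blast
  qed
  define K where "K = D^2 * L * (1 + L)"
  have K1: "D^2 * L \<le> K" using Lpos by (simp add: K_def distrib_left)
  have K2: "D^2 * L * L \<le> K" using Lpos by (simp add: K_def distrib_left)
  have "\<exists>v v1. csol U L lam v v1 f \<and> v 0 = 0 \<and> v L = 0 \<and>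
     (cmod (v1 0))^2 \<le> K * N2 L f \<and> (cmod (v1 L))^2 \<le> K * N2 L f \<and> N2 L v \<le> K * N2 L f" if f: "L2 L f" for f
  proof -
    obtain v v1 where v: "csol U L lam v v1 f" "v 0 = 0" "v L = 0"
      and b: "\<And>x. x \<in> {0..L} \<Longrightarrow> (cmod (v x))^2 \<le> D^2 * L * N2 L f" "\<And>x. x \<in> {0..L} \<Longrightarrow> (cmod (v1 x))^2 \<le> D^2 * L * N2 L f"
      using main[OF f] by blast
    have le: "D^2 * L * N2 L f \<le> K * N2 L f" by (rule mult_right_mono[OF K1]) simp
    interpret finite_measure "leb L" by (rule finite_measure_interval)
    have "N2 L v \<le> (LINT x|leb L. D^2 * L * N2 L f)"
      unfolding N2_def[of L v]
    proof (rule integral_mono_AE)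
      show "integrable (leb L) (\<lambda>x. (cmod (v x))^2)"
        using L2_continuous[OF csol_continuous(1)[OF v(1)]] by (simp add: L2_def)
      show "AE x in leb L. (cmod (v x))^2 \<le> D^2 * L * N2 L f" by (rule AE_I2) (simp add: b)
    qed simp
    also have "... = D^2 * L * L * N2 L f" using Lpos by (simp add: measure_restrict_space)
    also have "... \<le> K * N2 L f" by (rule mult_right_mono[OF K2]) simp
    finally show ?thesis using v b[OF zero_L(1)] b[OF zero_L(2)] le by (meson order_trans)
  qed
  moreover have "K \<ge> 0" using Lpos by (simp add: K_def)
  ultimately show ?thesis by blast
qed

end

section \<open>Equilateral quantum graphs\<close>

lemma ograph_edge:
  assumes "simple_ograph G" "e \<in> edges G"
  shows "e = {org G e, trm G e}" "org G e \<noteq> trm G e" "(org G e, trm G e) \<in> adj G" "(trm G e, org G e) \<in> adj G"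
    "org G e \<in> verts G" "trm G e \<in> verts G"
proof -
  show e: "e = {org G e, trm G e}" using assms unfolding simple_ograph_def by blast
  then show a: "(org G e, trm G e) \<in> adj G" using assms(2) by (simp add: adj_def)
  then show "(trm G e, org G e) \<in> adj G" by (rule adj_sym)
  show "org G e \<noteq> trm G e" "org G e \<in> verts G" "trm G e \<in> verts G" using simple_adjD[OF assms(1) a] by blast+
qed

text \<open>Each neighbour of v belongs to exactly one incident edge, which either starts or ends at
  v; this removes the orientation from vertex sums.\<close>

lemma incident_sum:
  fixes h :: "'v \<Rightarrow> 'b::comm_monoid_add"
  assumes G: "simple_ograph G" and fin: "finite (adj G `` {v})"
  shows "(\<Sum>e | e \<in> edges G \<and> org G e = v. h (trm G e)) + (\<Sum>e | e \<in> edges G \<and> trm G e = v. h (org G e)) = (\<Sum>y\<in>adj G `` {v}. h y)"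
    and "finite {e. e \<in> edges G \<and> org G e = v}" and "finite {e. e \<in> edges G \<and> trm G e = v}"
proof -
  let ?O = "{e. e \<in> edges G \<and> org G e = v}" and ?T = "{e. e \<in> edges G \<and> trm G e = v}"
  note ed = ograph_edge[OF G]
  have iO: "inj_on (trm G) ?O"
    by (rule inj_onI) (use ed(1) in \<open>metis (mono_tags, lifting) mem_Collect_eq\<close>)
  have iT: "inj_on (org G) ?T"
    by (rule inj_onI) (use ed(1) in \<open>metis (mono_tags, lifting) mem_Collect_eq\<close>)
  have un: "adj G `` {v} = trm G ` ?O \<union> org G ` ?T"
  proof (intro equalityI subsetI)
    fix y assume "y \<in> adj G `` {v}"
    then have e: "{v, y} \<in> edges G" by (simp add: adj_def)
    from ed(1)[OF e] have "(org G {v, y} = v \<and> trm G {v, y} = y) \<or> (org G {v, y} = y \<and> trm G {v, y} = v)"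
      by (simp add: doubleton_eq_iff) metis
    then have "(y = trm G {v, y} \<and> {v, y} \<in> ?O) \<or> (y = org G {v, y} \<and> {v, y} \<in> ?T)"
      using e by auto
    then show "y \<in> trm G ` ?O \<union> org G ` ?T" by blast
  next
    fix y assume "y \<in> trm G ` ?O \<union> org G ` ?T"
    then show "y \<in> adj G `` {v}" using ed(3,4) by auto
  qed
  show fO: "finite ?O" using fin un iO by (metis (no_types, lifting) finite_Un finite_imageD)
  show fT: "finite ?T" using fin un iT by (metis (no_types, lifting) finite_Un finite_imageD)
  have dis: "trm G ` ?O \<inter> org G ` ?T = {}"
  proof (rule ccontr)
    assume "trm G ` ?O \<inter> org G ` ?T \<noteq> {}"
    then obtain e e' where h: "e \<in> edges G" "org G e = v" "e' \<in> edges G" "trm G e' = v" "trm G e = org G e'" by auto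
    then have "e = e'" using ed(1)[OF h(1)] ed(1)[OF h(3)] by (metis insert_commute)
    then show False using h ed(2)[OF h(1)] by auto
  qed
  show "(\<Sum>e | e \<in> edges G \<and> org G e = v. h (trm G e)) + (\<Sum>e | e \<in> edges G \<and> trm G e = v. h (org G e)) = (\<Sum>y\<in>adj G `` {v}. h y)"
    unfolding un using fO fT dis iO iT by (subst sum.union_disjoint) (auto simp: sum.reindex)
qed

text \<open>The extra end derivatives p, r and the corrections \<theta> vanish for the eigenvalue
  equation; they are carried along for the corrected approximate solutions on the tree. The opposite
  signs of \<theta> at the two ends make its contributions to the current add up.\<close>

lemma incident_current:
  fixes y \<theta> :: "'v \<Rightarrow> complex"
  assumes G: "simple_ograph G" and fin: "finite (adj G `` {v})"
  shows "(\<Sum>e | e \<in> edges G \<and> org G e = v. (y (trm G e) - c * y (org G e)) / s + p e + \<theta> (org G e))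
     - (\<Sum>e | e \<in> edges G \<and> trm G e = v. (c * y (trm G e) - y (org G e)) / s + r e - \<theta> (trm G e))
    = ((\<Sum>z\<in>adj G `` {v}. y z) - of_nat (card (adj G `` {v})) * c * y v) / s
      + ((\<Sum>e | e \<in> edges G \<and> org G e = v. p e) - (\<Sum>e | e \<in> edges G \<and> trm G e = v. r e)) + of_nat (card (adj G `` {v})) * \<theta> v"
    (is "?l - ?m = _")
proof -
  let ?O = "{e. e \<in> edges G \<and> org G e = v}" and ?T = "{e. e \<in> edges G \<and> trm G e = v}"
  have 1: "?l = (\<Sum>e\<in>?O. (y (trm G e) - c * y v) / s) + (\<Sum>e\<in>?O. p e) + of_nat (card ?O) * \<theta> v"
    by (simp add: sum.distrib)
  have 2: "?m = - (\<Sum>e\<in>?T. (y (org G e) - c * y v) / s) + (\<Sum>e\<in>?T. r e) - of_nat (card ?T) * \<theta> v"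
    by (simp add: sum.distrib sum_subtractf sum_negf[symmetric] minus_divide_left)
  have 3: "(\<Sum>e\<in>?O. (y (trm G e) - c * y v) / s) + (\<Sum>e\<in>?T. (y (org G e) - c * y v) / s) = (\<Sum>z\<in>adj G `` {v}. (y z - c * y v) / s)"
    by (rule incident_sum(1)[OF G fin])
  have 4: "(\<Sum>z\<in>adj G `` {v}. (y z - c * y v) / s) = ((\<Sum>z\<in>adj G `` {v}. y z) - of_nat (card (adj G `` {v})) * c * y v) / s"
    unfolding sum_divide_distrib[symmetric] sum_subtractf by (simp add: algebra_simps)
  have "card ?O + card ?T = card (adj G `` {v})"
    using incident_sum(1)[OF G fin, where h = "\<lambda>_. 1::nat"] by simp
  from arg_cong[OF this, of "\<lambda>n. of_nat n * \<theta> v"]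
  have 5: "of_nat (card ?O) * \<theta> v + of_nat (card ?T) * \<theta> v = of_nat (card (adj G `` {v})) * \<theta> v" by (simp add: distrib_right)
  show ?thesis unfolding 1 2 using 3 4 5 by (simp add: algebra_simps)
qed

text \<open>With \<open>ctf\<close> a basis of the solutions adapted to the ends: \<open>stf\<close>
  has end values 0 and 1, \<open>ctf\<close> has 1 and 0.\<close>

definition stf :: "real \<Rightarrow> (real \<Rightarrow> real) \<Rightarrow> real \<Rightarrow> real" where
  "stf L S x = S x / S L"

definition ctf :: "real \<Rightarrow> (real \<Rightarrow> real) \<Rightarrow> (real \<Rightarrow> real) \<Rightarrow> real \<Rightarrow> real" where
  "ctf L C S x = C x - C L / S L * S x"

text \<open>With \<open>Qint\<close> the Gram matrix of this basis; by reflection both functions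
  have the same norm, so two numbers suffice.\<close>

definition Pint :: "real \<Rightarrow> (real \<Rightarrow> real) \<Rightarrow> real" where
  "Pint L S = (LINT x|leb L. (stf L S x)^2)"

definition Qint :: "real \<Rightarrow> (real \<Rightarrow> real) \<Rightarrow> (real \<Rightarrow> real) \<Rightarrow> real" where
  "Qint L C S = (LINT x|leb L. ctf L C S x * stf L S x)"

context sturm begin

lemma fundamental_exists:
  assumes "solves_ivp L U z 1 0 C" "solves_ivp L U z 0 1 S"
  obtains C1 S1 where "fundamental L U z (\<lambda>x. of_real (C x)) C1 (\<lambda>x. of_real (S x)) S1"
proof -
  obtain C1 where "csol U L z (\<lambda>x. of_real (C x)) C1 (\<lambda>_. 0)" "C 0 = 1" "C1 0 = of_real 0"
    using csol_of_real[OF assms(1)] by blast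
  moreover obtain S1 where "csol U L z (\<lambda>x. of_real (S x)) S1 (\<lambda>_. 0)" "S 0 = 0" "S1 0 = of_real 1"
    using csol_of_real[OF assms(2)] by blast
  ultimately have "fundamental L U z (\<lambda>x. of_real (C x)) C1 (\<lambda>x. of_real (S x)) S1"
    by unfold_locales simp_all
  then show ?thesis by (rule that)
qed

lemma ivp_continuous: "solves_ivp L U z y0 y1 F \<Longrightarrow> continuous_on {0..L} F"
proof -
  assume "solves_ivp L U z y0 y1 F"
  then obtain f1 where "csol U L z (\<lambda>x. of_real (F x)) f1 (\<lambda>_. 0)" using csol_of_real by blast
  from continuous_on_Re[OF csol_continuous(1)[OF this]] have "continuous_on {0..L} (\<lambda>x. Re (of_real (F x)))" .
  then show ?thesis by simp
qed

context
  fixes z :: real and C S :: "real \<Rightarrow> real"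
  assumes C: "solves_ivp L U z 1 0 C" and S: "solves_ivp L U z 0 1 S" and nz: "S L \<noteq> 0"
begin

lemma ctf_reflect: "x \<in> {0..L} \<Longrightarrow> ctf L C S x = stf L S (L - x)"
proof -
  assume x: "x \<in> {0..L}"
  obtain C1 S1 where "fundamental L U z (\<lambda>x. of_real (C x)) C1 (\<lambda>x. of_real (S x)) S1"
    by (rule fundamental_exists[OF C S])
  then interpret f: fundamental L U z "\<lambda>x. of_real (C x)" C1 "\<lambda>x. of_real (S x)" S1 .
  have "complex_of_real (S (L - x)) = of_real (S L * C x - C L * S x)"
    using f.reflected_S[OF x] nz by simp
  then have "S (L - x) = S L * C x - C L * S x" by (simp only: of_real_eq_iff)
  then show ?thesis using nz by (simp add: ctf_def stf_def field_simps)
qed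

lemma ends: "ctf L C S 0 = 1" "ctf L C S L = 0" "stf L S 0 = 0" "stf L S L = 1"
proof -
  have "C 0 = 1" "S 0 = 0" using C S unfolding solves_ivp_def by blast+
  then show "ctf L C S 0 = 1" "ctf L C S L = 0" "stf L S 0 = 0" "stf L S L = 1" using nz by (simp_all add: ctf_def stf_def)
qed

lemma ct_continuous: "continuous_on {0..L} (ctf L C S)" "continuous_on {0..L} (stf L S)"
  unfolding ctf_def[abs_def] stf_def[abs_def] using ivp_continuous[OF C] ivp_continuous[OF S] nz
  by (auto intro!: continuous_intros)

lemma ct_integrable:
  "integrable (leb L) (\<lambda>x. (ctf L C S x)^2)" "integrable (leb L) (\<lambda>x. (stf L S x)^2)"
  "integrable (leb L) (\<lambda>x. ctf L C S x * stf L S x)"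
  by (intro continuous_imp_integrable_real continuous_intros ct_continuous)+

lemma ct_square: "(LINT x|leb L. (ctf L C S x)^2) = Pint L S"
proof -
  have "(LINT x|leb L. (ctf L C S x)^2) = (LINT x|leb L. (stf L S (L - x))^2)"
    by (intro Bochner_Integration.integral_cong refl) (simp add: ctf_reflect)
  then show ?thesis using integrable_reflect_interval(2)[OF ct_integrable(2)] by (simp add: Pint_def)
qed

text \<open>The integrals of the squares of \<open>ctf + stf\<close> and \<open>ctf - stf\<close>
  are nonnegative. For |w| below q + 1 this bounds the normalisation factor P (q + 1) + Q w from
  below by a multiple of P.\<close>

lemma Qint_le: "\<bar>Qint L C S\<bar> \<le> Pint L S"
proof -
  have "0 \<le> (LINT x|leb L. (ctf L C S x + stf L S x)^2)" by simp
  also have "... = (LINT x|leb L. (ctf L C S x)^2 + (stf L S x)^2 + 2 * (ctf L C S x * stf L S x))"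
    by (intro Bochner_Integration.integral_cong refl) (simp add: power2_sum)
  also have "... = 2 * Pint L S + 2 * Qint L C S" using ct_integrable ct_square by (simp add: Pint_def Qint_def)
  finally have 1: "0 \<le> 2 * Pint L S + 2 * Qint L C S" .
  have "0 \<le> (LINT x|leb L. (ctf L C S x - stf L S x)^2)" by simp
  also have "... = (LINT x|leb L. (ctf L C S x)^2 + (stf L S x)^2 - 2 * (ctf L C S x * stf L S x))"
    by (intro Bochner_Integration.integral_cong refl) (simp add: power2_diff)
  also have "... = 2 * Pint L S - 2 * Qint L C S" using ct_integrable ct_square by (simp add: Pint_def Qint_def)
  finally show ?thesis using 1 by linarith
qed

lemma edge_form:
  assumes f: "\<And>x. x \<in> {0..L} \<Longrightarrow> f x = a * of_real (ctf L C S x) + b * of_real (stf L S x)"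
    and g: "\<And>x. x \<in> {0..L} \<Longrightarrow> g x = c * of_real (ctf L C S x) + d * of_real (stf L S x)"
  shows "(LINT x|leb L. cnj (f x) * g x)
    = of_real (Pint L S) * (cnj a * c + cnj b * d) + of_real (Qint L C S) * (cnj a * d + cnj b * c)"
proof -
  have "(LINT x|leb L. cnj (f x) * g x) = (LINT x|leb L. cnj a * c * of_real ((ctf L C S x)^2)
     + cnj b * d * of_real ((stf L S x)^2) + (cnj a * d + cnj b * c) * of_real (ctf L C S x * stf L S x))"
  proof (intro Bochner_Integration.integral_cong refl)
    fix x assume "x \<in> space (leb L)"
    then have x: "x \<in> {0..L}" by simp
    show "cnj (f x) * g x = cnj a * c * of_real ((ctf L C S x)^2)
     + cnj b * d * of_real ((stf L S x)^2) + (cnj a * d + cnj b * c) * of_real (ctf L C S x * stf L S x)"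
      unfolding f[OF x] g[OF x] by (simp add: power2_eq_square algebra_simps)
  qed
  also have "... = cnj a * c * of_real (LINT x|leb L. (ctf L C S x)^2)
     + cnj b * d * of_real (LINT x|leb L. (stf L S x)^2) + (cnj a * d + cnj b * c) * of_real (LINT x|leb L. ctf L C S x * stf L S x)"
  proof -
    have i: "integrable (leb L) (\<lambda>x. k * complex_of_real (h x))" "(LINT x|leb L. k * complex_of_real (h x)) = k * of_real (LINT x|leb L. h x)"
      if "integrable (leb L) h" for k h
      using that by auto
    show ?thesis
      using i[OF ct_integrable(1)] i[OF ct_integrable(2)] i[OF ct_integrable(3)]
      by (simp only: Bochner_Integration.integral_add Bochner_Integration.integrable_add)
  qed
  also have "... = of_real (Pint L S) * (cnj a * c + cnj b * d) + of_real (Qint L C S) * (cnj a * d + cnj b * c)"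
    unfolding ct_square Pint_def[symmetric] Qint_def[symmetric] by (simp add: algebra_simps)
  finally show ?thesis .
qed

text \<open>The end derivatives are the values of the Dirichlet-to-Neumann map.\<close>

lemma edge_solution:
  assumes f: "csol U L z f f1 (\<lambda>_. 0)"
  shows "x \<in> {0..L} \<Longrightarrow> f x = f 0 * of_real (ctf L C S x) + f L * of_real (stf L S x)"
    and "f1 0 = (f L - of_real (C L) * f 0) / of_real (S L)"
    and "f1 L = (of_real (C L) * f L - f 0) / of_real (S L)"
proof -
  obtain C1 S1 where "fundamental L U z (\<lambda>x. of_real (C x)) C1 (\<lambda>x. of_real (S x)) S1"
    by (rule fundamental_exists[OF C S])
  then interpret f: fundamental L U z "\<lambda>x. of_real (C x)" C1 "\<lambda>x. of_real (S x)" S1 .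
  have nz': "complex_of_real (S L) \<noteq> 0" using nz by simp
  have fL: "f L = f 0 * of_real (C L) + f1 0 * of_real (S L)" by (rule f.solution_rep(1)[OF f zero_L(2)])
  then show f10: "f1 0 = (f L - of_real (C L) * f 0) / of_real (S L)" using nz' by (simp add: field_simps)
  show "x \<in> {0..L} \<Longrightarrow> f x = f 0 * of_real (ctf L C S x) + f L * of_real (stf L S x)"
    using f.solution_rep(1)[OF f, of x] unfolding f10 using nz' by (simp add: ctf_def stf_def field_simps)
  have S1L: "S1 L = of_real (C L)" by (rule f.symmetric_data(2)[OF nz'])
  have C1L: "C1 L * of_real (S L) = of_real (C L) * of_real (C L) - 1" using f.symmetric_data(1) by (simp add: algebra_simps)
  have "f1 L * of_real (S L) = f 0 * (C1 L * of_real (S L)) + f1 0 * of_real (S L) * of_real (C L)"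
    using f.solution_rep(2)[OF f zero_L(2)] by (simp add: S1L algebra_simps)
  also have "f1 0 * of_real (S L) = f L - of_real (C L) * f 0" using f10 nz' by simp
  finally have "f1 L * of_real (S L) = of_real (C L) * f L - f 0" unfolding C1L by (simp add: algebra_simps)
  then show "f1 L = (of_real (C L) * f L - f 0) / of_real (S L)" using nz' by (simp add: field_simps)
qed

lemma edge_solution_exists:
  "\<exists>f1. csol U L z (\<lambda>x. a * of_real (ctf L C S x) + b * of_real (stf L S x)) f1 (\<lambda>_. 0)"
proof -
  obtain C1 S1 where "fundamental L U z (\<lambda>x. of_real (C x)) C1 (\<lambda>x. of_real (S x)) S1"
    by (rule fundamental_exists[OF C S])
  then interpret f: fundamental L U z "\<lambda>x. of_real (C x)" C1 "\<lambda>x. of_real (S x)" S1 .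
  have "csol U L z (\<lambda>x. a * of_real (C x) + (b - a * of_real (C L)) / of_real (S L) * of_real (S x))
     (\<lambda>x. a * C1 x + (b - a * of_real (C L)) / of_real (S L) * S1 x) (\<lambda>x. a * 0 + (b - a * of_real (C L)) / of_real (S L) * 0)"
    by (rule csol_lincomb[OF f.C(1) f.S(1)])
  moreover have "(\<lambda>x. a * complex_of_real (C x) + (b - a * of_real (C L)) / of_real (S L) * of_real (S x))
     = (\<lambda>x. a * of_real (ctf L C S x) + b * of_real (stf L S x))"
    by (rule ext) (simp add: ctf_def stf_def diff_divide_distrib algebra_simps)
  ultimately show ?thesis by auto
qed

end

end

section \<open>Finite quantum graphs and their vertex functions\<close>

locale qgraph = fgraph G q + sturm L U for G :: "'a ograph" and q L U +
  fixes \<alpha> :: real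
begin

abbreviation "E \<equiv> edges G"

lemma E_finite: "finite E"
proof -
  have "E \<subseteq> Pow V"
  proof
    fix e assume "e \<in> E"
    from ograph_edge(1,5,6)[OF simple this] show "e \<in> Pow V" by (metis PowI insert_subset empty_subsetI)
  qed
  then show ?thesis using finV by (meson finite_Pow_iff finite_subset)
qed

text \<open>Every edge is read in both directions, so orientation disappears from the sums that
  follow.\<close>

lemma sum_edges_bonds:
  fixes h :: "'a \<Rightarrow> 'a \<Rightarrow> 'b::comm_monoid_add"
  shows "(\<Sum>e\<in>E. h (org G e) (trm G e) + h (trm G e) (org G e)) = (\<Sum>x\<in>V. \<Sum>y\<in>nb x. h x y)"
proof -
  have o: "(\<Sum>e\<in>E. h (org G e) (trm G e)) = (\<Sum>v\<in>V. \<Sum>e | e \<in> E \<and> org G e = v. h v (trm G e))"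
  proof -
    have "(\<Sum>v\<in>V. \<Sum>e | e \<in> E \<and> org G e = v. h (org G e) (trm G e)) = (\<Sum>e\<in>E. h (org G e) (trm G e))"
      by (rule sum.group[OF E_finite finV]) (use ograph_edge(5)[OF simple] in auto)
    then show ?thesis by simp
  qed
  have t: "(\<Sum>e\<in>E. h (trm G e) (org G e)) = (\<Sum>v\<in>V. \<Sum>e | e \<in> E \<and> trm G e = v. h v (org G e))"
  proof -
    have "(\<Sum>v\<in>V. \<Sum>e | e \<in> E \<and> trm G e = v. h (trm G e) (org G e)) = (\<Sum>e\<in>E. h (trm G e) (org G e))"
      by (rule sum.group[OF E_finite finV]) (use ograph_edge(6)[OF simple] in auto)
    then show ?thesis by simp
  qed
  have "(\<Sum>e\<in>E. h (org G e) (trm G e) + h (trm G e) (org G e))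
     = (\<Sum>e\<in>E. h (org G e) (trm G e)) + (\<Sum>e\<in>E. h (trm G e) (org G e))" by (rule sum.distrib)
  also have "... = (\<Sum>v\<in>V. (\<Sum>e | e \<in> E \<and> org G e = v. h v (trm G e)) + (\<Sum>e | e \<in> E \<and> trm G e = v. h v (org G e)))"
    unfolding o t by (rule sum.distrib[symmetric])
  also have "... = (\<Sum>x\<in>V. \<Sum>y\<in>nb x. h x y)"
    by (intro sum.cong refl incident_sum(1)[OF simple] nb_fin)
  finally show ?thesis .
qed

lemma incident_edge_exists: "v \<in> V \<Longrightarrow> \<exists>e\<in>E. org G e = v \<or> trm G e = v"
proof -
  assume v: "v \<in> V"
  have "nb v \<noteq> {}" using nb_card[OF v] by (metis card.empty add_is_0 zero_neq_one)
  then obtain y where "y \<in> nb v" by blast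
  then have e: "{v, y} \<in> E" by (simp add: adj_def)
  from ograph_edge(1)[OF simple e] show ?thesis using e by (metis insertI1 insert_iff singletonD)
qed

definition eig :: "real \<Rightarrow> ('a set \<Rightarrow> real \<Rightarrow> complex) \<Rightarrow> bool" where
  "eig z \<psi> \<longleftrightarrow> (\<psi>, \<lambda>e x. complex_of_real z * \<psi> e x) \<in> quantum_graph_op L \<alpha> U G"

lemma qinner_finite: "qinner E L \<phi> \<psi> = (\<Sum>e\<in>E. LINT x|leb L. cnj (\<phi> e x) * \<psi> e x)"
  unfolding qinner_def by (rule infsum_finite[OF E_finite])

lemma qnorm_finite: "qnorm E L \<psi> = sqrt (\<Sum>e\<in>E. N2 L (\<psi> e))"
  unfolding qnorm_def N2_def by (subst infsum_finite[OF E_finite]) simp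

lemma qL2_iff: "\<psi> \<in> qL2 E L \<longleftrightarrow> (\<forall>e\<in>E. L2 L (\<psi> e))"
  unfolding qL2_def L2_def using E_finite by (auto intro: summable_on_finite)

text \<open>Green's formula on every edge leaves boundary terms; regrouped by vertices they cancel,
  because both functions are continuous there and satisfy the current condition with the same real
  \<alpha>.\<close>

lemma op_green:
  assumes "(\<psi>, \<eta>) \<in> quantum_graph_op L \<alpha> U G" "(\<phi>, \<zeta>) \<in> quantum_graph_op L \<alpha> U G"
  shows "qinner E L \<psi> \<zeta> = qinner E L \<eta> \<phi>"
proof -
  obtain \<psi>1 \<psi>2 where a: "\<forall>e\<in>E. W22_derivs L (\<psi> e) (\<psi>1 e) (\<psi>2 e) \<and>
                 (AE x in leb L. \<eta> e x = - \<psi>2 e x + complex_of_real (U x) * \<psi> e x)"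
     and ka: "kirchhoff G L \<alpha> \<psi> \<psi>1" and l2a: "\<psi> \<in> qL2 E L" "\<eta> \<in> qL2 E L"
    using assms(1) unfolding quantum_graph_op_def by blast
  obtain \<phi>1 \<phi>2 where b: "\<forall>e\<in>E. W22_derivs L (\<phi> e) (\<phi>1 e) (\<phi>2 e) \<and>
                 (AE x in leb L. \<zeta> e x = - \<phi>2 e x + complex_of_real (U x) * \<phi> e x)"
     and kb: "kirchhoff G L \<alpha> \<phi> \<phi>1" and l2b: "\<phi> \<in> qL2 E L" "\<zeta> \<in> qL2 E L"
    using assms(2) unfolding quantum_graph_op_def by blast
  obtain va where va: "\<And>v. v \<in> V \<Longrightarrow> (\<forall>e\<in>E. org G e = v \<longrightarrow> \<psi> e 0 = va v) \<and> (\<forall>e\<in>E. trm G e = v \<longrightarrow> \<psi> e L = va v) \<and>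
     (\<Sum>e | e \<in> E \<and> org G e = v. \<psi>1 e 0) - (\<Sum>e | e \<in> E \<and> trm G e = v. \<psi>1 e L) = complex_of_real \<alpha> * va v"
    using ka unfolding kirchhoff_def by blast
  obtain vb where vb: "\<And>v. v \<in> V \<Longrightarrow> (\<forall>e\<in>E. org G e = v \<longrightarrow> \<phi> e 0 = vb v) \<and> (\<forall>e\<in>E. trm G e = v \<longrightarrow> \<phi> e L = vb v) \<and>
     (\<Sum>e | e \<in> E \<and> org G e = v. \<phi>1 e 0) - (\<Sum>e | e \<in> E \<and> trm G e = v. \<phi>1 e L) = complex_of_real \<alpha> * vb v"
    using kb unfolding kirchhoff_def by blast
  have oe: "org G e \<in> V" "trm G e \<in> V" if "e \<in> E" for e using ograph_edge(5,6)[OF simple that] .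
  have edge: "(LINT x|leb L. cnj (\<psi> e x) * \<zeta> e x) - (LINT x|leb L. cnj (\<eta> e x) * \<phi> e x)
     = (cnj (\<psi>1 e L) * vb (trm G e) - cnj (va (trm G e)) * \<phi>1 e L) - (cnj (\<psi>1 e 0) * vb (org G e) - cnj (va (org G e)) * \<phi>1 e 0)"
    if e: "e \<in> E" for e
  proof -
    have w: "W22_derivs L (\<psi> e) (\<psi>1 e) (\<psi>2 e)" "W22_derivs L (\<phi> e) (\<phi>1 e) (\<phi>2 e)" using a b e by blast+
    have ae: "AE x in leb L. \<eta> e x = - \<psi>2 e x + complex_of_real (U x) * \<psi> e x"
      "AE x in leb L. \<zeta> e x = - \<phi>2 e x + complex_of_real (U x) * \<phi> e x" using a b e by blast+
    have l: "L2 L (\<psi> e)" "L2 L (\<eta> e)" "L2 L (\<phi> e)" "L2 L (\<zeta> e)" "L2 L (\<psi>2 e)" "L2 L (\<phi>2 e)"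
      using l2a l2b e W22_L2[OF w(1)] W22_L2[OF w(2)] by (auto simp: qL2_iff)
    have "(LINT x|leb L. cnj (\<psi> e x) * \<zeta> e x) - (LINT x|leb L. cnj (\<eta> e x) * \<phi> e x)
       = (LINT x|leb L. cnj (\<psi> e x) * \<zeta> e x - cnj (\<eta> e x) * \<phi> e x)"
      by (rule Bochner_Integration.integral_diff[symmetric]) (intro L2_product_integrable l)+
    also have "... = (LINT x|leb L. cnj (\<psi>2 e x) * \<phi> e x - cnj (\<psi> e x) * \<phi>2 e x)"
    proof (rule integral_cong_AE)
      show "(\<lambda>x. cnj (\<psi> e x) * \<zeta> e x - cnj (\<eta> e x) * \<phi> e x) \<in> borel_measurable (leb L)"
        using L2_product_integrable[OF l(1,4)] L2_product_integrable[OF l(2,3)] by auto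
      show "(\<lambda>x. cnj (\<psi>2 e x) * \<phi> e x - cnj (\<psi> e x) * \<phi>2 e x) \<in> borel_measurable (leb L)"
        using L2_product_integrable[OF l(5,3)] L2_product_integrable[OF l(1,6)] by auto
      show "AE x in leb L. cnj (\<psi> e x) * \<zeta> e x - cnj (\<eta> e x) * \<phi> e x = cnj (\<psi>2 e x) * \<phi> e x - cnj (\<psi> e x) * \<phi>2 e x"
        using ae
      proof eventually_elim
        case (elim x)
        show ?case unfolding elim by (simp add: algebra_simps)
      qed
    qed
    also have "... = (LINT x|leb L. cnj (\<psi>2 e x) * \<phi> e x) - (LINT x|leb L. cnj (\<psi> e x) * \<phi>2 e x)"
      by (rule Bochner_Integration.integral_diff) (intro L2_product_integrable l)+
    also have "... = (cnj (\<psi>1 e L) * \<phi> e L - cnj (\<psi> e L) * \<phi>1 e L) - (cnj (\<psi>1 e 0) * \<phi> e 0 - cnj (\<psi> e 0) * \<phi>1 e 0)"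
      by (rule W22_green[OF Lpos W22_cnj[OF w(1)] w(2)])
    also have "\<phi> e L = vb (trm G e)" using vb[OF oe(2)[OF e]] e by blast
    also have "\<phi> e 0 = vb (org G e)" using vb[OF oe(1)[OF e]] e by blast
    also have "\<psi> e L = va (trm G e)" using va[OF oe(2)[OF e]] e by blast
    also have "\<psi> e 0 = va (org G e)" using va[OF oe(1)[OF e]] e by blast
    finally show ?thesis .
  qed
  have "qinner E L \<psi> \<zeta> - qinner E L \<eta> \<phi> = (\<Sum>e\<in>E. (cnj (\<psi>1 e L) * vb (trm G e) - cnj (va (trm G e)) * \<phi>1 e L)
      - (cnj (\<psi>1 e 0) * vb (org G e) - cnj (va (org G e)) * \<phi>1 e 0))"
    unfolding qinner_finite sum_subtractf[symmetric] by (intro sum.cong refl edge)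
  also have "... = (\<Sum>e\<in>E. cnj (\<psi>1 e L) * vb (trm G e) - cnj (va (trm G e)) * \<phi>1 e L)
      - (\<Sum>e\<in>E. cnj (\<psi>1 e 0) * vb (org G e) - cnj (va (org G e)) * \<phi>1 e 0)"
    by (rule sum_subtractf)
  also have "(\<Sum>e\<in>E. cnj (\<psi>1 e L) * vb (trm G e) - cnj (va (trm G e)) * \<phi>1 e L)
     = (\<Sum>v\<in>V. \<Sum>e | e \<in> E \<and> trm G e = v. cnj (\<psi>1 e L) * vb (trm G e) - cnj (va (trm G e)) * \<phi>1 e L)"
    by (rule sum.group[OF E_finite finV, symmetric]) (use oe in auto)
  also have "... = (\<Sum>v\<in>V. vb v * cnj (\<Sum>e | e \<in> E \<and> trm G e = v. \<psi>1 e L) - cnj (va v) * (\<Sum>e | e \<in> E \<and> trm G e = v. \<phi>1 e L))"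
    by (intro sum.cong refl) (simp add: sum_subtractf sum_distrib_left mult.commute)
  also have "(\<Sum>e\<in>E. cnj (\<psi>1 e 0) * vb (org G e) - cnj (va (org G e)) * \<phi>1 e 0)
     = (\<Sum>v\<in>V. \<Sum>e | e \<in> E \<and> org G e = v. cnj (\<psi>1 e 0) * vb (org G e) - cnj (va (org G e)) * \<phi>1 e 0)"
    by (rule sum.group[OF E_finite finV, symmetric]) (use oe in auto)
  also have "... = (\<Sum>v\<in>V. vb v * cnj (\<Sum>e | e \<in> E \<and> org G e = v. \<psi>1 e 0) - cnj (va v) * (\<Sum>e | e \<in> E \<and> org G e = v. \<phi>1 e 0))"
    by (intro sum.cong refl) (simp add: sum_subtractf sum_distrib_left mult.commute)
  finally have "qinner E L \<psi> \<zeta> - qinner E L \<eta> \<phi> = (\<Sum>v\<in>V.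
      (vb v * cnj (\<Sum>e | e \<in> E \<and> trm G e = v. \<psi>1 e L) - cnj (va v) * (\<Sum>e | e \<in> E \<and> trm G e = v. \<phi>1 e L))
      - (vb v * cnj (\<Sum>e | e \<in> E \<and> org G e = v. \<psi>1 e 0) - cnj (va v) * (\<Sum>e | e \<in> E \<and> org G e = v. \<phi>1 e 0)))"
    unfolding sum_subtractf .
  also have "... = (\<Sum>v\<in>V. 0)"
  proof (rule sum.cong[OF refl])
    fix v assume v: "v \<in> V"
    define so st po pt where "so = (\<Sum>e | e \<in> E \<and> org G e = v. \<psi>1 e 0)" and "st = (\<Sum>e | e \<in> E \<and> trm G e = v. \<psi>1 e L)"
      and "po = (\<Sum>e | e \<in> E \<and> org G e = v. \<phi>1 e 0)" and "pt = (\<Sum>e | e \<in> E \<and> trm G e = v. \<phi>1 e L)"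
    have 1: "so - st = of_real \<alpha> * va v" using va[OF v] unfolding so_def st_def by blast
    have 2: "po - pt = of_real \<alpha> * vb v" using vb[OF v] unfolding po_def pt_def by blast
    have "(vb v * cnj st - cnj (va v) * pt) - (vb v * cnj so - cnj (va v) * po) = cnj (va v) * (po - pt) - vb v * cnj (so - st)"
      by (simp add: algebra_simps)
    also have "... = 0" unfolding 1 2 by simp
    finally show "(vb v * cnj (\<Sum>e | e \<in> E \<and> trm G e = v. \<psi>1 e L) - cnj (va v) * (\<Sum>e | e \<in> E \<and> trm G e = v. \<phi>1 e L))
      - (vb v * cnj (\<Sum>e | e \<in> E \<and> org G e = v. \<psi>1 e 0) - cnj (va v) * (\<Sum>e | e \<in> E \<and> org G e = v. \<phi>1 e 0)) = 0"
      unfolding so_def st_def po_def pt_def .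
  qed
  finally show ?thesis by simp
qed

lemma qinner_scale_right: "qinner E L \<phi> (\<lambda>e x. c * \<psi> e x) = c * qinner E L \<phi> \<psi>"
  unfolding qinner_finite sum_distrib_left by (intro sum.cong refl) (simp add: mult.left_commute)

lemma qinner_scale_left: "qinner E L (\<lambda>e x. c * \<phi> e x) \<psi> = cnj c * qinner E L \<phi> \<psi>"
  unfolding qinner_finite sum_distrib_left by (intro sum.cong refl) (simp add: mult.assoc)

lemma eig_orthogonal:
  assumes "eig z \<psi>" "eig z' \<phi>" "z \<noteq> z'" shows "qinner E L \<psi> \<phi> = 0"
proof -
  have "of_real z' * qinner E L \<psi> \<phi> = of_real z * qinner E L \<psi> \<phi>"
    using op_green[OF assms(1,2)[unfolded eig_def]] by (simp add: qinner_scale_right qinner_scale_left)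
  then show ?thesis using assms(3) by simp
qed

context
  fixes z :: real and C S :: "real \<Rightarrow> real"
  assumes C: "solves_ivp L U z 1 0 C" and S: "solves_ivp L U z 0 1 S" and nz: "S L \<noteq> 0"
begin

abbreviation "w \<equiv> (real q + 1) * C L + \<alpha> * S L"

definition spread :: "('a \<Rightarrow> complex) \<Rightarrow> 'a set \<Rightarrow> real \<Rightarrow> complex" where
  "spread f e x = f (org G e) * of_real (ctf L C S x) + f (trm G e) * of_real (stf L S x)"

text \<open>The current condition multiplied by \<open>S L\<close> becomes a sum over neighbours; C
  L and \<alpha> only enter the eigenvalue w.\<close>

lemma vertex_condition_iff:
  assumes v: "v \<in> V"
  shows "(\<Sum>e | e \<in> E \<and> org G e = v. (f (trm G e) - of_real (C L) * f (org G e)) / of_real (S L))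
     - (\<Sum>e | e \<in> E \<and> trm G e = v. (of_real (C L) * f (trm G e) - f (org G e)) / of_real (S L)) = complex_of_real \<alpha> * f v
   \<longleftrightarrow> (\<Sum>y\<in>nb v. f y) = of_real w * f v"
proof -
  have nz': "complex_of_real (S L) \<noteq> 0" using nz by simp
  show ?thesis
    using incident_current[OF simple nb_fin, where v = v and y = f and c = "of_real (C L)" and s = "of_real (S L)" and p = "\<lambda>_. 0" and r = "\<lambda>_. 0" and \<theta> = "\<lambda>_. 0"]
      nz' nb_card[OF v] by (simp add: divide_eq_eq) (simp add: algebra_simps)
qed

lemma eig_spread:
  assumes "eig z \<psi>"
  obtains f where "eigenfn (of_real w) f" "\<And>e x. e \<in> E \<Longrightarrow> x \<in> {0..L} \<Longrightarrow> \<psi> e x = spread f e x"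
proof -
  obtain \<psi>1 \<psi>2 where a: "\<forall>e\<in>E. W22_derivs L (\<psi> e) (\<psi>1 e) (\<psi>2 e) \<and>
                 (AE x in leb L. of_real z * \<psi> e x = - \<psi>2 e x + complex_of_real (U x) * \<psi> e x)"
     and ka: "kirchhoff G L \<alpha> \<psi> \<psi>1"
    using assms unfolding eig_def quantum_graph_op_def by blast
  obtain f where va: "\<And>v. v \<in> V \<Longrightarrow> (\<forall>e\<in>E. org G e = v \<longrightarrow> \<psi> e 0 = f v) \<and> (\<forall>e\<in>E. trm G e = v \<longrightarrow> \<psi> e L = f v) \<and>
     (\<Sum>e | e \<in> E \<and> org G e = v. \<psi>1 e 0) - (\<Sum>e | e \<in> E \<and> trm G e = v. \<psi>1 e L) = complex_of_real \<alpha> * f v"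
    using ka unfolding kirchhoff_def by blast
  have vals: "\<psi> e 0 = f (org G e)" "\<psi> e L = f (trm G e)" if "e \<in> E" for e
    using va ograph_edge(5,6)[OF simple that] that by blast+
  have cs: "csol U L z (\<psi> e) (\<psi>1 e) (\<lambda>_. 0)" if "e \<in> E" for e
  proof -
    have w: "W22_derivs L (\<psi> e) (\<psi>1 e) (\<psi>2 e)"
      and ae: "AE x in leb L. of_real z * \<psi> e x = - \<psi>2 e x + complex_of_real (U x) * \<psi> e x" using a that by blast+
    from ae have "AE x in leb L. - \<psi>2 e x + of_real (U x) * \<psi> e x = of_real z * \<psi> e x + 0"
      by eventually_elim simp
    then show ?thesis using w unfolding csol_def by blast
  qed
  have "\<psi> e x = spread f e x" if "e \<in> E" "x \<in> {0..L}" for e x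
    using edge_solution(1)[OF C S nz cs[OF that(1)] that(2)] vals[OF that(1)] by (simp add: spread_def)
  moreover have "eigenfn (of_real w) f"
    unfolding eigenfn_def
  proof
    fix v assume v: "v \<in> V"
    have "(\<Sum>e | e \<in> E \<and> org G e = v. \<psi>1 e 0) = (\<Sum>e | e \<in> E \<and> org G e = v. (f (trm G e) - of_real (C L) * f (org G e)) / of_real (S L))"
      using edge_solution(2)[OF C S nz cs] vals by (intro sum.cong refl) simp
    moreover have "(\<Sum>e | e \<in> E \<and> trm G e = v. \<psi>1 e L) = (\<Sum>e | e \<in> E \<and> trm G e = v. (of_real (C L) * f (trm G e) - f (org G e)) / of_real (S L))"
      using edge_solution(3)[OF C S nz cs] vals by (intro sum.cong refl) simp
    ultimately show "(\<Sum>y\<in>nb v. f y) = of_real w * f v"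
      using va[OF v] vertex_condition_iff[OF v, of f] by presburger
  qed
  ultimately show ?thesis using that by blast
qed

text \<open>The converse of \<open>eig_spread\<close>. It serves the lower bound for the number of
  eigenvalues in the window, where quantum eigenfunctions must be produced from discrete
  ones.\<close>

lemma spread_eig:
  assumes e: "eigenfn (of_real w) f"
  shows "eig z (spread f)"
proof -
  have "\<forall>e. \<exists>f1. csol U L z (spread f e) f1 (\<lambda>_. 0)"
    unfolding spread_def using edge_solution_exists[OF C S nz] by blast
  then obtain \<psi>1 where cs: "\<And>e. csol U L z (spread f e) (\<psi>1 e) (\<lambda>_. 0)" by metis
  then have "\<forall>e. \<exists>f2. W22_derivs L (spread f e) (\<psi>1 e) f2 \<and>
     (AE x in leb L. - f2 x + of_real (U x) * spread f e x = of_real z * spread f e x + 0)"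
    unfolding csol_def by blast
  from choice[OF this] obtain \<psi>2 where w2: "\<And>e. W22_derivs L (spread f e) (\<psi>1 e) (\<psi>2 e)"
     and ae: "\<And>e. AE x in leb L. - \<psi>2 e x + of_real (U x) * spread f e x = of_real z * spread f e x + 0"
    by blast
  have ends: "spread f e 0 = f (org G e)" "spread f e L = f (trm G e)" for e
    using ends[OF C S nz] by (simp_all add: spread_def)
  have l2: "L2 L (spread f e)" for e using L2_continuous[OF csol_continuous(1)[OF cs]] .
  have "kirchhoff G L \<alpha> (spread f) \<psi>1"
    unfolding kirchhoff_def
  proof (intro exI[of _ f] ballI conjI impI)
    fix v assume v: "v \<in> V"
    have "(\<Sum>e | e \<in> E \<and> org G e = v. \<psi>1 e 0) = (\<Sum>e | e \<in> E \<and> org G e = v. (f (trm G e) - of_real (C L) * f (org G e)) / of_real (S L))"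
      using edge_solution(2)[OF C S nz cs] ends by (intro sum.cong refl) simp
    moreover have "(\<Sum>e | e \<in> E \<and> trm G e = v. \<psi>1 e L) = (\<Sum>e | e \<in> E \<and> trm G e = v. (of_real (C L) * f (trm G e) - f (org G e)) / of_real (S L))"
      using edge_solution(3)[OF C S nz cs] ends by (intro sum.cong refl) simp
    moreover have "(\<Sum>y\<in>nb v. f y) = of_real w * f v" using e v unfolding eigenfn_def by blast
    ultimately show "(\<Sum>e | e \<in> E \<and> org G e = v. \<psi>1 e 0) - (\<Sum>e | e \<in> E \<and> trm G e = v. \<psi>1 e L) = complex_of_real \<alpha> * f v"
      using vertex_condition_iff[OF v, of f] by presburger
  qed (auto simp: ends)
  moreover have "\<forall>e\<in>E. W22_derivs L (spread f e) (\<psi>1 e) (\<psi>2 e) \<and>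
      (AE x in leb L. of_real z * spread f e x = - \<psi>2 e x + of_real (U x) * spread f e x)"
  proof (intro ballI conjI)
    fix e show "W22_derivs L (spread f e) (\<psi>1 e) (\<psi>2 e)" by (rule w2)
    show "AE x in leb L. of_real z * spread f e x = - \<psi>2 e x + of_real (U x) * spread f e x"
      using ae[of e] by eventually_elim simp
  qed
  moreover have "spread f \<in> qL2 E L" "(\<lambda>e x. of_real z * spread f e x) \<in> qL2 E L"
    by (auto simp: qL2_iff intro: l2 L2_scale)
  ultimately show ?thesis unfolding eig_def quantum_graph_op_def by blast
qed

text \<open>The factor is common to all eigenfunctions with the same z, so orthogonality at equal
  eigenvalues passes to the vertex functions.\<close>

lemma spread_inner:
  assumes "\<And>e x. e \<in> E \<Longrightarrow> x \<in> {0..L} \<Longrightarrow> \<psi> e x = spread f e x" "\<And>e x. e \<in> E \<Longrightarrow> x \<in> {0..L} \<Longrightarrow> \<phi> e x = spread g e x"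
    and g: "eigenfn (of_real w) g"
  shows "qinner E L \<psi> \<phi> = of_real (Pint L S * (real q + 1) + Qint L C S * w) * ip V f g"
proof -
  let ?h = "\<lambda>x y. of_real (Pint L S) * (cnj (f x) * g x) + of_real (Qint L C S) * (cnj (f x) * g y)"
  have "qinner E L \<psi> \<phi> = (\<Sum>e\<in>E. ?h (org G e) (trm G e) + ?h (trm G e) (org G e))"
    unfolding qinner_finite
  proof (intro sum.cong refl)
    fix e assume e: "e \<in> E"
    have "(LINT x|leb L. cnj (\<psi> e x) * \<phi> e x)
      = of_real (Pint L S) * (cnj (f (org G e)) * g (org G e) + cnj (f (trm G e)) * g (trm G e))
        + of_real (Qint L C S) * (cnj (f (org G e)) * g (trm G e) + cnj (f (trm G e)) * g (org G e))"
      by (rule edge_form[OF C S nz]) (use assms e in \<open>simp_all add: spread_def\<close>)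
    then show "(LINT x|leb L. cnj (\<psi> e x) * \<phi> e x) = ?h (org G e) (trm G e) + ?h (trm G e) (org G e)"
      by (simp add: algebra_simps)
  qed
  also have "... = (\<Sum>x\<in>V. \<Sum>y\<in>nb x. ?h x y)" by (rule sum_edges_bonds)
  also have "... = of_real (Pint L S) * (\<Sum>x\<in>V. \<Sum>y\<in>nb x. cnj (f x) * g x) + of_real (Qint L C S) * (\<Sum>x\<in>V. \<Sum>y\<in>nb x. cnj (f x) * g y)"
    by (simp only: sum.distrib sum_distrib_left)
  also have "(\<Sum>x\<in>V. \<Sum>y\<in>nb x. cnj (f x) * g x) = of_nat (q + 1) * ip V f g" unfolding sum_bond_origin ip_def ..
  also have "(\<Sum>x\<in>V. \<Sum>y\<in>nb x. cnj (f x) * g y) = of_real w * ip V f g" by (rule sum_cross_eigen[OF g])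
  finally show ?thesis by (simp add: algebra_simps)
qed

lemma spread_weighted:
  fixes a :: "'a set \<Rightarrow> real"
  assumes "\<And>e x. e \<in> E \<Longrightarrow> x \<in> {0..L} \<Longrightarrow> \<psi> e x = spread f e x"
  shows "(\<Sum>e\<in>E. a e * N2 L (\<psi> e)) = Pint L S * diagX (\<lambda>x y. a {x, y}) f + Qint L C S * offZ (\<lambda>x y. a {x, y}) f"
proof -
  let ?h = "\<lambda>x y. Pint L S * (a {x, y} * (cmod (f x))^2) + Qint L C S * (a {x, y} * Re (cnj (f x) * f y))"
  have "(\<Sum>e\<in>E. a e * N2 L (\<psi> e)) = (\<Sum>e\<in>E. ?h (org G e) (trm G e) + ?h (trm G e) (org G e))"
  proof (intro sum.cong refl)
    fix e assume e: "e \<in> E"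
    have ee: "{org G e, trm G e} = e" "{trm G e, org G e} = e" using ograph_edge(1)[OF simple e] by auto
    have "complex_of_real (N2 L (\<psi> e)) = (LINT x|leb L. cnj (\<psi> e x) * \<psi> e x)"
      unfolding N2_def by (subst integral_complex_of_real[symmetric]) (intro Bochner_Integration.integral_cong refl, simp add: complex_norm_square mult.commute del: of_real_power)
    also have "... = of_real (Pint L S) * (cnj (f (org G e)) * f (org G e) + cnj (f (trm G e)) * f (trm G e))
        + of_real (Qint L C S) * (cnj (f (org G e)) * f (trm G e) + cnj (f (trm G e)) * f (org G e))"
      by (rule edge_form[OF C S nz]) (use assms e in \<open>simp_all add: spread_def\<close>)
    finally have c: "complex_of_real (N2 L (\<psi> e)) = of_real (Pint L S) * (cnj (f (org G e)) * f (org G e) + cnj (f (trm G e)) * f (trm G e))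
        + of_real (Qint L C S) * (cnj (f (org G e)) * f (trm G e) + cnj (f (trm G e)) * f (org G e))" .
    have rm: "Re (of_real r * u) = r * Re u" for r u by simp
    have sq: "Re (cnj u * u) = (cmod u)^2" for u unfolding cmod_power2 by (simp add: power2_eq_square)
    have "N2 L (\<psi> e) = Pint L S * ((cmod (f (org G e)))^2 + (cmod (f (trm G e)))^2)
        + Qint L C S * (Re (cnj (f (org G e)) * f (trm G e)) + Re (cnj (f (trm G e)) * f (org G e)))"
      using arg_cong[OF c, of Re] by (simp only: Re_complex_of_real plus_complex.simps rm sq)
    then show "a e * N2 L (\<psi> e) = ?h (org G e) (trm G e) + ?h (trm G e) (org G e)"
      unfolding ee by (simp add: algebra_simps)
  qed
  also have "... = (\<Sum>x\<in>V. \<Sum>y\<in>nb x. ?h x y)" by (rule sum_edges_bonds)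
  also have "... = Pint L S * diagX (\<lambda>x y. a {x, y}) f + Qint L C S * offZ (\<lambda>x y. a {x, y}) f"
    unfolding diagX_def offZ_def by (simp only: sum.distrib sum_distrib_left)
  finally show ?thesis .
qed

end

end

lemma N2_eq_0:
  assumes L: "L > 0" and c: "continuous_on {0..L} f" and z: "N2 L f = 0" and x: "x \<in> {0..L}"
  shows "f x = 0"
proof -
  have "continuous_on {0..L} (\<lambda>x. (cmod (f x))^2)" by (intro continuous_intros c)
  from integralL_eq_0_iff[OF this L] z x show ?thesis by (auto simp: N2_def)
qed

lemma two_sqrt_less: "q \<ge> 2 \<Longrightarrow> 2 * sqrt (real q) < real q + 1"
proof -
  assume q: "q \<ge> 2"
  have "sqrt (real q) > 1" using q by simp
  then have "(sqrt (real q) - 1)^2 > 0" by simp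
  moreover have "(sqrt (real q) - 1)^2 = real q + 1 - 2 * sqrt (real q)" by (simp add: power2_diff)
  ultimately show ?thesis by simp
qed

context qgraph begin

lemma diagX_scale: "diagX \<kappa> (\<lambda>x. c * f x) = (cmod c)^2 * diagX \<kappa> f"
  unfolding diagX_def sum_distrib_left by (intro sum.cong refl) (simp add: norm_mult power_mult_distrib mult_ac)

lemma offZ_scale: "offZ \<kappa> (\<lambda>x. c * f x) = (cmod c)^2 * offZ \<kappa> f"
proof -
  have "Re (cnj (c * u) * (c * v)) = (cmod c)^2 * Re (cnj u * v)" for u v
  proof -
    have "cnj (c * u) * (c * v) = of_real ((cmod c)^2) * (cnj u * v)"
      by (simp only: complex_norm_square complex_cnj_mult mult_ac)
    then show ?thesis by (simp only:) simp
  qed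
  then show ?thesis unfolding offZ_def sum_distrib_left
    by (intro sum.cong refl) (simp only: mult.left_commute)
qed

lemma eigenfn_scale: "eigenfn m f \<Longrightarrow> eigenfn m (\<lambda>x. c * f x)"
  unfolding eigenfn_def by (simp add: sum_distrib_left[symmetric] del: Image_singleton_iff)

lemma eigenfn_orthogonal:
  assumes "eigenfn (of_real a) f" "eigenfn (of_real b) g" "a \<noteq> b" shows "ip V f g = 0"
proof -
  have "of_real b * ip V f g = (\<Sum>x\<in>V. \<Sum>y\<in>nb x. cnj (f x) * g y)" by (rule sum_cross_eigen[OF assms(2), symmetric])
  also have "... = (\<Sum>x\<in>V. \<Sum>y\<in>nb x. cnj (f y) * g x)" by (rule sum_bond_swap)
  also have "... = cnj (\<Sum>x\<in>V. \<Sum>y\<in>nb x. cnj (g x) * f y)" by (simp add: mult.commute)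
  also have "... = cnj (of_real a * ip V g f)" by (simp only: sum_cross_eigen[OF assms(1)])
  also have "... = of_real a * ip V f g" by (simp add: cnj_ip)
  finally show ?thesis using assms(3) by simp
qed

end

section \<open>Eigenfunctions in a spectral window\<close>

locale window = qgraph +
  fixes C S :: "real \<Rightarrow> real \<Rightarrow> real" and I :: "real set" and \<psi> :: "nat \<Rightarrow> 'a set \<Rightarrow> real \<Rightarrow> complex" and lam :: "nat \<Rightarrow> real"
  assumes C: "\<And>z. solves_ivp L U z 1 0 (C z)" and S: "\<And>z. solves_ivp L U z 0 1 (S z)"
    and nz: "\<And>z. z \<in> I \<Longrightarrow> S z L \<noteq> 0" and w: "\<And>z. z \<in> I \<Longrightarrow> \<bar>band_function q \<alpha> L C S z\<bar> \<le> 2 * sqrt (real q)"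
    and inj: "inj_on (band_function q \<alpha> L C S) I"
    and ob: "orthonormal_basis E L \<psi>" and ei: "\<And>n. eig (lam n) (\<psi> n)"
begin

text \<open>The last clause, which counts discrete eigenfunctions, is where completeness of \<psi>
  enters; the others only need orthonormality and the eigenvalue equation. The constants p n and r n
  absorb the normalisation of the vertex functions.\<close>

lemma band_reduction:
  obtains f p r where "finite {n. lam n \<in> I}" "orthonormal_on V {n. lam n \<in> I} f"
    "\<And>n. lam n \<in> I \<Longrightarrow> eigenfn (of_real (band_function q \<alpha> L C S (lam n))) (f n)"
    "\<And>n. lam n \<in> I \<Longrightarrow> \<bar>p n\<bar> \<le> 1 / (real q + 1 - 2 * sqrt (real q)) \<and> \<bar>r n\<bar> \<le> 1 / (real q + 1 - 2 * sqrt (real q))"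
    "\<And>n a. lam n \<in> I \<Longrightarrow> (\<Sum>e\<in>E. a e * N2 L (\<psi> n e)) = p n * diagX (\<lambda>x y. a {x, y}) (f n) + r n * offZ (\<lambda>x y. a {x, y}) (f n)"
    "\<And>\<phi> \<mu>. orthonormal_on V {..<card V} \<phi> \<Longrightarrow> (\<And>j. j < card V \<Longrightarrow> eigenfn (of_real (\<mu> j)) (\<phi> j)) \<Longrightarrow>
       card {j. j < card V \<and> \<mu> j \<in> band_function q \<alpha> L C S ` I} \<le> card {n. lam n \<in> I}"
proof -
  define W where "W = band_function q \<alpha> L C S"
  have Wz: "(real q + 1) * C z L + \<alpha> * S z L = W z" for z by (simp add: W_def band_function_def)
  define In where "In = {n. lam n \<in> I}"
  define c where "c = real q + 1 - 2 * sqrt (real q)"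
  have c0: "c > 0" using two_sqrt_less[OF q2] by (simp add: c_def)
  define D where "D z = Pint L (S z) * (real q + 1) + Qint L (C z) (S z) * W z" for z
  have "\<exists>g. eigenfn (of_real (W (lam n))) g \<and> (\<forall>e\<in>E. \<forall>x\<in>{0..L}. \<psi> n e x = spread (C (lam n)) (S (lam n)) g e x)" if "n \<in> In" for n
    using eig_spread[OF C S _ ei, of n] nz that unfolding In_def Wz by (metis mem_Collect_eq)
  then obtain g where ge: "\<And>n. n \<in> In \<Longrightarrow> eigenfn (of_real (W (lam n))) (g n)"
    and gr: "\<And>n e x. n \<in> In \<Longrightarrow> e \<in> E \<Longrightarrow> x \<in> {0..L} \<Longrightarrow> \<psi> n e x = spread (C (lam n)) (S (lam n)) (g n) e x" by metis
  have on: "qinner E L (\<psi> m) (\<psi> n) = (if m = n then 1 else 0)" for m n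
    using ob unfolding orthonormal_basis_def by blast
  have inner: "qinner E L (\<psi> m) (\<psi> n) = of_real (D (lam n)) * ip V (g m) (g n)" if "m \<in> In" "n \<in> In" "lam m = lam n" for m n
  proof -
    have nz': "S (lam n) L \<noteq> 0" using nz that by (simp add: In_def)
    show ?thesis unfolding D_def Wz[symmetric]
      by (rule spread_inner[OF C S nz']) (use gr[of m] gr[of n] ge[of n] that in \<open>simp_all add: Wz\<close>)
  qed
  have Dn: "D (lam n) * ns V (g n) = 1" if "n \<in> In" for n
  proof -
    have "complex_of_real (D (lam n) * ns V (g n)) = 1" using inner[OF that that] on[of n n] by (simp add: ip_self)
    then show ?thesis by (simp only: of_real_eq_1_iff)
  qed
  have gpos: "ns V (g n) > 0" if "n \<in> In" for n
    using Dn[OF that] ns_nonneg[of V "g n"] by (metis less_eq_real_def mult_zero_right zero_neq_one)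
  \<comment> \<open>Two reasons: at equal eigenvalues the edge and vertex inner products are
    proportional with a nonzero factor; at different ones injectivity of the band function gives
    different adjacency eigenvalues.\<close>
  have gorth: "ip V (g m) (g n) = 0" if mn: "m \<in> In" "n \<in> In" "m \<noteq> n" for m n
  proof (cases "lam m = lam n")
    case True
    then have "of_real (D (lam n)) * ip V (g m) (g n) = 0" using inner[OF mn(1,2) True] on[of m n] mn by simp
    moreover have "D (lam n) \<noteq> 0" using Dn[OF mn(2)] by auto
    ultimately show ?thesis by simp
  next
    case False
    then have "W (lam m) \<noteq> W (lam n)" using inj mn unfolding In_def W_def inj_on_def by blast
    then show ?thesis by (rule eigenfn_orthogonal[OF ge[OF mn(1)] ge[OF mn(2)]])
  qed
  define f where "f n x = of_real (1 / sqrt (ns V (g n))) * g n x" for n x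
  have o: "orthonormal_on V In f"
    unfolding orthonormal_on_def
  proof (intro ballI)
    fix m n assume mn: "m \<in> In" "n \<in> In"
    have "ip V (f m) (f n) = of_real (1 / sqrt (ns V (g m)) * (1 / sqrt (ns V (g n)))) * ip V (g m) (g n)"
      unfolding ip_def f_def sum_distrib_left by (intro sum.cong refl) simp
    then show "ip V (f m) (f n) = (if m = n then 1 else 0)"
      using gorth[OF mn] gpos[OF mn(1)] by (auto simp: ip_self simp flip: of_real_mult)
  qed
  have fe: "eigenfn (of_real (W (lam n))) (f n)" if "n \<in> In" for n
    unfolding f_def by (rule eigenfn_scale[OF ge[OF that]])
  have fin: "finite In"
  proof (rule ccontr)
    assume "infinite In"
    then obtain J where J: "J \<subseteq> In" "finite J" "card J = Suc (card V)" using infinite_arbitrarily_large by metis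
    have "orthonormal_on V J f" using o J(1) unfolding orthonormal_on_def by blast
    from orthonormal_on_card_le[OF finV J(2) this] J(3) show False by simp
  qed
  have gf: "g n = (\<lambda>x. of_real (sqrt (ns V (g n))) * f n x)" if "n \<in> In" for n
    using gpos[OF that] by (intro ext) (simp add: f_def)
  define p where "p n = Pint L (S (lam n)) * ns V (g n)" for n
  define r where "r n = Qint L (C (lam n)) (S (lam n)) * ns V (g n)" for n
  have pr: "\<bar>p n\<bar> \<le> 1 / c \<and> \<bar>r n\<bar> \<le> 1 / c" if n: "n \<in> In" for n
  proof -
    have nI: "lam n \<in> I" using n by (simp add: In_def)
    note QP = Qint_le[OF C S nz[OF nI]]
    have P0: "Pint L (S (lam n)) \<ge> 0" using QP by linarith
    \<comment> \<open>In the band |w| is at most 2 sqrt q, so D exceeds P times c, where c = q + 1 -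
      2 sqrt q; this bounds p n by 1 / c.\<close>
    have "\<bar>Qint L (C (lam n)) (S (lam n)) * W (lam n)\<bar> \<le> Pint L (S (lam n)) * (2 * sqrt (real q))"
      unfolding abs_mult using QP w[OF nI] P0 by (intro mult_mono) (auto simp: W_def)
    then have "Pint L (S (lam n)) * c \<le> D (lam n)" unfolding D_def c_def by (simp add: algebra_simps abs_le_iff)
    then have "Pint L (S (lam n)) * c * ns V (g n) \<le> 1" using Dn[OF n] ns_nonneg[of V "g n"] by (metis mult_right_mono)
    then have pc: "p n \<le> 1 / c" using c0 by (simp add: p_def field_simps)
    have "\<bar>p n\<bar> = p n" using P0 ns_nonneg[of V "g n"] by (simp add: p_def)
    moreover have "\<bar>r n\<bar> \<le> p n" unfolding r_def p_def abs_mult using QP ns_nonneg[of V "g n"] by (intro mult_mono) auto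
    ultimately show ?thesis using pc by linarith
  qed
  have form: "(\<Sum>e\<in>E. a e * N2 L (\<psi> n e)) = p n * diagX (\<lambda>x y. a {x, y}) (f n) + r n * offZ (\<lambda>x y. a {x, y}) (f n)"
    if n: "n \<in> In" for n a
  proof -
    have nI: "lam n \<in> I" using n by (simp add: In_def)
    have "(\<Sum>e\<in>E. a e * N2 L (\<psi> n e)) = Pint L (S (lam n)) * diagX (\<lambda>x y. a {x, y}) (g n) + Qint L (C (lam n)) (S (lam n)) * offZ (\<lambda>x y. a {x, y}) (g n)"
      by (rule spread_weighted[OF C S nz[OF nI]]) (rule gr[OF n])
    moreover have "(cmod (of_real (sqrt (ns V (g n)))))^2 = ns V (g n)" using ns_nonneg[of V "g n"] by simp
    then have "diagX \<kappa> (g n) = ns V (g n) * diagX \<kappa> (f n)" "offZ \<kappa> (g n) = ns V (g n) * offZ \<kappa> (f n)" for \<kappa>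
      using diagX_scale[of \<kappa> "of_real (sqrt (ns V (g n)))" "f n"] offZ_scale[of \<kappa> "of_real (sqrt (ns V (g n)))" "f n"]
      unfolding gf[OF n, symmetric] by simp_all
    ultimately show ?thesis by (simp add: p_def r_def)
  qed
  have count: "card {j. j < card V \<and> \<mu> j \<in> W ` I} \<le> card In"
    if po: "orthonormal_on V {..<card V} \<phi>" and pe: "\<And>j. j < card V \<Longrightarrow> eigenfn (of_real (\<mu> j)) (\<phi> j)" for \<phi> \<mu>
  proof -
    define JJ where "JJ = {j. j < card V \<and> \<mu> j \<in> W ` I}"
    have JJ: "finite JJ" "orthonormal_on V JJ \<phi>" using po by (auto simp: JJ_def orthonormal_on_def)
    \<comment> \<open>The discrete eigenfunction spreads to a quantum eigenfunction at z, which
      expands in those \<psi> n with \<open>lam n = z\<close>. Read off at the vertices, the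
      expansion puts \<phi> j into the span of the f n, where Bessel's inequality is an
      equality.\<close>
    have one: "(\<Sum>n\<in>In. (cmod (ip V (f n) (\<phi> j)))^2) = 1" if j: "j \<in> JJ" for j
    proof -
      obtain z where z: "z \<in> I" "\<mu> j = W z" and jV: "j < card V" using j by (auto simp: JJ_def)
      note nzz = nz[OF z(1)]
      let ?\<Phi> = "spread (C z) (S z) (\<phi> j)"
      have eigz: "eig z ?\<Phi>" by (rule spread_eig[OF C S nzz]) (use pe[OF jV] z in \<open>simp add: Wz\<close>)
      define d where "d n = qinner E L (\<psi> n) ?\<Phi>" for n
      define F where "F = {n. lam n = z}"
      have FI: "F \<subseteq> In" using z by (auto simp: F_def In_def)
      then have finF: "finite F" using fin finite_subset by blast
      have d0: "d n = 0" if "n \<notin> F" for n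
        unfolding d_def by (rule eig_orthogonal[OF ei eigz]) (use that in \<open>simp add: F_def\<close>)
      define h where "h x = \<phi> j x - (\<Sum>n\<in>F. d n * g n x)" for x
      have hrep: "?\<Phi> e x - (\<Sum>n\<in>F. d n * \<psi> n e x) = spread (C z) (S z) h e x" if "e \<in> E" "x \<in> {0..L}" for e x
      proof -
        have "(\<Sum>n\<in>F. d n * \<psi> n e x) = (\<Sum>n\<in>F. d n * spread (C z) (S z) (g n) e x)"
          using gr[OF _ that] FI by (intro sum.cong refl) (auto simp: F_def)
        also have "... = (\<Sum>n\<in>F. d n * g n (org G e)) * of_real (ctf L (C z) (S z) x) + (\<Sum>n\<in>F. d n * g n (trm G e)) * of_real (stf L (S z) x)"
          unfolding spread_def[OF C S nzz] sum_distrib_right sum.distrib[symmetric] by (intro sum.cong refl) (simp add: algebra_simps)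
        finally show ?thesis unfolding spread_def[OF C S nzz] h_def by (simp add: algebra_simps)
      qed
      \<comment> \<open>The coefficients outside the finite set F vanish, so the partial sums are
        constant from n0 on, and convergence of the error to zero means that it is zero
        there.\<close>
      obtain n0 where n0: "F \<subseteq> {..<n0}" using finF by (meson finite_nat_iff_bounded)
      define Q where "Q n = qnorm E L (\<lambda>e x. ?\<Phi> e x - (\<Sum>k<n. d k * \<psi> k e x))" for n
      have "?\<Phi> \<in> qL2 E L" using eigz unfolding eig_def quantum_graph_op_def by blast
      then have lim: "Q \<longlonglongrightarrow> 0" using ob unfolding orthonormal_basis_def Q_def d_def by blast
      have "Q n = Q n0" if "n \<ge> n0" for n
      proof -
        have "(\<Sum>k<m. d k * \<psi> k e x) = (\<Sum>k\<in>F. d k * \<psi> k e x)" if "m \<ge> n0" for m e x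
          using n0 that d0 by (intro sum.mono_neutral_right) auto
        then show ?thesis using that by (simp add: Q_def)
      qed
      then have "\<forall>\<^sub>F n in sequentially. Q n = Q n0" using eventually_sequentially by blast
      then have "Q \<longlonglongrightarrow> Q n0" by (rule tendsto_eventually)
      with lim have "Q n0 = 0" using LIMSEQ_unique by blast
      moreover have "(\<Sum>k<n0. d k * \<psi> k e x) = (\<Sum>k\<in>F. d k * \<psi> k e x)" for e x
        using n0 d0 by (intro sum.mono_neutral_right) auto
      ultimately have "(\<Sum>e\<in>E. N2 L (\<lambda>x. ?\<Phi> e x - (\<Sum>k\<in>F. d k * \<psi> k e x))) = 0"
        by (simp add: Q_def qnorm_finite)
      then have N0: "N2 L (\<lambda>x. ?\<Phi> e x - (\<Sum>k\<in>F. d k * \<psi> k e x)) = 0" if "e \<in> E" for e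
        using that E_finite by (simp add: sum_nonneg_eq_0_iff)
      have hz: "spread (C z) (S z) h e x = 0" if "e \<in> E" "x \<in> {0..L}" for e x
      proof (rule N2_eq_0[OF Lpos _ _ that(2)])
        show "continuous_on {0..L} (spread (C z) (S z) h e)"
          unfolding spread_def[OF C S nzz, abs_def]
          by (intro continuous_on_add continuous_on_mult continuous_on_const continuous_on_of_real ct_continuous[OF C S nzz])
        have "N2 L (spread (C z) (S z) h e) = N2 L (\<lambda>x. ?\<Phi> e x - (\<Sum>k\<in>F. d k * \<psi> k e x))"
          unfolding N2_def using hrep[OF that(1)] by (intro Bochner_Integration.integral_cong refl) simp
        then show "N2 L (spread (C z) (S z) h e) = 0" using N0[OF that(1)] by simp
      qed
      have hV: "h v = 0" if v: "v \<in> V" for v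
      proof -
        obtain e where e: "e \<in> E" "org G e = v \<or> trm G e = v" using incident_edge_exists[OF v] by blast
        show ?thesis using hz[OF e(1) zero_L(1)] hz[OF e(1) zero_L(2)] e(2) ends[OF C S nzz]
          by (auto simp: spread_def[OF C S nzz])
      qed
      define b where "b n = (if n \<in> F then d n * of_real (sqrt (ns V (g n))) else 0)" for n
      have rep: "\<phi> j v = (\<Sum>n\<in>In. b n * f n v)" if "v \<in> V" for v
      proof -
        have "\<phi> j v = (\<Sum>n\<in>F. d n * g n v)" using hV[OF that] by (simp add: h_def)
        also have "... = (\<Sum>n\<in>F. b n * f n v)"
        proof (intro sum.cong refl)
          fix n assume n: "n \<in> F"
          have "g n v = of_real (sqrt (ns V (g n))) * f n v" using gf[of n] n FI by (metis subsetD)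
          then show "d n * g n v = b n * f n v" using n by (simp add: b_def)
        qed
        also have "... = (\<Sum>n\<in>In. b n * f n v)"
          using FI fin by (intro sum.mono_neutral_left) (auto simp: b_def)
        finally show ?thesis .
      qed
      have ipb: "ip V (f n) (\<phi> j) = b n" if n: "n \<in> In" for n
      proof -
        have "ip V (f n) (\<phi> j) = ip V (f n) (\<lambda>v. \<Sum>m\<in>In. b m * f m v)" unfolding ip_def using rep by (intro sum.cong) auto
        also have "... = (\<Sum>m\<in>In. if n = m then b m else 0)"
          unfolding ip_sum_right ip_scale_right using o n by (intro sum.cong refl) (auto simp: orthonormal_on_def)
        finally show ?thesis using n fin by simp
      qed
      have "ns V (\<lambda>x. \<phi> j x - (\<Sum>n\<in>In. ip V (f n) (\<phi> j) * f n x)) = 0"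
        using rep ipb by (simp add: ns_def)
      then have "ns V (\<phi> j) = (\<Sum>n\<in>In. (cmod (ip V (f n) (\<phi> j)))^2)"
        using orthonormal_residual_eq(1)[OF fin o, of "\<phi> j"] by simp
      moreover have "ns V (\<phi> j) = 1"
        using JJ(2) j ip_self[of V "\<phi> j"] by (simp add: orthonormal_on_def)
      ultimately show ?thesis by simp
    qed
    \<comment> \<open>Double counting: for each j in JJ the squared coefficients sum to 1, for each
      n in In to at most 1.\<close>
    have "real (card JJ) = (\<Sum>j\<in>JJ. \<Sum>n\<in>In. (cmod (ip V (f n) (\<phi> j)))^2)" by (simp add: one)
    also have "... = (\<Sum>n\<in>In. \<Sum>j\<in>JJ. (cmod (ip V (\<phi> j) (f n)))^2)"
    proof -
      have "cmod (ip V (f n) (\<phi> j)) = cmod (ip V (\<phi> j) (f n))" for n j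
        using arg_cong[OF cnj_ip[of V "f n" "\<phi> j"], of cmod] by simp
      then show ?thesis by (simp only:) (rule sum.swap)
    qed
    also have "... \<le> (\<Sum>n\<in>In. ns V (f n))" by (intro sum_mono bessel JJ)
    also have "... = (\<Sum>n\<in>In. 1)"
    proof (intro sum.cong refl)
      fix n assume "n \<in> In"
      then show "ns V (f n) = 1" using o ip_self[of V "f n"] by (simp add: orthonormal_on_def)
    qed
    finally show ?thesis by (simp add: JJ_def)
  qed
  show ?thesis
  proof (rule that[of f p r])
    show "finite {n. lam n \<in> I}" using fin by (simp only: In_def)
    show "orthonormal_on V {n. lam n \<in> I} f" using o by (simp only: In_def)
    show "eigenfn (of_real (band_function q \<alpha> L C S (lam n))) (f n)" if "lam n \<in> I" for n
      using fe[of n] that by (simp only: In_def W_def mem_Collect_eq)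
    show "\<bar>p n\<bar> \<le> 1 / (real q + 1 - 2 * sqrt (real q)) \<and> \<bar>r n\<bar> \<le> 1 / (real q + 1 - 2 * sqrt (real q))" if "lam n \<in> I" for n
      using pr[of n] that by (simp only: In_def c_def mem_Collect_eq)
    show "(\<Sum>e\<in>E. a e * N2 L (\<psi> n e)) = p n * diagX (\<lambda>x y. a {x, y}) (f n) + r n * offZ (\<lambda>x y. a {x, y}) (f n)"
      if "lam n \<in> I" for n a
      by (rule form) (simp add: In_def that)
    show "card {j. j < card V \<and> \<mu> j \<in> band_function q \<alpha> L C S ` I} \<le> card {n. lam n \<in> I}"
      if "orthonormal_on V {..<card V} \<phi>" "\<And>j. j < card V \<Longrightarrow> eigenfn (of_real (\<mu> j)) (\<phi> j)" for \<phi> \<mu>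
      using count[OF that] by (simp only: In_def W_def)
  qed
qed

end

section \<open>The spectrum of the metric tree\<close>

locale rtree =
  fixes T :: "'b ograph" and q :: nat
  assumes tree: "regular_tree (q + 1) T" and q2: "q \<ge> 2"
begin

abbreviation "V \<equiv> verts T"
abbreviation "E \<equiv> edges T"
abbreviation "nb x \<equiv> adj T `` {x}"

lemma simple: "simple_ograph T" using tree unfolding regular_tree_def by blast

lemma nb_iff: "y \<in> nb x \<longleftrightarrow> {x, y} \<in> E" by (simp add: adj_def)

lemma nb_sym: "y \<in> nb x \<longleftrightarrow> x \<in> nb y" unfolding nb_iff by (simp add: insert_commute)

lemma nb_V: "y \<in> nb x \<Longrightarrow> x \<in> V \<and> y \<in> V \<and> x \<noteq> y" using simple_adjD[OF simple] by auto

lemma nb_card: "x \<in> V \<Longrightarrow> card (nb x) = q + 1"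
  using tree unfolding regular_tree_def regular_graph_def by blast

lemma nb_fin: "finite (nb x)"
proof (cases "x \<in> V")
  case True then show ?thesis using tree unfolding regular_tree_def regular_graph_def by blast
next
  case False then have "nb x = {}" using nb_V by blast
  then show ?thesis by simp
qed

lemma sqrt_q: "sqrt (real q) > 0" "sqrt (real q) * sqrt (real q) = real q" using q2 by auto

text \<open>The weight is \<open>q\<close> to the power minus half the distance to a root.\<close>

lemma positive_supersolution:
  obtains h :: "'b \<Rightarrow> real" where "\<And>x. x \<in> V \<Longrightarrow> h x > 0" "\<And>x. x \<in> V \<Longrightarrow> (\<Sum>y\<in>nb x. h y) \<le> 2 * sqrt (real q) * h x"
proof -
  have ac: "\<not> has_cycle E" using tree unfolding regular_tree_def by blast
  have sl: "{x} \<notin> E" for x using simple_no_loop[OF simple] by blast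
  have con: "connected_graph T" using tree unfolding regular_tree_def by blast
  then obtain o' where o: "o' \<in> V" unfolding connected_graph_def by blast
  define W where "W x w \<longleftrightarrow> nbw E w \<and> hd w = x \<and> last w = o'" for x w
  have uni: "w = w'" if "W x w" "W x w'" for x w w' using nbw_unique[OF ac sl] that unfolding W_def by metis
  \<comment> \<open>The walk from a neighbour y of x to the root drops x if y comes next on the walk
    of x, and prepends y otherwise; so the lengths differ by one.\<close>
  have step: "W y (if xs \<noteq> [] \<and> hd xs = y then xs else y # x # xs)" if W: "W x (x # xs)" and y: "y \<in> nb x" for x y xs
  proof (cases "xs \<noteq> [] \<and> hd xs = y")
    case True
    then obtain ys where "xs = y # ys" by (cases xs) auto
    then show ?thesis using W nbw_tl unfolding W_def by auto
  next
    case False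
    have "{y, x} \<in> E" using y nb_iff nb_sym by blast
    then have "nbw E (y # x # xs)" using W False by (intro nbw_ConsI) (auto simp: W_def)
    then show ?thesis using W False by (auto simp: W_def)
  qed
  have ne: "W x w \<Longrightarrow> \<exists>xs. w = x # xs" for x w unfolding W_def by (cases w) auto
  have ex: "\<exists>w. W x w" if "x \<in> V" for x
  proof -
    have "(o', x) \<in> (adj T)\<^sup>*" using con o that unfolding connected_graph_def by blast
    then show ?thesis
    proof induction
      case base show ?case by (rule exI[of _ "[o']"]) (simp add: W_def)
    next
      case (step y z)
      then obtain w where w: "W y w" by blast
      then obtain xs where "w = y # xs" using ne by blast
      with w step.hyps(2) \<open>\<And>y xs x. W x (x # xs) \<Longrightarrow> y \<in> nb x \<Longrightarrow> W y (if xs \<noteq> [] \<and> hd xs = y then xs else y # x # xs)\<close>[of y xs z]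
      show ?case by auto
    qed
  qed
  define wk where "wk x = (SOME w. W x w)" for x
  have wk: "W x (wk x)" if "x \<in> V" for x unfolding wk_def by (rule someI_ex[OF ex[OF that]])
  define s where "s = sqrt (real q)"
  have s: "s > 0" "s * s = real q" using sqrt_q by (simp_all add: s_def)
  define h where "h x = (1 / s) ^ length (wk x)" for x
  show ?thesis
  proof (rule that[of h])
    show "h x > 0" for x using s by (simp add: h_def)
    fix x assume x: "x \<in> V"
    obtain xs where xs: "wk x = x # xs" using ne wk[OF x] by blast
    have Wx: "W x (x # xs)" using wk[OF x] xs by simp
    have hy: "h y = (if xs \<noteq> [] \<and> hd xs = y then s * h x else h x / s)" if y: "y \<in> nb x" for y
    proof -
      have "wk y = (if xs \<noteq> [] \<and> hd xs = y then xs else y # x # xs)"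
        using uni wk step[OF Wx y] nb_V[OF y] by blast
      then show ?thesis using s by (simp add: h_def xs)
    qed
    have hx: "h x > 0" using s by (simp add: h_def)
    \<comment> \<open>Only the parent \<open>hd xs\<close> has weight s h x, the other neighbours h
      x / s. At the root \<open>hd xs\<close> is unspecified, which is harmless because the added
      term is nonnegative. As q = s^2, the total is (q / s + s) h x = 2 s h x.\<close>
    have "(\<Sum>y\<in>nb x. h y) \<le> (\<Sum>y\<in>nb x. h x / s + (if y = hd xs then (s - 1 / s) * h x else 0))"
    proof (rule sum_mono)
      fix y assume y: "y \<in> nb x"
      have "1 \<le> s * s" using s q2 by simp
      then have "1 / s \<le> s" using s by (simp add: divide_simps)
      then have "(s - 1 / s) * h x \<ge> 0" using hx by simp
      then show "h y \<le> h x / s + (if y = hd xs then (s - 1 / s) * h x else 0)"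
        unfolding hy[OF y] by (auto simp: algebra_simps)
    qed
    also have "... \<le> (real q + 1) * (h x / s) + (s - 1 / s) * h x"
    proof -
      have "1 \<le> s * s" using s q2 by simp
      then have "1 / s \<le> s" using s by (simp add: divide_simps)
      then have "(s - 1 / s) * h x \<ge> 0" using hx by simp
      then show ?thesis using nb_card[OF x] nb_fin[of x] unfolding sum.distrib
        by (simp add: algebra_simps del: Image_singleton_iff)
    qed
    also have "... = (s * s / s + s) * h x" unfolding s(2)[symmetric] using s(1) by (simp add: field_simps)
    also have "s * s / s = s" using s(1) by simp
    also have "(s + s) * h x = 2 * s * h x" by simp
    finally show "(\<Sum>y\<in>nb x. h y) \<le> 2 * sqrt (real q) * h x" unfolding s_def .
  qed
qed

section \<open>The adjacency operator on finitely supported functions\<close>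

text \<open>Finite supports keep all sums finite and all functions on the metric tree compactly
  supported; the price is the residual d in \<open>approximate_resolvent\<close>.\<close>

definition fs :: "('b \<Rightarrow> complex) \<Rightarrow> bool" where
  "fs y \<longleftrightarrow> finite {x. y x \<noteq> 0} \<and> {x. y x \<noteq> 0} \<subseteq> V"

definition sq :: "('b \<Rightarrow> complex) \<Rightarrow> real" where
  "sq y = ns {x. y x \<noteq> 0} y"

definition Ad :: "('b \<Rightarrow> complex) \<Rightarrow> 'b \<Rightarrow> complex" where
  "Ad y x = (\<Sum>z\<in>nb x. y z)"

lemma sq_eq: "finite F \<Longrightarrow> {x. y x \<noteq> 0} \<subseteq> F \<Longrightarrow> sq y = ns F y"
  unfolding sq_def ns_def by (rule sum.mono_neutral_left) auto

lemma sq_nonneg: "sq y \<ge> 0" by (simp add: sq_def ns_nonneg)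

lemma sq_ge: "fs y \<Longrightarrow> finite F \<Longrightarrow> ns F y \<le> sq y"
proof -
  assume y: "fs y" and F: "finite F"
  have "sq y = ns (F \<union> {x. y x \<noteq> 0}) y" using y F by (intro sq_eq) (auto simp: fs_def)
  moreover have "ns F y \<le> ns (F \<union> {x. y x \<noteq> 0}) y"
    unfolding ns_def using y F by (intro sum_mono2) (auto simp: fs_def)
  ultimately show ?thesis by simp
qed

lemma fs_lincomb: "fs y \<Longrightarrow> fs z \<Longrightarrow> fs (\<lambda>x. a * y x + b * z x)"
proof -
  assume "fs y" "fs z"
  moreover have "{x. a * y x + b * z x \<noteq> 0} \<subseteq> {x. y x \<noteq> 0} \<union> {x. z x \<noteq> 0}" by auto
  ultimately show ?thesis unfolding fs_def by (meson finite_UnI finite_subset order_trans Un_least)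
qed

lemma fs_scale: "fs y \<Longrightarrow> fs (\<lambda>x. a * y x)"
  using fs_lincomb[of y y a 0] by simp

lemma sq_scale: "fs y \<Longrightarrow> sq (\<lambda>x. a * y x) = (cmod a)^2 * sq y"
proof -
  assume y: "fs y"
  have "sq (\<lambda>x. a * y x) = ns {x. y x \<noteq> 0} (\<lambda>x. a * y x)" using y by (intro sq_eq) (auto simp: fs_def)
  then show ?thesis by (simp add: ns_scale sq_def)
qed

text \<open>Young's inequality; the free parameter brings the factor of the main term as close to 1
  as absorption requires.\<close>

lemma sq_sum_le_weighted:
  fixes a b :: complex assumes t: "t > 0"
  shows "(cmod (a + b))^2 \<le> (1 + t) * (cmod a)^2 + (1 + 1 / t) * (cmod b)^2"
proof -
  have "(cmod (a + b))^2 \<le> (cmod a + cmod b)^2" by (intro power_mono norm_triangle_ineq) auto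
  moreover have "0 \<le> (t * cmod a - cmod b)^2 / t" using t by simp
  then have "0 \<le> t * (cmod a)^2 - 2 * (cmod a * cmod b) + (cmod b)^2 / t"
    using t by (simp add: power2_eq_square field_simps)
  ultimately show ?thesis by (simp add: power2_sum algebra_simps)
qed

lemma sq_add_le:
  assumes "fs y" "fs z" "t > 0"
  shows "sq (\<lambda>x. y x + z x) \<le> (1 + t) * sq y + (1 + 1 / t) * sq z"
proof -
  let ?F = "{x. y x \<noteq> 0} \<union> {x. z x \<noteq> 0}"
  have F: "finite ?F" using assms by (simp add: fs_def)
  have "sq (\<lambda>x. y x + z x) = ns ?F (\<lambda>x. y x + z x)" by (rule sq_eq[OF F]) auto
  also have "... \<le> (1 + t) * ns ?F y + (1 + 1 / t) * ns ?F z"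
    unfolding ns_def sum_distrib_left sum.distrib[symmetric] by (intro sum_mono sq_sum_le_weighted assms)
  also have "ns ?F y = sq y" by (rule sq_eq[OF F, symmetric]) auto
  also have "ns ?F z = sq z" by (rule sq_eq[OF F, symmetric]) auto
  finally show ?thesis .
qed

lemma Ad_support: "{x. Ad y x \<noteq> 0} \<subseteq> (\<Union>z\<in>{x. y x \<noteq> 0}. nb z)"
proof
  fix x assume "x \<in> {x. Ad y x \<noteq> 0}"
  then obtain z where "z \<in> nb x" "y z \<noteq> 0" unfolding Ad_def by (metis (mono_tags, lifting) mem_Collect_eq sum.neutral)
  then show "x \<in> (\<Union>z\<in>{x. y x \<noteq> 0}. nb z)" using nb_sym by blast
qed

lemma fs_Ad: "fs y \<Longrightarrow> fs (Ad y)"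
proof -
  assume y: "fs y"
  have "finite (\<Union>z\<in>{x. y x \<noteq> 0}. nb z)" using y nb_fin unfolding fs_def by blast
  moreover have "(\<Union>z\<in>{x. y x \<noteq> 0}. nb z) \<subseteq> V" using nb_V by blast
  ultimately show ?thesis using Ad_support[of y] unfolding fs_def by (meson finite_subset order_trans)
qed

lemma Ad_lincomb: "Ad (\<lambda>x. a * y x + b * z x) v = a * Ad y v + b * Ad z v"
  unfolding Ad_def by (simp only: sum.distrib sum_distrib_left)

text \<open>Schur test with the supersolution h: Cauchy-Schwarz with weights sqrt h in each row
  gives 2 sqrt q times h x, and the summation over columns gives the same constant again.\<close>

lemma sq_Ad_le:
  assumes y: "fs y" shows "sq (Ad y) \<le> 4 * real q * sq y"
proof -
  obtain h :: "'b \<Rightarrow> real" where h: "\<And>x. x \<in> V \<Longrightarrow> h x > 0" "\<And>x. x \<in> V \<Longrightarrow> (\<Sum>y\<in>nb x. h y) \<le> 2 * sqrt (real q) * h x"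
    by (rule positive_supersolution) blast
  let ?F = "{x. y x \<noteq> 0}"
  have F: "finite ?F" "?F \<subseteq> V" using y by (auto simp: fs_def)
  define F' where "F' = (\<Union>z\<in>?F. nb z)"
  have F': "finite F'" "F' \<subseteq> V" using F nb_fin nb_V unfolding F'_def by blast+
  have row: "(cmod (Ad y x))^2 \<le> (\<Sum>z | z \<in> ?F \<and> z \<in> nb x. 2 * sqrt (real q) * h x * ((cmod (y z))^2 / h z))" if x: "x \<in> F'" for x
  proof -
    have xV: "x \<in> V" using x F' by blast
    have hz: "h z > 0" if "z \<in> nb x" for z using h(1) nb_V that by blast
    have "cmod (Ad y x) \<le> (\<Sum>z\<in>nb x. cmod (y z))" unfolding Ad_def by (rule norm_sum)
    also have "... = (\<Sum>z\<in>nb x. sqrt (h z) * (cmod (y z) / sqrt (h z)))"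
      using hz by (intro sum.cong refl) (metis less_irrefl nonzero_mult_div_cancel_left real_sqrt_eq_zero_cancel_iff times_divide_eq_right)
    finally have "(cmod (Ad y x))^2 \<le> (\<Sum>z\<in>nb x. sqrt (h z) * (cmod (y z) / sqrt (h z)))^2" by (rule power_mono) simp
    also have "... \<le> (\<Sum>z\<in>nb x. (sqrt (h z))^2) * (\<Sum>z\<in>nb x. (cmod (y z) / sqrt (h z))^2)" by (rule Cauchy_Schwarz_ineq_sum)
    also have "(\<Sum>z\<in>nb x. (sqrt (h z))^2) = (\<Sum>z\<in>nb x. h z)"
      using hz by (intro sum.cong refl real_sqrt_pow2 less_imp_le)
    also have "(\<Sum>z\<in>nb x. (cmod (y z) / sqrt (h z))^2) = (\<Sum>z\<in>nb x. (cmod (y z))^2 / h z)"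
    proof (intro sum.cong refl)
      fix z assume "z \<in> nb x"
      from hz[OF this] show "(cmod (y z) / sqrt (h z))^2 = (cmod (y z))^2 / h z"
        unfolding power_divide by (simp add: real_sqrt_pow2)
    qed
    also have "(\<Sum>z\<in>nb x. h z) * (\<Sum>z\<in>nb x. (cmod (y z))^2 / h z) \<le> (2 * sqrt (real q) * h x) * (\<Sum>z\<in>nb x. (cmod (y z))^2 / h z)"
    proof (rule mult_right_mono[OF h(2)[OF xV]])
      show "0 \<le> (\<Sum>z\<in>nb x. (cmod (y z))^2 / h z)"
      proof (rule sum_nonneg)
        fix z assume "z \<in> nb x"
        from hz[OF this] show "0 \<le> (cmod (y z))^2 / h z" by simp
      qed
    qed
    also have "(\<Sum>z\<in>nb x. (cmod (y z))^2 / h z) = (\<Sum>z | z \<in> ?F \<and> z \<in> nb x. (cmod (y z))^2 / h z)"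
      using nb_fin by (intro sum.mono_neutral_right) auto
    finally show ?thesis by (simp only: sum_distrib_left)
  qed
  have "sq (Ad y) = ns F' (Ad y)" using Ad_support[of y] F' by (intro sq_eq) (auto simp only: F'_def)
  also have "... \<le> (\<Sum>x\<in>F'. \<Sum>z | z \<in> ?F \<and> z \<in> nb x. 2 * sqrt (real q) * h x * ((cmod (y z))^2 / h z))"
    unfolding ns_def by (intro sum_mono row)
  also have "... = (\<Sum>z\<in>?F. \<Sum>x | x \<in> F' \<and> z \<in> nb x. 2 * sqrt (real q) * h x * ((cmod (y z))^2 / h z))"
    by (rule sum.swap_restrict[OF F'(1) F(1)])
  also have "... \<le> (\<Sum>z\<in>?F. 4 * real q * (cmod (y z))^2)"
  proof (rule sum_mono)
    fix z assume z: "z \<in> ?F"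
    have zV: "z \<in> V" and hz: "h z > 0" using z F h by blast+
    have "{x. x \<in> F' \<and> z \<in> nb x} = nb z" using z nb_sym unfolding F'_def by blast
    then have "(\<Sum>x | x \<in> F' \<and> z \<in> nb x. 2 * sqrt (real q) * h x * ((cmod (y z))^2 / h z))
       = 2 * sqrt (real q) * ((cmod (y z))^2 / h z) * (\<Sum>x\<in>nb z. h x)"
      unfolding sum_distrib_left by (simp only: mult_ac)
    also have "... \<le> 2 * sqrt (real q) * ((cmod (y z))^2 / h z) * (2 * sqrt (real q) * h z)"
      using hz by (intro mult_left_mono h(2) zV) simp
    also have "... = 4 * (sqrt (real q) * sqrt (real q)) * (cmod (y z))^2" using hz by (simp add: field_simps)
    finally show "(\<Sum>x | x \<in> F' \<and> z \<in> nb x. 2 * sqrt (real q) * h x * ((cmod (y z))^2 / h z)) \<le> 4 * real q * (cmod (y z))^2"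
      unfolding sqrt_q .
  qed
  also have "... = 4 * real q * sq y" by (simp add: sq_def ns_def sum_distrib_left)
  finally show ?thesis .
qed

text \<open>A truncated Neumann series keeps supports finite, with residual as small as desired. The
  bound on y is not taken from the series but from the norm bound applied to the equation y solves,
  so K does not depend on the number of terms.\<close>

lemma approximate_resolvent:
  assumes w: "\<bar>w\<bar> > 2 * sqrt (real q)"
  shows "\<exists>K\<ge>0. \<forall>r \<epsilon>. fs r \<longrightarrow> \<epsilon> > 0 \<longrightarrow> (\<exists>y d. fs y \<and> fs d \<and> (\<forall>x. Ad y x - of_real w * y x = r x + d x) \<and>
     sq y \<le> K * sq r \<and> sq d \<le> sq r \<and> sq d \<le> \<epsilon>)"
proof -
  have "(2 * sqrt (real q))^2 < \<bar>w\<bar>\<^sup>2" using w sqrt_q by (intro power_strict_mono) auto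
  then have w4: "4 * real q < w^2" by (simp add: power_mult_distrib)
  have w0: "w \<noteq> 0" "w^2 > 0" using w sqrt_q by auto
  have q0: "real q > 0" using q2 by simp
  \<comment> \<open>Makes (1 + t) 4 q the midpoint between 4 q and w^2.\<close>
  define t where "t = (w^2 - 4 * real q) / (8 * real q)"
  have t: "t > 0" using w4 q0 by (simp add: t_def)
  have tq: "(1 + t) * (4 * real q) = (w^2 + 4 * real q) / 2" using q0 by (simp add: t_def field_simps)
  define K where "K = (1 + 1 / t) * 4 / ((w^2 - 4 * real q) / 2)"
  have K: "K \<ge> 0" using t w4 by (simp add: K_def)
  \<comment> \<open>From w y = A y - g and the norm bound: the term with y on the right is absorbed
    because w^2 exceeds the midpoint.\<close>
  have ap: "sq y \<le> (1 + 1 / t) / ((w^2 - 4 * real q) / 2) * sq g"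
    if y: "fs y" and g: "fs g" and e: "\<And>x. Ad y x - of_real w * y x = g x" for y g
  proof -
    have "of_real w * y x = Ad y x + (-1) * g x" for x using e[of x] by (simp add: algebra_simps)
    then have "(cmod (of_real w))^2 * sq y = sq (\<lambda>x. Ad y x + (-1) * g x)" using sq_scale[OF y, of "of_real w"] by simp
    also have "... \<le> (1 + t) * sq (Ad y) + (1 + 1 / t) * sq (\<lambda>x. (-1) * g x)"
      by (intro sq_add_le fs_Ad y fs_scale g t)
    also have "sq (\<lambda>x. (-1) * g x) = sq g" using sq_scale[OF g, of "-1"] by simp
    also have "(1 + t) * sq (Ad y) \<le> (1 + t) * (4 * real q * sq y)" using sq_Ad_le[OF y] t by (intro mult_left_mono) auto
    finally have "w^2 * sq y \<le> (1 + t) * (4 * real q) * sq y + (1 + 1 / t) * sq g" by (simp add: mult.assoc)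
    then have "(w^2 - 4 * real q) / 2 * sq y \<le> (1 + 1 / t) * sq g" unfolding tq by (simp add: field_simps)
    then show ?thesis using w4 by (simp add: field_simps)
  qed
  have "\<exists>y d. fs y \<and> fs d \<and> (\<forall>x. Ad y x - of_real w * y x = r x + d x) \<and>
     sq y \<le> K * sq r \<and> sq d \<le> sq r \<and> sq d \<le> \<epsilon>" if r: "fs r" and \<epsilon>: "\<epsilon> > 0" for r \<epsilon>
  proof -
    \<comment> \<open>Starting from y = 0 and d = -r, replacing y by y + d / w turns the residual d
      into A d / w, whose squared norm is smaller by the factor 4 q / w^2.\<close>
    have it: "\<exists>y d. fs y \<and> fs d \<and> (\<forall>x. Ad y x - of_real w * y x = r x + d x) \<and> sq d \<le> (4 * real q / w^2) ^ n * sq r" for n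
    proof (induction n)
      case 0
      have "fs (\<lambda>x. 0)" by (simp add: fs_def)
      moreover have "fs (\<lambda>x. (-1) * r x)" "sq (\<lambda>x. (-1) * r x) = sq r" using fs_scale[OF r, of "-1"] sq_scale[OF r, of "-1"] by auto
      ultimately show ?case by (intro exI[of _ "\<lambda>x. 0"] exI[of _ "\<lambda>x. (-1) * r x"]) (simp add: Ad_def)
    next
      case (Suc n)
      then obtain y d where y: "fs y" and d: "fs d" and e: "\<And>x. Ad y x - of_real w * y x = r x + d x"
        and sd: "sq d \<le> (4 * real q / w^2) ^ n * sq r" by blast
      define k where "k = 1 / complex_of_real w"
      have k: "of_real w * k = 1" "(cmod k)^2 = 1 / w^2" using w0 by (simp_all add: k_def norm_divide power_divide)
      have "Ad (\<lambda>x. 1 * y x + k * d x) x - of_real w * (1 * y x + k * d x) = r x + k * Ad d x" for x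
      proof -
        have "Ad (\<lambda>x. 1 * y x + k * d x) x - of_real w * (1 * y x + k * d x) = (Ad y x - of_real w * y x) + k * Ad d x - (of_real w * k) * d x"
          unfolding Ad_lincomb by (simp add: algebra_simps)
        then show ?thesis unfolding e k(1) by simp
      qed
      moreover have "sq (\<lambda>x. k * Ad d x) \<le> (4 * real q / w^2) ^ Suc n * sq r"
      proof -
        have "sq (\<lambda>x. k * Ad d x) = 1 / w^2 * sq (Ad d)" using sq_scale[OF fs_Ad[OF d], of k] k by simp
        also have "... \<le> 1 / w^2 * (4 * real q * sq d)" using sq_Ad_le[OF d] w0 by (intro mult_left_mono) auto
        also have "... = 4 * real q / w^2 * sq d" by simp
        also have "... \<le> 4 * real q / w^2 * ((4 * real q / w^2) ^ n * sq r)" using sd by (intro mult_left_mono) auto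
        finally show ?thesis by (simp only: power_Suc mult.assoc)
      qed
      ultimately show ?case using fs_lincomb[OF y d, of 1 k] fs_scale[OF fs_Ad[OF d], of k] by blast
    qed
    have a: "4 * real q / w^2 < 1" "4 * real q / w^2 \<ge> 0" using w4 w0 by (auto simp: field_simps)
    have "(\<lambda>n. (4 * real q / w^2) ^ n * sq r) \<longlonglongrightarrow> 0 * sq r"
      by (intro tendsto_mult tendsto_const LIMSEQ_realpow_zero a)
    then have "\<forall>\<^sub>F n in sequentially. (4 * real q / w^2) ^ n * sq r < \<epsilon>" using \<epsilon> by (intro order_tendstoD(2)) auto
    then obtain n where n: "(4 * real q / w^2) ^ n * sq r < \<epsilon>" by (meson eventually_sequentially order_refl)
    obtain y d where y: "fs y" and d: "fs d" and e: "\<And>x. Ad y x - of_real w * y x = r x + d x"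
        and sd: "sq d \<le> (4 * real q / w^2) ^ n * sq r" using it[of n] by blast
    have "(4 * real q / w^2) ^ n * sq r \<le> 1 * sq r" using a sq_nonneg by (intro mult_right_mono power_le_one) auto
    then have d1: "sq d \<le> sq r" using sd by simp
    have "sq (\<lambda>x. r x + d x) \<le> (1 + 1) * sq r + (1 + 1 / 1) * sq d" by (intro sq_add_le r d) simp
    then have g4: "sq (\<lambda>x. r x + d x) \<le> 4 * sq r" using d1 by simp
    have fg: "fs (\<lambda>x. r x + d x)" using fs_lincomb[OF r d, of 1 1] by simp
    have "sq y \<le> (1 + 1 / t) / ((w^2 - 4 * real q) / 2) * sq (\<lambda>x. r x + d x)" by (rule ap[OF y fg e])
    also have "... \<le> (1 + 1 / t) / ((w^2 - 4 * real q) / 2) * (4 * sq r)" using g4 t w4 by (intro mult_left_mono) auto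
    also have "... = K * sq r" by (simp add: K_def)
    finally have "sq y \<le> K * sq r" .
    then show ?thesis using y d e d1 sd n by (intro exI[of _ y] exI[of _ d]) auto
  qed
  then show ?thesis using K by blast
qed

end

section \<open>Edge functions with prescribed end values and end derivatives\<close>

lemma N2_add_le: "L2 L f \<Longrightarrow> L2 L g \<Longrightarrow> N2 L (\<lambda>x. f x + g x) \<le> 2 * N2 L f + 2 * N2 L g"
proof -
  assume f: "L2 L f" and g: "L2 L g"
  have "N2 L (\<lambda>x. f x + g x) \<le> (LINT x|leb L. 2 * (cmod (f x))^2 + 2 * (cmod (g x))^2)"
    unfolding N2_def using L2_add[OF f g] f g by (intro integral_mono sq_sum_le) (auto simp: L2_def)
  also have "... = 2 * N2 L f + 2 * N2 L g" using f g by (simp add: N2_def L2_def)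
  finally show ?thesis .
qed

lemma N2_scale: "N2 L (\<lambda>x. c * f x) = (cmod c)^2 * N2 L f"
  by (simp add: N2_def norm_mult power_mult_distrib)

lemma N2_lincomb_le:
  "L2 L f \<Longrightarrow> L2 L g \<Longrightarrow> N2 L (\<lambda>x. a * f x + b * g x) \<le> 2 * (cmod a)^2 * N2 L f + 2 * (cmod b)^2 * N2 L g"
  using N2_add_le[OF L2_scale L2_scale, of L f g a b] by (simp add: N2_scale)

context sturm begin

lemma potential_L2: "continuous_on {0..L} k \<Longrightarrow> L2 L (\<lambda>x. of_real (U x) * k x)"
proof (rule L2_times_bounded[where B = Ub])
  show "L2 L k" if "continuous_on {0..L} k" by (rule L2_continuous[OF that])
  show "(\<lambda>x. complex_of_real (U x)) \<in> borel_measurable (leb L)"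
    using pot unfolding symmetric_Linfty_potential_def by auto
  show "AE x in leb L. cmod (of_real (U x)) \<le> Ub" using Ub by simp
qed

text \<open>Any C2 function solves the equation with its own residual as source; as U is bounded,
  the source is square-integrable.\<close>

lemma csol_C2:
  assumes k: "\<And>x. (k has_vector_derivative k1 x) (at x within {0..L})" "\<And>x. (k1 has_vector_derivative k2 x) (at x within {0..L})"
    and c: "continuous_on {0..L} (k2 :: real \<Rightarrow> complex)"
  obtains m where "csol U L lam k k1 m" "L2 L m" "L2 L k"
proof -
  define m where "m x = - k2 x + of_real (U x) * k x - of_real lam * k x" for x
  have c0: "continuous_on {0..L} k" "continuous_on {0..L} k1"
    using k by (meson continuous_on_eq_continuous_within has_vector_derivative_continuous)+
  have "W22_derivs L k k1 k2"
    by (intro W22_intro L2_continuous c prim_C1 k)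
  then have "csol U L lam k k1 m" unfolding csol_def m_def by (intro exI[of _ k2]) auto
  moreover have "L2 L (\<lambda>x. (- 1) * k2 x + of_real (U x) * k x - of_real lam * k x)"
    by (intro L2_add L2_diff L2_scale potential_L2 L2_continuous c c0)
  then have "L2 L m" by (simp add: m_def[abs_def])
  ultimately show ?thesis using that L2_continuous[OF c0(1)] by blast
qed

text \<open>The cubic Hermite polynomials k = x (1 - x / L)^2 and l = - (x^2 / L) (1 - x / L): they
  vanish at both ends and have end derivatives 1, 0 and 0, 1.\<close>

lemma endpoint_functions:
  obtains k k1 m l l1 n where "csol U L lam k k1 m" "L2 L m" "L2 L k" "k 0 = 0" "k L = 0" "k1 0 = 1" "k1 L = 0"
    "csol U L lam l l1 n" "L2 L n" "L2 L l" "l 0 = 0" "l L = 0" "l1 0 = 0" "l1 L = 1"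
proof -
  define a where "a = complex_of_real (1 / L)"
  have aL: "a * of_real L = 1" using Lpos by (simp add: a_def)
  define k k1 k2 l l1 l2 where d: "k x = of_real x - 2 * a * (of_real x)^2 + a^2 * (of_real x) ^ 3"
      "k1 x = 1 - 4 * a * of_real x + 3 * a^2 * (of_real x)^2" "k2 x = - 4 * a + 6 * a^2 * of_real x"
      "l x = - a * (of_real x)^2 + a^2 * (of_real x) ^ 3"
      "l1 x = - 2 * a * of_real x + 3 * a^2 * (of_real x)^2" "l2 x = - 2 * a + 6 * a^2 * of_real x" for x :: real
  have id: "(complex_of_real has_vector_derivative 1) (at x within A)" for x A
    using has_vector_derivative_of_real[OF DERIV_ident[of "at x within A"]] by simp
  have pw: "((\<lambda>x. complex_of_real x ^ j) has_vector_derivative of_nat j * of_real x ^ (j - 1)) (at x within A)" for j x A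
  proof -
    have "((\<lambda>x. x ^ j) has_real_derivative of_nat j * (1 * x ^ (j - Suc 0))) (at x within A)" by (rule DERIV_power[OF DERIV_ident])
    from has_vector_derivative_of_real[OF this] show ?thesis by simp
  qed
  have D: "(k has_vector_derivative k1 x) (at x within A)" "(k1 has_vector_derivative k2 x) (at x within A)"
    "(l has_vector_derivative l1 x) (at x within A)" "(l1 has_vector_derivative l2 x) (at x within A)" for x A
    unfolding d[abs_def]
    by (rule has_vector_derivative_eq_rhs,
        (rule has_vector_derivative_add has_vector_derivative_diff has_vector_derivative_mult_right has_vector_derivative_const id pw)+,
        simp add: power2_eq_square algebra_simps)+
  obtain m where m: "csol U L lam k k1 m" "L2 L m" "L2 L k"
    by (rule csol_C2[OF D(1,2), where lam = lam]) (auto simp: d[abs_def] intro!: continuous_intros)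
  obtain n where n: "csol U L lam l l1 n" "L2 L n" "L2 L l"
    by (rule csol_C2[OF D(3,4), where lam = lam]) (auto simp: d[abs_def] intro!: continuous_intros)
  have e: "a * of_real L ^ 2 = of_real L" "a^2 * of_real L ^ 3 = of_real L" "a^2 * of_real L ^ 2 = 1"
    using aL Lpos by (simp_all add: a_def power2_eq_square power3_eq_cube)
  have "k L = 0" "k1 L = 0" "l L = 0" "l1 L = 1"
    unfolding d using aL e by (simp_all add: mult.assoc)
  moreover have "k 0 = 0" "k1 0 = 1" "l 0 = 0" "l1 0 = 0" by (simp_all add: d)
  ultimately show ?thesis using that m n by blast
qed

text \<open>The end values \<open>a, b\<close> and the corrections \<open>c, d\<close> of the end derivatives are free; \<open>p, r\<close> are the
  end derivatives that \<open>f\<close> alone causes.\<close>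

definition edge_extends where
  "edge_extends z (C :: real \<Rightarrow> real) (S :: real \<Rightarrow> real) K f p r \<longleftrightarrow> (cmod p)\<^sup>2 \<le> K * N2 L f \<and> (cmod r)^2 \<le> K * N2 L f \<and>
    (\<forall>a b c d. \<exists>u u1 g. csol U L z u u1 (\<lambda>x. f x + g x) \<and> u 0 = a \<and> u L = b \<and> L2 L u \<and> L2 L g \<and>
       u1 0 = (b - of_real (C L) * a) / of_real (S L) + p + c \<and> u1 L = (of_real (C L) * b - a) / of_real (S L) + r - d \<and>
       N2 L u \<le> K * (N2 L f + ((cmod a)^2 + (cmod b)^2) + ((cmod c)^2 + (cmod d)^2)) \<and> N2 L g \<le> K * ((cmod c)^2 + (cmod d)^2))"

text \<open>u is the sum of the Dirichlet solution for f, the homogeneous solution with end values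
  a, b, and the Hermite combination with end derivatives c, -d; the error g comes from the last
  alone. That p and r depend only on f matters, since the vertex values are chosen in response to
  them.\<close>

lemma edge_extension:
  assumes C: "solves_ivp L U z 1 0 C" and S: "solves_ivp L U z 0 1 S" and nz: "S L \<noteq> 0"
  shows "\<exists>K\<ge>0. \<forall>f. L2 L f \<longrightarrow> (\<exists>p r. edge_extends z C S K f p r)"
proof -
  obtain C1 S1 where "fundamental L U z (\<lambda>x. of_real (C x)) C1 (\<lambda>x. of_real (S x)) S1"
    by (rule fundamental_exists[OF C S])
  then interpret f: fundamental L U z "\<lambda>x. of_real (C x)" C1 "\<lambda>x. of_real (S x)" S1 .
  have nz': "complex_of_real (S L) \<noteq> 0" using nz by simp
  obtain D where D: "D \<ge> 0" and Dv: "\<And>f. L2 L f \<Longrightarrow> \<exists>v v1. csol U L z v v1 f \<and> v 0 = 0 \<and> v L = 0 \<and>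
      (cmod (v1 0))^2 \<le> D * N2 L f \<and> (cmod (v1 L))^2 \<le> D * N2 L f \<and> N2 L v \<le> D * N2 L f"
    using f.dirichlet_solution[OF nz'] by blast
  obtain k k1 m l l1 n where k: "csol U L z k k1 m" "L2 L m" "L2 L k" "k 0 = 0" "k L = 0" "k1 0 = 1" "k1 L = 0"
    and l: "csol U L z l l1 n" "L2 L n" "L2 L l" "l 0 = 0" "l L = 0" "l1 0 = 0" "l1 L = 1"
    using endpoint_functions[of z] by metis
  let ?ct = "\<lambda>x. complex_of_real (ctf L C S x)" and ?st = "\<lambda>x. complex_of_real (stf L S x)"
  have ct: "L2 L ?ct" "L2 L ?st"
    by (intro L2_continuous continuous_on_of_real ct_continuous[OF C S nz])+
  define B where "B = N2 L ?ct + N2 L ?st + N2 L k + N2 L l + N2 L m + N2 L n"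
  have B: "N2 L ?ct \<le> B" "N2 L ?st \<le> B" "N2 L k \<le> B" "N2 L l \<le> B" "N2 L m \<le> B" "N2 L n \<le> B" "B \<ge> 0"
    unfolding B_def using N2_nonneg[of L ?ct] N2_nonneg[of L ?st] N2_nonneg[of L k] N2_nonneg[of L l] N2_nonneg[of L m] N2_nonneg[of L n]
    by linarith+
  have two: "N2 L (\<lambda>x. a * h x + b * j x) \<le> 2 * B * ((cmod a)^2 + (cmod b)^2)"
    if "L2 L h" "L2 L j" "N2 L h \<le> B" "N2 L j \<le> B" for a b h j
  proof -
    have "N2 L (\<lambda>x. a * h x + b * j x) \<le> 2 * (cmod a)^2 * N2 L h + 2 * (cmod b)^2 * N2 L j" by (rule N2_lincomb_le[OF that(1,2)])
    also have "... \<le> 2 * (cmod a)^2 * B + 2 * (cmod b)^2 * B" using that by (intro add_mono mult_left_mono) auto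
    finally show ?thesis by (simp add: algebra_simps)
  qed
  define K where "K = 4 * D + 8 * B"
  have K: "K \<ge> 0" "D \<le> K" "4 * D \<le> K" "8 * B \<le> K" "2 * B \<le> K" using D B(7) by (simp_all add: K_def)
  have "\<exists>p r. edge_extends z C S K f p r"
    if f: "L2 L f" for f
  proof -
    obtain v v1 where v: "csol U L z v v1 f" "v 0 = 0" "v L = 0"
      and vb: "(cmod (v1 0))^2 \<le> D * N2 L f" "(cmod (v1 L))^2 \<le> D * N2 L f" "N2 L v \<le> D * N2 L f" using Dv[OF f] by blast
    have vL: "L2 L v" by (rule L2_continuous[OF csol_continuous(1)[OF v(1)]])
    have DK: "D * N2 L f \<le> K * N2 L f" using K by (intro mult_right_mono) auto
    have "\<exists>u u1 g. csol U L z u u1 (\<lambda>x. f x + g x) \<and> u 0 = a \<and> u L = b \<and> L2 L u \<and> L2 L g \<and>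
       u1 0 = (b - of_real (C L) * a) / of_real (S L) + v1 0 + c \<and> u1 L = (of_real (C L) * b - a) / of_real (S L) + v1 L - d \<and>
       N2 L u \<le> K * (N2 L f + ((cmod a)^2 + (cmod b)^2) + ((cmod c)^2 + (cmod d)^2)) \<and> N2 L g \<le> K * ((cmod c)^2 + (cmod d)^2)"
      for a b c d
    proof -
      define h where "h x = a * ?ct x + b * ?st x" for x
      obtain h1 where h: "csol U L z h h1 (\<lambda>_. 0)"
        using edge_solution_exists[OF C S nz, of a b] unfolding h_def by blast
      have he: "h 0 = a" "h L = b" using ends[OF C S nz] by (simp_all add: h_def)
      have h1: "h1 0 = (b - of_real (C L) * a) / of_real (S L)" "h1 L = (of_real (C L) * b - a) / of_real (S L)"
        using edge_solution(2,3)[OF C S nz h] he by simp_all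
      have hL: "L2 L h" unfolding h_def by (intro L2_add L2_scale ct)
      define t where "t x = c * k x + (- d) * l x" for x
      define t1 where "t1 x = c * k1 x + (- d) * l1 x" for x
      define g where "g x = c * m x + (- d) * n x" for x
      have t: "csol U L z t t1 g" unfolding t_def t1_def g_def by (rule csol_lincomb[OF k(1) l(1)])
      have tL: "L2 L t" "L2 L g" unfolding t_def g_def by (intro L2_add L2_scale k l)+
      define u where "u x = 1 * (1 * v x + 1 * h x) + 1 * t x" for x
      define u1 where "u1 x = 1 * (1 * v1 x + 1 * h1 x) + 1 * t1 x" for x
      have "csol U L z u u1 (\<lambda>x. 1 * (1 * f x + 1 * 0) + 1 * g x)"
        unfolding u_def u1_def by (rule csol_lincomb[OF csol_lincomb[OF v(1) h] t])
      then have r1: "csol U L z u u1 (\<lambda>x. f x + g x)" by simp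
      have r2: "u 0 = a" "u L = b" by (simp_all add: u_def t_def v k l he)
      have r3: "L2 L u" unfolding u_def by (intro L2_add L2_scale vL hL tL)
      have r4: "u1 0 = (b - of_real (C L) * a) / of_real (S L) + v1 0 + c"
        "u1 L = (of_real (C L) * b - a) / of_real (S L) + v1 L - d" by (simp_all add: u1_def t1_def h1 k l)
      have nt: "N2 L t \<le> 2 * B * ((cmod c)^2 + (cmod d)^2)"
        using two[OF k(3) l(3) B(3,4), of c "- d"] by (simp add: t_def[abs_def])
      have nh: "N2 L h \<le> 2 * B * ((cmod a)^2 + (cmod b)^2)"
        using two[OF ct B(1,2), of a b] by (simp add: h_def[abs_def])
      have ng: "N2 L g \<le> 2 * B * ((cmod c)^2 + (cmod d)^2)"
        using two[OF k(2) l(2) B(5,6), of c "- d"] by (simp add: g_def[abs_def])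
      have "N2 L u = N2 L (\<lambda>x. (v x + h x) + t x)" by (simp add: u_def[abs_def])
      then have "N2 L u \<le> 2 * N2 L (\<lambda>x. v x + h x) + 2 * N2 L t"
        using N2_add_le[OF L2_add[OF vL hL] tL(1)] by simp
      also have "... \<le> 2 * (2 * N2 L v + 2 * N2 L h) + 2 * N2 L t" using N2_add_le[OF vL hL] by simp
      finally have "N2 L u \<le> 4 * D * N2 L f + 8 * B * ((cmod a)^2 + (cmod b)^2) + 8 * B * ((cmod c)^2 + (cmod d)^2)"
        using nt nh vb(3) mult_nonneg_nonneg[OF B(7), of "(cmod c)^2 + (cmod d)^2"] by simp
      also have "... \<le> K * N2 L f + K * ((cmod a)^2 + (cmod b)^2) + K * ((cmod c)^2 + (cmod d)^2)"
        using K by (intro add_mono mult_right_mono) auto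
      finally have r5: "N2 L u \<le> K * (N2 L f + ((cmod a)^2 + (cmod b)^2) + ((cmod c)^2 + (cmod d)^2))" by (simp add: ring_distribs)
      have "2 * B * ((cmod c)^2 + (cmod d)^2) \<le> K * ((cmod c)^2 + (cmod d)^2)"
        using K by (intro mult_right_mono) auto
      then have r6: "N2 L g \<le> K * ((cmod c)^2 + (cmod d)^2)" using ng by simp
      show ?thesis using r1 r2 r3 r4 r5 r6 tL(2) by blast
    qed
    then show ?thesis unfolding edge_extends_def using vb DK by (intro exI[of _ "v1 0"] exI[of _ "v1 L"]) auto
  qed
  then show ?thesis using K(1) by blast
qed

end

lemma qL2_finite_support:
  assumes F: "finite F" "F \<subseteq> E" and l: "\<And>e. e \<in> F \<Longrightarrow> L2 L (u e)" and z: "\<And>e x. e \<notin> F \<Longrightarrow> u e x = 0"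
  shows "u \<in> qL2 E L"
proof -
  have u: "L2 L (u e)" for e
  proof (cases "e \<in> F")
    case False
    then have "u e = (\<lambda>_. 0)" using z by blast
    then show ?thesis by (simp add: L2_def)
  qed (rule l)
  have "{e \<in> E. (LINT x|leb L. (cmod (u e x))^2) \<noteq> 0} \<subseteq> F" using z by (auto intro: ccontr)
  then have "finite {e \<in> E. (LINT x|leb L. (cmod (u e x))^2) \<noteq> 0}" using F(1) finite_subset by blast
  then have "(\<lambda>e. LINT x|leb L. (cmod (u e x))^2) summable_on E"
    by (rule finite_nonzero_values_imp_summable_on)
  then show ?thesis using u by (simp add: qL2_def L2_def)
qed

lemma norm_sum_sq_le:
  fixes f :: "'a \<Rightarrow> complex"
  shows "(cmod (\<Sum>i\<in>A. f i))^2 \<le> real (card A) * (\<Sum>i\<in>A. (cmod (f i))^2)"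
proof -
  have "(cmod (\<Sum>i\<in>A. f i))^2 \<le> (\<Sum>i\<in>A. 1 * cmod (f i))^2" by (intro power_mono) (simp_all add: norm_sum)
  also have "... \<le> (\<Sum>i\<in>A. 1^2) * (\<Sum>i\<in>A. (cmod (f i))^2)" by (rule Cauchy_Schwarz_ineq_sum)
  finally show ?thesis by simp
qed

section \<open>Compactly supported approximate solutions on the metric tree\<close>

locale qtree = rtree T q + sturm L U for T :: "'b ograph" and q L U + fixes \<alpha> :: real
begin

abbreviation "Or v \<equiv> {e. e \<in> E \<and> org T e = v}"
abbreviation "Te v \<equiv> {e. e \<in> E \<and> trm T e = v}"

lemma OT_finite: "finite (Or v)" "finite (Te v)"
  using incident_sum(2,3)[OF simple nb_fin] by auto

lemma OT_card: "card (Or v) + card (Te v) = card (nb v)"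
  using incident_sum(1)[OF simple nb_fin, where h = "\<lambda>_. 1::nat" and v = v] by simp

lemma OT_card_le: "card (Or v) \<le> q + 1" "card (Te v) \<le> q + 1"
proof -
  have "card (nb v) \<le> q + 1"
  proof (cases "v \<in> V")
    case True then show ?thesis using nb_card by simp
  next
    case False then have "nb v = {}" using nb_V by blast
    then show ?thesis by simp
  qed
  then show "card (Or v) \<le> q + 1" "card (Te v) \<le> q + 1" using OT_card[of v] by linarith+
qed

lemma sum_ends_le:
  assumes y: "fs y" and F: "finite F" "F \<subseteq> E"
  shows "(\<Sum>e\<in>F. (cmod (y (org T e)))^2) \<le> (real q + 1) * sq y" "(\<Sum>e\<in>F. (cmod (y (trm T e)))^2) \<le> (real q + 1) * sq y"
proof -
  have *: "(\<Sum>e\<in>F. (cmod (y (o' e)))^2) \<le> (real q + 1) * sq y"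
    if c: "\<And>v. finite {e. e \<in> E \<and> o' e = v}" "\<And>v. card {e. e \<in> E \<and> o' e = v} \<le> q + 1" for o'
  proof -
    have "(\<Sum>e\<in>F. (cmod (y (o' e)))^2) = (\<Sum>v\<in>o' ` F. \<Sum>e | e \<in> F \<and> o' e = v. (cmod (y (o' e)))^2)"
      by (rule sum.group[symmetric]) (use F in auto)
    also have "... = (\<Sum>v\<in>o' ` F. real (card {e. e \<in> F \<and> o' e = v}) * (cmod (y v))^2)" by (intro sum.cong refl) simp
    also have "... \<le> (\<Sum>v\<in>o' ` F. (real q + 1) * (cmod (y v))^2)"
    proof (intro sum_mono mult_right_mono)
      fix v
      have "card {e. e \<in> F \<and> o' e = v} \<le> card {e. e \<in> E \<and> o' e = v}" using F by (intro card_mono c) auto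
      then show "real (card {e. e \<in> F \<and> o' e = v}) \<le> real q + 1" using c(2)[of v] by linarith
    qed simp
    also have "... = (real q + 1) * ns (o' ` F) y" by (simp add: ns_def sum_distrib_left)
    also have "... \<le> (real q + 1) * sq y" using F by (intro mult_left_mono sq_ge y) auto
    finally show ?thesis .
  qed
  show "(\<Sum>e\<in>F. (cmod (y (org T e)))^2) \<le> (real q + 1) * sq y" "(\<Sum>e\<in>F. (cmod (y (trm T e)))^2) \<le> (real q + 1) * sq y"
    using *[of "org T"] *[of "trm T"] OT_finite OT_card_le by blast+
qed

text \<open>Each vertex meets at most q + 1 edges, so the squared vertex currents are controlled by
  the squared end derivatives on F, each of which occurs at one origin and one terminus.\<close>

lemma sq_current_le:
  assumes F: "finite F" "F \<subseteq> E" and z: "\<And>e. e \<notin> F \<Longrightarrow> p e = 0 \<and> r e = 0"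
    and b: "\<And>e. e \<in> F \<Longrightarrow> (cmod (p e))^2 \<le> b e \<and> (cmod (r e))^2 \<le> b e"
  shows "fs (\<lambda>v. (\<Sum>e\<in>Or v. p e) - (\<Sum>e\<in>Te v. r e))"
    and "sq (\<lambda>v. (\<Sum>e\<in>Or v. p e) - (\<Sum>e\<in>Te v. r e)) \<le> 4 * (real q + 1) * (\<Sum>e\<in>F. b e)"
proof -
  let ?\<rho> = "\<lambda>v. (\<Sum>e\<in>Or v. p e) - (\<Sum>e\<in>Te v. r e)"
  define X where "X = org T ` F \<union> trm T ` F"
  have X: "finite X" "X \<subseteq> V" using F ograph_edge(5,6)[OF simple] unfolding X_def by auto
  have sup: "{v. ?\<rho> v \<noteq> 0} \<subseteq> X"
  proof (rule subsetI, rule ccontr)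
    fix v assume v: "v \<in> {v. ?\<rho> v \<noteq> 0}" "v \<notin> X"
    have "(\<Sum>e\<in>Or v. p e) = 0" using v(2) z unfolding X_def by (intro sum.neutral) auto
    moreover have "(\<Sum>e\<in>Te v. r e) = 0" using v(2) z unfolding X_def by (intro sum.neutral) auto
    ultimately show False using v(1) by simp
  qed
  then show "fs ?\<rho>" using X unfolding fs_def by (meson finite_subset order_trans)
  have "sq ?\<rho> = ns X ?\<rho>" by (rule sq_eq[OF X(1) sup])
  also have "... \<le> (\<Sum>v\<in>X. 2 * ((real q + 1) * (\<Sum>e | e \<in> F \<and> org T e = v. b e)) + 2 * ((real q + 1) * (\<Sum>e | e \<in> F \<and> trm T e = v. b e)))"
    unfolding ns_def
  proof (rule sum_mono)
    fix v
    have half: "(cmod (\<Sum>e\<in>A. s e))^2 \<le> (real q + 1) * (\<Sum>e\<in>A'. b e)"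
      if A: "finite A" "card A \<le> q + 1" "A' = A \<inter> F" and s: "\<And>e. e \<notin> F \<Longrightarrow> s e = 0" "\<And>e. e \<in> F \<Longrightarrow> (cmod (s e))^2 \<le> b e" for A A' s
    proof -
      have "(cmod (\<Sum>e\<in>A. s e))^2 \<le> real (card A) * (\<Sum>e\<in>A. (cmod (s e))^2)" by (rule norm_sum_sq_le)
      also have "... \<le> (real q + 1) * (\<Sum>e\<in>A. (cmod (s e))^2)" using A(2) by (intro mult_right_mono sum_nonneg) auto
      also have "(\<Sum>e\<in>A. (cmod (s e))^2) = (\<Sum>e\<in>A'. (cmod (s e))^2)"
        using A s(1) by (intro sum.mono_neutral_right) auto
      also have "(real q + 1) * ... \<le> (real q + 1) * (\<Sum>e\<in>A'. b e)" using A s(2) by (intro mult_left_mono sum_mono) auto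
      finally show ?thesis .
    qed
    have "(cmod (?\<rho> v))^2 \<le> 2 * (cmod (\<Sum>e\<in>Or v. p e))^2 + 2 * (cmod (\<Sum>e\<in>Te v. r e))^2"
      using sq_sum_le[of "\<Sum>e\<in>Or v. p e" "- (\<Sum>e\<in>Te v. r e)"] by simp
    moreover have "(cmod (\<Sum>e\<in>Or v. p e))^2 \<le> (real q + 1) * (\<Sum>e | e \<in> F \<and> org T e = v. b e)"
      by (rule half) (use OT_finite OT_card_le z b F in auto)
    moreover have "(cmod (\<Sum>e\<in>Te v. r e))^2 \<le> (real q + 1) * (\<Sum>e | e \<in> F \<and> trm T e = v. b e)"
      by (rule half) (use OT_finite OT_card_le z b F in auto)
    ultimately show "(cmod (?\<rho> v))^2 \<le> 2 * ((real q + 1) * (\<Sum>e | e \<in> F \<and> org T e = v. b e)) + 2 * ((real q + 1) * (\<Sum>e | e \<in> F \<and> trm T e = v. b e))"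
      by linarith
  qed
  also have "... = 2 * ((real q + 1) * (\<Sum>v\<in>X. \<Sum>e | e \<in> F \<and> org T e = v. b e)) + 2 * ((real q + 1) * (\<Sum>v\<in>X. \<Sum>e | e \<in> F \<and> trm T e = v. b e))"
    by (simp only: sum.distrib sum_distrib_left)
  also have "(\<Sum>v\<in>X. \<Sum>e | e \<in> F \<and> org T e = v. b e) = (\<Sum>e\<in>F. b e)" by (rule sum.group) (use F X in \<open>auto simp: X_def\<close>)
  also have "(\<Sum>v\<in>X. \<Sum>e | e \<in> F \<and> trm T e = v. b e) = (\<Sum>e\<in>F. b e)" by (rule sum.group) (use F X in \<open>auto simp: X_def\<close>)
  finally show "sq ?\<rho> \<le> 4 * (real q + 1) * (\<Sum>e\<in>F. b e)" by (simp add: algebra_simps)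
qed

text \<open>K is meant to be uniform in F, f and \<epsilon>, whereas F' may depend on all of them; g
  is the error left when supports are kept finite.\<close>

definition near_solution :: "real \<Rightarrow> real \<Rightarrow> 'b set set \<Rightarrow> ('b set \<Rightarrow> real \<Rightarrow> complex) \<Rightarrow> real \<Rightarrow> bool" where
  "near_solution z K F f \<epsilon> \<longleftrightarrow>
    (\<exists>u g F'. finite F' \<and> F \<subseteq> F' \<and> F' \<subseteq> E \<and> (\<forall>e x. e \<notin> F' \<longrightarrow> u e x = 0 \<and> g e x = 0) \<and> (\<forall>e\<in>F'. L2 L (u e) \<and> L2 L (g e)) \<and>
      (\<Sum>e\<in>F'. N2 L (u e)) \<le> K * (\<Sum>e\<in>F. N2 L (f e)) \<and> (\<Sum>e\<in>F'. N2 L (g e)) \<le> \<epsilon> \<and>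
      (u, \<lambda>e x. of_real z * u e x + ((if e \<in> F then f e x else 0) + g e x)) \<in> compact_quantum_graph_op L \<alpha> U T)"

text \<open>Solving edge by edge leaves a current defect \<rho> at the vertices. Vertex values y
  with A y - W y = - \<open>S L\<close> \<rho> + d remove it up to d, and d is absorbed by changing
  the end derivatives by \<theta>, at the cost of a source g of the size of d.\<close>

lemma approximate_inverse:
  assumes C: "solves_ivp L U z 1 0 C" and S: "solves_ivp L U z 0 1 S" and nz: "S L \<noteq> 0"
    and w: "\<bar>(real q + 1) * C L + \<alpha> * S L\<bar> > 2 * sqrt (real q)"
  shows "\<exists>K\<ge>0. \<forall>F f \<epsilon>. finite F \<longrightarrow> F \<subseteq> E \<longrightarrow> (\<forall>e\<in>F. L2 L (f e)) \<longrightarrow> \<epsilon> > 0 \<longrightarrow> near_solution z K F f \<epsilon>"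
proof -
  define W where "W = (real q + 1) * C L + \<alpha> * S L"
  have nz': "complex_of_real (S L) \<noteq> 0" using nz by simp
  obtain K1 where K1: "K1 \<ge> 0" and ext: "\<And>f. L2 L f \<Longrightarrow> \<exists>p r. edge_extends z C S K1 f p r"
    using edge_extension[OF C S nz] by blast
  obtain K2 where K2: "K2 \<ge> 0" and res: "\<And>r \<epsilon>. fs r \<Longrightarrow> \<epsilon> > 0 \<Longrightarrow> (\<exists>y d. fs y \<and> fs d \<and> (\<forall>x. Ad y x - of_real W * y x = r x + d x) \<and>
     sq y \<le> K2 * sq r \<and> sq d \<le> sq r \<and> sq d \<le> \<epsilon>)"
    using approximate_resolvent[OF w] unfolding W_def by blast
  \<comment> \<open>A defect d in the adjacency equation is a current defect d / \<open>S L\<close>;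
    it is shared equally among the q + 1 edges at the vertex.\<close>
  define k where "k = - 1 / (complex_of_real (S L) * (of_nat q + 1))"
  define m where "m = (cmod k)^2"
  have m0: "m \<ge> 0" by (simp add: m_def)
  define K3 where "K3 = (S L)^2 * (4 * (real q + 1) * K1)"
  have K3: "K3 \<ge> 0" using K1 by (simp add: K3_def)
  define K where "K = K1 * (1 + 2 * (real q + 1) * (K2 * K3) + 2 * (real q + 1) * (m * K3))"
  have K: "K \<ge> 0" using K1 K2 K3 m0 by (simp add: K_def)
  have "near_solution z K F f \<epsilon>"
    if F: "finite F" "F \<subseteq> E" and fL: "\<forall>e\<in>F. L2 L (f e)" and \<epsilon>: "\<epsilon> > 0" for F f \<epsilon>
  proof -
    define f' where "f' e = (\<lambda>x. if e \<in> F then f e x else 0)" for e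
    have f'F: "e \<in> F \<Longrightarrow> f' e = f e" for e by (simp add: f'_def)
    have f'0: "e \<notin> F \<Longrightarrow> f' e = (\<lambda>_. 0)" for e by (simp add: f'_def)
    have f'L: "L2 L (f' e)" for e using fL f'F f'0 by (cases "e \<in> F") (auto simp: L2_def)
    have Nf': "N2 L (f' e) = (if e \<in> F then N2 L (f e) else 0)" for e using f'F f'0 by (auto simp: N2_def)
    have "\<forall>e. \<exists>p r. edge_extends z C S K1 (f' e) p r" using ext[OF f'L] by blast
    then obtain p r where epr: "\<And>e. edge_extends z C S K1 (f' e) (p e) (r e)" by metis
    have pr: "(cmod (p e))^2 \<le> K1 * N2 L (f' e) \<and> (cmod (r e))^2 \<le> K1 * N2 L (f' e)" for e
      using epr[of e] unfolding edge_extends_def by blast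
    have pr0: "p e = 0 \<and> r e = 0" if "e \<notin> F" for e using pr[of e] that by (simp add: Nf')
    define nf where "nf = (\<Sum>e\<in>F. N2 L (f e))"
    have nf0: "nf \<ge> 0" unfolding nf_def by (intro sum_nonneg) simp
    define \<rho> where "\<rho> v = (\<Sum>e\<in>Or v. p e) - (\<Sum>e\<in>Te v. r e)" for v
    have rho: "fs \<rho>" "sq \<rho> \<le> 4 * (real q + 1) * (\<Sum>e\<in>F. K1 * N2 L (f' e))"
      unfolding \<rho>_def using sq_current_le[OF F, of p r "\<lambda>e. K1 * N2 L (f' e)"] pr pr0 by blast+
    have "(\<Sum>e\<in>F. K1 * N2 L (f' e)) = K1 * nf" by (simp add: nf_def sum_distrib_left Nf')
    with rho have rb: "sq \<rho> \<le> 4 * (real q + 1) * K1 * nf" by simp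
    define r0 where "r0 v = - of_real (S L) * \<rho> v" for v
    have r0: "fs r0" "sq r0 \<le> K3 * nf"
    proof -
      show "fs r0" unfolding r0_def by (rule fs_scale[OF rho(1)])
      have "sq r0 = (S L)^2 * sq \<rho>" unfolding r0_def using sq_scale[OF rho(1), of "- of_real (S L)"] by simp
      also have "... \<le> (S L)^2 * (4 * (real q + 1) * K1 * nf)" using rb by (intro mult_left_mono) auto
      finally show "sq r0 \<le> K3 * nf" by (simp add: K3_def mult.assoc)
    qed
    \<comment> \<open>The tolerance for d that makes the sources g sum to at most \<epsilon>; the
      summand 1 keeps the denominator positive.\<close>
    define \<epsilon>' where "\<epsilon>' = \<epsilon> / (1 + K1 * (2 * (real q + 1) * m))"
    have den: "1 + K1 * (2 * (real q + 1) * m) > 0" using K1 m0 by (intro add_pos_nonneg) auto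
    have \<epsilon>': "\<epsilon>' > 0" using \<epsilon> den by (simp add: \<epsilon>'_def)
    obtain y d where y: "fs y" and d: "fs d" and yd: "\<And>x. Ad y x - of_real W * y x = r0 x + d x"
      and sy: "sq y \<le> K2 * sq r0" and sd: "sq d \<le> sq r0" "sq d \<le> \<epsilon>'" using res[OF r0(1) \<epsilon>'] by blast
    define \<theta> where "\<theta> v = k * d v" for v
    have th: "fs \<theta>" "sq \<theta> = m * sq d" unfolding \<theta>_def m_def using fs_scale[OF d] sq_scale[OF d] by auto
    \<comment> \<open>Besides F, all edges that meet the supports of y and d, since there u or g
      need not vanish.\<close>
    define F' where "F' = F \<union> (\<Union>v\<in>{x. y x \<noteq> 0} \<union> {x. d x \<noteq> 0}. Or v \<union> Te v)"
    have F': "finite F'" "F \<subseteq> F'" "F' \<subseteq> E"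
      using F y d OT_finite unfolding F'_def fs_def by auto
    have out: "e \<notin> F \<and> y (org T e) = 0 \<and> y (trm T e) = 0 \<and> \<theta> (org T e) = 0 \<and> \<theta> (trm T e) = 0" if "e \<in> E" "e \<notin> F'" for e
      using that unfolding F'_def \<theta>_def by auto
    define P where "P e u u1 g \<longleftrightarrow> csol U L z u u1 (\<lambda>x. f' e x + g x) \<and> u 0 = y (org T e) \<and> u L = y (trm T e) \<and> L2 L u \<and> L2 L g \<and>
       u1 0 = (y (trm T e) - of_real (C L) * y (org T e)) / of_real (S L) + p e + \<theta> (org T e) \<and>
       u1 L = (of_real (C L) * y (trm T e) - y (org T e)) / of_real (S L) + r e - \<theta> (trm T e) \<and>
       N2 L u \<le> K1 * (N2 L (f' e) + ((cmod (y (org T e)))^2 + (cmod (y (trm T e)))^2) + ((cmod (\<theta> (org T e)))^2 + (cmod (\<theta> (trm T e)))^2)) \<and>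
       N2 L g \<le> K1 * ((cmod (\<theta> (org T e)))^2 + (cmod (\<theta> (trm T e)))^2)" for e u u1 g
    have exP: "\<exists>u u1 g. P e u u1 g" for e using epr[of e] unfolding P_def edge_extends_def by blast
    have P0: "P e (\<lambda>_. 0) (\<lambda>_. 0) (\<lambda>_. 0)" if e: "e \<in> E" "e \<notin> F'" for e
    proof -
      note o = out[OF e]
      have "csol U L z (\<lambda>_. 0) (\<lambda>_. 0) (\<lambda>_. 0)"
      proof -
        obtain h1 where "csol U L z (\<lambda>x. of_real (C x)) h1 (\<lambda>_. 0)" using csol_of_real[OF C] by blast
        from csol_lincomb[OF this this, of 0 0] show ?thesis by simp
      qed
      then show ?thesis using o pr0[of e] f'0[of e] by (simp add: P_def L2_def N2_def)
    qed
    \<comment> \<open>On edges outside F' all data vanish and P0 admits the zero triple; choosing it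
      there gives u and g finite support.\<close>
    have "\<forall>e. \<exists>w. (e \<in> E \<longrightarrow> P e (fst w) (fst (snd w)) (snd (snd w))) \<and> (e \<notin> F' \<longrightarrow> w = (\<lambda>_. 0, \<lambda>_. 0, \<lambda>_. 0))"
    proof
      fix e
      show "\<exists>w. (e \<in> E \<longrightarrow> P e (fst w) (fst (snd w)) (snd (snd w))) \<and> (e \<notin> F' \<longrightarrow> w = (\<lambda>_. 0, \<lambda>_. 0, \<lambda>_. 0))"
      proof (cases "e \<in> F'")
        case True
        obtain u u1 g where "P e u u1 g" using exP by blast
        then show ?thesis using True by (intro exI[of _ "(u, u1, g)"]) simp
      next
        case False
        then show ?thesis using P0 by (intro exI[of _ "(\<lambda>_. 0, \<lambda>_. 0, \<lambda>_. 0)"]) simp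
      qed
    qed
    from choice[OF this] obtain w where w: "\<And>e. e \<in> E \<Longrightarrow> P e (fst (w e)) (fst (snd (w e))) (snd (snd (w e)))"
      and w0: "\<And>e. e \<notin> F' \<Longrightarrow> w e = (\<lambda>_. 0, \<lambda>_. 0, \<lambda>_. 0)" by blast
    define u where "u e = fst (w e)" for e
    define u1 where "u1 e = fst (snd (w e))" for e
    define g where "g e = snd (snd (w e))" for e
    have PE: "P e (u e) (u1 e) (g e)" if "e \<in> E" for e using w[OF that] by (simp add: u_def u1_def g_def)
    have zero: "u e = (\<lambda>_. 0)" "g e = (\<lambda>_. 0)" if "e \<notin> F'" for e using w0[OF that] by (simp_all add: u_def g_def)
    have cs: "csol U L z (u e) (u1 e) (\<lambda>x. f' e x + g e x)" and uy: "u e 0 = y (org T e)" "u e L = y (trm T e)"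
      and u1: "u1 e 0 = (y (trm T e) - of_real (C L) * y (org T e)) / of_real (S L) + p e + \<theta> (org T e)"
       "u1 e L = (of_real (C L) * y (trm T e) - y (org T e)) / of_real (S L) + r e - \<theta> (trm T e)"
      and Nu: "N2 L (u e) \<le> K1 * (N2 L (f' e) + ((cmod (y (org T e)))^2 + (cmod (y (trm T e)))^2) + ((cmod (\<theta> (org T e)))^2 + (cmod (\<theta> (trm T e)))^2))"
      and Ng: "N2 L (g e) \<le> K1 * ((cmod (\<theta> (org T e)))^2 + (cmod (\<theta> (trm T e)))^2)" if "e \<in> E" for e
      using PE[OF that] unfolding P_def by blast+
    have ugL: "L2 L (u e)" "L2 L (g e)" if "e \<in> F'" for e
      using PE[of e] that F'(3) unfolding P_def by blast+
    have inE: "e \<in> E" if "e \<in> F'" for e using that F'(3) by blast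
    have sN: "(\<Sum>e\<in>F'. N2 L (f' e)) = nf"
      unfolding nf_def Nf' using F' by (simp add: sum.If_cases Int_absorb1)
    have two: "(\<Sum>e\<in>F'. (cmod (h (org T e)))^2 + (cmod (h (trm T e)))^2) \<le> 2 * (real q + 1) * sq h" if "fs h" for h
      using sum_ends_le[OF that F'(1,3)] unfolding sum.distrib by linarith
    have thn: "sq \<theta> \<le> m * (K3 * nf)" using th(2) sd(1) r0(2) m0 by (auto intro!: mult_left_mono)
    have yn: "sq y \<le> K2 * (K3 * nf)" using sy mult_left_mono[OF r0(2) K2] by linarith
    have "(\<Sum>e\<in>F'. N2 L (u e)) \<le> (\<Sum>e\<in>F'. K1 * (N2 L (f' e) + ((cmod (y (org T e)))^2 + (cmod (y (trm T e)))^2) + ((cmod (\<theta> (org T e)))^2 + (cmod (\<theta> (trm T e)))^2)))"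
      by (intro sum_mono Nu inE)
    also have "... = K1 * (nf + (\<Sum>e\<in>F'. (cmod (y (org T e)))^2 + (cmod (y (trm T e)))^2) + (\<Sum>e\<in>F'. (cmod (\<theta> (org T e)))^2 + (cmod (\<theta> (trm T e)))^2))"
      unfolding sum_distrib_left[symmetric] sN[symmetric] by (simp only: sum.distrib)
    also have "... \<le> K1 * (nf + 2 * (real q + 1) * (K2 * (K3 * nf)) + 2 * (real q + 1) * (m * (K3 * nf)))"
    proof (intro mult_left_mono add_mono order_refl K1)
      show "(\<Sum>e\<in>F'. (cmod (y (org T e)))^2 + (cmod (y (trm T e)))^2) \<le> 2 * (real q + 1) * (K2 * (K3 * nf))"
        by (rule order_trans[OF two[OF y]]) (intro mult_left_mono yn, simp)
      show "(\<Sum>e\<in>F'. (cmod (\<theta> (org T e)))^2 + (cmod (\<theta> (trm T e)))^2) \<le> 2 * (real q + 1) * (m * (K3 * nf))"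
        by (rule order_trans[OF two[OF th(1)]]) (intro mult_left_mono thn, simp)
    qed
    also have "... = K * nf" by (simp add: K_def algebra_simps)
    finally have uK: "(\<Sum>e\<in>F'. N2 L (u e)) \<le> K * nf" .
    have "(\<Sum>e\<in>F'. N2 L (g e)) \<le> K1 * (\<Sum>e\<in>F'. (cmod (\<theta> (org T e)))^2 + (cmod (\<theta> (trm T e)))^2)"
      unfolding sum_distrib_left by (intro sum_mono Ng inE)
    also have "... \<le> K1 * (2 * (real q + 1) * (m * \<epsilon>'))"
    proof (intro mult_left_mono K1)
      have "sq \<theta> \<le> m * \<epsilon>'" unfolding th(2) using sd(2) m0 by (rule mult_left_mono)
      then have "2 * (real q + 1) * sq \<theta> \<le> 2 * (real q + 1) * (m * \<epsilon>')" by (intro mult_left_mono) auto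
      then show "(\<Sum>e\<in>F'. (cmod (\<theta> (org T e)))^2 + (cmod (\<theta> (trm T e)))^2) \<le> 2 * (real q + 1) * (m * \<epsilon>')"
        using two[OF th(1)] by linarith
    qed
    also have "... = K1 * (2 * (real q + 1) * m) * \<epsilon>'" by simp
    also have "... \<le> (1 + K1 * (2 * (real q + 1) * m)) * \<epsilon>'" using \<epsilon>' by (intro mult_right_mono) auto
    also have "... = \<epsilon>" using den by (simp add: \<epsilon>'_def)
    finally have g\<epsilon>: "(\<Sum>e\<in>F'. N2 L (g e)) \<le> \<epsilon>" .
    have uq: "u \<in> qL2 E L" by (rule qL2_finite_support[OF F'(1,3) ugL(1)]) (simp_all add: zero)
    have hq: "(\<lambda>e x. of_real z * u e x + (f' e x + g e x)) \<in> qL2 E L"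
    proof (rule qL2_finite_support[OF F'(1,3)])
      show "L2 L (\<lambda>x. of_real z * u e x + (f' e x + g e x))" if "e \<in> F'" for e by (intro L2_add L2_scale ugL[OF that] f'L)
      show "of_real z * u e x + (f' e x + g e x) = 0" if "e \<notin> F'" for e x
      proof -
        have "e \<notin> F" using that F' by blast
        then show ?thesis using zero[OF that] f'0 by simp
      qed
    qed
    have "\<forall>e. \<exists>u2. e \<in> E \<longrightarrow> W22_derivs L (u e) (u1 e) u2 \<and>
        (AE x in leb L. - u2 x + of_real (U x) * u e x = of_real z * u e x + (f' e x + g e x))"
      using cs unfolding csol_def by blast
    from choice[OF this] obtain u2 where u2: "\<And>e. e \<in> E \<Longrightarrow> W22_derivs L (u e) (u1 e) (u2 e)"
      and ae: "\<And>e. e \<in> E \<Longrightarrow> AE x in leb L. - u2 e x + of_real (U x) * u e x = of_real z * u e x + (f' e x + g e x)"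
      by blast
    have ae': "AE x in leb L. of_real z * u e x + (f' e x + g e x) = - u2 e x + of_real (U x) * u e x" if "e \<in> E" for e
      using ae[OF that] by eventually_elim simp
    have kir: "kirchhoff T L \<alpha> u u1"
      unfolding kirchhoff_def
    proof (intro exI[of _ y] ballI conjI impI)
      fix v assume v: "v \<in> V"
      have "(\<Sum>e\<in>Or v. u1 e 0) - (\<Sum>e\<in>Te v. u1 e L)
        = (\<Sum>e\<in>Or v. (y (trm T e) - of_real (C L) * y (org T e)) / of_real (S L) + p e + \<theta> (org T e))
          - (\<Sum>e\<in>Te v. (of_real (C L) * y (trm T e) - y (org T e)) / of_real (S L) + r e - \<theta> (trm T e))"
        using u1 by (intro arg_cong2[where f = "(-)"] sum.cong refl) simp_all
      also have "... = (Ad y v - (of_nat q + 1) * of_real (C L) * y v) / of_real (S L) + \<rho> v + (of_nat q + 1) * \<theta> v"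
        unfolding \<rho>_def Ad_def by (rule incident_current[OF simple nb_fin, where v = v, unfolded nb_card[OF v] of_nat_add of_nat_1])
      also have "Ad y v = of_real W * y v + (- of_real (S L) * \<rho> v + d v)" using yd[of v] by (simp add: r0_def algebra_simps)
      also have "(of_nat q + 1) * \<theta> v = - d v / of_real (S L)"
      proof -
        have "(of_nat q + 1 :: complex) \<noteq> 0" by (metis of_nat_Suc of_nat_neq_0 add.commute)
        moreover have "Q * (- 1 / (s * Q) * x) = - x / s" if "Q \<noteq> 0" "s \<noteq> 0" for Q s x :: complex using that by (simp add: field_simps)
        ultimately show ?thesis using nz' unfolding \<theta>_def k_def by blast
      qed
      also have "(of_real W * y v + (- of_real (S L) * \<rho> v + d v) - (of_nat q + 1) * of_real (C L) * y v) / of_real (S L) + \<rho> v + - d v / of_real (S L)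
        = of_real \<alpha> * y v"
        using nz' by (simp add: W_def field_simps)
      finally show "(\<Sum>e\<in>Or v. u1 e 0) - (\<Sum>e\<in>Te v. u1 e L) = of_real \<alpha> * y v" .
    qed (use uy in auto)
    have "{e \<in> E. \<exists>x\<in>{0..L}. u e x \<noteq> 0} \<subseteq> F'" by (auto simp: zero intro: ccontr)
    then have fin: "finite {e \<in> E. \<exists>x\<in>{0..L}. u e x \<noteq> 0}" using F'(1) finite_subset by blast
    have "\<forall>e\<in>E. W22_derivs L (u e) (u1 e) (u2 e) \<and> (AE x in leb L. of_real z * u e x + (f' e x + g e x) = - u2 e x + of_real (U x) * u e x)"
      using u2 ae' by blast
    with kir have "\<exists>u1 u2. (\<forall>e\<in>E. W22_derivs L (u e) (u1 e) (u2 e) \<and> (AE x in leb L. of_real z * u e x + (f' e x + g e x) = - u2 e x + of_real (U x) * u e x)) \<and> kirchhoff T L \<alpha> u u1"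
      by blast
    then have op: "(u, \<lambda>e x. of_real z * u e x + ((if e \<in> F then f e x else 0) + g e x)) \<in> compact_quantum_graph_op L \<alpha> U T"
      unfolding compact_quantum_graph_op_def quantum_graph_op_def using fin uq hq unfolding f'_def by simp
    have z: "\<forall>e x. e \<notin> F' \<longrightarrow> u e x = 0 \<and> g e x = 0" by (simp add: zero)
    show ?thesis unfolding near_solution_def by (intro exI[of _ u] exI[of _ g] exI[of _ F'] conjI F' z ballI ugL uK[unfolded nf_def] g\<epsilon> op)
  qed
  then show ?thesis using K by blast
qed

end

section \<open>Resolvent bounds and spectral measures\<close>

lemma integral_product_le:
  assumes f: "L2 L f" and g: "L2 L g" and t: "t > 0"
  shows "cmod (LINT x|leb L. cnj (f x) * g x) \<le> t / 2 * N2 L f + 1 / (2 * t) * N2 L g"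
proof -
  have "cmod (LINT x|leb L. cnj (f x) * g x) \<le> (LINT x|leb L. cmod (cnj (f x) * g x))"
    by (rule integral_norm_bound)
  also have "... \<le> (LINT x|leb L. t / 2 * (cmod (f x))^2 + 1 / (2 * t) * (cmod (g x))^2)"
  proof (rule integral_mono)
    show "integrable (leb L) (\<lambda>x. cmod (cnj (f x) * g x))" using L2_product_integrable[OF f g] by simp
    show "integrable (leb L) (\<lambda>x. t / 2 * (cmod (f x))^2 + 1 / (2 * t) * (cmod (g x))^2)"
      using f g by (auto simp: L2_def)
    fix x
    have "0 \<le> (t * cmod (f x) - cmod (g x))^2 / (2 * t)" using t by simp
    then have "0 \<le> t / 2 * (cmod (f x))^2 - cmod (f x) * cmod (g x) + 1 / (2 * t) * (cmod (g x))^2"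
      using t by (simp add: power2_eq_square field_simps)
    then show "cmod (cnj (f x) * g x) \<le> t / 2 * (cmod (f x))^2 + 1 / (2 * t) * (cmod (g x))^2"
      by (simp add: norm_mult)
  qed
  also have "... = t / 2 * N2 L f + 1 / (2 * t) * N2 L g" using f g by (simp add: N2_def L2_def)
  finally show ?thesis .
qed

lemma integral_self: "(LINT x|leb L. cnj (f x) * f x) = complex_of_real (N2 L f)"
  unfolding N2_def by (subst integral_complex_of_real[symmetric]) (intro Bochner_Integration.integral_cong refl, simp add: complex_norm_square mult.commute del: of_real_power)

text \<open>The square of \<open>qnorm\<close>, in which the absorption arguments are
  linear.\<close>

definition Q2 :: "'e set \<Rightarrow> real \<Rightarrow> ('e \<Rightarrow> real \<Rightarrow> complex) \<Rightarrow> real" where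
  "Q2 E L \<psi> = (\<Sum>\<^sub>\<infinity>e\<in>E. N2 L (\<psi> e))"

lemma qL2_D: "\<psi> \<in> qL2 E L \<Longrightarrow> e \<in> E \<Longrightarrow> L2 L (\<psi> e)" "\<psi> \<in> qL2 E L \<Longrightarrow> (\<lambda>e. N2 L (\<psi> e)) summable_on E"
  by (auto simp: qL2_def L2_def N2_def)

lemma qL2_lincomb:
  assumes f: "\<phi> \<in> qL2 E L" and g: "\<psi> \<in> qL2 E L"
  shows "(\<lambda>e x. a * \<phi> e x + b * \<psi> e x) \<in> qL2 E L"
    and "Q2 E L (\<lambda>e x. a * \<phi> e x + b * \<psi> e x) \<le> 2 * (cmod a)^2 * Q2 E L \<phi> + 2 * (cmod b)^2 * Q2 E L \<psi>"
proof -
  have l: "L2 L (\<phi> e)" "L2 L (\<psi> e)" if "e \<in> E" for e using qL2_D(1)[OF f that] qL2_D(1)[OF g that] .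
  have s: "(\<lambda>e. 2 * (cmod a)^2 * N2 L (\<phi> e)) summable_on E" "(\<lambda>e. 2 * (cmod b)^2 * N2 L (\<psi> e)) summable_on E"
    by (intro summable_on_cmult_right qL2_D f g)+
  then have sb: "(\<lambda>e. 2 * (cmod a)^2 * N2 L (\<phi> e) + 2 * (cmod b)^2 * N2 L (\<psi> e)) summable_on E" by (rule summable_on_add)
  have le: "N2 L (\<lambda>x. a * \<phi> e x + b * \<psi> e x) \<le> 2 * (cmod a)^2 * N2 L (\<phi> e) + 2 * (cmod b)^2 * N2 L (\<psi> e)" if "e \<in> E" for e
    by (rule N2_lincomb_le[OF l[OF that]])
  have sm: "(\<lambda>e. N2 L (\<lambda>x. a * \<phi> e x + b * \<psi> e x)) summable_on E"
    by (rule summable_on_comparison_test[OF sb le]) simp_all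
  have "L2 L (\<lambda>x. a * \<phi> e x + b * \<psi> e x)" if "e \<in> E" for e
    by (intro L2_add L2_scale l that)
  then show "(\<lambda>e x. a * \<phi> e x + b * \<psi> e x) \<in> qL2 E L" using sm by (simp add: qL2_def L2_def N2_def)
  have "Q2 E L (\<lambda>e x. a * \<phi> e x + b * \<psi> e x) \<le> (\<Sum>\<^sub>\<infinity>e\<in>E. 2 * (cmod a)^2 * N2 L (\<phi> e) + 2 * (cmod b)^2 * N2 L (\<psi> e))"
    unfolding Q2_def by (rule infsum_mono[OF sm sb le])
  also have "... = 2 * (cmod a)^2 * Q2 E L \<phi> + 2 * (cmod b)^2 * Q2 E L \<psi>"
    unfolding Q2_def infsum_add[OF s] infsum_cmult_right' ..
  finally show "Q2 E L (\<lambda>e x. a * \<phi> e x + b * \<psi> e x) \<le> 2 * (cmod a)^2 * Q2 E L \<phi> + 2 * (cmod b)^2 * Q2 E L \<psi>" .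
qed

lemma sum_N2_le_Q2: "\<psi> \<in> qL2 E L \<Longrightarrow> finite F \<Longrightarrow> F \<subseteq> E \<Longrightarrow> (\<Sum>e\<in>F. N2 L (\<psi> e)) \<le> Q2 E L \<psi>"
  unfolding Q2_def by (intro finite_sum_le_infsum qL2_D) auto

lemma Q2_nonneg: "Q2 E L \<psi> \<ge> 0"
  unfolding Q2_def by (rule infsum_nonneg) simp

lemma qinner_summable:
  assumes "\<phi> \<in> qL2 E L" "\<psi> \<in> qL2 E L"
  shows "(\<lambda>e. LINT x|leb L. cnj (\<phi> e x) * \<psi> e x) summable_on E"
proof (rule Infinite_Sum.abs_summable_summable, rule Infinite_Sum.abs_summable_on_comparison_test')
  show "(\<lambda>e. N2 L (\<phi> e) + N2 L (\<psi> e)) summable_on E" by (intro summable_on_add qL2_D assms)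
  fix e assume e: "e \<in> E"
  from integral_product_le[OF qL2_D(1)[OF assms(1) e] qL2_D(1)[OF assms(2) e], of 1]
  show "cmod (LINT x|leb L. cnj (\<phi> e x) * \<psi> e x) \<le> N2 L (\<phi> e) + N2 L (\<psi> e)"
    using N2_nonneg[of L "\<phi> e"] N2_nonneg[of L "\<psi> e"] by linarith
qed

lemma qinner_finite_support:
  assumes "finite F" "F \<subseteq> E" "\<And>e x. e \<notin> F \<Longrightarrow> g e x = 0"
  shows "qinner E L \<phi> g = (\<Sum>e\<in>F. LINT x|leb L. cnj (\<phi> e x) * g e x)"
proof -
  have "qinner E L \<phi> g = (\<Sum>\<^sub>\<infinity>e\<in>F. LINT x|leb L. cnj (\<phi> e x) * g e x)"
    unfolding qinner_def by (rule infsum_cong_neutral) (use assms in auto)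
  then show ?thesis using assms(1) by simp
qed

text \<open>With \<phi> = (T - z)^-1 \<psi> the pairing of T \<phi> = z \<phi> + \<psi> with \<phi>
  is real by symmetry; take imaginary parts.\<close>

lemma symmetric_resolvent_identity:
  assumes sa: "T = qadjoint E L T" and p: "(\<phi>, \<lambda>e x. z * \<phi> e x + \<psi> e x) \<in> T" and psi: "\<psi> \<in> qL2 E L"
  shows "Im z * Q2 E L \<phi> = Im (qinner E L \<psi> \<phi>)"
proof -
  have pa: "(\<phi>, \<lambda>e x. z * \<phi> e x + \<psi> e x) \<in> qadjoint E L T" using p sa by simp
  then have phi: "\<phi> \<in> qL2 E L" unfolding qadjoint_def by blast
  have l: "L2 L (\<phi> e)" "L2 L (\<psi> e)" if "e \<in> E" for e using qL2_D(1)[OF phi that] qL2_D(1)[OF psi that] .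
  have "qinner E L \<phi> (\<lambda>e x. z * \<phi> e x + \<psi> e x) = qinner E L (\<lambda>e x. z * \<phi> e x + \<psi> e x) \<phi>"
    using pa p unfolding qadjoint_def by blast
  moreover have "qinner E L \<phi> (\<lambda>e x. z * \<phi> e x + \<psi> e x) = cnj (qinner E L (\<lambda>e x. z * \<phi> e x + \<psi> e x) \<phi>)"
    unfolding qinner_def infsum_cnj[symmetric]
  proof (rule infsum_cong)
    fix e
    show "(LINT x|leb L. cnj (\<phi> e x) * (z * \<phi> e x + \<psi> e x)) = cnj (LINT x|leb L. cnj (z * \<phi> e x + \<psi> e x) * \<phi> e x)"
      unfolding Bochner_Integration.integral_cnj[symmetric] by (intro Bochner_Integration.integral_cong refl) (simp add: mult.commute)
  qed
  ultimately have "qinner E L (\<lambda>e x. z * \<phi> e x + \<psi> e x) \<phi> = cnj (qinner E L (\<lambda>e x. z * \<phi> e x + \<psi> e x) \<phi>)" by (rule trans[OF sym])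
  from arg_cong[OF this, of Im] have im0: "Im (qinner E L (\<lambda>e x. z * \<phi> e x + \<psi> e x) \<phi>) = 0" by simp
  have sB: "(\<lambda>e. LINT x|leb L. cnj (\<psi> e x) * \<phi> e x) summable_on E" by (rule qinner_summable[OF psi phi])
  have sA: "(\<lambda>e. cnj z * complex_of_real (N2 L (\<phi> e))) summable_on E"
    by (intro summable_on_cmult_right summable_on_of_real qL2_D phi)
  have tm: "(LINT x|leb L. cnj (z * \<phi> e x + \<psi> e x) * \<phi> e x)
      = cnj z * complex_of_real (N2 L (\<phi> e)) + (LINT x|leb L. cnj (\<psi> e x) * \<phi> e x)" if "e \<in> E" for e
  proof -
    have "(LINT x|leb L. cnj (z * \<phi> e x + \<psi> e x) * \<phi> e x)
      = (LINT x|leb L. cnj z * (cnj (\<phi> e x) * \<phi> e x) + cnj (\<psi> e x) * \<phi> e x)"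
      by (intro Bochner_Integration.integral_cong refl) (simp add: algebra_simps)
    also have "... = cnj z * (LINT x|leb L. cnj (\<phi> e x) * \<phi> e x) + (LINT x|leb L. cnj (\<psi> e x) * \<phi> e x)"
      using L2_product_integrable[OF l(1) l(1)] L2_product_integrable[OF l(2) l(1)] that by simp
    finally show ?thesis by (simp only: integral_self)
  qed
  have sp: "qinner E L (\<lambda>e x. z * \<phi> e x + \<psi> e x) \<phi> = (\<Sum>\<^sub>\<infinity>e\<in>E. cnj z * complex_of_real (N2 L (\<phi> e))) + qinner E L \<psi> \<phi>"
    unfolding qinner_def infsum_add[OF sA sB, symmetric] by (rule infsum_cong[OF tm])
  have "Im (\<Sum>\<^sub>\<infinity>e\<in>E. cnj z * complex_of_real (N2 L (\<phi> e))) = - Im z * Q2 E L \<phi>"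
    unfolding infsum_Im[OF sA, symmetric] Q2_def infsum_cmult_right'[symmetric] by (rule infsum_cong) simp
  then show ?thesis using im0 unfolding sp by simp
qed

text \<open>The imaginary part of 1 / (t - z) is the Poisson kernel, which is at least 1 / (2 Im z)
  for t within Im z of Re z.\<close>

lemma stieltjes_lower_bound:
  assumes fin: "finite_measure \<mu>" and sets: "sets \<mu> = sets borel" and \<eta>: "Im z > 0"
  shows "measure \<mu> {Re z - Im z..Re z + Im z} \<le> 2 * Im z * Im (LINT t|\<mu>. 1 / (complex_of_real t - z))"
proof -
  interpret finite_measure \<mu> by (rule fin)
  let ?\<eta> = "Im z" and ?A = "{Re z - Im z..Re z + Im z}"
  have nz: "complex_of_real t - z \<noteq> 0" for t using \<eta> by (metis Im_complex_of_real eq_iff_diff_eq_0 less_irrefl)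
  have int: "integrable \<mu> (\<lambda>t. 1 / (complex_of_real t - z))"
  proof (rule integrable_const_bound[where B = "1 / ?\<eta>"])
    have "(\<lambda>t. 1 / (complex_of_real t - z)) \<in> borel_measurable borel"
      by (intro borel_measurable_continuous_onI continuous_intros) (use nz in auto)
    then show "(\<lambda>t. 1 / (complex_of_real t - z)) \<in> borel_measurable \<mu>" by (simp add: measurable_cong_sets[OF sets refl])
    have "norm (1 / (complex_of_real t - z)) \<le> 1 / ?\<eta>" for t
      using abs_Im_le_cmod[of "complex_of_real t - z"] \<eta> by (simp add: norm_divide frac_le)
    then show "AE t in \<mu>. norm (1 / (complex_of_real t - z)) \<le> 1 / ?\<eta>" by simp
  qed
  have A: "?A \<in> sets \<mu>" by (simp add: sets)
  have "measure \<mu> ?A / (2 * ?\<eta>) = (LINT t|\<mu>. 1 / (2 * ?\<eta>) * indicator ?A t)"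
    using A sets_eq_imp_space_eq[OF sets] by simp
  also have "... \<le> (LINT t|\<mu>. Im (1 / (complex_of_real t - z)))"
  proof (rule integral_mono)
    show "integrable \<mu> (\<lambda>t. 1 / (2 * ?\<eta>) * indicator ?A t :: real)" using A by (intro integrable_mult_right integrable_real_indicator) (auto simp: emeasure_eq_measure)
    show "integrable \<mu> (\<lambda>t. Im (1 / (complex_of_real t - z)))" using int by simp
    fix t
    have I: "Im (1 / (complex_of_real t - z)) = ?\<eta> / ((t - Re z)^2 + ?\<eta>\<^sup>2)" by (simp add: Im_divide)
    show "1 / (2 * ?\<eta>) * indicator ?A t \<le> Im (1 / (complex_of_real t - z))"
    proof (cases "t \<in> ?A")
      case True
      then have "\<bar>t - Re z\<bar> \<le> ?\<eta>" by auto
      then have "\<bar>t - Re z\<bar>\<^sup>2 \<le> ?\<eta>\<^sup>2" by (rule power_mono) simp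
      then have "(t - Re z)^2 + ?\<eta>\<^sup>2 \<le> 2 * ?\<eta>\<^sup>2" by simp
      moreover have "(t - Re z)^2 + ?\<eta>\<^sup>2 > 0" using \<eta> by (simp add: add_nonneg_pos)
      ultimately have "?\<eta> / (2 * ?\<eta>\<^sup>2) \<le> ?\<eta> / ((t - Re z)^2 + ?\<eta>\<^sup>2)" using \<eta> by (intro divide_left_mono) auto
      then show ?thesis using True \<eta> unfolding I by (simp add: power2_eq_square)
    next
      case False
      then show ?thesis unfolding I using \<eta> by simp
    qed
  qed
  also have "... = Im (LINT t|\<mu>. 1 / (complex_of_real t - z))" by (rule integral_Im[OF int])
  finally show ?thesis using \<eta> by (simp add: field_simps)
qed

text \<open>If the resolvent norm stays bounded near a real point, the imaginary part of the Stieltjes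
  transform is of the order of the distance to the real axis there, so small intervals have
  quadratically small measure.\<close>

lemma resolvent_bound_not_in_sigma_ac:
  fixes z :: real
  assumes sa: "T = qadjoint E L T" and K: "K > 0"
    and ap: "\<And>\<phi> \<zeta>. (\<phi>, \<zeta>) \<in> T \<Longrightarrow> Q2 E L \<phi> \<le> K * Q2 E L (\<lambda>e x. \<zeta> e x - of_real z * \<phi> e x)"
  shows "z \<notin> sigma_ac E L T"
proof
  assume "z \<in> sigma_ac E L T"
  \<comment> \<open>For spectral parameters within \<epsilon> of z in both directions the squared
    shift is at most 2 \<epsilon>^2; with 8 K \<epsilon>^2 = 1 the term it produces is half of
    \<open>Q2 E L \<phi>\<close> and can be absorbed.\<close>
  define \<epsilon> where "\<epsilon> = sqrt (1 / (8 * K))"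
  have \<epsilon>: "\<epsilon> > 0" "8 * K * \<epsilon>^2 = 1" using K by (simp_all add: \<epsilon>_def)
  obtain \<psi> \<mu> where sm: "spectral_measure E L T \<psi> \<mu>" and em: "emeasure \<mu> {z - \<epsilon><..<z + \<epsilon>} \<noteq> 0"
    using \<open>z \<in> sigma_ac E L T\<close> \<epsilon>(1) unfolding sigma_ac_def by blast
  have psi: "\<psi> \<in> qL2 E L" and sets: "sets \<mu> = sets borel" and fin: "finite_measure \<mu>"
    and st: "\<And>z. Im z \<noteq> 0 \<Longrightarrow> \<exists>\<phi>. (\<phi>, \<lambda>e x. z * \<phi> e x + \<psi> e x) \<in> T \<and> qinner E L \<psi> \<phi> = (LINT t|\<mu>. 1 / (complex_of_real t - z))"
    using sm unfolding spectral_measure_def by blast+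
  interpret finite_measure \<mu> by (rule fin)
  define D where "D = 8 * K * Q2 E L \<psi>"
  have small: "measure \<mu> {c - \<eta>..c + \<eta>} \<le> D * \<eta>^2" if c: "\<bar>c - z\<bar> \<le> \<epsilon>" and \<eta>: "0 < \<eta>" "\<eta> \<le> \<epsilon>" for c \<eta>
  proof -
    let ?z = "Complex c \<eta>"
    obtain \<phi> where p: "(\<phi>, \<lambda>e x. ?z * \<phi> e x + \<psi> e x) \<in> T" and qi: "qinner E L \<psi> \<phi> = (LINT t|\<mu>. 1 / (complex_of_real t - ?z))"
      using st[of ?z] \<eta> by auto
    have phi: "\<phi> \<in> qL2 E L" using p sa unfolding qadjoint_def by blast
    have "Q2 E L \<phi> \<le> K * Q2 E L (\<lambda>e x. (?z - of_real z) * \<phi> e x + 1 * \<psi> e x)"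
      using ap[OF p] by (simp add: algebra_simps)
    also have "... \<le> K * (2 * (cmod (?z - of_real z))^2 * Q2 E L \<phi> + 2 * (cmod 1)^2 * Q2 E L \<psi>)"
      using K by (intro mult_left_mono qL2_lincomb phi psi) auto
    also have "(cmod (?z - of_real z))^2 = (c - z)^2 + \<eta>^2" by (simp add: cmod_power2)
    also have "K * (2 * ((c - z)^2 + \<eta>^2) * Q2 E L \<phi> + 2 * (cmod 1)^2 * Q2 E L \<psi>) \<le> K * (2 * (\<epsilon>^2 + \<epsilon>^2) * Q2 E L \<phi> + 2 * (cmod 1)^2 * Q2 E L \<psi>)"
    proof -
      have "(c - z)^2 \<le> \<epsilon>^2" "\<eta>^2 \<le> \<epsilon>^2" using c \<eta> power_mono[of "\<bar>c - z\<bar>" \<epsilon> 2] by (auto intro: power_mono)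
      then show ?thesis using K Q2_nonneg[of E L \<phi>] by (intro mult_left_mono add_mono mult_right_mono) auto
    qed
    also have "... = (8 * K * \<epsilon>^2) * Q2 E L \<phi> / 2 + 2 * K * Q2 E L \<psi>" by (simp add: algebra_simps)
    finally have Qp: "Q2 E L \<phi> \<le> 4 * K * Q2 E L \<psi>" unfolding \<epsilon>(2) by simp
    have "Im (LINT t|\<mu>. 1 / (complex_of_real t - ?z)) = \<eta> * Q2 E L \<phi>"
      using symmetric_resolvent_identity[OF sa p psi] qi by simp
    also have "... \<le> \<eta> * (4 * K * Q2 E L \<psi>)" using Qp \<eta> by (intro mult_left_mono) auto
    finally have "2 * \<eta> * Im (LINT t|\<mu>. 1 / (complex_of_real t - ?z)) \<le> 2 * \<eta> * (\<eta> * (4 * K * Q2 E L \<psi>))"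
      using \<eta> by (intro mult_left_mono) auto
    moreover have "measure \<mu> {c - \<eta>..c + \<eta>} \<le> 2 * \<eta> * Im (LINT t|\<mu>. 1 / (complex_of_real t - ?z))"
      using stieltjes_lower_bound[OF fin sets, of ?z] \<eta> by simp
    moreover have "2 * \<eta> * (\<eta> * (4 * K * Q2 E L \<psi>)) = D * \<eta>^2" by (simp add: D_def power2_eq_square)
    ultimately show ?thesis by linarith
  qed
  \<comment> \<open>N = n + 1 intervals of half-length \<epsilon> / N cover the window, each of
    measure at most D (\<epsilon> / N)^2; the total D \<epsilon>^2 / N tends to zero.\<close>
  have le: "measure \<mu> {z - \<epsilon><..<z + \<epsilon>} \<le> D * \<epsilon>^2 / real (Suc n)" for n
  proof -
    define N where "N = Suc n"
    define \<eta> where "\<eta> = \<epsilon> / real N"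
    have N: "real N \<ge> 1" by (simp add: N_def)
    have \<eta>: "0 < \<eta>" "\<eta> \<le> \<epsilon>" using \<epsilon> N by (simp_all add: \<eta>_def field_simps)
    have N\<eta>: "real N * \<eta> = \<epsilon>" using N by (simp add: \<eta>_def)
    define c where "c j = z - \<epsilon> + (2 * real j + 1) * \<eta>" for j
    have c: "\<bar>c j - z\<bar> \<le> \<epsilon>" if "j < N" for j
    proof -
      have "(2 * real j + 1) * \<eta> \<le> (2 * real N) * \<eta>" using that \<eta> by (intro mult_right_mono) auto
      then have "(2 * real j + 1) * \<eta> \<le> 2 * \<epsilon>" using N\<eta> by linarith
      moreover have "0 \<le> (2 * real j + 1) * \<eta>" using \<eta> by simp
      ultimately show ?thesis unfolding c_def by linarith
    qed
    have "{z - \<epsilon><..<z + \<epsilon>} \<subseteq> (\<Union>j\<in>{..<N}. {c j - \<eta>..c j + \<eta>})"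
    proof
      fix t assume t: "t \<in> {z - \<epsilon><..<z + \<epsilon>}"
      define s where "s = (t - z + \<epsilon>) / (2 * \<eta>)"
      have s: "s \<ge> 0" "s * (2 * \<eta>) = t - z + \<epsilon>" using t \<eta> by (simp_all add: s_def)
      have "s * (2 * \<eta>) < real N * (2 * \<eta>)" unfolding s(2) using t N\<eta> by auto
      then have sN: "s < real N" using \<eta> by simp
      define j where "j = nat \<lfloor>s\<rfloor>"
      have j: "real j \<le> s" "s \<le> real j + 1" using s(1) by (simp_all add: j_def le_nat_floor)
      have "j < N" using j(1) sN by linarith
      moreover have "real j * (2 * \<eta>) \<le> t - z + \<epsilon>" "t - z + \<epsilon> \<le> (real j + 1) * (2 * \<eta>)"
        unfolding s(2)[symmetric] using j \<eta> by (intro mult_right_mono; simp)+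
      then have "t \<in> {c j - \<eta>..c j + \<eta>}" unfolding c_def by (simp add: algebra_simps)
      ultimately show "t \<in> (\<Union>j\<in>{..<N}. {c j - \<eta>..c j + \<eta>})" by blast
    qed
    then have "measure \<mu> {z - \<epsilon><..<z + \<epsilon>} \<le> measure \<mu> (\<Union>j\<in>{..<N}. {c j - \<eta>..c j + \<eta>})"
      by (rule finite_measure_mono) (simp add: sets)
    also have "... \<le> (\<Sum>j<N. measure \<mu> {c j - \<eta>..c j + \<eta>})"
      by (rule finite_measure_subadditive_finite) (auto simp: sets)
    also have "... \<le> (\<Sum>j<N. D * \<eta>^2)" by (intro sum_mono small c \<eta>) auto
    also have "... = D * (real N * \<eta>) * \<eta>" by (simp add: power2_eq_square)
    also have "... = D * \<epsilon>^2 / real N" unfolding N\<eta> by (simp add: \<eta>_def power2_eq_square)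
    finally show ?thesis by (simp add: N_def)
  qed
  have "(\<lambda>n. D * \<epsilon>^2 / real (Suc n)) \<longlonglongrightarrow> 0" by (rule LIMSEQ_Suc[OF lim_const_over_n])
  then have "measure \<mu> {z - \<epsilon><..<z + \<epsilon>} \<le> 0" by (rule LIMSEQ_le_const) (use le in blast)
  then have "measure \<mu> {z - \<epsilon><..<z + \<epsilon>} = 0" using measure_nonneg[of \<mu> "{z - \<epsilon><..<z + \<epsilon>}"] by linarith
  then show False using em by (simp add: emeasure_eq_measure)
qed

context qtree begin

text \<open>The domain of \<open>H\<close> is not known explicitly; testing against compactly supported approximate solutions
  makes its regularity irrelevant.\<close>

lemma a_priori_bound:
  assumes C: "solves_ivp L U z 1 0 C" and S: "solves_ivp L U z 0 1 S" and nz: "S L \<noteq> 0"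
    and w: "\<bar>(real q + 1) * C L + \<alpha> * S L\<bar> > 2 * sqrt (real q)"
    and sa: "H = qadjoint E L H" and cH: "compact_quantum_graph_op L \<alpha> U T \<subseteq> H"
  shows "\<exists>K>0. \<forall>\<phi> \<zeta>. (\<phi>, \<zeta>) \<in> H \<longrightarrow> Q2 E L \<phi> \<le> K * Q2 E L (\<lambda>e x. \<zeta> e x - of_real z * \<phi> e x)"
proof -
  obtain K where K: "K \<ge> 0" and inv: "\<And>F f \<epsilon>. finite F \<Longrightarrow> F \<subseteq> E \<Longrightarrow> \<forall>e\<in>F. L2 L (f e) \<Longrightarrow> \<epsilon> > 0 \<Longrightarrow> near_solution z K F f \<epsilon>"
    using approximate_inverse[OF C S nz w] by blast
  have "Q2 E L \<phi> \<le> (K + 1) * Q2 E L (\<lambda>e x. \<zeta> e x - of_real z * \<phi> e x)" if H: "(\<phi>, \<zeta>) \<in> H" for \<phi> \<zeta>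
  proof -
    have ad: "\<phi> \<in> qL2 E L" "\<zeta> \<in> qL2 E L" "\<And>u g. (u, g) \<in> H \<Longrightarrow> qinner E L \<phi> g = qinner E L \<zeta> u"
      using H sa unfolding qadjoint_def by blast+
    define \<xi> where "\<xi> = (\<lambda>e x. \<zeta> e x - of_real z * \<phi> e x)"
    have xi: "\<xi> \<in> qL2 E L" using qL2_lincomb(1)[OF ad(2,1), of 1 "- of_real z"] by (simp add: \<xi>_def)
    have l: "L2 L (\<phi> e)" "L2 L (\<zeta> e)" "L2 L (\<xi> e)" if "e \<in> E" for e
      using qL2_D(1)[OF ad(1) that] qL2_D(1)[OF ad(2) that] qL2_D(1)[OF xi that] .
    show ?thesis unfolding \<xi>_def[symmetric]
      unfolding Q2_def[of E L \<phi>]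
    proof (rule infsum_le_finite_sums[OF qL2_D(2)[OF ad(1)]])
      fix F assume F: "finite F" "F \<subseteq> E"
      define X where "X = (\<Sum>e\<in>F. N2 L (\<phi> e))"
      have X0: "X \<ge> 0" unfolding X_def by (intro sum_nonneg) simp
      have bd: "X \<le> (K + 1) * Q2 E L \<xi> + \<epsilon> * (Q2 E L \<phi> + 1)" if \<epsilon>: "\<epsilon> > 0" for \<epsilon>
      proof -
        \<comment> \<open>The tolerance \<epsilon>^2 meets the weight 1 / (2 \<epsilon>) of Young's
          inequality below and leaves a term of order \<epsilon>.\<close>
        have "\<forall>e\<in>F. L2 L (\<phi> e)" "\<epsilon>^2 > 0" using l(1) F \<epsilon> by auto
        from inv[OF F this, unfolded near_solution_def, folded X_def]
        obtain u g F' where F': "finite F'" "F \<subseteq> F'" "F' \<subseteq> E"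
          and z0: "\<forall>e x. e \<notin> F' \<longrightarrow> u e x = 0 \<and> g e x = 0" and ugL: "\<forall>e\<in>F'. L2 L (u e) \<and> L2 L (g e)"
          and un: "(\<Sum>e\<in>F'. N2 L (u e)) \<le> K * X" and gn: "(\<Sum>e\<in>F'. N2 L (g e)) \<le> \<epsilon>^2"
          and op: "(u, \<lambda>e x. of_real z * u e x + ((if e \<in> F then \<phi> e x else 0) + g e x)) \<in> compact_quantum_graph_op L \<alpha> U T"
          by (elim exE conjE) (rule that; assumption)
        define f' where "f' e = (\<lambda>x. if e \<in> F then \<phi> e x else 0)" for e
        have "qinner E L \<phi> (\<lambda>e x. of_real z * u e x + ((if e \<in> F then \<phi> e x else 0) + g e x)) = qinner E L \<zeta> u"
          by (rule ad(3)) (use op cH in blast)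
        moreover have "qinner E L \<zeta> u = (\<Sum>e\<in>F'. LINT x|leb L. cnj (\<zeta> e x) * u e x)"
          by (rule qinner_finite_support) (use F' z0 in auto)
        moreover have "qinner E L \<phi> (\<lambda>e x. of_real z * u e x + ((if e \<in> F then \<phi> e x else 0) + g e x))
          = (\<Sum>e\<in>F'. LINT x|leb L. cnj (\<phi> e x) * (of_real z * u e x + ((if e \<in> F then \<phi> e x else 0) + g e x)))"
          by (rule qinner_finite_support) (use F' z0 in auto)
        ultimately have eq: "(\<Sum>e\<in>F'. (LINT x|leb L. cnj (\<phi> e x) * (of_real z * u e x + ((if e \<in> F then \<phi> e x else 0) + g e x)))
            - (LINT x|leb L. cnj (\<zeta> e x) * u e x)) = 0"
          by (simp add: sum_subtractf)
        have edge: "(LINT x|leb L. cnj (\<phi> e x) * (of_real z * u e x + ((if e \<in> F then \<phi> e x else 0) + g e x)))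
            - (LINT x|leb L. cnj (\<zeta> e x) * u e x)
          = (if e \<in> F then of_real (N2 L (\<phi> e)) else 0) - ((LINT x|leb L. cnj (\<xi> e x) * u e x) - (LINT x|leb L. cnj (\<phi> e x) * g e x))"
          if e: "e \<in> F'" for e
        proof -
          have eE: "e \<in> E" using e F' by blast
          have ug: "L2 L (u e)" "L2 L (g e)" using ugL e by blast+
          have f'L: "L2 L (f' e)" using l(1)[OF eE] by (cases "e \<in> F") (simp_all add: f'_def L2_def)
          note i = L2_product_integrable[OF l(1)[OF eE] ug(1)] L2_product_integrable[OF l(1)[OF eE] ug(2)]
            L2_product_integrable[OF l(1)[OF eE] f'L] L2_product_integrable[OF l(2)[OF eE] ug(1)] L2_product_integrable[OF l(3)[OF eE] ug(1)]
          have 1: "(LINT x|leb L. cnj (\<phi> e x) * (of_real z * u e x + (f' e x + g e x)))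
             = (LINT x|leb L. of_real z * (cnj (\<phi> e x) * u e x)) + ((LINT x|leb L. cnj (\<phi> e x) * f' e x) + (LINT x|leb L. cnj (\<phi> e x) * g e x))"
          proof -
            have "(LINT x|leb L. cnj (\<phi> e x) * (of_real z * u e x + (f' e x + g e x)))
              = (LINT x|leb L. of_real z * (cnj (\<phi> e x) * u e x) + (cnj (\<phi> e x) * f' e x + cnj (\<phi> e x) * g e x))"
              by (intro Bochner_Integration.integral_cong refl) (simp add: algebra_simps)
            then show ?thesis using i(1-3) by simp
          qed
          have 2: "(LINT x|leb L. cnj (\<phi> e x) * f' e x) = (if e \<in> F then of_real (N2 L (\<phi> e)) else 0)"
            by (simp add: f'_def integral_self)
          have 3: "(LINT x|leb L. cnj (\<xi> e x) * u e x) = (LINT x|leb L. cnj (\<zeta> e x) * u e x) - (LINT x|leb L. of_real z * (cnj (\<phi> e x) * u e x))"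
          proof -
            have "(LINT x|leb L. cnj (\<xi> e x) * u e x) = (LINT x|leb L. cnj (\<zeta> e x) * u e x - of_real z * (cnj (\<phi> e x) * u e x))"
              by (intro Bochner_Integration.integral_cong refl) (simp add: \<xi>_def algebra_simps)
            then show ?thesis using i(1,4) by simp
          qed
          show ?thesis using 1 unfolding f'_def using 2[unfolded f'_def] 3 by simp
        qed
        have "complex_of_real X = (\<Sum>e\<in>F'. (if e \<in> F then of_real (N2 L (\<phi> e)) else 0))"
          unfolding X_def using F' by (simp add: sum.If_cases Int_absorb1)
        also have "... = (\<Sum>e\<in>F'. (LINT x|leb L. cnj (\<xi> e x) * u e x) - (LINT x|leb L. cnj (\<phi> e x) * g e x))"
        proof -
          have "(\<Sum>e\<in>F'. (if e \<in> F then of_real (N2 L (\<phi> e)) else 0) - ((LINT x|leb L. cnj (\<xi> e x) * u e x) - (LINT x|leb L. cnj (\<phi> e x) * g e x))) = 0"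
            by (rule trans[OF sum.cong[OF refl edge[symmetric]] eq])
          then show ?thesis unfolding sum_subtractf by simp
        qed
        finally have "X = cmod (\<Sum>e\<in>F'. (LINT x|leb L. cnj (\<xi> e x) * u e x) - (LINT x|leb L. cnj (\<phi> e x) * g e x))"
          using X0 by (metis norm_of_real abs_of_nonneg)
        \<comment> \<open>Young's inequality with weight K + 1 in the first product, so that the
          term with u becomes at most X / 2 and is absorbed, and with weight \<epsilon> in the
          second, so that the full norm of \<phi> enters with a small factor.\<close>
        also have "... \<le> (\<Sum>e\<in>F'. ((K + 1) / 2 * N2 L (\<xi> e) + 1 / (2 * (K + 1)) * N2 L (u e)) + (\<epsilon> / 2 * N2 L (\<phi> e) + 1 / (2 * \<epsilon>) * N2 L (g e)))"
        proof (rule sum_norm_le)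
          fix e assume e: "e \<in> F'"
          have eE: "e \<in> E" using e F' by blast
          have ug: "L2 L (u e)" "L2 L (g e)" using ugL e by blast+
          have "K + 1 > 0" using K by simp
          from integral_product_le[OF l(3)[OF eE] ug(1) this] integral_product_le[OF l(1)[OF eE] ug(2) \<epsilon>]
          show "cmod ((LINT x|leb L. cnj (\<xi> e x) * u e x) - (LINT x|leb L. cnj (\<phi> e x) * g e x))
            \<le> ((K + 1) / 2 * N2 L (\<xi> e) + 1 / (2 * (K + 1)) * N2 L (u e)) + (\<epsilon> / 2 * N2 L (\<phi> e) + 1 / (2 * \<epsilon>) * N2 L (g e))"
            by (intro order_trans[OF norm_triangle_ineq4] add_mono)
        qed
        also have "... = ((K + 1) / 2 * (\<Sum>e\<in>F'. N2 L (\<xi> e)) + 1 / (2 * (K + 1)) * (\<Sum>e\<in>F'. N2 L (u e))) + (\<epsilon> / 2 * (\<Sum>e\<in>F'. N2 L (\<phi> e)) + 1 / (2 * \<epsilon>) * (\<Sum>e\<in>F'. N2 L (g e)))"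
          by (simp only: sum.distrib sum_distrib_left)
        also have "... \<le> ((K + 1) / 2 * Q2 E L \<xi> + 1 / (2 * (K + 1)) * (K * X)) + (\<epsilon> / 2 * Q2 E L \<phi> + 1 / (2 * \<epsilon>) * \<epsilon>^2)"
          using K \<epsilon> un gn by (intro add_mono mult_left_mono sum_N2_le_Q2 xi ad F') auto
        finally have main: "X \<le> ((K + 1) / 2 * Q2 E L \<xi> + 1 / (2 * (K + 1)) * (K * X)) + (\<epsilon> / 2 * Q2 E L \<phi> + 1 / (2 * \<epsilon>) * \<epsilon>^2)" .
        have h1: "1 / (2 * (K + 1)) * (K * X) \<le> X / 2"
        proof -
          have "K / (K + 1) * X \<le> 1 * X" using K X0 by (intro mult_right_mono) auto
          then have "K / (K + 1) * X / 2 \<le> 1 * X / 2" by (rule divide_right_mono) simp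
          moreover have "1 / (2 * (K + 1)) * (K * X) = K / (K + 1) * X / 2" using K by (simp add: field_simps)
          ultimately show ?thesis by (simp only: mult_1)
        qed
        have h2: "1 / (2 * \<epsilon>) * \<epsilon>^2 = \<epsilon> / 2" using \<epsilon> by (simp add: power2_eq_square)
        have "X \<le> ((K + 1) / 2 * Q2 E L \<xi> + X / 2) + (\<epsilon> / 2 * Q2 E L \<phi> + \<epsilon> / 2)"
          by (intro order_trans[OF main[unfolded h2]] add_mono h1 order_refl)
        then have "X \<le> (K + 1) * Q2 E L \<xi> + (\<epsilon> * Q2 E L \<phi> + \<epsilon>)" by (simp add: field_simps)
        then show ?thesis by (simp add: algebra_simps)
      qed
      have "X \<le> (K + 1) * Q2 E L \<xi>"
      proof (rule field_le_epsilon)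
        fix d :: real assume d: "d > 0"
        have p: "Q2 E L \<phi> + 1 > 0" using Q2_nonneg[of E L \<phi>] by linarith
        then have "d / (Q2 E L \<phi> + 1) > 0" using d by simp
        from bd[OF this] p show "X \<le> (K + 1) * Q2 E L \<xi> + d" by simp
      qed
      then show "(\<Sum>e\<in>F. N2 L (\<phi> e)) \<le> (K + 1) * Q2 E L \<xi>" unfolding X_def .
    qed
  qed
  then show ?thesis using K by (intro exI[of _ "K + 1"]) auto
qed

lemma tree_spectrum:
  assumes C: "solves_ivp L U z 1 0 C" and S: "solves_ivp L U z 0 1 S" and nz: "S L \<noteq> 0"
    and sa: "self_adjoint E L H" and cH: "compact_quantum_graph_op L \<alpha> U T \<subseteq> H" and z: "z \<in> sigma_ac E L H"
  shows "\<bar>(real q + 1) * C L + \<alpha> * S L\<bar> \<le> 2 * sqrt (real q)"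
proof (rule ccontr)
  assume "\<not> \<bar>(real q + 1) * C L + \<alpha> * S L\<bar> \<le> 2 * sqrt (real q)"
  then have w: "\<bar>(real q + 1) * C L + \<alpha> * S L\<bar> > 2 * sqrt (real q)" by simp
  have sa': "H = qadjoint E L H" using sa unfolding self_adjoint_def by blast
  obtain K where "K > 0" "\<And>\<phi> \<zeta>. (\<phi>, \<zeta>) \<in> H \<Longrightarrow> Q2 E L \<phi> \<le> K * Q2 E L (\<lambda>e x. \<zeta> e x - of_real z * \<phi> e x)"
    using a_priori_bound[OF C S nz w sa' cH] by blast
  from resolvent_bound_not_in_sigma_ac[OF sa' this] z show False by blast
qed

end

section \<open>Averages over a spectral window\<close>

context sturm begin

lemma band_function_continuous:
  assumes "\<And>z. solves_ivp L U z 1 0 (C z)" "\<And>z. solves_ivp L U z 0 1 (S z)"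
  shows "isCont (band_function q \<alpha> L C S) z"
proof -
  have "isCont (\<lambda>z. C z L) z" "isCont (\<lambda>z. S z L) z"
    using solution_continuous_in_parameter[OF assms(1)] solution_continuous_in_parameter[OF assms(2)] by blast+
  then show ?thesis unfolding band_function_def[abs_def] by (intro continuous_add continuous_mult continuous_const)
qed

text \<open>Where \<open>S z L\<close> vanishes, the identity c^2 - c' s = 1 leaves c^2 = 1. For q
  \<ge> 2 such points lie strictly outside the band, as 2 sqrt q < q + 1.\<close>

lemma dirichlet_eigenvalue_band:
  assumes C: "solves_ivp L U z 1 0 (C z)" and S: "solves_ivp L U z 0 1 (S z)" and "S z L = 0"
  shows "\<bar>band_function q \<alpha> L C S z\<bar> = real q + 1"
proof -
  obtain C1 S1 where "fundamental L U z (\<lambda>x. of_real (C z x)) C1 (\<lambda>x. of_real (S z x)) S1"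
    by (rule fundamental_exists[OF C S])
  then interpret f: fundamental L U z "\<lambda>x. of_real (C z x)" C1 "\<lambda>x. of_real (S z x)" S1 .
  have "complex_of_real (C z L * C z L) = 1" using f.symmetric_data(1) assms(3) by simp
  then have "C z L * C z L = 1" by (simp only: of_real_eq_1_iff)
  then have "\<bar>C z L\<bar> = 1" using square_eq_1_iff[of "C z L"] by auto
  then show ?thesis by (simp add: band_function_def assms(3) abs_mult)
qed

end

context qtree begin

lemma band_interval:
  fixes C S :: "real \<Rightarrow> real \<Rightarrow> real"
  assumes C: "\<And>z. solves_ivp L U z 1 0 (C z)" and S: "\<And>z. solves_ivp L U z 0 1 (S z)"
    and sa: "self_adjoint E L H" and cH: "compact_quantum_graph_op L \<alpha> U T \<subseteq> H"
    and I: "open I" "I \<subseteq> sigma_ac E L H" and inj: "inj_on (band_function q \<alpha> L C S) I" and z: "z \<in> I"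
  shows "\<bar>band_function q \<alpha> L C S z\<bar> \<le> 2 * sqrt (real q)" and "S z L \<noteq> 0"
proof -
  let ?W = "band_function q \<alpha> L C S"
  show le: "\<bar>?W z\<bar> \<le> 2 * sqrt (real q)"
  proof (rule ccontr)
    assume "\<not> \<bar>?W z\<bar> \<le> 2 * sqrt (real q)"
    then have gt: "\<bar>?W z\<bar> > 2 * sqrt (real q)" by simp
    have "continuous_on UNIV (\<lambda>t. \<bar>?W t\<bar>)"
      by (intro continuous_intros continuous_at_imp_continuous_on ballI band_function_continuous[OF C S])
    then have "open {t. \<bar>?W t\<bar> > 2 * sqrt (real q)}" by (intro open_Collect_less continuous_on_const)
    then have "open (I \<inter> {t. \<bar>?W t\<bar> > 2 * sqrt (real q)})" using I(1) by blast
    moreover have "z \<in> I \<inter> {t. \<bar>?W t\<bar> > 2 * sqrt (real q)}" using z gt by simp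
    ultimately obtain e where e: "e > 0" "ball z e \<subseteq> I \<inter> {t. \<bar>?W t\<bar> > 2 * sqrt (real q)}"
      by (rule openE)
    have val: "\<bar>?W t\<bar> = real q + 1" if t: "t \<in> ball z e" for t
    proof (rule dirichlet_eigenvalue_band[where C = C and S = S, OF C S], rule ccontr)
      assume nz: "S t L \<noteq> 0"
      have "t \<in> sigma_ac E L H" using t e(2) I(2) by blast
      from tree_spectrum[OF C S nz sa cH this] have "\<bar>?W t\<bar> \<le> 2 * sqrt (real q)" by (simp add: band_function_def)
      then show False using t e(2) by force
    qed
    have p: "z \<in> ball z e" "z + e / 2 \<in> ball z e" "z - e / 2 \<in> ball z e" using e(1) by (auto simp: dist_real_def)
    note v = val[OF p(1)] val[OF p(2)] val[OF p(3)]
    \<comment> \<open>Three points but only the two values q + 1 and -(q + 1), so two of them share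
      a value, against injectivity.\<close>
    have "?W z = ?W (z + e / 2) \<or> ?W z = ?W (z - e / 2) \<or> ?W (z + e / 2) = ?W (z - e / 2)"
      using v by (auto simp: abs_if split: if_splits)
    moreover have "z \<in> I" "z + e / 2 \<in> I" "z - e / 2 \<in> I" using p e(2) by blast+
    ultimately have "z = z + e / 2 \<or> z = z - e / 2 \<or> z + e / 2 = z - e / 2" using inj unfolding inj_on_def by blast
    then show False using e(1) by auto
  qed
  show "S z L \<noteq> 0"
  proof
    assume "S z L = 0"
    from dirichlet_eigenvalue_band[where C = C and S = S, OF C S this] le two_sqrt_less[OF q2] show False by simp
  qed
qed

end

text \<open>Two points of I have different values, and by the intermediate value theorem everything
  between them is attained; the midpoint s is strictly inside [-B, B] although the values themselves
  may be at its ends.\<close>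

lemma band_image_contains_interval:
  fixes W :: "real \<Rightarrow> real"
  assumes c: "\<And>z. isCont W z" and I: "open I" "is_interval I" "I \<noteq> {}" and inj: "inj_on W I"
    and b: "\<And>z. z \<in> I \<Longrightarrow> \<bar>W z\<bar> \<le> B"
  obtains s \<delta> where "\<bar>s\<bar> < B" "\<delta> > 0" "\<And>t. \<bar>t - s\<bar> < \<delta> \<Longrightarrow> t \<in> W ` I"
proof -
  obtain x where x: "x \<in> I" using I(3) by blast
  obtain e where e: "e > 0" "ball x e \<subseteq> I" using I(1) x by (meson openE)
  have y: "x + e / 2 \<in> I" using e by (auto simp: dist_real_def)
  have ne: "W x \<noteq> W (x + e / 2)" using inj_onD[OF inj _ x y] e(1) by auto
  define l u where "l = min (W x) (W (x + e / 2))" and "u = max (W x) (W (x + e / 2))"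
  have lu: "l < u" "- B \<le> l" "u \<le> B" using ne b[OF x] b[OF y] unfolding l_def u_def by (auto simp: min_def max_def abs_le_iff)
  have "connected (W ` I)"
    using I(2) c by (intro connected_continuous_image continuous_at_imp_continuous_on) (auto simp: is_interval_connected)
  moreover have "l \<in> W ` I" "u \<in> W ` I" using x y unfolding l_def u_def by (auto simp: min_def max_def)
  ultimately have sub: "{l..u} \<subseteq> W ` I" by (meson connected_contains_Icc)
  show ?thesis
  proof (rule that[of "(l + u) / 2" "(u - l) / 2"])
    show "\<bar>(l + u) / 2\<bar> < B" "(u - l) / 2 > 0" using lu by auto
    fix t assume "\<bar>t - (l + u) / 2\<bar> < (u - l) / 2"
    then have "t \<in> {l..u}" unfolding abs_less_iff atLeastAtMost_iff by (auto simp: field_simps)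
    then show "t \<in> W ` I" using sub by blast
  qed
qed

context window begin

text \<open>Any adjacency eigenbasis may be used for the comparison: its eigenvalues near s lie in
  the image of I, and \<open>band_reduction\<close> turns each into room for an eigenvalue in the
  window.\<close>

lemma window_count:
  assumes J: "\<And>t. \<bar>t - s\<bar> < \<delta> \<Longrightarrow> t \<in> band_function q \<alpha> L C S ` I"
    and lo: "\<And>\<phi> \<mu>. orthonormal_on V {..<card V} \<phi> \<Longrightarrow> (\<forall>i<card V. eigenfn (of_real (\<mu> i)) (\<phi> i)) \<Longrightarrow>
      real (card {i. i < card V \<and> \<bar>\<mu> i - s\<bar> < \<delta>}) \<ge> B"
  shows "real (card {n. lam n \<in> I}) \<ge> B"
proof -
  obtain \<phi> \<mu> where o: "orthonormal_on V {..<card V} \<phi>" and e: "\<And>j. j < card V \<Longrightarrow> eigenfn (of_real (\<mu> j)) (\<phi> j)"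
    using adjacency_spectral by metis
  have "card {j. j < card V \<and> \<mu> j \<in> band_function q \<alpha> L C S ` I} \<le> card {n. lam n \<in> I}"
  proof (rule band_reduction)
    assume "\<And>\<phi> \<mu>. orthonormal_on V {..<card V} \<phi> \<Longrightarrow> (\<And>j. j < card V \<Longrightarrow> eigenfn (of_real (\<mu> j)) (\<phi> j)) \<Longrightarrow>
       card {j. j < card V \<and> \<mu> j \<in> band_function q \<alpha> L C S ` I} \<le> card {n. lam n \<in> I}"
    from this[OF o e] show "card {j. j < card V \<and> \<mu> j \<in> band_function q \<alpha> L C S ` I} \<le> card {n. lam n \<in> I}" .
  qed
  moreover have "card {i. i < card V \<and> \<bar>\<mu> i - s\<bar> < \<delta>} \<le> card {j. j < card V \<and> \<mu> j \<in> band_function q \<alpha> L C S ` I}"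
    using J by (intro card_mono) auto
  moreover have "B \<le> real (card {i. i < card V \<and> \<bar>\<mu> i - s\<bar> < \<delta>})" using lo[OF o] e by blast
  ultimately show ?thesis by linarith
qed

lemma total_mass: "(\<Sum>e\<in>E. N2 L (\<psi> n e)) = 1"
proof -
  have "complex_of_real (\<Sum>e\<in>E. N2 L (\<psi> n e)) = qinner E L (\<psi> n) (\<psi> n)"
    unfolding qinner_finite by (simp add: integral_self)
  also have "... = 1" using ob unfolding orthonormal_basis_def by simp
  finally show ?thesis by (simp only: of_real_eq_1_iff)
qed

definition variance :: "('a set \<Rightarrow> real) \<Rightarrow> real" where
  "variance a = (\<Sum>n | lam n \<in> I. \<bar>(\<Sum>e\<in>E. a e * (LINT x|leb L. (cmod (\<psi> n e x))^2)) - 1 / real (card E) * (\<Sum>e\<in>E. a e)\<bar>\<^sup>2)"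

text \<open>The deviation X n is at most 2 in absolute value, so an eigenvalue near an end of the
  band costs at most 4; two ends with at most B eigenvalues each give 8 B. The factor 2^2 is the
  bound of the centred observable, squared.\<close>

lemma window_variance:
  fixes a :: "'a set \<Rightarrow> real"
  assumes g: "gap \<beta>" "\<beta> > 0" and \<sigma>: "0 < \<sigma>" "\<sigma> \<le> 1" and a: "\<And>e. e \<in> E \<Longrightarrow> a e \<in> {-1..1}"
    and up: "\<And>(J :: nat set) \<phi> \<mu> s. s \<in> {2 * sqrt (real q), - (2 * sqrt (real q))} \<Longrightarrow> finite J \<Longrightarrow> orthonormal_on V J \<phi> \<Longrightarrow>
      (\<forall>i\<in>J. eigenfn (of_real (\<mu> i)) (\<phi> i)) \<Longrightarrow> (\<forall>i\<in>J. \<bar>\<mu> i - s\<bar> < \<sigma>^2) \<Longrightarrow> real (card J) \<le> B"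
  shows "variance a
    \<le> 8 * B + 1 / (real q + 1 - 2 * sqrt (real q))^2 * ((8 * real q ^ 3 / \<sigma>)^2 * (8 * (real q + 1)^2 *
       (6 / real (k + 1) * ((3 + 6 * (real q - 1)^2 / \<beta>^2) * ((real q + 1) * real (card V) * 2^2)) + real (bad (k + 1)) * ((real q + 1) * real q ^ k * 2^2))))"
proof -
  define W where "W = band_function q \<alpha> L C S"
  define In where "In = {n. lam n \<in> I}"
  define c where "c = real q + 1 - 2 * sqrt (real q)"
  have c0: "c > 0" using two_sqrt_less[OF q2] by (simp add: c_def)
  obtain f p r where br: "finite {n. lam n \<in> I}" "orthonormal_on V {n. lam n \<in> I} f"
    "\<And>n. lam n \<in> I \<Longrightarrow> eigenfn (of_real (band_function q \<alpha> L C S (lam n))) (f n)"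
    "\<And>n. lam n \<in> I \<Longrightarrow> \<bar>p n\<bar> \<le> 1 / (real q + 1 - 2 * sqrt (real q)) \<and> \<bar>r n\<bar> \<le> 1 / (real q + 1 - 2 * sqrt (real q))"
    and form: "\<And>n a. lam n \<in> I \<Longrightarrow> (\<Sum>e\<in>E. a e * N2 L (\<psi> n e)) = p n * diagX (\<lambda>x y. a {x, y}) (f n) + r n * offZ (\<lambda>x y. a {x, y}) (f n)"
  proof (rule band_reduction)
    fix f and p r :: "nat \<Rightarrow> real"
    assume "finite {n. lam n \<in> I}" "orthonormal_on V {n. lam n \<in> I} f"
    "\<And>n. lam n \<in> I \<Longrightarrow> eigenfn (of_real (band_function q \<alpha> L C S (lam n))) (f n)"
    "\<And>n. lam n \<in> I \<Longrightarrow> \<bar>p n\<bar> \<le> 1 / (real q + 1 - 2 * sqrt (real q)) \<and> \<bar>r n\<bar> \<le> 1 / (real q + 1 - 2 * sqrt (real q))"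
    "\<And>n a. lam n \<in> I \<Longrightarrow> (\<Sum>e\<in>E. a e * N2 L (\<psi> n e)) = p n * diagX (\<lambda>x y. a {x, y}) (f n) + r n * offZ (\<lambda>x y. a {x, y}) (f n)"
    then show thesis by (rule that)
  qed
  note fin = br(1)[folded In_def] and o = br(2)[folded In_def] and fe = br(3)[folded W_def] and pr = br(4)[folded c_def]
  define av where "av = 1 / real (card E) * (\<Sum>e\<in>E. a e)"
  have sum_a: "\<bar>\<Sum>e\<in>E. a e\<bar> \<le> real (card E)"
    using a by (intro order_trans[OF sum_abs] order_trans[OF sum_bounded_above[where K = 1]]) (auto simp: abs_le_iff)
  have av1: "\<bar>av\<bar> \<le> 1"
    unfolding av_def abs_mult using sum_a by (cases "card E = 0") (auto simp: divide_simps)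
  define X where "X n = (\<Sum>e\<in>E. a e * N2 L (\<psi> n e)) - av" for n
  \<comment> \<open>Each \<psi> n has total mass 1, so the mean of a can be moved inside the sum
    over edges.\<close>
  have Xb: "X n = (\<Sum>e\<in>E. (a e - av) * N2 L (\<psi> n e))" for n
    using total_mass[of n] unfolding X_def by (simp add: left_diff_distrib sum_subtractf sum_distrib_left[symmetric])
  have b2: "\<bar>a e - av\<bar> \<le> 2" if "e \<in> E" for e using a[OF that] av1 by auto
  have X2: "\<bar>X n\<bar> \<le> 2" for n
  proof -
    have "\<bar>X n\<bar> \<le> (\<Sum>e\<in>E. \<bar>(a e - av) * N2 L (\<psi> n e)\<bar>)" unfolding Xb by (rule sum_abs)
    also have "... \<le> (\<Sum>e\<in>E. 2 * N2 L (\<psi> n e))"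
      unfolding abs_mult using b2 by (intro sum_mono) (simp add: mult_right_mono)
    also have "... = 2" using total_mass[of n] by (simp add: sum_distrib_left[symmetric])
    finally show ?thesis .
  qed
  \<comment> \<open>Centred on edges and zero elsewhere, hence bounded by 2 on all pairs, symmetric,
    and of sum zero over directed edges.\<close>
  define \<kappa> where "\<kappa> x y = (if {x, y} \<in> E then a {x, y} - av else 0)" for x y
  have \<kappa>M: "\<bar>\<kappa> x y\<bar> \<le> 2" for x y using b2 by (simp add: \<kappa>_def)
  have \<kappa>s: "\<kappa> x y = \<kappa> y x" for x y by (simp add: \<kappa>_def insert_commute)
  have \<kappa>0: "(\<Sum>x\<in>V. \<Sum>y\<in>nb x. \<kappa> x y) = 0"
  proof -
    have "(\<Sum>x\<in>V. \<Sum>y\<in>nb x. \<kappa> x y) = (\<Sum>e\<in>E. \<kappa> (org G e) (trm G e) + \<kappa> (trm G e) (org G e))" by (rule sum_edges_bonds[symmetric])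
    also have "... = (\<Sum>e\<in>E. 2 * (a e - av))"
    proof (intro sum.cong refl)
      fix e assume e: "e \<in> E"
      have "{org G e, trm G e} = e" using ograph_edge(1)[OF simple e] by simp
      then have "\<kappa> (org G e) (trm G e) = a e - av" using e by (simp add: \<kappa>_def)
      then show "\<kappa> (org G e) (trm G e) + \<kappa> (trm G e) (org G e) = 2 * (a e - av)" using \<kappa>s[of "trm G e" "org G e"] by simp
    qed
    also have "... = 2 * ((\<Sum>e\<in>E. a e) - real (card E) * av)" by (simp add: sum_distrib_left[symmetric] sum_subtractf)
    also have "real (card E) * av = (\<Sum>e\<in>E. a e)" using E_finite by (cases "card E = 0") (auto simp: av_def)
    finally show ?thesis by simp
  qed
  have eqX: "X n = p n * diagX \<kappa> (f n) + r n * offZ \<kappa> (f n)" if "lam n \<in> I" for n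
  proof -
    have k: "\<kappa> x y = a {x, y} - av" if "y \<in> nb x" for x y using that by (simp add: \<kappa>_def adj_def)
    have "diagX (\<lambda>x y. a {x, y} - av) (f n) = diagX \<kappa> (f n)" "offZ (\<lambda>x y. a {x, y} - av) (f n) = offZ \<kappa> (f n)"
      unfolding diagX_def offZ_def using k by (intro sum.cong refl; simp del: Image_singleton_iff)+
    then show ?thesis unfolding Xb form[OF that] by simp
  qed
  define DZ where "DZ n = \<bar>diagX \<kappa> (f n)\<bar> + \<bar>offZ \<kappa> (f n)\<bar>" for n
  have XD: "(X n)^2 \<le> 1 / c^2 * (DZ n)^2" if n: "lam n \<in> I" for n
  proof -
    have "\<bar>X n\<bar> \<le> \<bar>p n\<bar> * \<bar>diagX \<kappa> (f n)\<bar> + \<bar>r n\<bar> * \<bar>offZ \<kappa> (f n)\<bar>"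
      unfolding eqX[OF n] by (rule order_trans[OF abs_triangle_ineq]) (simp add: abs_mult)
    also have "... \<le> 1 / c * \<bar>diagX \<kappa> (f n)\<bar> + 1 / c * \<bar>offZ \<kappa> (f n)\<bar>"
      using pr[OF n] by (intro add_mono mult_right_mono) auto
    finally have "\<bar>X n\<bar> \<le> 1 / c * DZ n" by (simp add: DZ_def algebra_simps)
    then have "\<bar>X n\<bar>\<^sup>2 \<le> (1 / c * DZ n)^2" by (rule power_mono) simp
    then show ?thesis by (simp add: power_divide power_mult_distrib)
  qed
  define J where "J = {n \<in> In. (W (lam n))^2 + \<sigma>^2 \<le> 4 * real q}"
  define Jp where "Jp = {n \<in> In. \<bar>W (lam n) - 2 * sqrt (real q)\<bar> < \<sigma>^2}"
  define Jm where "Jm = {n \<in> In. \<bar>W (lam n) - - (2 * sqrt (real q))\<bar> < \<sigma>^2}"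
  have fins: "finite J" "finite Jp" "finite Jm" using fin by (simp_all add: J_def Jp_def Jm_def)
  have sub: "In \<subseteq> J \<union> (Jp \<union> Jm)"
  proof
    fix n assume n: "n \<in> In"
    show "n \<in> J \<union> (Jp \<union> Jm)"
    proof (rule ccontr)
      assume no: "n \<notin> J \<union> (Jp \<union> Jm)"
      define s t where "s = 2 * sqrt (real q)" and "t = \<bar>W (lam n)\<bar>"
      have ss: "s^2 = 4 * real q" by (simp add: s_def power_mult_distrib)
      have "sqrt (real q) \<ge> 1" using q2 by simp
      then have s1: "s \<ge> 1" unfolding s_def by linarith
      have t: "t \<le> s" "t \<ge> 0" using w[of "lam n"] n by (simp_all add: t_def s_def W_def In_def)
      \<comment> \<open>Outside J one has (s - t) (s + t) < \<sigma>^2, and s \<ge> 1 gives s - t <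
        \<sigma>^2. Hence the neighbourhoods of the ends have radius \<sigma>^2.\<close>
      have "t^2 + \<sigma>^2 > s\<^sup>2" using no n unfolding ss t_def J_def by simp
      then have "(s - t) * (s + t) < \<sigma>^2" by (simp add: power2_eq_square algebra_simps)
      moreover have "(s - t) * 1 \<le> (s - t) * (s + t)" using t s1 by (intro mult_left_mono) auto
      ultimately have st: "s - t < \<sigma>^2" by simp
      have "\<bar>W (lam n) - s\<bar> = s - t \<or> \<bar>W (lam n) - - s\<bar> = s - t" using t(1) unfolding t_def by (auto simp: abs_if)
      then show False using no n st unfolding Jp_def Jm_def s_def by auto
    qed
  qed
  have on: "orthonormal_on V J' f" "\<forall>i\<in>J'. eigenfn (of_real (W (lam i))) (f i)" if "J' \<subseteq> In" for J'
    using o that fe unfolding orthonormal_on_def In_def by blast+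
  have cp: "real (card Jp) \<le> B"
    by (rule up[of "2 * sqrt (real q)", where \<phi> = f and \<mu> = "\<lambda>i. W (lam i)"]) (use fins on[of Jp] in \<open>auto simp: Jp_def\<close>)
  have cm: "real (card Jm) \<le> B"
    by (rule up[of "- (2 * sqrt (real q))", where \<phi> = f and \<mu> = "\<lambda>i. W (lam i)"]) (use fins on[of Jm] in \<open>auto simp: Jm_def\<close>)
  have "(\<Sum>n\<in>In. (X n)^2) \<le> (\<Sum>n\<in>J \<union> (Jp \<union> Jm). (X n)^2)" using sub fins by (intro sum_mono2) auto
  also have "... \<le> (\<Sum>n\<in>J. (X n)^2) + (\<Sum>n\<in>Jp \<union> Jm. (X n)^2)" 
    using fins by (subst sum_Un) (auto intro: sum_nonneg)
  finally have s0: "(\<Sum>n\<in>In. (X n)^2) \<le> (\<Sum>n\<in>J. (X n)^2) + (\<Sum>n\<in>Jp \<union> Jm. (X n)^2)" .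
  have sB: "(\<Sum>n\<in>Jp \<union> Jm. (X n)^2) \<le> 8 * B"
  proof -
    have "(X n)^2 \<le> 4" for n using power_mono[OF X2[of n], of 2] by simp
    then have "(\<Sum>n\<in>Jp \<union> Jm. (X n)^2) \<le> real (card (Jp \<union> Jm)) * 4" by (intro sum_bounded_above) auto
    also have "... \<le> (real (card Jp) + real (card Jm)) * 4" using card_Un_le[of Jp Jm] by (intro mult_right_mono) linarith+
    also have "... \<le> (B + B) * 4" using cp cm by (intro mult_right_mono add_mono) auto
    finally show ?thesis by simp
  qed
  have sJ: "(\<Sum>n\<in>J. (X n)^2) \<le> 1 / c^2 * (\<Sum>n\<in>J. (DZ n)^2)"
    unfolding sum_distrib_left by (intro sum_mono XD) (simp add: J_def In_def)
  have s1: "(\<Sum>n\<in>In. (X n)^2) \<le> 1 / c^2 * (\<Sum>n\<in>J. (DZ n)^2) + 8 * B"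
    by (rule order_trans[OF s0 add_mono[OF sJ sB]])
  have dq: "(\<Sum>n\<in>J. (DZ n)^2) \<le> (8 * real q ^ 3 / \<sigma>)^2 * (8 * (real q + 1)^2 *
       (6 / real (k + 1) * ((3 + 6 * (real q - 1)^2 / \<beta>^2) * ((real q + 1) * real (card V) * 2^2)) + real (bad (k + 1)) * ((real q + 1) * real q ^ k * 2^2)))"
    unfolding DZ_def
    by (rule discrete_quantum_variance[where \<mu> = "\<lambda>n. W (lam n)"])
      (use fins on[of J] \<sigma> \<kappa>M \<kappa>s \<kappa>0 g in \<open>auto simp: J_def\<close>)
  have "variance a = (\<Sum>n\<in>In. (X n)^2)" by (simp add: variance_def In_def X_def av_def N2_def)
  also have "... \<le> 8 * B + 1 / c^2 * (\<Sum>n\<in>J. (DZ n)^2)" using s1 by simp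
  also have "... \<le> 8 * B + 1 / c^2 * ((8 * real q ^ 3 / \<sigma>)^2 * (8 * (real q + 1)^2 *
       (6 / real (k + 1) * ((3 + 6 * (real q - 1)^2 / \<beta>^2) * ((real q + 1) * real (card V) * 2^2)) + real (bad (k + 1)) * ((real q + 1) * real q ^ k * 2^2))))"
    by (intro add_left_mono mult_left_mono dq) simp
  finally show ?thesis unfolding c_def .
qed

end

context fgraph begin

lemma gap_from_spectrum:
  assumes "scaled_adj_spectrum (1 / (real q + 1)) G \<subseteq> complex_of_real ` ({- 1 + \<beta>..1 - \<beta>} \<union> {1})"
  shows "gap \<beta>"
  unfolding gap_def
proof (intro allI impI)
  fix \<mu> :: real and f assume e: "eigenfn (of_real \<mu>) f" and nz: "\<exists>x\<in>V. f x \<noteq> 0"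
  have q1: "real q + 1 > 0" by simp
  have "complex_of_real (1 / (real q + 1)) * (\<Sum>u\<in>nb v. f u) = complex_of_real (\<mu> / (real q + 1)) * f v" if "v \<in> V" for v
  proof -
    have "(\<Sum>u\<in>nb v. f u) = of_real \<mu> * f v" using e that unfolding eigenfn_def by blast
    then show ?thesis by simp
  qed
  then have "complex_of_real (\<mu> / (real q + 1)) \<in> scaled_adj_spectrum (1 / (real q + 1)) G"
    using nz unfolding scaled_adj_spectrum_def by blast
  then have "complex_of_real (\<mu> / (real q + 1)) \<in> complex_of_real ` ({- 1 + \<beta>..1 - \<beta>} \<union> {1})" using assms by blast
  then have "\<mu> / (real q + 1) \<in> {- 1 + \<beta>..1 - \<beta>} \<union> {1}" by (auto simp only: image_iff of_real_eq_iff)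
  then have "\<mu> / (real q + 1) \<le> 1 - \<beta> \<or> \<mu> / (real q + 1) = 1" by auto
  then show "\<mu> \<le> (1 - \<beta>) * (real q + 1) \<or> \<mu> = real q + 1"
    using q1 by (simp only: pos_divide_le_eq) (simp add: divide_eq_eq)
qed

text \<open>A bad vertex has injectivity radius below n; the bound n + 1 is positive also for n = 0,
  as (BST) asks of its radius.\<close>

lemma bad_le: "bad n \<le> card {x \<in> V. real (inj_radius G x) < real n + 1}"
  unfolding bad_def
proof (rule card_mono)
  show "{x \<in> V. \<not> acyclic_ball G n x} \<subseteq> {x \<in> V. real (inj_radius G x) < real n + 1}"
    using acyclic_ball_inj_radius[of _ n] by force
qed (use finV in auto)

end

text \<open>The numerator is at most \<eta> N + o(N) with arbitrary \<eta>, the denominator at least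
  c N - o(N) with fixed c. Sums over radii up to n allow different estimates to use different
  radii.\<close>

lemma ratio_tendsto_zero:
  fixes F M :: "nat \<Rightarrow> real" and b :: "nat \<Rightarrow> nat \<Rightarrow> real" and A :: "nat set"
  assumes b: "\<And>n. ((\<lambda>N. b n N / real N) \<longlongrightarrow> 0) (inf sequentially (principal A))" and F0: "\<And>N. F N \<ge> 0"
    and b0: "\<And>n N. b n N \<ge> 0"
    and up: "\<And>\<eta>. \<eta> > 0 \<Longrightarrow> \<exists>n K. K \<ge> 0 \<and> (\<forall>N\<in>A. F N \<le> \<eta> * real N + K * (\<Sum>k\<le>n. b k N))"
    and lo: "\<exists>c>0. \<exists>n K. K \<ge> 0 \<and> (\<forall>N\<in>A. M N \<ge> c * real N - K * (\<Sum>k\<le>n. b k N))"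
  shows "((\<lambda>N. 1 / M N * F N) \<longlongrightarrow> 0) (inf sequentially (principal A))"
proof (rule tendstoI)
  fix \<epsilon> :: real assume \<epsilon>: "\<epsilon> > 0"
  obtain c n0 K0 where c: "c > 0" and K0: "K0 \<ge> 0" and lo': "\<And>N. N \<in> A \<Longrightarrow> M N \<ge> c * real N - K0 * (\<Sum>k\<le>n0. b k N)"
    using lo by blast
  \<comment> \<open>Eventually F \<le> 2 \<eta> N and M \<ge> c N / 2, so the ratio is at most 4
    \<eta> / c = \<epsilon> / 2.\<close>
  define \<eta> where "\<eta> = \<epsilon> * c / 8"
  have \<eta>: "\<eta> > 0" using \<epsilon> c by (simp add: \<eta>_def)
  obtain n1 K1 where K1: "K1 \<ge> 0" and up': "\<And>N. N \<in> A \<Longrightarrow> F N \<le> \<eta> * real N + K1 * (\<Sum>k\<le>n1. b k N)"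
    using up[OF \<eta>] by blast
  have sum0: "((\<lambda>N. (\<Sum>k\<le>n. b k N) / real N) \<longlongrightarrow> 0) (inf sequentially (principal A))" for n
    unfolding sum_divide_distrib by (rule tendsto_null_sum[OF b])
  have ev: "\<forall>\<^sub>F N in inf sequentially (principal A). N > 0 \<and> N \<in> A"
    unfolding eventually_inf_principal using eventually_gt_at_top[of "0::nat"] by eventually_elim simp
  have small: "\<forall>\<^sub>F N in inf sequentially (principal A). K * (\<Sum>k\<le>n. b k N) \<le> t * real N" if "K \<ge> 0" "t > 0" for K n t
  proof -
    have "t / (K + 1) > 0" using that by simp
    from order_tendstoD(2)[OF sum0 this]
    have "\<forall>\<^sub>F N in inf sequentially (principal A). (\<Sum>k\<le>n. b k N) / real N < t / (K + 1)" .
    then show ?thesis using ev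
    proof eventually_elim
      case (elim N)
      then have "(\<Sum>k\<le>n. b k N) * (K + 1) \<le> t * real N" using that by (simp add: field_simps)
      moreover have "(\<Sum>k\<le>n. b k N) \<ge> 0" by (intro sum_nonneg b0)
      ultimately show ?case by (simp add: algebra_simps)
    qed
  qed
  have "c / 2 > 0" using c by simp
  from small[OF K0 this, of n0] small[OF K1 \<eta>, of n1] ev
  show "\<forall>\<^sub>F N in inf sequentially (principal A). dist (1 / M N * F N) 0 < \<epsilon>"
  proof eventually_elim
    case (elim N)
    have M: "M N \<ge> c / 2 * real N" using lo'[of N] elim by (simp add: algebra_simps)
    have F: "F N \<le> 2 * \<eta> * real N" using up'[of N] elim by simp
    have cN: "c / 2 * real N > 0" using c elim by simp
    have "1 / M N * F N \<le> 1 / (c / 2 * real N) * (2 * \<eta> * real N)"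
      using M F cN F0 by (intro mult_mono divide_left_mono) auto
    also have "... = \<epsilon> / 2" using c elim by (simp add: \<eta>_def field_simps)
    finally have "1 / M N * F N < \<epsilon>" using \<epsilon> by linarith
    moreover have "1 / M N * F N \<ge> 0" using M cN F0[of N] by simp
    ultimately show ?case by (simp add: dist_real_def)
  qed
qed

text \<open>Order of choices: first \<sigma>, from the counts near the band ends, then the walk
  length k, which depends on \<sigma> through D1. Both depend on q, \<beta> and \<eta> alone, so n
  and K are uniform in the graph and in the edge data.\<close>

lemma variance_small:
  fixes q :: nat and \<beta> \<eta> :: real
  assumes q: "q \<ge> 2" and \<beta>: "\<beta> > 0" and \<eta>: "\<eta> > 0"
  shows "\<exists>n K. K \<ge> 0 \<and> (\<forall>(G :: 'a ograph) L U \<alpha> C S I \<psi> lam a. window G q L U \<alpha> C S I \<psi> lam \<longrightarrow>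
     fgraph.gap G q \<beta> \<longrightarrow> (\<forall>e\<in>edges G. a e \<in> {-1..1}) \<longrightarrow>
     window.variance G L I \<psi> lam a \<le> \<eta> * real (card (verts G)) + K * (\<Sum>k\<le>n. real (fgraph.bad G k)))"
proof -
  \<comment> \<open>The share \<eta> / 16 enters 8 B and uses up \<eta> / 2; the other half is left
    for the term that decays in k.\<close>
  have e: "\<bar>2 * sqrt (real q)\<bar> \<le> 2 * sqrt (real q)" "\<bar>- (2 * sqrt (real q))\<bar> \<le> 2 * sqrt (real q)" "\<eta> / 16 > 0" using \<eta> by auto
  obtain \<delta>1 n1 K1 where \<delta>1: "\<delta>1 > 0" and up1: "\<forall>(G :: 'a ograph) (J :: nat set) \<phi> \<mu>. fgraph G q \<longrightarrow> finite J \<longrightarrow> orthonormal_on (verts G) J \<phi> \<longrightarrow>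
     (\<forall>i\<in>J. fgraph.eigenfn G (of_real (\<mu> i)) (\<phi> i)) \<longrightarrow> (\<forall>i\<in>J. \<bar>\<mu> i - 2 * sqrt (real q)\<bar> < \<delta>1) \<longrightarrow>
     real (card J) \<le> \<eta> / 16 * real (card (verts G)) + K1 * real (fgraph.bad G n1)"
    using eigenvalue_count_upper[OF q e(1) e(3)] by blast
  obtain \<delta>2 n2 K2 where \<delta>2: "\<delta>2 > 0" and up2: "\<forall>(G :: 'a ograph) (J :: nat set) \<phi> \<mu>. fgraph G q \<longrightarrow> finite J \<longrightarrow> orthonormal_on (verts G) J \<phi> \<longrightarrow>
     (\<forall>i\<in>J. fgraph.eigenfn G (of_real (\<mu> i)) (\<phi> i)) \<longrightarrow> (\<forall>i\<in>J. \<bar>\<mu> i - - (2 * sqrt (real q))\<bar> < \<delta>2) \<longrightarrow>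
     real (card J) \<le> \<eta> / 16 * real (card (verts G)) + K2 * real (fgraph.bad G n2)"
    using eigenvalue_count_upper[OF q e(2) e(3)] by blast
  \<comment> \<open>\<sigma>^2 is to be at most both radii found for the ends, and
    \<open>window_variance\<close> asks for \<sigma> \<le> 1.\<close>
  define \<sigma> where "\<sigma> = min 1 (sqrt (min \<delta>1 \<delta>2))"
  have \<sigma>: "0 < \<sigma>" "\<sigma> \<le> 1" "\<sigma>^2 \<le> \<delta>1" "\<sigma>^2 \<le> \<delta>2"
  proof -
    show p: "0 < \<sigma>" "\<sigma> \<le> 1" using \<delta>1 \<delta>2 by (auto simp: \<sigma>_def)
    have "\<sigma>^2 \<le> (sqrt (min \<delta>1 \<delta>2))^2" using p by (intro power_mono) (auto simp: \<sigma>_def)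
    also have "... = min \<delta>1 \<delta>2" using \<delta>1 \<delta>2 by (intro real_sqrt_pow2) simp
    finally show "\<sigma>^2 \<le> \<delta>1" "\<sigma>^2 \<le> \<delta>2" by auto
  qed
  define D1 where "D1 = 1 / (real q + 1 - 2 * sqrt (real q))^2 * ((8 * real q ^ 3 / \<sigma>)^2 * (8 * (real q + 1)^2))"
  define D2 where "D2 = (3 + 6 * (real q - 1)^2 / \<beta>^2) * ((real q + 1) * 4)"
  have D: "D1 \<ge> 0" "D2 \<ge> 0" by (simp_all add: D1_def D2_def)
  \<comment> \<open>Makes the term with 6 / (k + 1) at most \<eta> / 2 times the number of
    vertices.\<close>
  obtain k where k: "12 * D1 * D2 / \<eta> < real k" using reals_Archimedean2 by blast
  have k6: "D1 * (6 / real (k + 1) * D2) \<le> \<eta> / 2"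
  proof -
    have "12 * D1 * D2 \<le> \<eta> * real (k + 1)" using k \<eta> by (simp add: field_simps)
    then show ?thesis by (simp add: field_simps)
  qed
  define D3 where "D3 = D1 * ((real q + 1) * real q ^ k * 4)"
  have D3: "D3 \<ge> 0" using D by (simp add: D3_def)
  define n where "n = n1 + n2 + (k + 1)"
  define K where "K = 8 * \<bar>K1\<bar> + 8 * \<bar>K2\<bar> + D3"
  have K: "K \<ge> 0" using D3 by (simp add: K_def)
  show ?thesis
  proof (intro exI[of _ n] exI[of _ K] conjI K allI impI)
    fix G :: "'a ograph" and L U \<alpha> C S I and \<psi> :: "nat \<Rightarrow> 'a set \<Rightarrow> real \<Rightarrow> complex"
      and lam and a :: "'a set \<Rightarrow> real"
    assume h: "window G q L U \<alpha> C S I \<psi> lam" "fgraph.gap G q \<beta>" "\<forall>e\<in>edges G. a e \<in> {-1..1}"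
    interpret window G q L U \<alpha> C S I \<psi> lam by (rule h(1))
    define B where "B = \<eta> / 16 * real (card V) + (\<bar>K1\<bar> * real (bad n1) + \<bar>K2\<bar> * real (bad n2))"
    have bn: "K1 * real (bad n1) \<le> \<bar>K1\<bar> * real (bad n1)" "K2 * real (bad n2) \<le> \<bar>K2\<bar> * real (bad n2)"
      by (intro mult_right_mono; simp)+
    have p: "\<bar>K1\<bar> * real (bad n1) \<ge> 0" "\<bar>K2\<bar> * real (bad n2) \<ge> 0" by simp_all
    have up: "real (card J) \<le> B"
      if s: "s \<in> {2 * sqrt (real q), - (2 * sqrt (real q))}" and J: "finite J" "orthonormal_on V J \<phi>"
        "\<forall>i\<in>J. eigenfn (of_real (\<mu> i)) (\<phi> i)" "\<forall>i\<in>J. \<bar>\<mu> i - s\<bar> < \<sigma>^2" for J :: "nat set" and \<phi> \<mu> s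
    proof (cases "s = 2 * sqrt (real q)")
      case True
      have "\<forall>i\<in>J. \<bar>\<mu> i - 2 * sqrt (real q)\<bar> < \<delta>1" using J(4) \<sigma>(3) True by fastforce
      then have "real (card J) \<le> \<eta> / 16 * real (card V) + K1 * real (bad n1)" using up1 fgraph_axioms J by blast
      then show ?thesis using bn p unfolding B_def by linarith
    next
      case False
      then have "s = - (2 * sqrt (real q))" using s by simp
      then have "\<forall>i\<in>J. \<bar>\<mu> i - - (2 * sqrt (real q))\<bar> < \<delta>2" using J(4) \<sigma>(4) by fastforce
      then have "real (card J) \<le> \<eta> / 16 * real (card V) + K2 * real (bad n2)" using up2 fgraph_axioms J by blast
      then show ?thesis using bn p unfolding B_def by linarith
    qed
    have "variance a \<le> 8 * B + 1 / (real q + 1 - 2 * sqrt (real q))^2 * ((8 * real q ^ 3 / \<sigma>)^2 * (8 * (real q + 1)^2 *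
       (6 / real (k + 1) * ((3 + 6 * (real q - 1)^2 / \<beta>^2) * ((real q + 1) * real (card V) * 2^2)) + real (bad (k + 1)) * ((real q + 1) * real q ^ k * 2^2))))"
      by (rule window_variance[OF h(2) \<beta> \<sigma>(1,2)]) (use h(3) up in blast)+
    also have "... = 8 * B + (D1 * (6 / real (k + 1) * D2)) * real (card V) + D3 * real (bad (k + 1))"
    proof -
      have alg: "m * (s * (e * (x * (d * (u * v * 2^2)) + y * (u * t * 2^2))))
        = (m * (s * e)) * (x * (d * (u * 4))) * v + (m * (s * e)) * (u * t * 4) * y" for m s e x d u v y t :: real
        by (simp add: algebra_simps)
      show ?thesis unfolding D1_def D2_def D3_def alg by (rule add.assoc[symmetric])
    qed
    also have "... \<le> 8 * B + \<eta> / 2 * real (card V) + D3 * real (bad (k + 1))"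
      by (intro add_mono mult_right_mono order_refl k6) simp
    also have "... = \<eta> * real (card V) + (8 * \<bar>K1\<bar> * real (bad n1) + 8 * \<bar>K2\<bar> * real (bad n2) + D3 * real (bad (k + 1)))"
      unfolding B_def by (simp add: algebra_simps)
    also have "... \<le> \<eta> * real (card V) + K * (\<Sum>k\<le>n. real (bad k))"
    proof -
      have le: "real (bad j) \<le> (\<Sum>k\<le>n. real (bad k))" if "j \<le> n" for j
        using that by (intro member_le_sum) auto
      have "8 * \<bar>K1\<bar> * real (bad n1) + 8 * \<bar>K2\<bar> * real (bad n2) + D3 * real (bad (k + 1))
        \<le> 8 * \<bar>K1\<bar> * (\<Sum>k\<le>n. real (bad k)) + 8 * \<bar>K2\<bar> * (\<Sum>k\<le>n. real (bad k)) + D3 * (\<Sum>k\<le>n. real (bad k))"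
        using D3 by (intro add_mono mult_left_mono le) (auto simp: n_def)
      also have "... = K * (\<Sum>k\<le>n. real (bad k))" unfolding K_def by (simp only: distrib_right)
      finally show ?thesis by simp
    qed
    finally show "variance a \<le> \<eta> * real (card V) + K * (\<Sum>k\<le>n. real (bad k))" .
  qed
qed

theorem theorem2p1:
  fixes q :: nat and L \<alpha> :: real and U :: "real \<Rightarrow> real"
    and C S :: "real \<Rightarrow> real \<Rightarrow> real"
    and Tq :: "'b ograph" and HT :: "'b set qop"
    and A :: "nat set" and G :: "nat \<Rightarrow> 'a ograph"
    and \<psi> :: "nat \<Rightarrow> nat \<Rightarrow> 'a set \<Rightarrow> real \<Rightarrow> complex" and lam :: "nat \<Rightarrow> nat \<Rightarrow> real"
    and I :: "real set" and a :: "nat \<Rightarrow> 'a set \<Rightarrow> real"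
  assumes "q \<ge> 2" and "L > 0" and "symmetric_Linfty_potential L U"
    and "\<And>z. solves_ivp L U z 1 0 (C z)" and "\<And>z. solves_ivp L U z 0 1 (S z)"
    and "regular_tree (q + 1) Tq"
    and "self_adjoint (edges Tq) L HT" and "compact_quantum_graph_op L \<alpha> U Tq \<subseteq> HT"
    and "infinite A"
    and "\<And>N. N \<in> A \<Longrightarrow> simple_ograph (G N) \<and> finite (verts (G N)) \<and> card (verts (G N)) = N \<and>
               connected_graph (G N) \<and> regular_graph (q + 1) (G N)"
    and "EXP q A G" and "BST A G"
    and "\<And>N. N \<in> A \<Longrightarrow> orthonormal_basis (edges (G N)) L (\<psi> N)"
    and "\<And>N n. N \<in> A \<Longrightarrow>
           (\<psi> N n, \<lambda>e x. complex_of_real (lam N n) * \<psi> N n e x) \<in> quantum_graph_op L \<alpha> U (G N)"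
    and "open I" and "is_interval I" and "I \<noteq> {}"
    and "closure I \<subseteq> sigma_ac (edges Tq) L HT"
    and "inj_on (band_function q \<alpha> L C S) (closure I)"
    and "\<And>N e. N \<in> A \<Longrightarrow> e \<in> edges (G N) \<Longrightarrow> a N e \<in> {-1..1}"
  shows "((\<lambda>N. 1 / real (card {n. lam N n \<in> I}) *
             (\<Sum>n | lam N n \<in> I.
                \<bar>(\<Sum>e\<in>edges (G N). a N e * (LINT x|lebesgue_on {0..L}. (cmod (\<psi> N n e x))\<^sup>2))
                  - 1 / real (card (edges (G N))) * (\<Sum>e\<in>edges (G N). a N e)\<bar>\<^sup>2))
          \<longlongrightarrow> 0) (inf sequentially (principal A))"
proof -
  note q = assms(1) and C = assms(4) and S = assms(5)
  interpret t: qtree Tq q L U \<alpha> by unfold_locales (fact assms)+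
  let ?W = "band_function q \<alpha> L C S"
  have I: "I \<subseteq> sigma_ac (edges Tq) L HT" "inj_on ?W I"
    using assms(18,19) closure_subset by (blast intro: inj_on_subset)+
  have w: "\<bar>?W z\<bar> \<le> 2 * sqrt (real q)" and nz: "S z L \<noteq> 0" if "z \<in> I" for z
    using t.band_interval[OF C S assms(7,8,15) I that] by blast+
  obtain s \<delta> where s: "\<bar>s\<bar> < 2 * sqrt (real q)" "\<delta> > 0" and win: "\<And>t. \<bar>t - s\<bar> < \<delta> \<Longrightarrow> t \<in> ?W ` I"
    by (rule band_image_contains_interval[OF t.band_function_continuous[OF C S] assms(15,16,17) I(2) w]) (assumption, rule that)
  obtain \<beta> where \<beta>: "\<beta> > 0" and sp: "\<And>N. N \<in> A \<Longrightarrow> scaled_adj_spectrum (1 / (real q + 1)) (G N) \<subseteq> complex_of_real ` ({- 1 + \<beta>..1 - \<beta>} \<union> {1})"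
    using assms(11) unfolding EXP_def by blast
  have qg: "qgraph (G N) q L U" if "N \<in> A" for N
    by unfold_locales (use assms(10)[OF that] assms(1,2,3) in blast)+
  have fg: "fgraph (G N) q" if "N \<in> A" for N using qg[OF that] by (simp add: qgraph_def)
  have cardV: "card (verts (G N)) = N" if "N \<in> A" for N using assms(10)[OF that] by blast
  have wd: "window (G N) q L U \<alpha> C S I (\<psi> N) (lam N)" if N: "N \<in> A" for N
  proof -
    interpret qgraph "G N" q L U \<alpha> by (rule qg[OF N])
    show ?thesis
    proof
      show "eig (lam N n) (\<psi> N n)" for n using assms(14)[OF N] unfolding eig_def .
    qed (use C S nz w I(2) assms(13)[OF N] in blast)+
  qed
  \<comment> \<open>Outside A nothing is known about G N; the value zero there keeps b nonnegative
    for all N, as \<open>ratio_tendsto_zero\<close> asks.\<close>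
  define b where "b k N = (if N \<in> A then real (fgraph.bad (G N) k) else 0)" for k N
  have b0: "b k N \<ge> 0" for k N by (simp add: b_def)
  have blim: "((\<lambda>N. b k N / real N) \<longlongrightarrow> 0) (inf sequentially (principal A))" for k
  proof (rule tendsto_sandwich)
    show "((\<lambda>N. 0) \<longlongrightarrow> (0::real)) (inf sequentially (principal A))" by (rule tendsto_const)
    show "((\<lambda>N. 1 / real N * real (card {x \<in> verts (G N). real (inj_radius (G N) x) < real k + 1})) \<longlongrightarrow> 0) (inf sequentially (principal A))"
      by (rule assms(12)[unfolded BST_def, rule_format]) simp
    show "\<forall>\<^sub>F N in inf sequentially (principal A). 0 \<le> b k N / real N" using b0 by simp
    have "b k N / real N \<le> 1 / real N * real (card {x \<in> verts (G N). real (inj_radius (G N) x) < real k + 1})" if "N \<in> A" for N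
    proof -
      have "b k N \<le> real (card {x \<in> verts (G N). real (inj_radius (G N) x) < real k + 1})"
        using fgraph.bad_le[OF fg[OF that], of k] that by (simp add: b_def)
      then have "b k N / real N \<le> real (card {x \<in> verts (G N). real (inj_radius (G N) x) < real k + 1}) / real N"
        by (rule divide_right_mono) simp
      then show ?thesis by simp
    qed
    then show "\<forall>\<^sub>F N in inf sequentially (principal A). b k N / real N \<le> 1 / real N * real (card {x \<in> verts (G N). real (inj_radius (G N) x) < real k + 1})"
      unfolding eventually_inf_principal by (intro always_eventually) blast
  qed
  show ?thesis
  proof (rule ratio_tendsto_zero[OF blim])
    show "b k N \<ge> 0" for k N by (rule b0)
    show "0 \<le> (\<Sum>n | lam N n \<in> I.
                \<bar>(\<Sum>e\<in>edges (G N). a N e * (LINT x|leb L. (cmod (\<psi> N n e x))^2))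
                  - 1 / real (card (edges (G N))) * (\<Sum>e\<in>edges (G N). a N e)\<bar>\<^sup>2)" for N
      by (intro sum_nonneg) simp
  next
    fix \<eta> :: real assume \<eta>: "\<eta> > 0"
    obtain n K where K: "K \<ge> 0" and vs: "\<forall>(G :: 'a ograph) L U \<alpha> C S I \<psi> lam a. window G q L U \<alpha> C S I \<psi> lam \<longrightarrow>
        fgraph.gap G q \<beta> \<longrightarrow> (\<forall>e\<in>edges G. a e \<in> {-1..1}) \<longrightarrow>
        window.variance G L I \<psi> lam a \<le> \<eta> * real (card (verts G)) + K * (\<Sum>k\<le>n. real (fgraph.bad G k))"
      using variance_small[OF q \<beta> \<eta>] by (elim exE conjE) (rule that; assumption)
    show "\<exists>n K. K \<ge> 0 \<and> (\<forall>N\<in>A. (\<Sum>n | lam N n \<in> I.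
                \<bar>(\<Sum>e\<in>edges (G N). a N e * (LINT x|leb L. (cmod (\<psi> N n e x))^2))
                  - 1 / real (card (edges (G N))) * (\<Sum>e\<in>edges (G N). a N e)\<bar>\<^sup>2) \<le> \<eta> * real N + K * (\<Sum>k\<le>n. b k N))"
    proof (intro exI[of _ n] exI[of _ K] conjI K ballI)
      fix N assume N: "N \<in> A"
      have "\<forall>e\<in>edges (G N). a N e \<in> {-1..1}" using assms(20)[OF N] by blast
      with wd[OF N] fgraph.gap_from_spectrum[OF fg[OF N] sp[OF N]]
      have "window.variance (G N) L I (\<psi> N) (lam N) (a N) \<le> \<eta> * real (card (verts (G N))) + K * (\<Sum>k\<le>n. real (fgraph.bad (G N) k))"
        using vs by blast
      then show "(\<Sum>n | lam N n \<in> I.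
                \<bar>(\<Sum>e\<in>edges (G N). a N e * (LINT x|leb L. (cmod (\<psi> N n e x))^2))
                  - 1 / real (card (edges (G N))) * (\<Sum>e\<in>edges (G N). a N e)\<bar>\<^sup>2) \<le> \<eta> * real N + K * (\<Sum>k\<le>n. b k N)"
        using N cardV[OF N] unfolding window.variance_def[OF wd[OF N]] by (simp add: b_def)
    qed
  next
    obtain c n K where c: "c > 0" and lo: "\<forall>(G :: 'a ograph) \<phi> \<mu>. fgraph G q \<longrightarrow> orthonormal_on (verts G) {..<card (verts G)} \<phi> \<longrightarrow>
     (\<forall>i<card (verts G). fgraph.eigenfn G (of_real (\<mu> i)) (\<phi> i)) \<longrightarrow>
     real (card {i. i < card (verts G) \<and> \<bar>\<mu> i - s\<bar> < \<delta>}) \<ge> c * real (card (verts G)) - K * real (fgraph.bad G n)"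
      using eigenvalue_count_lower[OF q s] by blast
    show "\<exists>c>0. \<exists>n K. K \<ge> 0 \<and> (\<forall>N\<in>A. real (card {n. lam N n \<in> I}) \<ge> c * real N - K * (\<Sum>k\<le>n. b k N))"
    proof (rule exI[of _ c], intro conjI c, rule exI[of _ n], rule exI[of _ "\<bar>K\<bar>"], intro conjI ballI)
      show "0 \<le> \<bar>K\<bar>" by simp
      fix N assume N: "N \<in> A"
      interpret g: window "G N" q L U \<alpha> C S I "\<psi> N" "lam N" by (rule wd[OF N])
      have "real (card {n. lam N n \<in> I}) \<ge> c * real (card (verts (G N))) - K * real (g.bad n)"
      proof (rule g.window_count[OF win])
        show "c * real (card (verts (G N))) - K * real (g.bad n) \<le> real (card {i. i < card (verts (G N)) \<and> \<bar>\<mu> i - s\<bar> < \<delta>})"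
          if "orthonormal_on (verts (G N)) {..<card (verts (G N))} \<phi>" "\<forall>i<card (verts (G N)). g.eigenfn (of_real (\<mu> i)) (\<phi> i)" for \<phi> \<mu>
          using lo fg[OF N] that by blast
      qed
      moreover have "K * real (g.bad n) \<le> \<bar>K\<bar> * (\<Sum>k\<le>n. b k N)"
      proof -
        have "b n N \<le> (\<Sum>k\<le>n. b k N)" using b0 by (intro member_le_sum) auto
        then have "\<bar>K\<bar> * b n N \<le> \<bar>K\<bar> * (\<Sum>k\<le>n. b k N)" by (rule mult_left_mono) simp
        moreover have "K * b n N \<le> \<bar>K\<bar> * b n N" using b0 by (intro mult_right_mono) auto
        ultimately show ?thesis using N by (simp add: b_def)
      qed
      ultimately show "c * real N - \<bar>K\<bar> * (\<Sum>k\<le>n. b k N) \<le> real (card {n. lam N n \<in> I})"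
        using cardV[OF N] by simp
    qed
  qed
qed

end
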